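(* Let $\mathbf{k}$ be a field of characteristic $\neq2$, let $A$ be a (commutative) Poisson algebra over $\mathbf{k}$ such that $A^{\otimes n}$ is an integral domain ($n\ge 1$), and let $f_0,\ldots,f_n\in A$ be linearly independent. Let $K=\operatorname{Frac}(A^{\otimes n})$ with its Poisson structure and let $h_i=\Delta_i/\Delta_0\in K$ ($i=1,\ldots,n$) be the Poisson commuting family associated with $(f_0,\ldots,f_n)$, where $\Delta_i=[f_0,\ldots,\check f_i,\ldots,f_n]$. If the Poisson algebra $A$ admits a quantization, then the commuting family $(h_i)_{i=1,\ldots,n}$ admits a quantization; that is, there exist (1) a quantization $K_\hbar$ of the Poisson field $K$, and (2) a family $((h_i)_\hbar)_{i=1,\ldots,n}$ of elements of $K_\hbar$, commuting with each other, such that the reduction of $(h_i)_\hbar$ modulo $\hbar$ is $h_i$ for each $i=1,\ldots,n$.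
   Context: For $g_1,\ldots,g_n\in A$, set $[g_1,\ldots,g_n]=\sum_{\sigma\in\mathfrak{S}_n}\epsilon(\sigma)\,g_{\sigma(1)}\otimes\cdots\otimes g_{\sigma(n)}\in A^{\otimes n}$, where $\epsilon(\sigma)$ is the sign of $\sigma$; $\check f_i$ means that $f_i$ is omitted. $A^{\otimes n}$ carries the tensor product Poisson structure (distinct tensor factors Poisson commute), and the Poisson structure of an integral Poisson algebra extends uniquely to its fraction field; this is the Poisson structure on $K$. The element $\Delta_0$ is nonzero by linear independence, and the $h_i$ pairwise Poisson commute. A quantization of a commutative Poisson $\mathbf{k}$-algebra $B$ is an associative unital $\mathbf{k}[[\hbar]]$-algebra $B_\hbar$, topologically free as a $\mathbf{k}[[\hbar]]$-module (i.e. isomorphic to $V[[\hbar]]$ for some $\mathbf{k}$-vector space $V$), together with an algebra isomorphism $B_\hbar/\hbar B_\hbar\simeq B$, such that for all $a,b\in B_\hbar$ with reductions $a_0,b_0\in B$, the reduction modulo $\hbar$ of $\frac1\hbar(ab-ba)$ is $\{a_0,b_0\}$. *)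

theory Defs
  imports "HOL-Algebra.Algebra" "HOL-Combinatorics.Permutations"
begin

section \<open>Poisson algebras\<close>

record ('k, 'a) poisson = "('k, 'a) module" +
  pbracket :: "'a \<Rightarrow> 'a \<Rightarrow> 'a"  (\<open>\<lbrace>_, _\<rbrace>\<index>\<close>)

text \<open>The locale \<^locale>\<open>algebra\<close> of the library is that of commutative unital algebras.\<close>

locale poisson_algebra = algebra k A
  for k :: "('k, 'm) ring_scheme" and A :: "('k, 'a, 'n) poisson_scheme" (structure) +
  assumes pbracket_closed:
      "\<lbrakk>a \<in> carrier A; b \<in> carrier A\<rbrakk> \<Longrightarrow> \<lbrace>a, b\<rbrace> \<in> carrier A"
    and pbracket_add_left:
      "\<lbrakk>a \<in> carrier A; b \<in> carrier A; c \<in> carrier A\<rbrakk>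
        \<Longrightarrow> \<lbrace>a \<oplus> b, c\<rbrace> = \<lbrace>a, c\<rbrace> \<oplus> \<lbrace>b, c\<rbrace>"
    and pbracket_add_right:
      "\<lbrakk>a \<in> carrier A; b \<in> carrier A; c \<in> carrier A\<rbrakk>
        \<Longrightarrow> \<lbrace>a, b \<oplus> c\<rbrace> = \<lbrace>a, b\<rbrace> \<oplus> \<lbrace>a, c\<rbrace>"
    and pbracket_smult_left:
      "\<lbrakk>r \<in> carrier k; a \<in> carrier A; b \<in> carrier A\<rbrakk>
        \<Longrightarrow> \<lbrace>r \<odot> a, b\<rbrace> = r \<odot> \<lbrace>a, b\<rbrace>"
    and pbracket_smult_right:
      "\<lbrakk>r \<in> carrier k; a \<in> carrier A; b \<in> carrier A\<rbrakk>
        \<Longrightarrow> \<lbrace>a, r \<odot> b\<rbrace> = r \<odot> \<lbrace>a, b\<rbrace>"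
    and pbracket_alternating:
      "a \<in> carrier A \<Longrightarrow> \<lbrace>a, a\<rbrace> = \<zero>"
    and pbracket_jacobi:
      "\<lbrakk>a \<in> carrier A; b \<in> carrier A; c \<in> carrier A\<rbrakk>
        \<Longrightarrow> \<lbrace>a, \<lbrace>b, c\<rbrace>\<rbrace> \<oplus> \<lbrace>b, \<lbrace>c, a\<rbrace>\<rbrace> \<oplus> \<lbrace>c, \<lbrace>a, b\<rbrace>\<rbrace> = \<zero>"
    and pbracket_leibniz:
      "\<lbrakk>a \<in> carrier A; b \<in> carrier A; c \<in> carrier A\<rbrakk>
        \<Longrightarrow> \<lbrace>a, b \<otimes> c\<rbrace> = \<lbrace>a, b\<rbrace> \<otimes> c \<oplus> b \<otimes> \<lbrace>a, c\<rbrace>"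

definition lin_indep :: "('k, 'm) ring_scheme \<Rightarrow> ('k, 'a, 'n) module_scheme \<Rightarrow> 'i set \<Rightarrow> ('i \<Rightarrow> 'a) \<Rightarrow> bool"
  where "lin_indep k M I f \<longleftrightarrow>
    (\<forall>c \<in> I \<rightarrow> carrier k. (\<Oplus>\<^bsub>M\<^esub>i\<in>I. c i \<odot>\<^bsub>M\<^esub> f i) = \<zero>\<^bsub>M\<^esub> \<longrightarrow> (\<forall>i\<in>I. c i = \<zero>\<^bsub>k\<^esub>))"


section \<open>The Poisson algebra \<open>A\<^sup>\<otimes>\<^sup>n\<close>\<close>

text \<open>
  The tensor power is the free \<open>k\<close>-module on the set of \<open>n\<close>-tuples of elements of \<open>A\<close> (extensional
  functions on \<open>{1..n}\<close>), divided by the multilinearity relations. The free module is the monoid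
  algebra \<open>k[A\<^sup>n]\<close> of the multiplicative monoid \<open>A\<^sup>n\<close>; the set of relations is stable, up to scalars,
  under multiplication by tuples, so the ideal it generates is also its linear span.
\<close>

definition tuples :: "('a, 'm) ring_scheme \<Rightarrow> nat \<Rightarrow> (nat \<Rightarrow> 'a) set"
  where "tuples A n = {1..n} \<rightarrow>\<^sub>E carrier A"

definition tuple_mult :: "('a, 'm) ring_scheme \<Rightarrow> nat \<Rightarrow> (nat \<Rightarrow> 'a) \<Rightarrow> (nat \<Rightarrow> 'a) \<Rightarrow> (nat \<Rightarrow> 'a)"
  where "tuple_mult A n x y = (\<lambda>i\<in>{1..n}. x i \<otimes>\<^bsub>A\<^esub> y i)"

definition supp :: "('k, 'm) ring_scheme \<Rightarrow> ('t \<Rightarrow> 'k) \<Rightarrow> 't set"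
  where "supp k p = {x. p x \<noteq> \<zero>\<^bsub>k\<^esub>}"

definition single :: "('k, 'm) ring_scheme \<Rightarrow> 't \<Rightarrow> ('t \<Rightarrow> 'k)"
  where "single k x = (\<lambda>y. if y = x then \<one>\<^bsub>k\<^esub> else \<zero>\<^bsub>k\<^esub>)"

definition tuple_algebra ::
  "('k, 'm) ring_scheme \<Rightarrow> ('a, 'n) ring_scheme \<Rightarrow> nat \<Rightarrow> ('k, (nat \<Rightarrow> 'a) \<Rightarrow> 'k) module"
  where "tuple_algebra k A n =
    \<lparr>carrier = {p. range p \<subseteq> carrier k \<and> finite (supp k p) \<and> supp k p \<subseteq> tuples A n},
     monoid.mult = (\<lambda>p q z. \<Oplus>\<^bsub>k\<^esub>x\<in>supp k p. \<Oplus>\<^bsub>k\<^esub>y\<in>supp k q.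
       if tuple_mult A n x y = z then p x \<otimes>\<^bsub>k\<^esub> q y else \<zero>\<^bsub>k\<^esub>),
     one = single k (\<lambda>i\<in>{1..n}. \<one>\<^bsub>A\<^esub>),
     ring.zero = (\<lambda>x. \<zero>\<^bsub>k\<^esub>),
     add = (\<lambda>p q x. p x \<oplus>\<^bsub>k\<^esub> q x),
     smult = (\<lambda>c p x. c \<otimes>\<^bsub>k\<^esub> p x)\<rparr>"

definition multilinear_relations ::
  "('k, 'm) ring_scheme \<Rightarrow> ('k, 'a, 'n) module_scheme \<Rightarrow> nat \<Rightarrow> ((nat \<Rightarrow> 'a) \<Rightarrow> 'k) set"
  where "multilinear_relations k A n = (let F = tuple_algebra k A n in
    {single k (x(i := a \<oplus>\<^bsub>A\<^esub> b)) \<ominus>\<^bsub>F\<^esub> (single k (x(i := a)) \<oplus>\<^bsub>F\<^esub> single k (x(i := b))) | x i a b.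
        x \<in> tuples A n \<and> i \<in> {1..n} \<and> a \<in> carrier A \<and> b \<in> carrier A} \<union>
    {single k (x(i := c \<odot>\<^bsub>A\<^esub> a)) \<ominus>\<^bsub>F\<^esub> c \<odot>\<^bsub>F\<^esub> single k (x(i := a)) | x i c a.
        x \<in> tuples A n \<and> i \<in> {1..n} \<and> c \<in> carrier k \<and> a \<in> carrier A})"

definition tensor_ideal ::
  "('k, 'm) ring_scheme \<Rightarrow> ('k, 'a, 'n) module_scheme \<Rightarrow> nat \<Rightarrow> ((nat \<Rightarrow> 'a) \<Rightarrow> 'k) set"
  where "tensor_ideal k A n = Idl\<^bsub>tuple_algebra k A n\<^esub> (multilinear_relations k A n)"

text \<open>
  The bilinear extension of
  \<open>{x\<^sub>1 \<otimes> \<dots> \<otimes> x\<^sub>n, y\<^sub>1 \<otimes> \<dots> \<otimes> y\<^sub>n} = (\<Sum>i. x\<^sub>1y\<^sub>1 \<otimes> \<dots> \<otimes> {x\<^sub>i, y\<^sub>i} \<otimes> \<dots> \<otimes> x\<^sub>ny\<^sub>n)\<close>,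
  the bracket for which distinct tensor factors Poisson commute.
\<close>

definition tuple_bracket ::
  "('k, 'm) ring_scheme \<Rightarrow> ('k, 'a, 'n) poisson_scheme \<Rightarrow> nat
    \<Rightarrow> ((nat \<Rightarrow> 'a) \<Rightarrow> 'k) \<Rightarrow> ((nat \<Rightarrow> 'a) \<Rightarrow> 'k) \<Rightarrow> ((nat \<Rightarrow> 'a) \<Rightarrow> 'k)"
  where "tuple_bracket k A n p q = (\<lambda>z.
    \<Oplus>\<^bsub>k\<^esub>x\<in>supp k p. \<Oplus>\<^bsub>k\<^esub>y\<in>supp k q. \<Oplus>\<^bsub>k\<^esub>i\<in>{1..n}.
      if (tuple_mult A n x y)(i := \<lbrace>x i, y i\<rbrace>\<^bsub>A\<^esub>) = z then p x \<otimes>\<^bsub>k\<^esub> q y else \<zero>\<^bsub>k\<^esub>)"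

text \<open>
  As for \<^const>\<open>rcoset_mult\<close>, operations on cosets are written as unions over representatives; all
  the cosets in such a union coincide.
\<close>

definition tensor_power ::
  "('k, 'm) ring_scheme \<Rightarrow> ('k, 'a, 'n) poisson_scheme \<Rightarrow> nat
    \<Rightarrow> ('k, ((nat \<Rightarrow> 'a) \<Rightarrow> 'k) set) poisson"
  where "tensor_power k A n = (let F = tuple_algebra k A n; N = tensor_ideal k A n in
    \<lparr>carrier = carrier (F Quot N),
     monoid.mult = monoid.mult (F Quot N),
     one = one (F Quot N),
     ring.zero = ring.zero (F Quot N),
     add = add (F Quot N),
     smult = (\<lambda>c U. \<Union>p\<in>U. N +>\<^bsub>F\<^esub> (c \<odot>\<^bsub>F\<^esub> p)),
     pbracket = (\<lambda>U W. \<Union>p\<in>U. \<Union>q\<in>W. N +>\<^bsub>F\<^esub> tuple_bracket k A n p q)\<rparr>)"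

text \<open>\<open>g 1 \<otimes> \<dots> \<otimes> g n\<close>\<close>

definition pure_tensor ::
  "('k, 'm) ring_scheme \<Rightarrow> ('k, 'a, 'n) poisson_scheme \<Rightarrow> nat \<Rightarrow> (nat \<Rightarrow> 'a) \<Rightarrow> ((nat \<Rightarrow> 'a) \<Rightarrow> 'k) set"
  where "pure_tensor k A n g =
    tensor_ideal k A n +>\<^bsub>tuple_algebra k A n\<^esub> single k (restrict g {1..n})"

text \<open>\<open>[g 1, \<dots>, g n]\<close>\<close>

definition antisym_tensor ::
  "('k, 'm) ring_scheme \<Rightarrow> ('k, 'a, 'n) poisson_scheme \<Rightarrow> nat \<Rightarrow> (nat \<Rightarrow> 'a) \<Rightarrow> ((nat \<Rightarrow> 'a) \<Rightarrow> 'k) set"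
  where "antisym_tensor k A n g =
    (\<Oplus>\<^bsub>tensor_power k A n\<^esub>\<sigma>\<in>{\<sigma>. \<sigma> permutes {1..n}}.
      [sign \<sigma>] \<cdot>\<^bsub>tensor_power k A n\<^esub> pure_tensor k A n (\<lambda>i. g (\<sigma> i)))"

text \<open>
  \<open>\<Delta>\<^sub>i = [f 0, \<dots>, f (i - 1), f (i + 1), \<dots>, f n]\<close>: the entry number \<open>j \<in> {1..n}\<close> is \<open>f (j - 1)\<close> for
  \<open>j \<le> i\<close> and \<open>f j\<close> for \<open>j > i\<close>.
\<close>

definition Delta ::
  "('k, 'm) ring_scheme \<Rightarrow> ('k, 'a, 'n) poisson_scheme \<Rightarrow> nat \<Rightarrow> (nat \<Rightarrow> 'a) \<Rightarrow> nat \<Rightarrow> ((nat \<Rightarrow> 'a) \<Rightarrow> 'k) set"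
  where "Delta k A n f i = antisym_tensor k A n (\<lambda>j. if j \<le> i then f (j - 1) else f j)"


section \<open>The fraction field of an integral Poisson algebra\<close>

definition fraction :: "('a, 'm) ring_scheme \<Rightarrow> 'a \<Rightarrow> 'a \<Rightarrow> ('a \<times> 'a) set"
  where "fraction T a s = {(b, t). b \<in> carrier T \<and> t \<in> carrier T - {\<zero>\<^bsub>T\<^esub>} \<and> a \<otimes>\<^bsub>T\<^esub> t = b \<otimes>\<^bsub>T\<^esub> s}"

text \<open>
  A fraction is the set of all pairs (numerator, denominator) representing it. The bracket is the
  only biderivation extending that of \<open>T\<close>: the Leibniz rule forces
  \<open>{a/s, b/t} = {a,b}/(st) - b{a,t}/(st\<^sup>2) - a{s,b}/(s\<^sup>2t) + ab{s,t}/(s\<^sup>2t\<^sup>2)\<close>.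
\<close>

definition frac_field :: "('k, 'a, 'm) poisson_scheme \<Rightarrow> ('k, ('a \<times> 'a) set) poisson"
  where "frac_field T =
    \<lparr>carrier = {fraction T a s | a s. a \<in> carrier T \<and> s \<in> carrier T - {\<zero>\<^bsub>T\<^esub>}},
     monoid.mult = (\<lambda>U W. \<Union>(a, s)\<in>U. \<Union>(b, t)\<in>W. fraction T (a \<otimes>\<^bsub>T\<^esub> b) (s \<otimes>\<^bsub>T\<^esub> t)),
     one = fraction T \<one>\<^bsub>T\<^esub> \<one>\<^bsub>T\<^esub>,
     ring.zero = fraction T \<zero>\<^bsub>T\<^esub> \<one>\<^bsub>T\<^esub>,
     add = (\<lambda>U W. \<Union>(a, s)\<in>U. \<Union>(b, t)\<in>W. fraction T (a \<otimes>\<^bsub>T\<^esub> t \<oplus>\<^bsub>T\<^esub> b \<otimes>\<^bsub>T\<^esub> s) (s \<otimes>\<^bsub>T\<^esub> t)),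
     smult = (\<lambda>c U. \<Union>(a, s)\<in>U. fraction T (c \<odot>\<^bsub>T\<^esub> a) s),
     pbracket = (\<lambda>U W. \<Union>(a, s)\<in>U. \<Union>(b, t)\<in>W.
       fraction T
         (((s \<otimes>\<^bsub>T\<^esub> t \<otimes>\<^bsub>T\<^esub> \<lbrace>a, b\<rbrace>\<^bsub>T\<^esub> \<ominus>\<^bsub>T\<^esub> s \<otimes>\<^bsub>T\<^esub> b \<otimes>\<^bsub>T\<^esub> \<lbrace>a, t\<rbrace>\<^bsub>T\<^esub>)
            \<ominus>\<^bsub>T\<^esub> a \<otimes>\<^bsub>T\<^esub> t \<otimes>\<^bsub>T\<^esub> \<lbrace>s, b\<rbrace>\<^bsub>T\<^esub>)
            \<oplus>\<^bsub>T\<^esub> a \<otimes>\<^bsub>T\<^esub> b \<otimes>\<^bsub>T\<^esub> \<lbrace>s, t\<rbrace>\<^bsub>T\<^esub>)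
         ((s \<otimes>\<^bsub>T\<^esub> s) \<otimes>\<^bsub>T\<^esub> (t \<otimes>\<^bsub>T\<^esub> t)))\<rparr>"


section \<open>Quantizations\<close>

text \<open>The ring \<open>k[[\<hbar>]]\<close>; a series is the function giving its coefficients.\<close>

definition power_series_ring :: "('k, 'm) ring_scheme \<Rightarrow> (nat \<Rightarrow> 'k) ring"
  where "power_series_ring k =
    \<lparr>carrier = UNIV \<rightarrow> carrier k,
     monoid.mult = (\<lambda>c d m. \<Oplus>\<^bsub>k\<^esub>i\<in>{..m}. c i \<otimes>\<^bsub>k\<^esub> d (m - i)),
     one = (\<lambda>m. if m = 0 then \<one>\<^bsub>k\<^esub> else \<zero>\<^bsub>k\<^esub>),
     ring.zero = (\<lambda>m. \<zero>\<^bsub>k\<^esub>),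
     add = (\<lambda>c d m. c m \<oplus>\<^bsub>k\<^esub> d m)\<rparr>"

definition hbar :: "('k, 'm) ring_scheme \<Rightarrow> nat \<Rightarrow> 'k"
  where "hbar k = (\<lambda>m. if m = 1 then \<one>\<^bsub>k\<^esub> else \<zero>\<^bsub>k\<^esub>)"

definition const_series :: "('k, 'm) ring_scheme \<Rightarrow> 'k \<Rightarrow> nat \<Rightarrow> 'k"
  where "const_series k c = (\<lambda>m. if m = 0 then c else \<zero>\<^bsub>k\<^esub>)"

locale assoc_algebra = module R B + B?: ring B
  for R :: "('r, 'm) ring_scheme" and B :: "('r, 'b, 'n) module_scheme" (structure) +
  assumes smult_mult_left:
      "\<lbrakk>r \<in> carrier R; x \<in> carrier B; y \<in> carrier B\<rbrakk> \<Longrightarrow> (r \<odot> x) \<otimes> y = r \<odot> (x \<otimes> y)"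
    and smult_mult_right:
      "\<lbrakk>r \<in> carrier R; x \<in> carrier B; y \<in> carrier B\<rbrakk> \<Longrightarrow> x \<otimes> (r \<odot> y) = r \<odot> (x \<otimes> y)"

text \<open>
  \<open>\<Phi>\<close> is an isomorphism of \<open>k[[\<hbar>]]\<close>-modules from \<open>B\<close> to \<open>V[[\<hbar>]]\<close>, whose elements are the sequences
  in \<open>V\<close>. Taking the elements of \<open>V\<close> in the same type as those of \<open>B\<close> is no restriction, since
  \<open>V\<close> can be replaced by its image in \<open>B\<close> as the set of constant series. The multiplication
  contained in the record \<open>V\<close> plays no role.
\<close>

definition topologically_free ::
  "('k, 'm) ring_scheme \<Rightarrow> (nat \<Rightarrow> 'k, 'b, 'n) module_scheme \<Rightarrow> bool"
  where "topologically_free k B \<longleftrightarrow>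
    (\<exists>(V :: ('k, 'b) module) \<Phi>. module k V \<and>
      bij_betw \<Phi> (carrier B) (UNIV \<rightarrow> carrier V) \<and>
      (\<forall>x\<in>carrier B. \<forall>y\<in>carrier B. \<forall>m. \<Phi> (x \<oplus>\<^bsub>B\<^esub> y) m = \<Phi> x m \<oplus>\<^bsub>V\<^esub> \<Phi> y m) \<and>
      (\<forall>c\<in>carrier (power_series_ring k). \<forall>x\<in>carrier B. \<forall>m.
        \<Phi> (c \<odot>\<^bsub>B\<^esub> x) m = (\<Oplus>\<^bsub>V\<^esub>i\<in>{..m}. c i \<odot>\<^bsub>V\<^esub> \<Phi> x (m - i))))"

definition hbar_ideal :: "('k, 'm) ring_scheme \<Rightarrow> (nat \<Rightarrow> 'k, 'b, 'n) module_scheme \<Rightarrow> 'b set"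
  where "hbar_ideal k B = (\<lambda>x. hbar k \<odot>\<^bsub>B\<^esub> x) ` carrier B"

text \<open>The reduction modulo \<open>\<hbar>\<close>, relative to an identification \<open>\<phi>\<close> of \<open>Bh/\<hbar>Bh\<close> with \<open>B\<close>.\<close>

definition reduction ::
  "('k, 'm) ring_scheme \<Rightarrow> (nat \<Rightarrow> 'k, 'b, 'n) module_scheme \<Rightarrow> ('b set \<Rightarrow> 'a) \<Rightarrow> 'b \<Rightarrow> 'a"
  where "reduction k Bh \<phi> x = \<phi> (hbar_ideal k Bh +>\<^bsub>Bh\<^esub> x)"

text \<open>
  In the last assumption \<open>c\<close> is \<open>(ab - ba)/\<hbar>\<close>; it is unique because a topologically free module has
  no \<open>\<hbar>\<close>-torsion. As \<open>Bh\<close> is isomorphic to \<open>V[[\<hbar>]]\<close> with \<open>V\<close> isomorphic to \<open>B\<close> as a \<open>k\<close>-module,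
  every quantization of \<open>B\<close> is isomorphic to one whose elements are sequences in \<open>B\<close>; so asking
  for the existence of one over the type \<open>nat \<Rightarrow> 'a\<close> is no restriction.
\<close>

locale quantization = Bh?: assoc_algebra "power_series_ring k" Bh
  for k :: "('k, 'm) ring_scheme" and B :: "('k, 'a, 'n) poisson_scheme"
    and Bh :: "(nat \<Rightarrow> 'k, 'b) module" (structure) and \<phi> :: "'b set \<Rightarrow> 'a" +
  assumes top_free: "topologically_free k Bh"
    and quotient_iso: "\<phi> \<in> ring_iso (Bh Quot (hbar_ideal k Bh)) B"
    and quotient_iso_smult:
      "\<lbrakk>c \<in> carrier k; x \<in> carrier Bh\<rbrakk> \<Longrightarrow>
        reduction k Bh \<phi> (const_series k c \<odot> x) = c \<odot>\<^bsub>B\<^esub> reduction k Bh \<phi> x"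
    and quotient_commutator:
      "\<lbrakk>a \<in> carrier Bh; b \<in> carrier Bh\<rbrakk> \<Longrightarrow>
        \<exists>c\<in>carrier Bh. a \<otimes> b \<ominus> b \<otimes> a = hbar k \<odot> c \<and>
          reduction k Bh \<phi> c = \<lbrace>reduction k Bh \<phi> a, reduction k Bh \<phi> b\<rbrace>\<^bsub>B\<^esub>"

end

theory Submission
  imports Defs
begin

text \<open>
  Let \<open>B\<close> be a quantization of \<open>A\<close> and \<open>R\<close> the \<open>n\<close>-fold tensor power of \<open>B\<close> over \<open>k[[\<hbar>]]\<close>, which need
  not be complete. Commutators in \<open>R\<close> are divisible by \<open>\<hbar>\<close>, so the elements with nonzero reduction form
  an Ore set modulo every power of \<open>\<hbar>\<close>, and the \<open>\<hbar>\<close>-adic completion \<open>Q\<close> of the localization is a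
  quantization of the fraction field \<open>K\<close> of \<open>A\<^sup>\<otimes>\<^sup>n\<close>. By Cramer's rule the \<open>h\<^sub>a\<close> are, up to sign, the
  solution of the linear system \<open>\<Sum>\<^sub>a f\<^sub>a\<^sup>(\<^sup>j\<^sup>) x\<^sub>a = f\<^sub>0\<^sup>(\<^sup>j\<^sup>)\<close> for \<open>1 \<le> j \<le> n\<close>, where \<open>f\<^sup>(\<^sup>j\<^sup>)\<close> is \<open>f\<close> placed in the
  tensor factor number \<open>j\<close>. Lifting the coefficients to \<open>Q\<close>, the entries of different rows commute, and
  this forces the entries of the solution of the lifted system to commute with each other.
\<close>

section \<open>Completed Ore localization\<close>

text \<open>A determinant with noncommuting entries depends on the order of its factors, so the
  quotients themselves are not lifted. A linear system with its coefficients on the left has no such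
  ambiguity. Let \<open>c\<close> be the matrix of the commutators of the entries of a solution and
  \<open>M\<close> the reduced coefficient matrix. The products of \<open>c\<close> with two
  different rows of coefficients vanish; modulo \<hbar>, antisymmetry and characteristic different
  from 2 add the case of equal rows, so \<open>M c M^T = 0\<close> and \<open>c\<close> is divisible
  by \<hbar>. The quotient satisfies the same equations, hence \<open>c\<close> is divisible by
  every power of \<hbar> and vanishes.

  The obstacle is \<open>R\<close>: it is known through its universal property, so neither
  \<hbar>-torsion nor elements divisible by all powers of \<hbar> are excluded beforehand, and
  common multiples exist only modulo each power. What is shown is that the associated graded ring is
  the polynomial ring over the tensor power of \<open>A\<close>; what this does not see disappears
  in the completion. Fractions are represented by the graphs of their right multiplications modulo
  each power, which avoids choices of numerators and denominators.\<close>

locale formal_ring = R?: ring R + T: "domain" T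
  for R :: "('r, 'x) ring_scheme" (structure) and T :: "('t, 'y) ring_scheme" +
  fixes h :: 'r and \<rho> :: "'r \<Rightarrow> 't"
  assumes h_closed [simp, intro]: "h \<in> carrier R"
    and h_central: "r \<in> carrier R \<Longrightarrow> r \<otimes> h = h \<otimes> r"
    and rho_hom: "\<rho> \<in> ring_hom R T"
    and rho_surj: "\<rho> ` carrier R = carrier T"
    and rho_kernel: "r \<in> carrier R \<Longrightarrow> \<rho> r = \<zero>\<^bsub>T\<^esub> \<Longrightarrow> \<exists>x\<in>carrier R. r = h \<otimes> x"
    \<comment> \<open>Multiplication by \<open>h^N\<close> is injective from \<open>R/hR\<close> to
      \<open>h^N R / h^(N+1) R\<close>: the associated graded ring is \<open>T[h]\<close>. An
      element killed by \<open>h\<close> is then divisible by every power of \<open>h\<close>, so it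
      dies in the completion.\<close>
    and rho_graded: "\<lbrakk>x \<in> carrier R; y \<in> carrier R; h [^] N \<otimes> x = h [^] Suc N \<otimes> y\<rbrakk> \<Longrightarrow> \<rho> x = \<zero>\<^bsub>T\<^esub>"
begin

lemmas rho_simps [simp] =
  ring_hom_closed[OF rho_hom] ring_hom_mult[OF rho_hom] ring_hom_add[OF rho_hom] ring_hom_one[OF rho_hom]

lemma rho_zero [simp]: "\<rho> \<zero> = \<zero>\<^bsub>T\<^esub>"
  by (rule ring_hom_zero[OF rho_hom]) (unfold_locales)

lemma rho_a_inv [simp]: "r \<in> carrier R \<Longrightarrow> \<rho> (\<ominus> r) = \<ominus>\<^bsub>T\<^esub> \<rho> r"
  by (metis R.a_inv_closed R.l_neg T.minus_equality rho_simps(1,3) rho_zero)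

lemma rho_minus [simp]: "r \<in> carrier R \<Longrightarrow> s \<in> carrier R \<Longrightarrow> \<rho> (r \<ominus> s) = \<rho> r \<ominus>\<^bsub>T\<^esub> \<rho> s"
  by (simp add: a_minus_def)

lemma rho_h [simp]: "\<rho> h = \<zero>\<^bsub>T\<^esub>"
  using rho_graded[of h \<one> 0] by simp

lemma h_pow_central: "r \<in> carrier R \<Longrightarrow> r \<otimes> h [^] (N::nat) = h [^] N \<otimes> r"
proof (induction N)
  case (Suc N)
  have "r \<otimes> (h [^] N \<otimes> h) = (r \<otimes> h [^] N) \<otimes> h"
    using Suc.prems by (simp add: m_assoc)
  also have "\<dots> = h [^] N \<otimes> (r \<otimes> h)"
    unfolding Suc.IH[OF Suc.prems] using Suc.prems by (simp add: m_assoc)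
  also have "\<dots> = h [^] N \<otimes> h \<otimes> r"
    unfolding h_central[OF Suc.prems] using Suc.prems by (simp add: m_assoc)
  finally show ?case by simp
qed simp

definition I :: "nat \<Rightarrow> 'r set" where "I N = (\<lambda>x. h [^] N \<otimes> x) ` carrier R"

lemma I_carrier: "x \<in> I N \<Longrightarrow> x \<in> carrier R"
  by (auto simp: I_def)

lemma I_0 [simp]: "I 0 = carrier R"
  by (auto simp: I_def image_iff)

lemma I_1: "x \<in> carrier R \<Longrightarrow> x \<in> I (Suc 0) \<longleftrightarrow> \<rho> x = \<zero>\<^bsub>T\<^esub>"
  using rho_kernel[of x] by (auto simp: I_def)

lemma zero_in_I [simp]: "\<zero> \<in> I N"
  unfolding I_def by (rule image_eqI[of _ _ \<zero>]) auto

lemma I_add: "x \<in> I N \<Longrightarrow> y \<in> I N \<Longrightarrow> x \<oplus> y \<in> I N"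
  unfolding I_def by clarify (metis (no_types, lifting) R.a_closed R.nat_pow_closed R.r_distr h_closed image_eqI)

lemma I_a_inv: "x \<in> I N \<Longrightarrow> \<ominus> x \<in> I N"
  unfolding I_def by clarify (metis (no_types, lifting) R.a_inv_closed R.nat_pow_closed R.r_minus h_closed image_eqI)

lemma I_minus: "x \<in> I N \<Longrightarrow> y \<in> I N \<Longrightarrow> x \<ominus> y \<in> I N"
  by (simp add: a_minus_def I_add I_a_inv)

lemma I_lmult: "r \<in> carrier R \<Longrightarrow> x \<in> I N \<Longrightarrow> r \<otimes> x \<in> I N"
proof -
  assume r: "r \<in> carrier R" "x \<in> I N"
  then obtain y where y: "y \<in> carrier R" "x = h [^] N \<otimes> y" by (auto simp: I_def)
  have "r \<otimes> x = h [^] N \<otimes> (r \<otimes> y)"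
    using r y by (simp add: m_assoc[symmetric] h_pow_central)
  then show ?thesis using r y by (auto simp: I_def)
qed

lemma I_rmult: "r \<in> carrier R \<Longrightarrow> x \<in> I N \<Longrightarrow> x \<otimes> r \<in> I N"
  by (auto simp: I_def m_assoc)

lemma I_Suc_subset: "I (Suc N) \<subseteq> I N"
  by (auto simp: I_def m_assoc)

lemma I_Suc_h: "x \<in> I N \<Longrightarrow> h \<otimes> x \<in> I (Suc N)"
  unfolding I_def
  by clarify (metis (no_types, lifting) R.m_assoc R.nat_pow_Suc R.nat_pow_closed h_closed h_pow_central image_eqI)

definition S :: "'r set" where "S = {s \<in> carrier R. \<rho> s \<noteq> \<zero>\<^bsub>T\<^esub>}"

lemma S_carrier: "s \<in> S \<Longrightarrow> s \<in> carrier R"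
  by (simp add: S_def)

lemma one_in_S [simp]: "\<one> \<in> S"
  by (simp add: S_def)

lemma S_mult: "s \<in> S \<Longrightarrow> s' \<in> S \<Longrightarrow> s \<otimes> s' \<in> S"
  by (auto simp: S_def T.integral_iff)

text \<open>Write \<open>x = h^N y\<close>; then \<open>rho_graded\<close> turns the divisibility of
  \<open>s x\<close> or \<open>x s\<close> into a vanishing product of \<open>\<rho> s\<close> and
  \<open>\<rho> y\<close> in the domain \<open>T\<close>. So elements of \<open>S\<close> can be
  cancelled on either side modulo each power of \<open>h\<close>.\<close>

lemma S_regular:
  assumes s: "s \<in> S" and x: "x \<in> carrier R" and "s \<otimes> x \<in> I N \<or> x \<otimes> s \<in> I N"
  shows "x \<in> I N"
  using assms(3)
proof (induction N)
  case 0 then show ?case using x by simp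
next
  case (Suc N)
  then have "x \<in> I N" using I_Suc_subset by blast
  then obtain y where y: "y \<in> carrier R" "x = h [^] N \<otimes> y" by (auto simp: I_def)
  have c: "s \<in> carrier R" using S_carrier[OF s] .
  have "\<rho> s \<otimes>\<^bsub>T\<^esub> \<rho> y = \<zero>\<^bsub>T\<^esub>"
    using Suc.prems
  proof
    assume "s \<otimes> x \<in> I (Suc N)"
    then obtain z where z: "z \<in> carrier R" "s \<otimes> x = h [^] Suc N \<otimes> z" by (auto simp: I_def)
    then have "h [^] N \<otimes> (s \<otimes> y) = h [^] Suc N \<otimes> z"
      using y c by (simp add: m_assoc[symmetric] h_pow_central)
    then show ?thesis using rho_graded[of "s \<otimes> y" z N] y z c by simp
  next
    assume "x \<otimes> s \<in> I (Suc N)"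
    then obtain z where z: "z \<in> carrier R" "x \<otimes> s = h [^] Suc N \<otimes> z" by (auto simp: I_def)
    then have "h [^] N \<otimes> (y \<otimes> s) = h [^] Suc N \<otimes> z"
      using y c by (simp add: m_assoc)
    then have "\<rho> (y \<otimes> s) = \<zero>\<^bsub>T\<^esub>" using rho_graded[of "y \<otimes> s" z N] y z c by simp
    then show ?thesis using y c by (simp add: T.m_comm)
  qed
  then have "\<rho> y = \<zero>\<^bsub>T\<^esub>"
    using s y by (auto simp: S_def T.integral_iff)
  then obtain w where "w \<in> carrier R" "y = h \<otimes> w" using rho_kernel y by blast
  then show ?case using y by (auto simp: I_def m_assoc)
qed

lemma h_regular:
  assumes x: "x \<in> carrier R" and hx: "h \<otimes> x \<in> I (Suc N)"
  shows "x \<in> I N"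
proof -
  obtain z where z: "z \<in> carrier R" "h \<otimes> x = h [^] Suc N \<otimes> z" using hx by (auto simp: I_def)
  have "M \<le> N \<Longrightarrow> x \<in> I M" for M
  proof (induction M)
    case (Suc M)
    then obtain y where y: "y \<in> carrier R" "x = h [^] M \<otimes> y" by (auto simp: I_def)
    obtain L where L: "Suc N = Suc (Suc M) + L" using Suc.prems by (metis add_Suc le_Suc_ex)
    have "h [^] Suc M \<otimes> y = h \<otimes> x"
      using y by (simp add: m_assoc[symmetric] h_pow_central)
    also have "\<dots> = h [^] Suc (Suc M) \<otimes> (h [^] L \<otimes> z)"
      unfolding z(2) L using z(1) by (simp only: nat_pow_mult[symmetric] m_assoc h_closed nat_pow_closed)
    finally have "\<rho> y = \<zero>\<^bsub>T\<^esub>"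
      using rho_graded[of y "h [^] L \<otimes> z" "Suc M"] y z(1) by simp
    then obtain w where "w \<in> carrier R" "y = h \<otimes> w" using rho_kernel y by blast
    then show ?case using y by (auto simp: I_def m_assoc)
  qed (use x in simp)
  then show ?thesis by simp
qed

text \<open>Since commutators are divisible by \<open>h\<close>, a common multiple of \<open>r\<close> and \<open>s\<close> modulo \<open>h\<^sup>N\<close> can
  be corrected to one modulo \<open>h\<^sup>N\<^sup>+\<^sup>1\<close>.\<close>

lemma ore:
  assumes r: "r \<in> carrier R" and s: "s \<in> S"
  shows "\<exists>s'\<in>S. \<exists>r'\<in>carrier R. s' \<otimes> r \<ominus> r' \<otimes> s \<in> I N"
proof (induction N)
  case 0
  then show ?case using r s by (intro bexI[of _ \<one>] bexI[of _ \<zero>]) (simp_all add: S_carrier)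
next
  case (Suc N)
  then obtain s' r' where 1: "s' \<in> S" "r' \<in> carrier R" "s' \<otimes> r \<ominus> r' \<otimes> s \<in> I N" by blast
  then obtain w where w: "w \<in> carrier R" "s' \<otimes> r \<ominus> r' \<otimes> s = h [^] N \<otimes> w" by (auto simp: I_def)
  note c = 1(2) r w(1) S_carrier[OF s] S_carrier[OF 1(1)]
  have "\<rho> (s \<otimes> w \<ominus> w \<otimes> s) = \<zero>\<^bsub>T\<^esub>" using c by (simp add: T.m_comm T.r_right_minus_eq)
  then obtain v where v: "v \<in> carrier R" "s \<otimes> w \<ominus> w \<otimes> s = h \<otimes> v"
    using rho_kernel[of "s \<otimes> w \<ominus> w \<otimes> s"] c by auto
  define p where "p = h [^] N \<otimes> w"
  have p: "p \<in> carrier R" using c by (simp add: p_def)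
  \<comment> \<open>With \<open>p\<close> the old defect \<open>h^N w\<close>, the new defect is
    \<open>s p - p s\<close>, that is \<open>h^N (s w - w s)\<close>, and the commutator contributes
    one more \<open>h\<close>.\<close>
  have "s \<otimes> s' \<otimes> r \<ominus> (s \<otimes> r' \<oplus> p) \<otimes> s = s \<otimes> (s' \<otimes> r \<ominus> r' \<otimes> s) \<ominus> p \<otimes> s"
    using c p by (simp add: a_minus_def l_distr r_distr r_minus minus_add m_assoc a_assoc)
  also have "\<dots> = h [^] N \<otimes> (s \<otimes> w) \<ominus> h [^] N \<otimes> (w \<otimes> s)"
    unfolding w(2) p_def using c by (simp add: m_assoc[symmetric] h_pow_central)
  also have "\<dots> = h [^] N \<otimes> (s \<otimes> w \<ominus> w \<otimes> s)"
    using c by (simp add: a_minus_def r_distr r_minus)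
  also have "\<dots> = h [^] Suc N \<otimes> v"
    using v by (simp add: m_assoc)
  finally have "s \<otimes> s' \<otimes> r \<ominus> (s \<otimes> r' \<oplus> p) \<otimes> s \<in> I (Suc N)"
    using v unfolding I_def by blast
  then show ?case
    using c p S_mult[OF s 1(1)] by blast
qed

end

section \<open>Fractions modulo each power of \<open>h\<close> as graphs of right multiplications,
  and their completion\<close>

context formal_ring
begin

lemma I_diff_self [simp]: "x \<in> carrier R \<Longrightarrow> x \<ominus> x \<in> I N"
  by (simp add: a_minus_def r_neg)

text \<open>A pair \<open>(t, u)\<close> means \<open>t x = u\<close> modulo \<open>h^N\<close> for
  a fraction \<open>x = s^(-1) v\<close>. The graph of right multiplication by such an
  \<open>x\<close> is a left submodule of \<open>R \<times> R\<close> that is single-valued modulo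
  \<open>h^N R\<close> and whose domain meets \<open>S\<close>; these properties are taken as the
  definition.\<close>

definition lrel :: "nat \<Rightarrow> ('r \<times> 'r) set \<Rightarrow> bool" where
  "lrel N \<Gamma> \<longleftrightarrow> \<Gamma> \<subseteq> carrier R \<times> carrier R \<and> I N \<times> I N \<subseteq> \<Gamma> \<and>
    (\<forall>t u t' u'. (t, u) \<in> \<Gamma> \<longrightarrow> (t', u') \<in> \<Gamma> \<longrightarrow> (t \<oplus> t', u \<oplus> u') \<in> \<Gamma>) \<and>
    (\<forall>r t u. r \<in> carrier R \<longrightarrow> (t, u) \<in> \<Gamma> \<longrightarrow> (r \<otimes> t, r \<otimes> u) \<in> \<Gamma>) \<and>
    (\<forall>t u. (t, u) \<in> \<Gamma> \<longrightarrow> t \<in> I N \<longrightarrow> u \<in> I N) \<and>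
    (\<exists>s\<in>S. \<exists>u. (s, u) \<in> \<Gamma>)"

text \<open>A saturated graph has the largest possible domain. Each fraction then has exactly one
  graph, so that equality of fractions is equality of sets and no quotient is formed.\<close>

definition saturated :: "('r \<times> 'r) set \<Rightarrow> bool" where
  "saturated \<Gamma> \<longleftrightarrow> (\<forall>a t u. a \<in> S \<longrightarrow> t \<in> carrier R \<longrightarrow> u \<in> carrier R \<longrightarrow> (a \<otimes> t, a \<otimes> u) \<in> \<Gamma> \<longrightarrow> (t, u) \<in> \<Gamma>)"

definition sat :: "('r \<times> 'r) set \<Rightarrow> ('r \<times> 'r) set" where
  "sat \<Gamma> = {(t, u). t \<in> carrier R \<and> u \<in> carrier R \<and> (\<exists>a\<in>S. (a \<otimes> t, a \<otimes> u) \<in> \<Gamma>)}"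

lemma lrelD:
  assumes "lrel N \<Gamma>"
  shows "(t, u) \<in> \<Gamma> \<Longrightarrow> t \<in> carrier R" "(t, u) \<in> \<Gamma> \<Longrightarrow> u \<in> carrier R"
    "t \<in> I N \<Longrightarrow> u \<in> I N \<Longrightarrow> (t, u) \<in> \<Gamma>"
    "(t, u) \<in> \<Gamma> \<Longrightarrow> (t', u') \<in> \<Gamma> \<Longrightarrow> (t \<oplus> t', u \<oplus> u') \<in> \<Gamma>"
    "r \<in> carrier R \<Longrightarrow> (t, u) \<in> \<Gamma> \<Longrightarrow> (r \<otimes> t, r \<otimes> u) \<in> \<Gamma>"
    "(t, u) \<in> \<Gamma> \<Longrightarrow> t \<in> I N \<Longrightarrow> u \<in> I N"
    "\<exists>s\<in>S. \<exists>u. (s, u) \<in> \<Gamma>"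
proof -
  note 1 = assms[unfolded lrel_def] and 2 = conjunct2[OF 1] and 3 = conjunct2[OF 2]
    and 4 = conjunct2[OF 3] and 5 = conjunct2[OF 4]
  show "(t, u) \<in> \<Gamma> \<Longrightarrow> t \<in> carrier R" "(t, u) \<in> \<Gamma> \<Longrightarrow> u \<in> carrier R"
    using conjunct1[OF 1] by blast+
  show "t \<in> I N \<Longrightarrow> u \<in> I N \<Longrightarrow> (t, u) \<in> \<Gamma>" using conjunct1[OF 2] by blast
  show "(t, u) \<in> \<Gamma> \<Longrightarrow> (t', u') \<in> \<Gamma> \<Longrightarrow> (t \<oplus> t', u \<oplus> u') \<in> \<Gamma>" using conjunct1[OF 3] by simp
  show "r \<in> carrier R \<Longrightarrow> (t, u) \<in> \<Gamma> \<Longrightarrow> (r \<otimes> t, r \<otimes> u) \<in> \<Gamma>" using conjunct1[OF 4] by simp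
  show "(t, u) \<in> \<Gamma> \<Longrightarrow> t \<in> I N \<Longrightarrow> u \<in> I N" using conjunct1[OF 5] by simp
  show "\<exists>s\<in>S. \<exists>u. (s, u) \<in> \<Gamma>" using conjunct2[OF 5] .
qed

lemma lrelI:
  assumes "\<And>t u. (t, u) \<in> \<Gamma> \<Longrightarrow> t \<in> carrier R \<and> u \<in> carrier R"
    "\<And>t u. t \<in> I N \<Longrightarrow> u \<in> I N \<Longrightarrow> (t, u) \<in> \<Gamma>"
    "\<And>t u t' u'. (t, u) \<in> \<Gamma> \<Longrightarrow> (t', u') \<in> \<Gamma> \<Longrightarrow> (t \<oplus> t', u \<oplus> u') \<in> \<Gamma>"
    "\<And>r t u. r \<in> carrier R \<Longrightarrow> (t, u) \<in> \<Gamma> \<Longrightarrow> (r \<otimes> t, r \<otimes> u) \<in> \<Gamma>"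
    "\<And>t u. (t, u) \<in> \<Gamma> \<Longrightarrow> t \<in> I N \<Longrightarrow> u \<in> I N"
    "\<exists>s\<in>S. \<exists>u. (s, u) \<in> \<Gamma>"
  shows "lrel N \<Gamma>"
  unfolding lrel_def
proof (intro conjI allI impI subsetI)
  show "p \<in> carrier R \<times> carrier R" if "p \<in> \<Gamma>" for p using assms(1)[of "fst p" "snd p"] that by (cases p) simp
  show "p \<in> \<Gamma>" if "p \<in> I N \<times> I N" for p using assms(2)[of "fst p" "snd p"] that by (cases p) simp
qed (rule assms(3-6); assumption?)+

text \<open>As \<open>\<Gamma>\<close> contains \<open>I N \<times> I N\<close>, both entries of a
  pair may be changed modulo \<open>h^N\<close>, independently of each other.\<close>

lemma lrel_cong:
  assumes \<Gamma>: "lrel N \<Gamma>" and tu: "(t, u) \<in> \<Gamma>" and c: "t' \<in> carrier R" "u' \<in> carrier R"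
    and "t' \<ominus> t \<in> I N" "u' \<ominus> u \<in> I N"
  shows "(t', u') \<in> \<Gamma>"
proof -
  have "((t' \<ominus> t) \<oplus> t, (u' \<ominus> u) \<oplus> u) \<in> \<Gamma>"
    by (rule lrelD(4)[OF \<Gamma> lrelD(3)[OF \<Gamma> assms(5,6)] tu])
  then show ?thesis
    using c lrelD(1,2)[OF \<Gamma> tu] by (simp add: a_minus_def a_assoc l_neg)
qed

lemma lrel_cong_left:
  assumes \<Gamma>: "lrel N \<Gamma>" and "(d \<otimes> t, d \<otimes> u) \<in> \<Gamma>" "c \<ominus> d \<in> I N"
    and "c \<in> carrier R" "d \<in> carrier R" "t \<in> carrier R" "u \<in> carrier R"
  shows "(c \<otimes> t, c \<otimes> u) \<in> \<Gamma>"
proof -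
  have "c \<otimes> x \<ominus> d \<otimes> x \<in> I N" if "x \<in> carrier R" for x
    using I_rmult[OF that assms(3)] that assms by (simp add: a_minus_def l_distr l_minus)
  then show ?thesis
    using assms by (intro lrel_cong[OF \<Gamma> assms(2)]) simp_all
qed

text \<open>The condition in \<open>lrel\<close> speaks of pairs with first entry zero modulo
  \<open>h^N\<close>; applied to the difference of two pairs it gives single-valuedness.\<close>

lemma lrel_unique:
  assumes \<Gamma>: "lrel N \<Gamma>" and tu: "(t, u) \<in> \<Gamma>" "(t', u') \<in> \<Gamma>" and "t \<ominus> t' \<in> I N"
  shows "u \<ominus> u' \<in> I N"
proof -
  have "(\<ominus> \<one> \<otimes> t', \<ominus> \<one> \<otimes> u') \<in> \<Gamma>" using lrelD(5)[OF \<Gamma>] tu by simp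
  then have "(t \<ominus> t', u \<ominus> u') \<in> \<Gamma>"
    using lrelD(4)[OF \<Gamma> tu(1), of "\<ominus> \<one> \<otimes> t'" "\<ominus> \<one> \<otimes> u'"] lrelD(1,2)[OF \<Gamma> tu(1)] lrelD(1,2)[OF \<Gamma> tu(2)]
    by (simp add: a_minus_def l_minus)
  then show ?thesis using assms(4) lrelD(6)[OF \<Gamma>] by simp
qed

text \<open>The Ore condition for \<open>u\<close> and a denominator \<open>s\<close> already in the
  domain. It serves to clear one more denominator whenever a pair has to be continued to another
  fraction.\<close>

lemma lrel_dense:
  assumes \<Gamma>: "lrel N \<Gamma>" and u: "u \<in> carrier R"
  obtains a w where "a \<in> S" "w \<in> carrier R" "(a \<otimes> u, w) \<in> \<Gamma>"
proof -
  obtain s v where sv: "s \<in> S" "(s, v) \<in> \<Gamma>" using lrelD(7)[OF \<Gamma>] by blast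
  obtain a b where ab: "a \<in> S" "b \<in> carrier R" "a \<otimes> u \<ominus> b \<otimes> s \<in> I N"
    using ore[OF u sv(1)] by blast
  note c = S_carrier[OF ab(1)] S_carrier[OF sv(1)] lrelD(2)[OF \<Gamma> sv(2)]
  have "(a \<otimes> u, b \<otimes> v) \<in> \<Gamma>"
    using lrel_cong[OF \<Gamma> lrelD(5)[OF \<Gamma> ab(2) sv(2)]] ab u c by simp
  then show thesis using that ab c by blast
qed

lemma saturatedD:
  "saturated \<Gamma> \<Longrightarrow> a \<in> S \<Longrightarrow> t \<in> carrier R \<Longrightarrow> u \<in> carrier R \<Longrightarrow> (a \<otimes> t, a \<otimes> u) \<in> \<Gamma> \<Longrightarrow> (t, u) \<in> \<Gamma>"
  unfolding saturated_def by blast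

text \<open>A single common pair with \<open>s\<close> in \<open>S\<close> determines a fraction: by
  the Ore condition a multiple of \<open>(t, v)\<close> is congruent to a multiple of
  \<open>(s, u)\<close>, and saturation of \<open>\<Gamma>'\<close> divides the multiplier out
  again.\<close>

lemma saturated_subset:
  assumes \<Gamma>: "lrel N \<Gamma>" and \<Gamma>': "lrel N \<Gamma>'" "saturated \<Gamma>'"
    and s: "s \<in> S" "(s, u) \<in> \<Gamma>" "(s, u) \<in> \<Gamma>'"
  shows "\<Gamma> \<subseteq> \<Gamma>'"
proof clarify
  fix t v assume tv: "(t, v) \<in> \<Gamma>"
  note c = lrelD(1,2)[OF \<Gamma> tv] lrelD(1,2)[OF \<Gamma> s(2)]
  obtain a b where ab: "a \<in> S" "b \<in> carrier R" "a \<otimes> t \<ominus> b \<otimes> s \<in> I N"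
    using ore[OF c(1) s(1)] by blast
  note a = S_carrier[OF ab(1)]
  have "a \<otimes> v \<ominus> b \<otimes> u \<in> I N"
    using lrel_unique[OF \<Gamma> lrelD(5)[OF \<Gamma> a tv] lrelD(5)[OF \<Gamma> ab(2) s(2)] ab(3)] .
  then have "(a \<otimes> t, a \<otimes> v) \<in> \<Gamma>'"
    using lrel_cong[OF \<Gamma>'(1) lrelD(5)[OF \<Gamma>'(1) ab(2) s(3)]] ab(3) a c by simp
  then show "(t, v) \<in> \<Gamma>'" using saturatedD[OF \<Gamma>'(2) ab(1)] c by blast
qed

lemma sat_incl: "lrel N \<Gamma> \<Longrightarrow> \<Gamma> \<subseteq> sat \<Gamma>"
proof clarify
  fix t u assume "lrel N \<Gamma>" "(t, u) \<in> \<Gamma>"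
  then show "(t, u) \<in> sat \<Gamma>"
    using lrelD(1,2)[of N \<Gamma> t u] one_in_S by (auto simp: sat_def intro!: bexI[of _ \<one>])
qed

lemma sat_mono: "\<Gamma> \<subseteq> \<Gamma>' \<Longrightarrow> sat \<Gamma> \<subseteq> sat \<Gamma>'"
  by (auto simp: sat_def)

text \<open>Two pairs of the saturation come with different multipliers \<open>a\<close> and
  \<open>a'\<close>; the Ore condition replaces them by a common one, and also moves a multiplier
  past a left factor \<open>r\<close>. Single-valuedness follows from
  \<open>S_regular\<close>.\<close>

lemma lrel_sat:
  assumes \<Gamma>: "lrel N \<Gamma>"
  shows "lrel N (sat \<Gamma>)"
proof (rule lrelI)
  fix t u assume "t \<in> I N" "u \<in> I N"
  then show "(t, u) \<in> sat \<Gamma>" using lrelD(3)[OF \<Gamma>] sat_incl[OF \<Gamma>] by blast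
next
  fix t u t' u' assume "(t, u) \<in> sat \<Gamma>" "(t', u') \<in> sat \<Gamma>"
  then obtain a a' where a: "a \<in> S" "a' \<in> S" "(a \<otimes> t, a \<otimes> u) \<in> \<Gamma>" "(a' \<otimes> t', a' \<otimes> u') \<in> \<Gamma>"
    and c: "t \<in> carrier R" "u \<in> carrier R" "t' \<in> carrier R" "u' \<in> carrier R"
    by (auto simp: sat_def)
  note ac = S_carrier[OF a(1)] S_carrier[OF a(2)]
  obtain b d where bd: "b \<in> S" "d \<in> carrier R" "b \<otimes> a \<ominus> d \<otimes> a' \<in> I N" using ore ac a(2) by blast
  note b = S_carrier[OF bd(1)]
  have 1: "(b \<otimes> a \<otimes> t, b \<otimes> a \<otimes> u) \<in> \<Gamma>"
    using lrelD(5)[OF \<Gamma> b a(3)] ac b c by (simp add: m_assoc)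
  have "(d \<otimes> a' \<otimes> t', d \<otimes> a' \<otimes> u') \<in> \<Gamma>"
    using lrelD(5)[OF \<Gamma> bd(2) a(4)] ac bd(2) c by (simp add: m_assoc)
  then have "(b \<otimes> a \<otimes> t', b \<otimes> a \<otimes> u') \<in> \<Gamma>"
    using lrel_cong_left[OF \<Gamma> _ bd(3)] ac b bd(2) c by simp
  then have "(b \<otimes> a \<otimes> (t \<oplus> t'), b \<otimes> a \<otimes> (u \<oplus> u')) \<in> \<Gamma>"
    using lrelD(4)[OF \<Gamma> 1] ac b c by (simp add: r_distr)
  then show "(t \<oplus> t', u \<oplus> u') \<in> sat \<Gamma>"
    using c S_mult[OF bd(1) a(1)] by (auto simp: sat_def)
next
  fix r t u assume r: "r \<in> carrier R" and "(t, u) \<in> sat \<Gamma>"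
  then obtain a where a: "a \<in> S" "(a \<otimes> t, a \<otimes> u) \<in> \<Gamma>" and c: "t \<in> carrier R" "u \<in> carrier R"
    by (auto simp: sat_def)
  note ac = S_carrier[OF a(1)]
  obtain b d where bd: "b \<in> S" "d \<in> carrier R" "b \<otimes> r \<ominus> d \<otimes> a \<in> I N" using ore r a(1) by blast
  note b = S_carrier[OF bd(1)]
  have "(d \<otimes> a \<otimes> t, d \<otimes> a \<otimes> u) \<in> \<Gamma>"
    using lrelD(5)[OF \<Gamma> bd(2) a(2)] ac bd(2) c by (simp add: m_assoc)
  then have "(b \<otimes> r \<otimes> t, b \<otimes> r \<otimes> u) \<in> \<Gamma>"
    using lrel_cong_left[OF \<Gamma> _ bd(3)] ac b bd(2) c r by simp
  then show "(r \<otimes> t, r \<otimes> u) \<in> sat \<Gamma>"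
    using b c r bd(1) by (auto simp: sat_def m_assoc)
next
  fix t u assume "(t, u) \<in> sat \<Gamma>" and t: "t \<in> I N"
  then obtain a where a: "a \<in> S" "(a \<otimes> t, a \<otimes> u) \<in> \<Gamma>" and u: "u \<in> carrier R"
    by (auto simp: sat_def)
  have "a \<otimes> u \<in> I N" using lrelD(6)[OF \<Gamma> a(2)] I_lmult[OF S_carrier[OF a(1)] t] by blast
  then show "u \<in> I N" using S_regular[OF a(1) u] by blast
next
  show "\<exists>s\<in>S. \<exists>u. (s, u) \<in> sat \<Gamma>" using lrelD(7)[OF \<Gamma>] sat_incl[OF \<Gamma>] by blast
qed (simp add: sat_def)

lemma saturated_sat: "saturated (sat \<Gamma>)"
  unfolding saturated_def
proof (intro allI impI)
  fix a t u assume a: "a \<in> S" and c: "t \<in> carrier R" "u \<in> carrier R" and "(a \<otimes> t, a \<otimes> u) \<in> sat \<Gamma>"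
  then obtain b where b: "b \<in> S" "(b \<otimes> (a \<otimes> t), b \<otimes> (a \<otimes> u)) \<in> \<Gamma>" by (auto simp: sat_def)
  then show "(t, u) \<in> sat \<Gamma>"
    using c S_mult[OF b(1) a] S_carrier[OF a] S_carrier[OF b(1)] by (auto simp: sat_def m_assoc intro!: bexI[of _ "b \<otimes> a"])
qed

text \<open>The inverse limit over \<open>N\<close>. A saturated graph modulo \<open>h^N\<close>
  that contains the graph \<open>x (Suc N)\<close> is the reduction of that fraction, so
  compatibility of the levels is plain inclusion.\<close>

definition completed_localization :: "(nat \<Rightarrow> ('r \<times> 'r) set) set" where
  "completed_localization = {x. \<forall>N. lrel N (x N) \<and> saturated (x N) \<and> x (Suc N) \<subseteq> x N}"

definition loc_add where
  "loc_add x y = (\<lambda>N. sat {(t, u \<oplus> v) | t u v. (t, u) \<in> x N \<and> (t, v) \<in> y N})"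

text \<open>From \<open>t x = u\<close> and \<open>u y = v\<close> follows
  \<open>t (x y) = v\<close>, so a product is a relational composition in the order of the
  factors.\<close>

definition loc_mult :: "(nat \<Rightarrow> ('r \<times> 'r) set) \<Rightarrow> (nat \<Rightarrow> ('r \<times> 'r) set) \<Rightarrow> nat \<Rightarrow> ('r \<times> 'r) set" where
  "loc_mult x y = (\<lambda>N. sat (x N O y N))"

definition emb :: "'r \<Rightarrow> nat \<Rightarrow> ('r \<times> 'r) set" where
  "emb r = (\<lambda>N. {(t, u). t \<in> carrier R \<and> u \<in> carrier R \<and> u \<ominus> t \<otimes> r \<in> I N})"

definition Q :: "(nat \<Rightarrow> ('r \<times> 'r) set) ring" where
  "Q = \<lparr>carrier = completed_localization, monoid.mult = loc_mult, one = emb \<one>,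
        ring.zero = emb \<zero>, add = loc_add\<rparr>"

lemma Q_simps:
  "carrier Q = completed_localization" "x \<otimes>\<^bsub>Q\<^esub> y = loc_mult x y" "\<one>\<^bsub>Q\<^esub> = emb \<one>"
  "\<zero>\<^bsub>Q\<^esub> = emb \<zero>" "x \<oplus>\<^bsub>Q\<^esub> y = loc_add x y"
  by (simp_all add: Q_def)

lemma QD:
  assumes "x \<in> carrier Q"
  shows "lrel N (x N)" "saturated (x N)" "x (Suc N) \<subseteq> x N"
  using assms by (auto simp: Q_simps completed_localization_def)

lemma Q_eq_at:
  assumes "x \<in> carrier Q" "y \<in> carrier Q" "s \<in> S" "(s, u) \<in> x N" "(s, u) \<in> y N"
  shows "x N = y N"
  using saturated_subset[OF QD(1)[OF assms(1)] QD(1,2)[OF assms(2)] assms(3-5)]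
    saturated_subset[OF QD(1)[OF assms(2)] QD(1,2)[OF assms(1)] assms(3,5,4)] by simp

lemma Q_eqI:
  assumes "x \<in> carrier Q" "y \<in> carrier Q" "\<And>N. \<exists>s\<in>S. \<exists>u. (s, u) \<in> x N \<and> (s, u) \<in> y N"
  shows "x = y"
  using assms Q_eq_at by (intro ext) blast

lemma Q_carrier:
  assumes "x \<in> carrier Q" "(t, u) \<in> x N"
  shows "t \<in> carrier R" "u \<in> carrier R"
  using lrelD(1,2)[OF QD(1)[OF assms(1)] assms(2)] .

lemma Q_scale: "x \<in> carrier Q \<Longrightarrow> (t, u) \<in> x N \<Longrightarrow> r \<in> carrier R \<Longrightarrow> (r \<otimes> t, r \<otimes> u) \<in> x N"
  by (rule lrelD(5)[OF QD(1)])

lemma Q_common: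
  assumes x: "x \<in> carrier Q" and y: "y \<in> carrier Q"
  obtains s u v where "s \<in> S" "(s, u) \<in> x N" "(s, v) \<in> y N"
proof -
  obtain s u where s: "s \<in> S" "(s, u) \<in> x N" using lrelD(7) QD(1)[OF x] by blast
  obtain a w where "a \<in> S" "(a \<otimes> s, w) \<in> y N" using lrel_dense[OF QD(1)[OF y] S_carrier[OF s(1)]] by blast
  then show thesis using that[OF S_mult[OF _ s(1)] Q_scale[OF x s(2) S_carrier]] by simp
qed

text \<open>A denominator of \<open>x\<close> is multiplied further, on the left, until the
  resulting value lies in the domain of \<open>y\<close>.\<close>

lemma Q_comp:
  assumes x: "x \<in> carrier Q" and y: "y \<in> carrier Q"
  obtains s u v where "s \<in> S" "(s, u) \<in> x N" "(u, v) \<in> y N"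
proof -
  obtain s u where s: "s \<in> S" "(s, u) \<in> x N" using lrelD(7) QD(1)[OF x] by blast
  obtain a w where "a \<in> S" "(a \<otimes> u, w) \<in> y N" using lrel_dense[OF QD(1)[OF y] Q_carrier(2)[OF x s(2)]] by blast
  then show thesis using that[OF S_mult[OF _ s(1)] Q_scale[OF x s(2) S_carrier]] by simp
qed

lemma lrel_sum:
  assumes x: "x \<in> carrier Q" and y: "y \<in> carrier Q"
  shows "lrel N {(t, u \<oplus> v) | t u v. (t, u) \<in> x N \<and> (t, v) \<in> y N}" (is "lrel N ?\<Gamma>")
proof (rule lrelI)
  note lx = lrelD[OF QD(1)[OF x]] and ly = lrelD[OF QD(1)[OF y]]
  fix t u
  { assume "t \<in> I N" "u \<in> I N"
    then have "(t, u) \<in> x N" "(t, \<zero>) \<in> y N" "u = u \<oplus> \<zero>"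
      using lx(3) ly(3) by (simp_all add: I_carrier)
    then show "(t, u) \<in> ?\<Gamma>" by blast }
  assume "(t, u) \<in> ?\<Gamma>"
  then obtain v w where 1: "u = v \<oplus> w" "(t, v) \<in> x N" "(t, w) \<in> y N" by auto
  note c = Q_carrier[OF x 1(2)] Q_carrier[OF y 1(3)]
  show "t \<in> carrier R \<and> u \<in> carrier R" using c 1 by simp
  show "t \<in> I N \<Longrightarrow> u \<in> I N" using 1(1) lx(6)[OF 1(2)] ly(6)[OF 1(3)] I_add by simp
  { fix r assume r: "r \<in> carrier R"
    show "(r \<otimes> t, r \<otimes> u) \<in> ?\<Gamma>"
      using Q_scale[OF x 1(2) r] Q_scale[OF y 1(3) r] r_distr[OF c(2,4) r] 1(1) by auto }
  fix t' u' assume "(t', u') \<in> ?\<Gamma>"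
  then obtain v' w' where 2: "u' = v' \<oplus> w'" "(t', v') \<in> x N" "(t', w') \<in> y N" by auto
  note c' = Q_carrier[OF x 2(2)] Q_carrier[OF y 2(3)]
  have "u \<oplus> u' = (v \<oplus> v') \<oplus> (w \<oplus> w')" using c c' 1 2 by (simp add: a_ac)
  then show "(t \<oplus> t', u \<oplus> u') \<in> ?\<Gamma>" using lx(4)[OF 1(2) 2(2)] ly(4)[OF 1(3) 2(3)] by auto
next
  obtain s u v where "s \<in> S" "(s, u) \<in> x N" "(s, v) \<in> y N" by (rule Q_common[OF x y])
  then show "\<exists>s\<in>S. \<exists>u. (s, u) \<in> {(t, u \<oplus> v) | t u v. (t, u) \<in> x N \<and> (t, v) \<in> y N}"
    by (intro bexI[of _ s] exI[of _ "u \<oplus> v"]) auto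
qed

lemma lrel_comp:
  assumes x: "x \<in> carrier Q" and y: "y \<in> carrier Q"
  shows "lrel N (x N O y N)"
proof (rule lrelI)
  note lx = lrelD[OF QD(1)[OF x]] and ly = lrelD[OF QD(1)[OF y]]
  show "(t, u) \<in> x N O y N" if "t \<in> I N" "u \<in> I N" for t u
    using that lx(3)[of t N \<zero>] ly(3)[of \<zero> N u] by auto
  show "(t \<oplus> t', u \<oplus> u') \<in> x N O y N" if "(t, u) \<in> x N O y N" "(t', u') \<in> x N O y N" for t u t' u'
    using that lx(4) ly(4) by blast
  show "\<exists>s\<in>S. \<exists>u. (s, u) \<in> x N O y N" using Q_comp[OF x y] by blast
  show "(r \<otimes> t, r \<otimes> u) \<in> x N O y N" if "r \<in> carrier R" "(t, u) \<in> x N O y N" for r t u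
    using that lx(5) ly(5) by blast
qed (use lrelD(1,2,6)[OF QD(1)[OF x]] lrelD(1,2,6)[OF QD(1)[OF y]] in \<open>auto\<close>)

lemma loc_add_closed [simp]:
  assumes "x \<in> carrier Q" "y \<in> carrier Q"
  shows "loc_add x y \<in> carrier Q"
proof -
  have "loc_add x y (Suc N) \<subseteq> loc_add x y N" for N
    unfolding loc_add_def using QD(3)[OF assms(1), of N] QD(3)[OF assms(2), of N]
    by (intro sat_mono) blast
  then show ?thesis
    unfolding Q_simps completed_localization_def
    using lrel_sat[OF lrel_sum[OF assms]] saturated_sat by (auto simp: loc_add_def)
qed

lemma loc_mult_closed [simp]:
  assumes "x \<in> carrier Q" "y \<in> carrier Q"
  shows "loc_mult x y \<in> carrier Q"
proof -
  have "loc_mult x y (Suc N) \<subseteq> loc_mult x y N" for N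
    unfolding loc_mult_def using QD(3)[OF assms(1), of N] QD(3)[OF assms(2), of N]
    by (intro sat_mono) blast
  then show ?thesis
    unfolding Q_simps completed_localization_def
    using lrel_sat[OF lrel_comp[OF assms]] saturated_sat by (auto simp: loc_mult_def)
qed

lemma loc_addI: "\<lbrakk>x \<in> carrier Q; y \<in> carrier Q; (t, u) \<in> x N; (t, v) \<in> y N\<rbrakk> \<Longrightarrow> (t, u \<oplus> v) \<in> loc_add x y N"
  unfolding loc_add_def using sat_incl[OF lrel_sum] by blast

lemma loc_multI: "\<lbrakk>x \<in> carrier Q; y \<in> carrier Q; (t, u) \<in> x N; (u, v) \<in> y N\<rbrakk> \<Longrightarrow> (t, v) \<in> loc_mult x y N"
  unfolding loc_mult_def using sat_incl[OF lrel_comp] by blast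

lemma embI: "t \<in> carrier R \<Longrightarrow> r \<in> carrier R \<Longrightarrow> (t, t \<otimes> r) \<in> emb r N"
  by (simp add: emb_def a_minus_def r_neg)

lemma emb_closed [simp]:
  assumes r: "r \<in> carrier R"
  shows "emb r \<in> carrier Q"
proof -
  have "lrel N (emb r N)" for N
  proof (rule lrelI)
    fix t u assume "(t, u) \<in> emb r N"
    then have 1: "t \<in> carrier R" "u \<in> carrier R" "u \<ominus> t \<otimes> r \<in> I N" by (auto simp: emb_def)
    then show "t \<in> carrier R \<and> u \<in> carrier R" by simp
    { assume "t \<in> I N"
      then have "(u \<ominus> t \<otimes> r) \<oplus> t \<otimes> r \<in> I N" using I_add 1(3) I_rmult r by blast
      then show "u \<in> I N" using 1 r by (simp add: a_minus_def a_assoc l_neg) }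
    { fix a assume a: "a \<in> carrier R"
      have "a \<otimes> (u \<ominus> t \<otimes> r) \<in> I N" using I_lmult[OF a 1(3)] .
      then show "(a \<otimes> t, a \<otimes> u) \<in> emb r N"
        using 1 r a by (simp add: emb_def a_minus_def r_distr r_minus m_assoc) }
    fix t' u' assume "(t', u') \<in> emb r N"
    then have 2: "t' \<in> carrier R" "u' \<in> carrier R" "u' \<ominus> t' \<otimes> r \<in> I N" by (auto simp: emb_def)
    have "(u \<ominus> t \<otimes> r) \<oplus> (u' \<ominus> t' \<otimes> r) = (u \<oplus> u') \<ominus> (t \<oplus> t') \<otimes> r"
      using 1 2 r by (simp add: a_minus_def l_distr minus_add a_ac)
    then show "(t \<oplus> t', u \<oplus> u') \<in> emb r N"
      using I_add[OF 1(3) 2(3)] 1 2 by (simp add: emb_def)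
  next
    show "\<exists>s\<in>S. \<exists>u. (s, u) \<in> emb r N" using embI[OF one_closed r] one_in_S by blast
  qed (use r I_carrier I_minus I_rmult in \<open>auto simp: emb_def\<close>)
  moreover have "saturated (emb r N)" for N
    unfolding saturated_def
  proof (intro allI impI)
    fix a t u assume a: "a \<in> S" and c: "t \<in> carrier R" "u \<in> carrier R" and "(a \<otimes> t, a \<otimes> u) \<in> emb r N"
    then have "a \<otimes> (u \<ominus> t \<otimes> r) \<in> I N"
      using r S_carrier[OF a] by (simp add: emb_def a_minus_def r_distr r_minus m_assoc)
    then show "(t, u) \<in> emb r N" using S_regular[OF a] c r by (simp add: emb_def)
  qed
  moreover have "emb r (Suc N) \<subseteq> emb r N" for N
    using I_Suc_subset by (auto simp: emb_def)
  ultimately show ?thesis by (simp add: Q_simps completed_localization_def)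
qed

text \<open>By \<open>Q_eqI\<close> each law has to be checked, at each level, on one pair only.
  Denominators are cleared one after the other until all the values that occur in the law are
  defined on that pair.\<close>

lemma ring_Q: "ring Q"
proof (rule ringI)
  note simps = Q_simps(2-)
  have add_assoc: "loc_add (loc_add x y) z = loc_add x (loc_add y z)"
    if x: "x \<in> carrier Q" and y: "y \<in> carrier Q" and z: "z \<in> carrier Q" for x y z
  proof (rule Q_eqI)
    fix N
    obtain s u v where 1: "s \<in> S" "(s, u) \<in> x N" "(s, v) \<in> y N" using Q_common[OF x y] .
    obtain a w where 2: "a \<in> S" "(a \<otimes> s, w) \<in> z N" using lrel_dense[OF QD(1)[OF z] S_carrier[OF 1(1)]] by blast
    note 3 = Q_scale[OF x 1(2) S_carrier[OF 2(1)]] Q_scale[OF y 1(3) S_carrier[OF 2(1)]] 2(2)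
    show "\<exists>s\<in>S. \<exists>u. (s, u) \<in> loc_add (loc_add x y) z N \<and> (s, u) \<in> loc_add x (loc_add y z) N"
    proof (intro bexI exI conjI)
      show "(a \<otimes> s, (a \<otimes> u \<oplus> a \<otimes> v) \<oplus> w) \<in> loc_add (loc_add x y) z N"
        using 3 x y z by (intro loc_addI) simp_all
      have "(a \<otimes> s, a \<otimes> u \<oplus> (a \<otimes> v \<oplus> w)) \<in> loc_add x (loc_add y z) N"
        using 3 x y z by (intro loc_addI) simp_all
      then show "(a \<otimes> s, (a \<otimes> u \<oplus> a \<otimes> v) \<oplus> w) \<in> loc_add x (loc_add y z) N"
        using Q_carrier[OF x 3(1)] Q_carrier[OF y 3(2)] Q_carrier[OF z 3(3)] by (simp add: a_assoc)
    qed (use S_mult 1 2 in blast)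
  qed (use x y z in simp_all)
  have add_comm: "loc_add x y = loc_add y x" if x: "x \<in> carrier Q" and y: "y \<in> carrier Q" for x y
  proof (rule Q_eqI)
    fix N
    obtain s u v where 1: "s \<in> S" "(s, u) \<in> x N" "(s, v) \<in> y N" using Q_common[OF x y] .
    show "\<exists>s\<in>S. \<exists>u. (s, u) \<in> loc_add x y N \<and> (s, u) \<in> loc_add y x N"
      using loc_addI[OF x y 1(2,3)] loc_addI[OF y x 1(3,2)] 1(1) Q_carrier[OF x 1(2)] Q_carrier[OF y 1(3)]
      by (metis a_comm)
  qed (use x y in simp_all)
  have add_zero: "loc_add (emb \<zero>) x = x" if x: "x \<in> carrier Q" for x
  proof (rule Q_eqI)
    fix N
    obtain s u where s: "s \<in> S" "(s, u) \<in> x N" using lrelD(7) QD(1)[OF x] by blast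
    have "(s, \<zero> \<oplus> u) \<in> loc_add (emb \<zero>) x N"
      using embI[OF S_carrier[OF s(1)] zero_closed] S_carrier[OF s(1)] s(2) x by (intro loc_addI) simp_all
    then show "\<exists>s\<in>S. \<exists>u. (s, u) \<in> loc_add (emb \<zero>) x N \<and> (s, u) \<in> x N"
      using s Q_carrier[OF x s(2)] by auto
  qed (use x in simp_all)
  have add_inv: "\<exists>y\<in>carrier Q. loc_add y x = emb \<zero>" if x: "x \<in> carrier Q" for x
  \<comment> \<open>The negative of \<open>x\<close> is \<open>x\<close> times the image of
    \<open>-1\<close>, so it needs no graph of its own.\<close>
  proof (rule bexI[of _ "loc_mult x (emb (\<ominus> \<one>))"], rule Q_eqI)
    fix N
    obtain s u where s: "s \<in> S" "(s, u) \<in> x N" using lrelD(7) QD(1)[OF x] by blast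
    note c = Q_carrier[OF x s(2)]
    have "(s, u \<otimes> \<ominus> \<one>) \<in> loc_mult x (emb (\<ominus> \<one>)) N"
      using c x s(2) by (intro loc_multI[of x "emb (\<ominus> \<one>)" s u] embI) simp_all
    then have "(s, u \<otimes> \<ominus> \<one> \<oplus> u) \<in> loc_add (loc_mult x (emb (\<ominus> \<one>))) x N"
      using s x by (intro loc_addI) simp_all
    then have "(s, \<zero>) \<in> loc_add (loc_mult x (emb (\<ominus> \<one>))) x N"
      using c by (simp add: r_minus l_neg)
    then show "\<exists>s\<in>S. \<exists>u. (s, u) \<in> loc_add (loc_mult x (emb (\<ominus> \<one>))) x N \<and> (s, u) \<in> emb \<zero> N"
      using s embI[OF c(1) zero_closed, of N] c by auto
  qed (use x in simp_all)
  show "abelian_group Q"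
    by (rule abelian_groupI; unfold simps;
        (rule loc_add_closed emb_closed[OF zero_closed] add_assoc add_zero add_inv | rule add_comm); assumption?)
  have "loc_mult (loc_mult x y) z = loc_mult x (loc_mult y z)"
    if x: "x \<in> carrier Q" and y: "y \<in> carrier Q" and z: "z \<in> carrier Q" for x y z
  proof (rule Q_eqI)
    fix N
    obtain s u v where 1: "s \<in> S" "(s, u) \<in> x N" "(u, v) \<in> y N" using Q_comp[OF x y] .
    obtain a w where 2: "a \<in> S" "(a \<otimes> v, w) \<in> z N"
      using lrel_dense[OF QD(1)[OF z] Q_carrier(2)[OF y 1(3)]] by blast
    note 3 = Q_scale[OF x 1(2) S_carrier[OF 2(1)]] Q_scale[OF y 1(3) S_carrier[OF 2(1)]] 2(2)
    have "(a \<otimes> s, w) \<in> loc_mult (loc_mult x y) z N"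
      using loc_multI[of "loc_mult x y" z, OF _ z loc_multI[OF x y 3(1,2)] 3(3)] x y by simp
    moreover have "(a \<otimes> s, w) \<in> loc_mult x (loc_mult y z) N"
      using loc_multI[of x "loc_mult y z", OF x _ 3(1) loc_multI[OF y z 3(2,3)]] y z by simp
    ultimately show "\<exists>s\<in>S. \<exists>u. (s, u) \<in> loc_mult (loc_mult x y) z N \<and> (s, u) \<in> loc_mult x (loc_mult y z) N"
      using S_mult[OF 2(1) 1(1)] by blast
  qed (use x y z in simp_all)
  moreover have "loc_mult (emb \<one>) x = x" "loc_mult x (emb \<one>) = x" if x: "x \<in> carrier Q" for x
  proof (rule_tac [!] Q_eqI)
    fix N
    obtain s u where s: "s \<in> S" "(s, u) \<in> x N" using lrelD(7) QD(1)[OF x] by blast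
    note c = Q_carrier[OF x s(2)]
    show "\<exists>s\<in>S. \<exists>u. (s, u) \<in> loc_mult (emb \<one>) x N \<and> (s, u) \<in> x N"
      using loc_multI[of "emb \<one>" x s s N u] embI[OF c(1) one_closed, of N] x c s by auto
    show "\<exists>s\<in>S. \<exists>u. (s, u) \<in> loc_mult x (emb \<one>) N \<and> (s, u) \<in> x N"
      using loc_multI[of x "emb \<one>" s u N u] embI[OF c(2) one_closed, of N] x c s by auto
  qed (use x in simp_all)
  ultimately show "Group.monoid Q"
    by (intro monoidI) (simp_all add: simps)
  fix x y z assume x: "x \<in> carrier Q" and y: "y \<in> carrier Q" and z: "z \<in> carrier Q"
  have "loc_mult (loc_add x y) z = loc_add (loc_mult x z) (loc_mult y z)"
  proof (rule Q_eqI)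
    fix N
    obtain s u v where 1: "s \<in> S" "(s, u) \<in> x N" "(s, v) \<in> y N" using Q_common[OF x y] .
    obtain a p where 2: "a \<in> S" "(a \<otimes> u, p) \<in> z N"
      using lrel_dense[OF QD(1)[OF z] Q_carrier(2)[OF x 1(2)]] by blast
    note a = S_carrier[OF 2(1)]
    note 3 = Q_scale[OF x 1(2) a] Q_scale[OF y 1(3) a]
    obtain b q where 4: "b \<in> S" "(b \<otimes> (a \<otimes> v), q) \<in> z N"
      using lrel_dense[OF QD(1)[OF z] Q_carrier(2)[OF y 3(2)]] by blast
    note b = S_carrier[OF 4(1)]
    note 5 = Q_scale[OF x 3(1) b] Q_scale[OF y 3(2) b] Q_scale[OF z 2(2) b] 4(2)
    have "(b \<otimes> (a \<otimes> s), b \<otimes> p \<oplus> q) \<in> loc_mult (loc_add x y) z N"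
      using loc_multI[of "loc_add x y" z, OF _ z loc_addI[OF x y 5(1,2)]] lrelD(4)[OF QD(1)[OF z] 5(3,4)] x y by simp
    moreover have "(b \<otimes> (a \<otimes> s), b \<otimes> p \<oplus> q) \<in> loc_add (loc_mult x z) (loc_mult y z) N"
      using loc_addI[of "loc_mult x z" "loc_mult y z", OF _ _ loc_multI[OF x z 5(1,3)] loc_multI[OF y z 5(2,4)]] x y z by simp
    ultimately show "\<exists>s\<in>S. \<exists>u. (s, u) \<in> loc_mult (loc_add x y) z N \<and> (s, u) \<in> loc_add (loc_mult x z) (loc_mult y z) N"
      using S_mult[OF 4(1) S_mult[OF 2(1) 1(1)]] by blast
  qed (use x y z in simp_all)
  then show "(x \<oplus>\<^bsub>Q\<^esub> y) \<otimes>\<^bsub>Q\<^esub> z = x \<otimes>\<^bsub>Q\<^esub> z \<oplus>\<^bsub>Q\<^esub> y \<otimes>\<^bsub>Q\<^esub> z" by (simp add: simps)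
  have "loc_mult z (loc_add x y) = loc_add (loc_mult z x) (loc_mult z y)"
  proof (rule Q_eqI)
    fix N
    obtain s u p where 1: "s \<in> S" "(s, u) \<in> z N" "(u, p) \<in> x N" using Q_comp[OF z x] .
    obtain a q where 2: "a \<in> S" "(a \<otimes> u, q) \<in> y N"
      using lrel_dense[OF QD(1)[OF y] Q_carrier(2)[OF z 1(2)]] by blast
    note a = S_carrier[OF 2(1)]
    note 3 = Q_scale[OF z 1(2) a] Q_scale[OF x 1(3) a] 2(2)
    have "(a \<otimes> s, a \<otimes> p \<oplus> q) \<in> loc_mult z (loc_add x y) N"
      using loc_multI[of z "loc_add x y", OF z _ 3(1) loc_addI[OF x y 3(2,3)]] x y by simp
    moreover have "(a \<otimes> s, a \<otimes> p \<oplus> q) \<in> loc_add (loc_mult z x) (loc_mult z y) N"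
      using loc_addI[of "loc_mult z x" "loc_mult z y", OF _ _ loc_multI[OF z x 3(1,2)] loc_multI[OF z y 3(1,3)]] x y z by simp
    ultimately show "\<exists>s\<in>S. \<exists>u. (s, u) \<in> loc_mult z (loc_add x y) N \<and> (s, u) \<in> loc_add (loc_mult z x) (loc_mult z y) N"
      using S_mult[OF 2(1) 1(1)] by blast
  qed (use x y z in simp_all)
  then show "z \<otimes>\<^bsub>Q\<^esub> (x \<oplus>\<^bsub>Q\<^esub> y) = z \<otimes>\<^bsub>Q\<^esub> x \<oplus>\<^bsub>Q\<^esub> z \<otimes>\<^bsub>Q\<^esub> y" by (simp add: simps)
qed

end

section \<open>Fraction fields\<close>

text \<open>Operations of \<open>frac_field\<close> are unions over representatives; they are
  evaluated by showing that all members of the union agree.\<close>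

lemma UN_const_eq:
  assumes "U \<noteq> {}" "W \<noteq> {}" "\<And>a s b t. (a, s) \<in> U \<Longrightarrow> (b, t) \<in> W \<Longrightarrow> F a s b t = C"
  shows "(\<Union>(a, s)\<in>U. \<Union>(b, t)\<in>W. F a s b t) = C"
proof -
  have "(\<Union>(a, s)\<in>U. \<Union>(b, t)\<in>W. F a s b t) = (\<Union>(a, s)\<in>U. \<Union>(b, t)\<in>W. C)"
    using assms(3) by (intro SUP_cong refl) (auto intro!: SUP_cong)
  then show ?thesis using assms(1,2) by auto
qed

locale fractions = "domain" T for T :: "('k, 'a, 'm) poisson_scheme" (structure)
begin

abbreviation D where "D \<equiv> carrier T - {\<zero>}"
abbreviation K where "K \<equiv> frac_field T"

lemma D_mult [simp]: "s \<in> D \<Longrightarrow> t \<in> D \<Longrightarrow> s \<otimes> t \<in> D"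
  by (auto simp: integral_iff)

lemma one_in_D [simp]: "\<one> \<in> D" by simp

lemma fraction_subset:
  assumes "a \<in> carrier T" "s \<in> D" "b \<in> carrier T" "t \<in> D" "a \<otimes> t = b \<otimes> s"
  shows "fraction T a s \<subseteq> fraction T b t"
proof (clarsimp simp: fraction_def)
  fix c u assume 1: "c \<in> carrier T" "u \<in> carrier T" "a \<otimes> u = c \<otimes> s"
  have "s \<otimes> (b \<otimes> u) = (b \<otimes> s) \<otimes> u" using assms 1 by (simp add: m_ac)
  also have "\<dots> = t \<otimes> (a \<otimes> u)" unfolding assms(5)[symmetric] using assms(1-4) 1(1,2) by (simp add: m_ac)
  also have "\<dots> = s \<otimes> (c \<otimes> t)" unfolding 1(3) using assms(1-4) 1(1,2) by (simp add: m_ac)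
  finally show "b \<otimes> u = c \<otimes> t" using assms(1-4) 1 m_lcancel by simp
qed

lemma fraction_eq_iff:
  assumes "a \<in> carrier T" "s \<in> D" "b \<in> carrier T" "t \<in> D"
  shows "fraction T a s = fraction T b t \<longleftrightarrow> a \<otimes> t = b \<otimes> s"
proof
  assume "fraction T a s = fraction T b t"
  moreover have "(b, t) \<in> fraction T b t" using assms by (simp add: fraction_def)
  ultimately have "(b, t) \<in> fraction T a s" by simp
  then show "a \<otimes> t = b \<otimes> s" by (simp add: fraction_def)
next
  assume "a \<otimes> t = b \<otimes> s"
  then show "fraction T a s = fraction T b t"
    using fraction_subset[OF assms] fraction_subset[OF assms(3,4,1,2)] by simp
qed

lemma fraction_mem:
  assumes "(b, t) \<in> fraction T a s" "a \<in> carrier T" "s \<in> D"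
  shows "b \<in> carrier T" "t \<in> D" "fraction T b t = fraction T a s"
proof -
  show b: "b \<in> carrier T" and t: "t \<in> D" using assms by (auto simp: fraction_def)
  show "fraction T b t = fraction T a s"
    using assms b t fraction_eq_iff[OF b t assms(2,3)] by (auto simp: fraction_def)
qed

lemma fraction_nonempty: "a \<in> carrier T \<Longrightarrow> s \<in> D \<Longrightarrow> fraction T a s \<noteq> {}"
  by (auto simp: fraction_def)

lemma frac_carrier: "carrier K = {fraction T a s | a s. a \<in> carrier T \<and> s \<in> D}"
  by (simp add: frac_field_def)

lemma frac_closed [simp]: "a \<in> carrier T \<Longrightarrow> s \<in> D \<Longrightarrow> fraction T a s \<in> carrier K"
  unfolding frac_carrier by blast

lemma frac_cases:
  assumes "x \<in> carrier K"
  obtains a s where "a \<in> carrier T" "s \<in> D" "x = fraction T a s"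
  using assms unfolding frac_carrier by blast

lemma frac_zero: "\<zero>\<^bsub>K\<^esub> = fraction T \<zero> \<one>" and frac_one: "\<one>\<^bsub>K\<^esub> = fraction T \<one> \<one>"
  by (simp_all add: frac_field_def)

lemma frac_eq_zero: "a \<in> carrier T \<Longrightarrow> s \<in> D \<Longrightarrow> fraction T a s = \<zero>\<^bsub>K\<^esub> \<longleftrightarrow> a = \<zero>"
  unfolding frac_zero by (subst fraction_eq_iff) auto

lemma frac_eq_one: "s \<in> D \<Longrightarrow> fraction T s s = \<one>\<^bsub>K\<^esub>"
  unfolding frac_one by (subst fraction_eq_iff) auto

lemma frac_mult:
  assumes "a \<in> carrier T" "s \<in> D" "b \<in> carrier T" "t \<in> D"
  shows "fraction T a s \<otimes>\<^bsub>K\<^esub> fraction T b t = fraction T (a \<otimes> b) (s \<otimes> t)"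
proof -
  have "fraction T (a' \<otimes> b') (s' \<otimes> t') = fraction T (a \<otimes> b) (s \<otimes> t)"
    if "(a', s') \<in> fraction T a s" "(b', t') \<in> fraction T b t" for a' s' b' t'
  proof -
    note 1 = fraction_mem[OF that(1) assms(1,2)] and 2 = fraction_mem[OF that(2) assms(3,4)]
    have e: "a' \<otimes> s = a \<otimes> s'" "b' \<otimes> t = b \<otimes> t'"
      using fraction_eq_iff[OF 1(1,2) assms(1,2)] fraction_eq_iff[OF 2(1,2) assms(3,4)] 1 2 by simp_all
    have "a' \<otimes> b' \<otimes> (s \<otimes> t) = (a' \<otimes> s) \<otimes> (b' \<otimes> t)" using 1 2 assms by (simp add: m_ac)
    also have "\<dots> = a \<otimes> b \<otimes> (s' \<otimes> t')" unfolding e using 1 2 assms by (simp add: m_ac)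
    finally show ?thesis using 1 2 assms by (subst fraction_eq_iff) (simp_all add: DiffD1 del: Diff_iff)
  qed
  then show ?thesis
    unfolding frac_field_def using fraction_nonempty assms by (simp add: UN_const_eq del: Diff_iff)
qed

lemma frac_add:
  assumes "a \<in> carrier T" "s \<in> D" "b \<in> carrier T" "t \<in> D"
  shows "fraction T a s \<oplus>\<^bsub>K\<^esub> fraction T b t = fraction T (a \<otimes> t \<oplus> b \<otimes> s) (s \<otimes> t)"
proof -
  have "fraction T (a' \<otimes> t' \<oplus> b' \<otimes> s') (s' \<otimes> t') = fraction T (a \<otimes> t \<oplus> b \<otimes> s) (s \<otimes> t)"
    if "(a', s') \<in> fraction T a s" "(b', t') \<in> fraction T b t" for a' s' b' t'
  proof -
    note 1 = fraction_mem[OF that(1) assms(1,2)] and 2 = fraction_mem[OF that(2) assms(3,4)]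
    have e: "a' \<otimes> s = a \<otimes> s'" "b' \<otimes> t = b \<otimes> t'"
      using fraction_eq_iff[OF 1(1,2) assms(1,2)] fraction_eq_iff[OF 2(1,2) assms(3,4)] 1 2 by simp_all
    have "(a' \<otimes> t' \<oplus> b' \<otimes> s') \<otimes> (s \<otimes> t) = (a' \<otimes> s) \<otimes> (t' \<otimes> t) \<oplus> (b' \<otimes> t) \<otimes> (s' \<otimes> s)"
      using 1 2 assms by (simp add: m_ac l_distr r_distr)
    also have "\<dots> = (a \<otimes> t \<oplus> b \<otimes> s) \<otimes> (s' \<otimes> t')"
      unfolding e using 1 2 assms by (simp add: m_ac l_distr r_distr)
    finally show ?thesis using 1 2 assms by (subst fraction_eq_iff) (simp_all add: DiffD1 del: Diff_iff)
  qed
  then show ?thesis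
    unfolding frac_field_def using fraction_nonempty assms by (simp add: UN_const_eq del: Diff_iff)
qed

lemma frac_add_same:
  assumes "a \<in> carrier T" "b \<in> carrier T" "s \<in> D"
  shows "fraction T a s \<oplus>\<^bsub>K\<^esub> fraction T b s = fraction T (a \<oplus> b) s"
proof -
  have "(a \<otimes> s \<oplus> b \<otimes> s) \<otimes> s = (a \<oplus> b) \<otimes> (s \<otimes> s)" using assms by (simp add: m_ac l_distr r_distr)
  then show ?thesis
    using assms by (simp add: frac_add del: Diff_iff) (subst fraction_eq_iff, simp_all del: Diff_iff add: DiffD1)
qed

lemma field_K: "field K"
proof -
  have "abelian_group K"
  proof (rule abelian_groupI)
    fix x y z assume x: "x \<in> carrier K" and y: "y \<in> carrier K" and z: "z \<in> carrier K"
    obtain a s where 11: "a \<in> carrier T" "s \<in> D" "x = fraction T a s" by (rule frac_cases[OF x])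
    obtain b t where 12: "b \<in> carrier T" "t \<in> D" "y = fraction T b t" by (rule frac_cases[OF y])
    obtain c u where 13: "c \<in> carrier T" "u \<in> D" "z = fraction T c u" by (rule frac_cases[OF z])
    note 1 = 11 12 13 and 2 = DiffD1[OF 11(2)] DiffD1[OF 12(2)] DiffD1[OF 13(2)]
    show "x \<oplus>\<^bsub>K\<^esub> y \<oplus>\<^bsub>K\<^esub> z = x \<oplus>\<^bsub>K\<^esub> (y \<oplus>\<^bsub>K\<^esub> z)"
      using 1 2 by (simp add: frac_add l_distr r_distr m_ac a_ac del: Diff_iff)
    show "x \<oplus>\<^bsub>K\<^esub> y \<in> carrier K" using 1 2 by (simp add: frac_add del: Diff_iff)
    show "x \<oplus>\<^bsub>K\<^esub> y = y \<oplus>\<^bsub>K\<^esub> x" using 1 2 by (simp add: frac_add m_ac a_ac del: Diff_iff)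
    show "\<zero>\<^bsub>K\<^esub> \<oplus>\<^bsub>K\<^esub> x = x" unfolding frac_zero using 1 2 by (simp add: frac_add del: Diff_iff)
    have "fraction T (\<ominus> a) s \<oplus>\<^bsub>K\<^esub> x = \<zero>\<^bsub>K\<^esub>"
      using 1 by (simp add: frac_add_same l_neg frac_eq_zero del: Diff_iff)
    then show "\<exists>y\<in>carrier K. y \<oplus>\<^bsub>K\<^esub> x = \<zero>\<^bsub>K\<^esub>" using 1(1-3) by (intro bexI[of _ "fraction T (\<ominus> a) s"] frac_closed) simp_all
  qed (simp add: frac_zero)
  moreover have "comm_monoid K"
  proof (rule comm_monoidI)
    fix x y z assume x: "x \<in> carrier K" and y: "y \<in> carrier K" and z: "z \<in> carrier K"
    obtain a s where 11: "a \<in> carrier T" "s \<in> D" "x = fraction T a s" by (rule frac_cases[OF x])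
    obtain b t where 12: "b \<in> carrier T" "t \<in> D" "y = fraction T b t" by (rule frac_cases[OF y])
    obtain c u where 13: "c \<in> carrier T" "u \<in> D" "z = fraction T c u" by (rule frac_cases[OF z])
    note 1 = 11 12 13 and 2 = DiffD1[OF 11(2)] DiffD1[OF 12(2)] DiffD1[OF 13(2)]
    show "x \<otimes>\<^bsub>K\<^esub> y \<otimes>\<^bsub>K\<^esub> z = x \<otimes>\<^bsub>K\<^esub> (y \<otimes>\<^bsub>K\<^esub> z)"
      using 1 2 by (simp add: frac_mult m_ac del: Diff_iff)
    show "x \<otimes>\<^bsub>K\<^esub> y \<in> carrier K" using 1 2 by (simp add: frac_mult del: Diff_iff)
    show "x \<otimes>\<^bsub>K\<^esub> y = y \<otimes>\<^bsub>K\<^esub> x" using 1 2 by (simp add: frac_mult m_ac del: Diff_iff)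
    show "\<one>\<^bsub>K\<^esub> \<otimes>\<^bsub>K\<^esub> x = x" unfolding frac_one using 1 2 by (simp add: frac_mult del: Diff_iff)
  qed (simp add: frac_one)
  moreover have "(x \<oplus>\<^bsub>K\<^esub> y) \<otimes>\<^bsub>K\<^esub> z = x \<otimes>\<^bsub>K\<^esub> z \<oplus>\<^bsub>K\<^esub> y \<otimes>\<^bsub>K\<^esub> z"
    if x: "x \<in> carrier K" and y: "y \<in> carrier K" and z: "z \<in> carrier K" for x y z
  proof -
    obtain a s where 11: "a \<in> carrier T" "s \<in> D" "x = fraction T a s" by (rule frac_cases[OF x])
    obtain b t where 12: "b \<in> carrier T" "t \<in> D" "y = fraction T b t" by (rule frac_cases[OF y])
    obtain c u where 13: "c \<in> carrier T" "u \<in> D" "z = fraction T c u" by (rule frac_cases[OF z])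
    note 1 = 11 12 13 and 2 = DiffD1[OF 11(2)] DiffD1[OF 12(2)] DiffD1[OF 13(2)]
    show ?thesis
      using 1 2 by (simp add: frac_mult frac_add del: Diff_iff)
        (subst fraction_eq_iff, simp_all add: l_distr r_distr m_ac del: Diff_iff)
  qed
  ultimately interpret K: cring K by (intro cringI) auto
  show ?thesis
  proof (rule K.cring_fieldI2)
    show "\<zero>\<^bsub>K\<^esub> \<noteq> \<one>\<^bsub>K\<^esub>" using frac_eq_zero[of \<one> \<one>] by (simp add: frac_one)
    fix x assume x: "x \<in> carrier K" "x \<noteq> \<zero>\<^bsub>K\<^esub>"
    obtain a s where 1: "a \<in> carrier T" "s \<in> D" "x = fraction T a s" by (rule frac_cases[OF x(1)])
    have a: "a \<in> D" using x 1 frac_eq_zero by auto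
    have "x \<otimes>\<^bsub>K\<^esub> fraction T s a = fraction T (a \<otimes> s) (s \<otimes> a)"
      using 1 a by (auto simp: frac_mult)
    also have "\<dots> = \<one>\<^bsub>K\<^esub>"
      using 1 a frac_eq_one[of "a \<otimes> s"] by (simp add: m_comm integral_iff)
    finally show "\<exists>y\<in>carrier K. x \<otimes>\<^bsub>K\<^esub> y = \<one>\<^bsub>K\<^esub>" using 1 a by (intro bexI[of _ "fraction T s a"]) auto
  qed
qed


definition incl :: "'a \<Rightarrow> ('a \<times> 'a) set" where "incl a = fraction T a \<one>"

lemma incl_hom: "incl \<in> ring_hom T K"
  unfolding incl_def using one_in_D
  by (intro ring_hom_memI) (simp_all add: frac_mult frac_add_same frac_one del: Diff_iff)

lemma frac_unique:
  assumes "x \<in> carrier K" "a \<in> carrier T" "s \<in> D" "x \<otimes>\<^bsub>K\<^esub> incl s = incl a"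
  shows "x = fraction T a s"
proof -
  obtain b t where b: "b \<in> carrier T" "t \<in> D" "x = fraction T b t" using frac_cases[OF assms(1)] .
  have "fraction T (b \<otimes> s) t = fraction T a \<one>"
    using assms(4) assms(3) b one_in_D unfolding incl_def by (simp add: frac_mult DiffD1 del: Diff_iff)
  then have "b \<otimes> s = a \<otimes> t"
    using fraction_eq_iff[of "b \<otimes> s" t a \<one>] assms b by simp
  then show ?thesis using fraction_eq_iff[OF b(1,2) assms(2,3)] b by simp
qed

lemma frac_smult:
  assumes smult: "\<And>x. x \<in> carrier T \<Longrightarrow> c \<odot> x = r \<otimes> x" and r: "r \<in> carrier T" and x: "x \<in> carrier K"
  shows "c \<odot>\<^bsub>K\<^esub> x = incl r \<otimes>\<^bsub>K\<^esub> x"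
proof -
  obtain a s where a: "a \<in> carrier T" "s \<in> D" "x = fraction T a s" using frac_cases[OF x] .
  have *: "fraction T (c \<odot> a') s' = incl r \<otimes>\<^bsub>K\<^esub> x" if "(a', s') \<in> x" for a' s'
  proof -
    note 1 = fraction_mem[OF that[unfolded a(3)] a(1,2)]
    then show ?thesis using r one_in_D smult[OF 1(1)] unfolding incl_def a(3) 1(3)[symmetric]
      by (simp add: frac_mult DiffD1 del: Diff_iff)
  qed
  have "(\<Union>(a, s)\<in>x. fraction T (c \<odot> a) s) = (\<Union>(a, s)\<in>x. incl r \<otimes>\<^bsub>K\<^esub> x)"
  proof (intro SUP_cong refl)
    fix p assume "p \<in> x"
    then show "(case p of (a, s) \<Rightarrow> fraction T (c \<odot> a) s) = (case p of (a, s) \<Rightarrow> incl r \<otimes>\<^bsub>K\<^esub> x)"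
      using *[of "fst p" "snd p"] by (simp add: case_prod_beta)
  qed
  moreover have "x \<noteq> {}" using a fraction_nonempty by simp
  moreover have "c \<odot>\<^bsub>K\<^esub> x = (\<Union>(a, s)\<in>x. fraction T (c \<odot> a) s)" by (simp add: frac_field_def)
  ultimately show ?thesis by (simp add: case_prod_beta)
qed

end

text \<open>The properties of the completion on which all later arguments rest. Completeness is
  stated without limits: \<open>\<Sigma> g\<close> stands for the sum of the terms
  \<open>h^m g m\<close>, and the recursion for it, iterated, fixes it modulo every power of
  \<open>h\<close>.\<close>

locale hadic_ring = Q?: ring Q + K: field K
  for Q :: "('q, 'x) ring_scheme" (structure) and K :: "('v, 'y) ring_scheme" +
  fixes h :: 'q and red :: "'q \<Rightarrow> 'v"
  assumes h_closed [simp, intro]: "h \<in> carrier Q"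
    and h_central: "x \<in> carrier Q \<Longrightarrow> x \<otimes> h = h \<otimes> x"
    and h_torsion_free: "x \<in> carrier Q \<Longrightarrow> h \<otimes> x = \<zero> \<Longrightarrow> x = \<zero>"
    and red_hom: "red \<in> ring_hom Q K"
    and red_h: "red h = \<zero>\<^bsub>K\<^esub>"
    and red_surj: "red ` carrier Q = carrier K"
    and red_kernel: "x \<in> carrier Q \<Longrightarrow> red x = \<zero>\<^bsub>K\<^esub> \<Longrightarrow> \<exists>y\<in>carrier Q. x = h \<otimes> y"
    and separated: "x \<in> carrier Q \<Longrightarrow> (\<And>N::nat. \<exists>y\<in>carrier Q. x = h [^] N \<otimes> y) \<Longrightarrow> x = \<zero>"
    and complete: "\<exists>\<Sigma>. \<forall>g. (\<forall>m. g m \<in> carrier Q) \<longrightarrow>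
        \<Sigma> g \<in> carrier Q \<and> \<Sigma> g = g 0 \<oplus> h \<otimes> \<Sigma> (\<lambda>m::nat. g (Suc m))"

section \<open>The reduction map from the completed localization to the fraction field\<close>

locale formal_domain = formal_ring R T h \<rho> + T: fractions T
  for R :: "('r, 'x) ring_scheme" (structure) and T :: "('k, 't, 'y) poisson_scheme" and h \<rho>
begin

definition red :: "(nat \<Rightarrow> ('r \<times> 'r) set) \<Rightarrow> ('t \<times> 't) set" where
  "red x = (let p = (SOME p. fst p \<in> S \<and> p \<in> x 1) in fraction T (\<rho> (snd p)) (\<rho> (fst p)))"

lemma rho_S: "s \<in> S \<Longrightarrow> \<rho> s \<in> T.D"
  by (simp add: S_def)

text \<open>Level 1 describes the fraction modulo \<open>h\<close>. For two of its pairs the Ore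
  condition gives \<open>a s' = b s\<close> and \<open>a u' = b u\<close> modulo \<open>h\<close>;
  cancelling \<open>\<rho> a\<close> in \<open>T\<close> shows that the choice made in
  \<open>red\<close> does not matter.\<close>

lemma red_eq:
  assumes x: "x \<in> carrier Q" and s: "s \<in> S" "(s, u) \<in> x 1"
  shows "red x = fraction T (\<rho> u) (\<rho> s)"
proof -
  define p where "p = (SOME p. fst p \<in> S \<and> p \<in> x 1)"
  have "fst p \<in> S \<and> p \<in> x 1"
    unfolding p_def by (rule someI[of _ "(s, u)"]) (use s in simp)
  then obtain s' u' where p: "p = (s', u')" "s' \<in> S" "(s', u') \<in> x 1" by (cases p) auto
  note c = Q_carrier[OF x s(2)] Q_carrier[OF x p(3)]
  obtain a b where ab: "a \<in> S" "b \<in> carrier R" "a \<otimes> s' \<ominus> b \<otimes> s \<in> I 1"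
    using ore[OF c(3) s(1)] by blast
  note a = S_carrier[OF ab(1)]
  have "a \<otimes> u' \<ominus> b \<otimes> u \<in> I 1"
    using lrel_unique[OF QD(1)[OF x] Q_scale[OF x p(3) a] Q_scale[OF x s(2) ab(2)] ab(3)] .
  then have "\<rho> (a \<otimes> u' \<ominus> b \<otimes> u) = \<zero>\<^bsub>T\<^esub>" using I_1 a ab(2) c by simp
  then have 1: "\<rho> a \<otimes>\<^bsub>T\<^esub> \<rho> u' = \<rho> b \<otimes>\<^bsub>T\<^esub> \<rho> u" using a ab(2) c by (simp add: T.r_right_minus_eq)
  have "\<rho> (a \<otimes> s' \<ominus> b \<otimes> s) = \<zero>\<^bsub>T\<^esub>" using I_1 ab(3) a ab(2) c by simp
  then have 2: "\<rho> a \<otimes>\<^bsub>T\<^esub> \<rho> s' = \<rho> b \<otimes>\<^bsub>T\<^esub> \<rho> s" using a ab(2) c by (simp add: T.r_right_minus_eq)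
  have t: "\<rho> a \<in> carrier T" "\<rho> u' \<in> carrier T" "\<rho> b \<in> carrier T" "\<rho> u \<in> carrier T"
    "\<rho> s' \<in> carrier T" "\<rho> s \<in> carrier T" using a ab(2) c by simp_all
  have "\<rho> a \<otimes>\<^bsub>T\<^esub> (\<rho> u' \<otimes>\<^bsub>T\<^esub> \<rho> s) = (\<rho> a \<otimes>\<^bsub>T\<^esub> \<rho> u') \<otimes>\<^bsub>T\<^esub> \<rho> s" using t by (simp add: T.m_assoc)
  also have "\<dots> = \<rho> u \<otimes>\<^bsub>T\<^esub> (\<rho> b \<otimes>\<^bsub>T\<^esub> \<rho> s)" unfolding 1 using t by (simp add: T.m_ac)
  also have "\<dots> = \<rho> a \<otimes>\<^bsub>T\<^esub> (\<rho> u \<otimes>\<^bsub>T\<^esub> \<rho> s')" unfolding 2[symmetric] using t by (simp add: T.m_ac)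
  finally have "\<rho> u' \<otimes>\<^bsub>T\<^esub> \<rho> s = \<rho> u \<otimes>\<^bsub>T\<^esub> \<rho> s'"
    using T.m_lcancel[of "\<rho> a"] rho_S[OF ab(1)] t by simp
  then have "fraction T (\<rho> u') (\<rho> s') = fraction T (\<rho> u) (\<rho> s)"
    using T.fraction_eq_iff[OF t(2) rho_S[OF p(2)] t(4) rho_S[OF s(1)]] by simp
  then show ?thesis unfolding red_def p_def[symmetric] Let_def by (simp add: p(1))
qed

lemma emb_hom: "emb \<in> ring_hom R Q"
proof (rule ring_hom_memI)
  fix r r' assume r: "r \<in> carrier R" and r': "r' \<in> carrier R"
  show "emb (r \<otimes> r') = emb r \<otimes>\<^bsub>Q\<^esub> emb r'"
    unfolding Q_simps
  proof (rule Q_eqI)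
    show "\<exists>s\<in>S. \<exists>u. (s, u) \<in> emb (r \<otimes> r') N \<and> (s, u) \<in> loc_mult (emb r) (emb r') N" for N
      using embI[of \<one> "r \<otimes> r'" N] loc_multI[of "emb r" "emb r'" \<one> r N "r \<otimes> r'"] embI[of \<one> r N] embI[of r r' N] r r'
      by auto
  qed (use r r' in simp_all)
  show "emb (r \<oplus> r') = emb r \<oplus>\<^bsub>Q\<^esub> emb r'"
    unfolding Q_simps
  proof (rule Q_eqI)
    show "\<exists>s\<in>S. \<exists>u. (s, u) \<in> emb (r \<oplus> r') N \<and> (s, u) \<in> loc_add (emb r) (emb r') N" for N
      using embI[of \<one> "r \<oplus> r'" N] loc_addI[of "emb r" "emb r'" \<one> r N "r'"] embI[of \<one> r N] embI[of \<one> r' N] r r'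
      by auto
  qed (use r r' in simp_all)
qed (simp_all add: Q_simps(3))

text \<open>If \<open>(s, u)\<close> is in the graph of \<open>x\<close>, then so is
  \<open>(r s, r u)\<close>, which equals \<open>(s r, u r)\<close>; both products therefore contain
  \<open>(s, u r)\<close>. Used for \<open>h\<close> and for the scalars.\<close>

lemma emb_central:
  assumes r: "r \<in> carrier R" "\<And>u. u \<in> carrier R \<Longrightarrow> u \<otimes> r = r \<otimes> u" and x: "x \<in> carrier Q"
  shows "x \<otimes>\<^bsub>Q\<^esub> emb r = emb r \<otimes>\<^bsub>Q\<^esub> x"
  unfolding Q_simps
proof (rule Q_eqI)
  fix N
  obtain s u where s: "s \<in> S" "(s, u) \<in> x N" using lrelD(7) QD(1)[OF x] by blast
  note c = Q_carrier[OF x s(2)]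
  have "(s, u \<otimes> r) \<in> loc_mult x (emb r) N"
    using loc_multI[OF x _ s(2), of "emb r" "u \<otimes> r"] embI[OF c(2) r(1)] r(1) by simp
  moreover have "(s \<otimes> r, u \<otimes> r) \<in> x N"
    using Q_scale[OF x s(2) r(1)] r(2) c by simp
  then have "(s, u \<otimes> r) \<in> loc_mult (emb r) x N"
    using loc_multI[of "emb r" x s "s \<otimes> r" N "u \<otimes> r"] embI[OF c(1) r(1)] r(1) x by simp
  ultimately show "\<exists>s\<in>S. \<exists>u. (s, u) \<in> loc_mult x (emb r) N \<and> (s, u) \<in> loc_mult (emb r) x N"
    using s(1) by blast
qed (use x r(1) in simp_all)

lemma red_hom: "red \<in> ring_hom Q T.K"
proof (rule ring_hom_memI)
  fix x assume x: "x \<in> carrier Q"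
  obtain s u where s: "s \<in> S" "(s, u) \<in> x 1" using lrelD(7) QD(1)[OF x] by blast
  note c = Q_carrier[OF x s(2)]
  show "red x \<in> carrier T.K" unfolding red_eq[OF x s] using T.frac_closed rho_S[OF s(1)] c by simp
  fix y assume y: "y \<in> carrier Q"
  obtain s u v where 1: "s \<in> S" "(s, u) \<in> x 1" "(s, v) \<in> y 1" using Q_common[OF x y] .
  show "red (x \<oplus>\<^bsub>Q\<^esub> y) = red x \<oplus>\<^bsub>T.K\<^esub> red y"
    unfolding red_eq[OF x 1(1,2)] red_eq[OF y 1(1,3)] Q_simps red_eq[OF loc_add_closed[OF x y] 1(1) loc_addI[OF x y 1(2,3)]]
    using Q_carrier[OF x 1(2)] Q_carrier[OF y 1(3)] T.frac_add_same rho_S[OF 1(1)] by simp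
  obtain s u v where 2: "s \<in> S" "(s, u) \<in> x 1" "(u, v) \<in> y 1" using Q_comp[OF x y] .
  note c = Q_carrier[OF x 2(2)] Q_carrier[OF y 2(3)]
  have t: "\<rho> u \<in> carrier T" "\<rho> v \<in> carrier T" "\<rho> s \<in> T.D" using c rho_S[OF 2(1)] by simp_all
  have e: "red (x \<otimes>\<^bsub>Q\<^esub> y) = fraction T (\<rho> v) (\<rho> s)" "red x = fraction T (\<rho> u) (\<rho> s)"
    unfolding Q_simps using red_eq[OF loc_mult_closed[OF x y] 2(1) loc_multI[OF x y 2(2,3)]] red_eq[OF x 2(1,2)] by simp_all
  show "red (x \<otimes>\<^bsub>Q\<^esub> y) = red x \<otimes>\<^bsub>T.K\<^esub> red y"
  \<comment> \<open>The pair \<open>(u, v)\<close> computes \<open>red y\<close> only if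
    \<open>u\<close> is in \<open>S\<close>. Otherwise \<open>u\<close>, and hence \<open>v\<close>,
    vanishes modulo \<open>h\<close>, and both sides are zero.\<close>
  proof (cases "u \<in> S")
    case True
    have "\<rho> v \<otimes>\<^bsub>T\<^esub> (\<rho> s \<otimes>\<^bsub>T\<^esub> \<rho> u) = \<rho> u \<otimes>\<^bsub>T\<^esub> \<rho> v \<otimes>\<^bsub>T\<^esub> \<rho> s"
      using t by (simp add: T.m_ac)
    then show ?thesis
      unfolding e red_eq[OF y True 2(3)] T.frac_mult[OF t(1,3,2) rho_S[OF True]]
      using t T.D_mult[OF t(3) rho_S[OF True]] by (subst T.fraction_eq_iff) simp_all
  next
    case False
    interpret K: field T.K by (rule T.field_K)
    have u: "\<rho> u = \<zero>\<^bsub>T\<^esub>" using False c by (simp add: S_def)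
    then have "v \<in> I 1" using lrelD(6)[OF QD(1)[OF y] 2(3)] I_1 c by simp
    then have "\<rho> v = \<zero>\<^bsub>T\<^esub>" using I_1 c by simp
    moreover have "red y \<in> carrier T.K"
    proof -
      obtain s u where s: "s \<in> S" "(s, u) \<in> y 1" using lrelD(7) QD(1)[OF y] by blast
      then show ?thesis unfolding red_eq[OF y s] using T.frac_closed rho_S[OF s(1)] Q_carrier[OF y s(2)] by simp
    qed
    ultimately show ?thesis
      using e u t T.frac_eq_zero[of "\<zero>\<^bsub>T\<^esub>" "\<rho> s"] by simp
  qed
next
  show "red \<one>\<^bsub>Q\<^esub> = \<one>\<^bsub>T.K\<^esub>"
    unfolding Q_simps using red_eq[OF emb_closed[OF one_closed] one_in_S embI[OF one_closed one_closed]]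
    by (simp add: T.frac_one)
qed

lemma red_emb: "r \<in> carrier R \<Longrightarrow> red (emb r) = T.incl (\<rho> r)"
  using red_eq[OF emb_closed one_in_S embI[OF one_closed]] by (simp add: T.incl_def)

lemma red_surj: "red ` carrier Q = carrier T.K"
proof (rule equalityI)
  show "carrier T.K \<subseteq> red ` carrier Q"
  proof
    fix y assume "y \<in> carrier T.K"
    then obtain a t where a: "a \<in> carrier T" "t \<in> T.D" "y = fraction T a t" by (rule T.frac_cases)
    have "a \<in> \<rho> ` carrier R" "t \<in> \<rho> ` carrier R" using a unfolding rho_surj by simp_all
    then obtain u s where us: "u \<in> carrier R" "s \<in> carrier R" "a = \<rho> u" "t = \<rho> s" by blast
    have s: "s \<in> S" using us a by (simp add: S_def)
    \<comment> \<open>The pairs congruent to \<open>(b s, b u)\<close>: the graph of right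
      multiplication by \<open>s^(-1) u\<close> on the left ideal generated by \<open>s\<close>
      modulo \<open>h^N\<close>, with saturation still to be applied.\<close>
    define \<Gamma> where "\<Gamma> = (\<lambda>N. {(t, v). t \<in> carrier R \<and> v \<in> carrier R \<and>
        (\<exists>b\<in>carrier R. t \<ominus> b \<otimes> s \<in> I N \<and> v \<ominus> b \<otimes> u \<in> I N)})"
    have "lrel N (\<Gamma> N)" for N
    proof (rule lrelI)
      fix t v assume "(t, v) \<in> \<Gamma> N"
      then obtain b where b: "t \<in> carrier R" "v \<in> carrier R" "b \<in> carrier R"
        "t \<ominus> b \<otimes> s \<in> I N" "v \<ominus> b \<otimes> u \<in> I N" by (auto simp: \<Gamma>_def)
      show "t \<in> carrier R \<and> v \<in> carrier R" using b by simp
      { assume "t \<in> I N"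
        then have "t \<ominus> (t \<ominus> b \<otimes> s) \<in> I N" using I_minus[OF _ b(4)] by simp
        then have "b \<otimes> s \<in> I N" using b us by (simp add: a_minus_def minus_add a_assoc[symmetric] r_neg)
        then have "b \<in> I N" using S_regular[OF s b(3)] by simp
        then have "(v \<ominus> b \<otimes> u) \<oplus> b \<otimes> u \<in> I N" using I_add[OF b(5)] I_rmult[OF us(1)] by simp
        then show "v \<in> I N" using b us by (simp add: a_minus_def a_assoc l_neg) }
      { fix r assume r: "r \<in> carrier R"
        have "r \<otimes> t \<ominus> (r \<otimes> b) \<otimes> s \<in> I N" "r \<otimes> v \<ominus> (r \<otimes> b) \<otimes> u \<in> I N"
          using I_lmult[OF r b(4)] I_lmult[OF r b(5)] b us r
          by (simp_all add: a_minus_def r_distr r_minus m_assoc)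
        then show "(r \<otimes> t, r \<otimes> v) \<in> \<Gamma> N"
          using b r unfolding \<Gamma>_def by (simp, intro bexI[of _ "r \<otimes> b"]) simp_all }
      fix t' v' assume "(t', v') \<in> \<Gamma> N"
      then obtain b' where b': "t' \<in> carrier R" "v' \<in> carrier R" "b' \<in> carrier R"
        "t' \<ominus> b' \<otimes> s \<in> I N" "v' \<ominus> b' \<otimes> u \<in> I N" by (auto simp: \<Gamma>_def)
      have "(t \<oplus> t') \<ominus> (b \<oplus> b') \<otimes> s \<in> I N" "(v \<oplus> v') \<ominus> (b \<oplus> b') \<otimes> u \<in> I N"
        using I_add[OF b(4) b'(4)] I_add[OF b(5) b'(5)] b(1-3) b'(1-3) us
        by (simp_all add: a_minus_def l_distr minus_add a_ac)
      then show "(t \<oplus> t', v \<oplus> v') \<in> \<Gamma> N"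
        using b b' unfolding \<Gamma>_def by (simp, intro bexI[of _ "b \<oplus> b'"]) simp_all
    next
      show "(t, v) \<in> \<Gamma> N" if "t \<in> I N" "v \<in> I N" for t v
        using that I_carrier us unfolding \<Gamma>_def by (simp, intro bexI[of _ \<zero>]) (simp_all add: a_minus_def)
      have "(s, u) \<in> \<Gamma> N" using us unfolding \<Gamma>_def by (simp, intro bexI[of _ \<one>]) simp_all
      then show "\<exists>s\<in>S. \<exists>u. (s, u) \<in> \<Gamma> N" using s by blast
    qed
    note lr = this
    have mono: "\<Gamma> (Suc N) \<subseteq> \<Gamma> N" for N using I_Suc_subset unfolding \<Gamma>_def by blast
    define x where "x = (\<lambda>N. sat (\<Gamma> N))"
    have x: "x \<in> carrier Q"
      unfolding Q_simps completed_localization_def x_def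
      using lrel_sat[OF lr] saturated_sat sat_mono[OF mono] by simp
    have "(s, u) \<in> \<Gamma> 1" using us unfolding \<Gamma>_def by (simp, intro bexI[of _ \<one>]) simp_all
    then have "(s, u) \<in> x 1" using sat_incl[OF lr] by (auto simp: x_def)
    then have "red x = y" using red_eq[OF x s] a(3) us(3,4) by simp
    then show "y \<in> red ` carrier Q" using x by blast
  qed
qed (use ring_hom_closed[OF red_hom] in blast)

abbreviation \<eta> where "\<eta> \<equiv> emb h"

lemma eta_multI: "x \<in> carrier Q \<Longrightarrow> (t, u) \<in> x N \<Longrightarrow> (t, h \<otimes> u) \<in> (\<eta> \<otimes>\<^bsub>Q\<^esub> x) N"
proof -
  assume x: "x \<in> carrier Q" and tu: "(t, u) \<in> x N"
  note c = Q_carrier[OF x tu]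
  have "(t, t \<otimes> h) \<in> \<eta> N" using embI c by simp
  moreover have "(t \<otimes> h, h \<otimes> u) \<in> x N" using Q_scale[OF x tu h_closed] h_central c by simp
  ultimately show ?thesis unfolding Q_simps using loc_multI[of \<eta> x] x by simp
qed

lemma Q_eq_zero_at:
  assumes "x \<in> carrier Q" "s \<in> S" "(s, u) \<in> x N" "u \<in> I N"
  shows "x N = \<zero>\<^bsub>Q\<^esub> N"
proof (rule Q_eq_at[OF assms(1) _ assms(2,3)])
  show "(s, u) \<in> \<zero>\<^bsub>Q\<^esub> N" unfolding Q_simps
    using assms I_carrier[OF assms(4)] by (simp add: emb_def S_carrier a_minus_def)
qed (simp add: Q_simps(4))

lemma Q_zero_atD: "(t, u) \<in> \<zero>\<^bsub>Q\<^esub> N \<Longrightarrow> u \<in> I N"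
  unfolding Q_simps by (auto simp: emb_def a_minus_def)

text \<open>Vanishing at level \<open>N\<close> is read off at level \<open>N + 1\<close>, because
  dividing by \<open>h\<close> costs one power.\<close>

lemma eta_torsion_free:
  assumes x: "x \<in> carrier Q" and 0: "\<eta> \<otimes>\<^bsub>Q\<^esub> x = \<zero>\<^bsub>Q\<^esub>"
  shows "x = \<zero>\<^bsub>Q\<^esub>"
proof
  fix N
  obtain s u where s: "s \<in> S" "(s, u) \<in> x (Suc N)" using lrelD(7) QD(1)[OF x] by blast
  have "h \<otimes> u \<in> I (Suc N)" using eta_multI[OF x s(2)] Q_zero_atD unfolding 0 by blast
  then have "u \<in> I N" using h_regular Q_carrier[OF x s(2)] by simp
  moreover have "(s, u) \<in> x N" using QD(3)[OF x] s(2) by blast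
  ultimately show "x N = \<zero>\<^bsub>Q\<^esub> N" using Q_eq_zero_at[OF x s(1)] by blast
qed

lemma red_kernel:
  assumes x: "x \<in> carrier Q" and 0: "red x = \<zero>\<^bsub>T.K\<^esub>"
  shows "\<exists>y\<in>carrier Q. x = \<eta> \<otimes>\<^bsub>Q\<^esub> y"
proof -
  \<comment> \<open>\<open>t y = u\<close> has to mean \<open>t x = h u\<close>; as division by
    \<open>h\<close> loses one power, level \<open>N\<close> of \<open>y\<close> comes from level
    \<open>N + 1\<close> of \<open>x\<close>.\<close>
  define y where "y = (\<lambda>N. {(t, u). t \<in> carrier R \<and> u \<in> carrier R \<and> (t, h \<otimes> u) \<in> x (Suc N)})"
  have dense: "\<exists>s u. s \<in> S \<and> (s, h \<otimes> u) \<in> x (Suc N) \<and> s \<in> carrier R \<and> u \<in> carrier R" for N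
  proof -
    obtain s u where s: "s \<in> S" "(s, u) \<in> x (Suc N)" using lrelD(7) QD(1)[OF x] by blast
    note c = Q_carrier[OF x s(2)]
    have "(s, u) \<in> x 1" using s(2) QD(3)[OF x] by (induction N) auto
    then have "fraction T (\<rho> u) (\<rho> s) = \<zero>\<^bsub>T.K\<^esub>" using red_eq[OF x s(1)] 0 by simp
    then have "\<rho> u = \<zero>\<^bsub>T\<^esub>" using T.frac_eq_zero rho_S[OF s(1)] c by simp
    then obtain v where "v \<in> carrier R" "u = h \<otimes> v" using rho_kernel c by blast
    then show ?thesis using s c by blast
  qed
  have "lrel N (y N)" for N
  proof (rule lrelI)
    note lx = lrelD[OF QD(1)[OF x, of "Suc N"]]
    show "t \<in> carrier R \<and> u \<in> carrier R" if "(t, u) \<in> y N" for t u using that by (simp add: y_def)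
    show "(t \<oplus> t', u \<oplus> u') \<in> y N" if "(t, u) \<in> y N" "(t', u') \<in> y N" for t u t' u'
      using that lx(4)[of t "h \<otimes> u" t' "h \<otimes> u'"] by (simp add: y_def r_distr)
    show "(r \<otimes> t, r \<otimes> u) \<in> y N" if "r \<in> carrier R" "(t, u) \<in> y N" for r t u
      using that lx(5)[of r t "h \<otimes> u"] h_central[of r] by (simp add: y_def m_assoc[symmetric])
    show "\<exists>s\<in>S. \<exists>u. (s, u) \<in> y N" using dense[of N] unfolding y_def by auto
    obtain s v where s: "s \<in> S" "(s, h \<otimes> v) \<in> x (Suc N)" "s \<in> carrier R" "v \<in> carrier R" using dense by blast
    \<comment> \<open>Single-valuedness of \<open>y\<close>. Above \<open>h^N t'\<close> the value
      of \<open>x\<close> is compared with the multiple of \<open>(s, h v)\<close> by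
      \<open>h^N b\<close>, whose second entry lies in \<open>h^(N+1) R\<close>; the Ore multiplier
      \<open>a\<close> is removed by \<open>S_regular\<close>.\<close>
    have key: "h \<otimes> u \<in> I (Suc N)" if t': "t' \<in> carrier R" and u: "u \<in> carrier R"
      and tu: "(h [^] N \<otimes> t', h \<otimes> u) \<in> x (Suc N)" for t' u
    proof -
      obtain a b where ab: "a \<in> S" "b \<in> carrier R" "a \<otimes> t' \<ominus> b \<otimes> s \<in> I (Suc N)"
        using ore[OF t' s(1)] by blast
      note a = S_carrier[OF ab(1)]
      have 1: "(a \<otimes> (h [^] N \<otimes> t'), a \<otimes> (h \<otimes> u)) \<in> x (Suc N)" using Q_scale[OF x tu a] .
      have 2: "(h [^] N \<otimes> b \<otimes> s, h [^] N \<otimes> b \<otimes> (h \<otimes> v)) \<in> x (Suc N)"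
        using Q_scale[OF x s(2)] ab(2) by simp
      have "a \<otimes> (h [^] N \<otimes> t') \<ominus> h [^] N \<otimes> b \<otimes> s = h [^] N \<otimes> (a \<otimes> t' \<ominus> b \<otimes> s)"
        using a t' ab(2) s(3) h_pow_central[OF a, of N] by (simp add: a_minus_def r_distr r_minus m_assoc[symmetric])
      then have "a \<otimes> (h [^] N \<otimes> t') \<ominus> h [^] N \<otimes> b \<otimes> s \<in> I (Suc N)"
        using I_lmult[OF _ ab(3), of "h [^] N"] by simp
      then have "a \<otimes> (h \<otimes> u) \<ominus> h [^] N \<otimes> b \<otimes> (h \<otimes> v) \<in> I (Suc N)"
        by (rule lrel_unique[OF QD(1)[OF x] 1 2])
      moreover have "h [^] N \<otimes> b \<otimes> (h \<otimes> v) = h [^] Suc N \<otimes> (b \<otimes> v)"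
        using ab(2) s(4) h_central[OF ab(2)] by (simp add: m_assoc) (simp add: m_assoc[symmetric])
      then have "h [^] N \<otimes> b \<otimes> (h \<otimes> v) \<in> I (Suc N)" using ab(2) s(4) by (auto simp: I_def)
      ultimately have "(a \<otimes> (h \<otimes> u) \<ominus> h [^] N \<otimes> b \<otimes> (h \<otimes> v)) \<oplus> h [^] N \<otimes> b \<otimes> (h \<otimes> v) \<in> I (Suc N)"
        by (rule I_add)
      then have "a \<otimes> (h \<otimes> u) \<in> I (Suc N)"
        using a u ab(2) s(4) by (simp add: a_minus_def a_assoc l_neg)
      then show ?thesis using S_regular[OF ab(1)] u by blast
    qed
    show "u \<in> I N" if "(t, u) \<in> y N" "t \<in> I N" for t u
      using that h_regular[of u N] key[of _ u] by (auto simp: y_def I_def[of N])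
    \<comment> \<open>The graph \<open>x (Suc N)\<close> is only known to contain
      \<open>I (Suc N) \<times> I (Suc N)\<close>, while \<open>t\<close> lies in
      \<open>I N\<close>. A multiple of \<open>(t, h u)\<close> by an element of \<open>S\<close> is
      congruent to a multiple of \<open>(s, h v)\<close>, and saturation gives the pair
      itself.\<close>
    show "(t, u) \<in> y N" if ti: "t \<in> I N" and ui: "u \<in> I N" for t u
    proof -
      obtain t' where t': "t' \<in> carrier R" "t = h [^] N \<otimes> t'" using ti by (auto simp: I_def)
      obtain a b where ab: "a \<in> S" "b \<in> carrier R" "a \<otimes> t' \<ominus> b \<otimes> s \<in> I (Suc N)"
        using ore[OF t'(1) s(1)] by blast
      note a = S_carrier[OF ab(1)] and u = I_carrier[OF ui]
      have 2: "(h [^] N \<otimes> b \<otimes> s, h [^] N \<otimes> b \<otimes> (h \<otimes> v)) \<in> x (Suc N)"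
        using Q_scale[OF x s(2)] ab(2) by simp
      have 3: "a \<otimes> t \<ominus> h [^] N \<otimes> b \<otimes> s = h [^] N \<otimes> (a \<otimes> t' \<ominus> b \<otimes> s)"
        using a t' ab(2) s(3) h_pow_central[OF a, of N] by (simp add: a_minus_def r_distr r_minus m_assoc[symmetric])
      have 4: "h [^] N \<otimes> b \<otimes> (h \<otimes> v) = h [^] Suc N \<otimes> (b \<otimes> v)"
        using ab(2) s(4) h_central[OF ab(2)] by (simp add: m_assoc) (simp add: m_assoc[symmetric])
      have "a \<otimes> (h \<otimes> u) \<ominus> h [^] N \<otimes> b \<otimes> (h \<otimes> v) \<in> I (Suc N)"
        unfolding 4 using I_minus[OF I_lmult[OF a I_Suc_h[OF ui]]] ab(2) s(4) by (simp add: I_def)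
      then have "(a \<otimes> t, a \<otimes> (h \<otimes> u)) \<in> x (Suc N)"
        using lrel_cong[OF QD(1)[OF x] 2] 3 I_lmult[OF _ ab(3), of "h [^] N"] a u t' by simp
      then show ?thesis
        using saturatedD[OF QD(2)[OF x] ab(1)] u t' by (simp add: y_def)
    qed
  qed
  note lr = this
  have "saturated (y N)" for N
    unfolding saturated_def
  proof (intro allI impI)
    fix a t u assume a: "a \<in> S" and c: "t \<in> carrier R" "u \<in> carrier R" "(a \<otimes> t, a \<otimes> u) \<in> y N"
    have "h \<otimes> (a \<otimes> u) = a \<otimes> (h \<otimes> u)"
      using c S_carrier[OF a] h_central[of a] by (simp add: m_assoc[symmetric])
    then show "(t, u) \<in> y N"
      using c saturatedD[OF QD(2)[OF x] a, of t "h \<otimes> u"] by (simp add: y_def)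
  qed
  then have y: "y \<in> carrier Q"
    unfolding Q_simps completed_localization_def using lr QD(3)[OF x] by (auto simp: y_def)
  moreover have "x = \<eta> \<otimes>\<^bsub>Q\<^esub> y"
  proof (rule Q_eqI[OF x])
    show "\<eta> \<otimes>\<^bsub>Q\<^esub> y \<in> carrier Q" unfolding Q_simps(2) using y by simp
    fix N
    obtain s v where s: "s \<in> S" "(s, h \<otimes> v) \<in> x (Suc N)" "s \<in> carrier R" "v \<in> carrier R" using dense by blast
    then have "(s, v) \<in> y N" by (simp add: y_def)
    then show "\<exists>s\<in>S. \<exists>u. (s, u) \<in> x N \<and> (s, u) \<in> (\<eta> \<otimes>\<^bsub>Q\<^esub> y) N"
      using eta_multI[OF y] QD(3)[OF x] s by blast
  qed
  ultimately show ?thesis by blast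
qed

lemma eta_pow_at:
  assumes y: "y \<in> carrier Q"
  shows "(\<eta> [^]\<^bsub>Q\<^esub> (N::nat) \<otimes>\<^bsub>Q\<^esub> y) N = \<zero>\<^bsub>Q\<^esub> N"
proof -
  interpret Q: ring Q by (rule ring_Q)
  have "\<exists>s\<in>S. \<exists>u\<in>carrier R. (s, h [^] M \<otimes> u) \<in> (\<eta> [^]\<^bsub>Q\<^esub> M \<otimes>\<^bsub>Q\<^esub> y) N" for M :: nat
  proof (induction M)
    case 0
    obtain s u where s: "s \<in> S" "(s, u) \<in> y N" using lrelD(7) QD(1)[OF y] by blast
    then show ?case using y Q_carrier(2)[OF y s(2)] by (intro bexI[of _ s] bexI[of _ u]) simp_all
  next
    case (Suc M)
    then obtain s u where s: "s \<in> S" "u \<in> carrier R" "(s, h [^] M \<otimes> u) \<in> (\<eta> [^]\<^bsub>Q\<^esub> M \<otimes>\<^bsub>Q\<^esub> y) N" by blast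
    have "(s, h \<otimes> (h [^] M \<otimes> u)) \<in> (\<eta> \<otimes>\<^bsub>Q\<^esub> (\<eta> [^]\<^bsub>Q\<^esub> M \<otimes>\<^bsub>Q\<^esub> y)) N"
      using eta_multI[of "\<eta> [^]\<^bsub>Q\<^esub> M \<otimes>\<^bsub>Q\<^esub> y", OF _ s(3)] y by simp
    moreover have "h \<otimes> (h [^] M \<otimes> u) = h [^] Suc M \<otimes> u"
      using s(2) h_pow_central[of h M] by (simp add: m_assoc[symmetric])
    moreover have "\<eta> \<otimes>\<^bsub>Q\<^esub> (\<eta> [^]\<^bsub>Q\<^esub> M \<otimes>\<^bsub>Q\<^esub> y) = \<eta> [^]\<^bsub>Q\<^esub> Suc M \<otimes>\<^bsub>Q\<^esub> y"
      using y Q.nat_pow_Suc2[of \<eta> M] by (simp add: Q.m_assoc)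
    ultimately show ?case using s(1,2) by (intro bexI[of _ s] bexI[of _ u]) simp_all
  qed
  then obtain s u where s: "s \<in> S" "u \<in> carrier R" "(s, h [^] N \<otimes> u) \<in> (\<eta> [^]\<^bsub>Q\<^esub> N \<otimes>\<^bsub>Q\<^esub> y) N" by blast
  show ?thesis
    using Q_eq_zero_at[of "\<eta> [^]\<^bsub>Q\<^esub> N \<otimes>\<^bsub>Q\<^esub> y", OF _ s(1,3)] y s(2) by (simp add: I_def)
qed

lemma Q_separated:
  assumes "\<And>N::nat. \<exists>y\<in>carrier Q. x = \<eta> [^]\<^bsub>Q\<^esub> N \<otimes>\<^bsub>Q\<^esub> y"
  shows "x = \<zero>\<^bsub>Q\<^esub>"
proof
  fix N :: nat
  obtain y where "y \<in> carrier Q" "x = \<eta> [^]\<^bsub>Q\<^esub> N \<otimes>\<^bsub>Q\<^esub> y" using assms[of N] by (rule bexE)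
  then show "x N = \<zero>\<^bsub>Q\<^esub> N" by (simp only: eta_pow_at)
qed

lemma Q_at_0: "x \<in> carrier Q \<Longrightarrow> x 0 = carrier R \<times> carrier R"
proof -
  assume x: "x \<in> carrier Q"
  have "p \<in> x 0 \<longleftrightarrow> p \<in> carrier R \<times> carrier R" for p
    using lrelD(1-3)[OF QD(1)[OF x, of 0], of "fst p" "snd p"] by (cases p) auto
  then show "x 0 = carrier R \<times> carrier R" by blast
qed

text \<open>Multiplication by \<open>h\<close> gains one level of agreement; this makes the partial
  sums in the completeness proof stabilize.\<close>

lemma eta_mult_cong:
  assumes x: "x \<in> carrier Q" and y: "y \<in> carrier Q" and "x N = y N"
  shows "(\<eta> \<otimes>\<^bsub>Q\<^esub> x) (Suc N) = (\<eta> \<otimes>\<^bsub>Q\<^esub> y) (Suc N)"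
proof -
  obtain s u v where s: "s \<in> S" "(s, u) \<in> x (Suc N)" "(s, v) \<in> y (Suc N)" using Q_common[OF x y] .
  have "(s, u) \<in> x N" "(s, v) \<in> x N" using s QD(3)[OF x] QD(3)[OF y] assms(3) by blast+
  then have "u \<ominus> v \<in> I N" using lrel_unique[OF QD(1)[OF x]] Q_carrier[OF x s(2)] by simp
  then have "h \<otimes> u \<ominus> h \<otimes> v \<in> I (Suc N)"
    using I_Suc_h[of "u \<ominus> v" N] Q_carrier[OF x s(2)] Q_carrier[OF y s(3)] by (simp add: a_minus_def r_distr r_minus)
  moreover have c: "\<eta> \<otimes>\<^bsub>Q\<^esub> x \<in> carrier Q" "\<eta> \<otimes>\<^bsub>Q\<^esub> y \<in> carrier Q" unfolding Q_simps(2) using x y by simp_all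
  ultimately have "(s, h \<otimes> u) \<in> (\<eta> \<otimes>\<^bsub>Q\<^esub> y) (Suc N)"
    using lrel_cong[OF QD(1)[OF c(2)] eta_multI[OF y s(3)], of s "h \<otimes> u"] Q_carrier[OF x s(2)] by simp
  then show ?thesis using Q_eq_at[OF c s(1) eta_multI[OF x s(2)]] by simp
qed

lemma add_cong:
  assumes x: "x \<in> carrier Q" and y: "y \<in> carrier Q" and z: "z \<in> carrier Q" and "x N = y N"
  shows "(z \<oplus>\<^bsub>Q\<^esub> x) N = (z \<oplus>\<^bsub>Q\<^esub> y) N"
  unfolding Q_simps loc_add_def assms(4) ..

lemma Q_complete:
  "\<exists>\<Sigma>. \<forall>g. (\<forall>m. g m \<in> carrier Q) \<longrightarrow>
    \<Sigma> g \<in> carrier Q \<and> \<Sigma> g = g 0 \<oplus>\<^bsub>Q\<^esub> \<eta> \<otimes>\<^bsub>Q\<^esub> \<Sigma> (\<lambda>m::nat. g (Suc m))"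
proof -
  interpret Q: ring Q by (rule ring_Q)
  \<comment> \<open>\<open>P N g\<close> is the sum of \<open>h^m g m\<close> over
    \<open>m < N\<close>, in nested form.\<close>
  define P where "P = rec_nat (\<lambda>_. \<zero>\<^bsub>Q\<^esub>) (\<lambda>_ p g. g 0 \<oplus>\<^bsub>Q\<^esub> \<eta> \<otimes>\<^bsub>Q\<^esub> p (\<lambda>m::nat. g (Suc m)))"
  have P_0: "P 0 g = \<zero>\<^bsub>Q\<^esub>" and P_Suc: "P (Suc N) g = g 0 \<oplus>\<^bsub>Q\<^esub> \<eta> \<otimes>\<^bsub>Q\<^esub> P N (\<lambda>m. g (Suc m))" for g N
    by (simp_all add: P_def)
  have P_closed: "(\<forall>m. g m \<in> carrier Q) \<Longrightarrow> P N g \<in> carrier Q" for g N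
    by (induction N arbitrary: g) (simp_all add: P_0 P_Suc)
  have P_at: "P (Suc N) g N = P N g N" if "\<forall>m. g m \<in> carrier Q" for g N
    using that
  proof (induction N arbitrary: g)
    case 0
    then show ?case using Q_at_0 P_closed by blast
  next
    case (Suc N)
    have "(\<eta> \<otimes>\<^bsub>Q\<^esub> P (Suc N) (\<lambda>m. g (Suc m))) (Suc N) = (\<eta> \<otimes>\<^bsub>Q\<^esub> P N (\<lambda>m. g (Suc m))) (Suc N)"
      by (rule eta_mult_cong[OF P_closed P_closed Suc.IH]) (simp_all add: Suc.prems)
    then show ?case
      unfolding P_Suc[of "Suc N"] P_Suc[of N g] by (intro add_cong) (use Suc.prems P_closed in simp_all)
  qed
  \<comment> \<open>By \<open>P_at\<close> the diagonal is a compatible sequence of fractions; it is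
    the limit of the partial sums.\<close>
  define \<Sigma> where "\<Sigma> g = (\<lambda>N. P N g N)" for g
  have closed: "\<Sigma> g \<in> carrier Q" if g: "\<forall>m. g m \<in> carrier Q" for g
    unfolding Q_simps(1) completed_localization_def \<Sigma>_def
    using QD(1,2)[OF P_closed[OF g]] QD(3)[OF P_closed[OF g]] P_at[OF g] by blast
  moreover have "\<Sigma> g = g 0 \<oplus>\<^bsub>Q\<^esub> \<eta> \<otimes>\<^bsub>Q\<^esub> \<Sigma> (\<lambda>m. g (Suc m))" if g: "\<forall>m. g m \<in> carrier Q" for g
  proof
    fix N
    show "\<Sigma> g N = (g 0 \<oplus>\<^bsub>Q\<^esub> \<eta> \<otimes>\<^bsub>Q\<^esub> \<Sigma> (\<lambda>m. g (Suc m))) N"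
    proof (cases N)
      case 0
      then show ?thesis
        using Q_at_0[OF closed[OF g]] Q_at_0[of "g 0 \<oplus>\<^bsub>Q\<^esub> \<eta> \<otimes>\<^bsub>Q\<^esub> \<Sigma> (\<lambda>m. g (Suc m))"] closed[of "\<lambda>m. g (Suc m)"] g by simp
    next
      case (Suc M)
      have "(\<eta> \<otimes>\<^bsub>Q\<^esub> P M (\<lambda>m. g (Suc m))) (Suc M) = (\<eta> \<otimes>\<^bsub>Q\<^esub> \<Sigma> (\<lambda>m. g (Suc m))) (Suc M)"
        by (rule eta_mult_cong[OF P_closed closed]) (simp_all add: g \<Sigma>_def)
      then have "P (Suc M) g (Suc M) = (g 0 \<oplus>\<^bsub>Q\<^esub> \<eta> \<otimes>\<^bsub>Q\<^esub> \<Sigma> (\<lambda>m. g (Suc m))) (Suc M)"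
        unfolding P_Suc by (intro add_cong) (use g P_closed closed in simp_all)
      then show ?thesis by (simp add: \<Sigma>_def Suc)
    qed
  qed
  ultimately show ?thesis by blast
qed

lemma hadic_ring_Q: "hadic_ring Q T.K \<eta> red"
proof -
  interpret Q: ring Q by (rule ring_Q)
  interpret K: field T.K by (rule T.field_K)
  show ?thesis
  proof unfold_locales
    show "x \<otimes>\<^bsub>Q\<^esub> \<eta> = \<eta> \<otimes>\<^bsub>Q\<^esub> x" if "x \<in> carrier Q" for x
      using emb_central[OF h_closed h_central that] .
    show "red \<eta> = \<zero>\<^bsub>T.K\<^esub>" by (simp add: red_emb T.incl_def T.frac_zero)
  qed (use eta_torsion_free red_hom red_surj red_kernel Q_separated Q_complete in \<open>simp_all\<close>)
qed

end

section \<open>Power series and complements\<close>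

context cring
begin

abbreviation PS where "PS \<equiv> power_series_ring R"

lemma PS_simps:
  "carrier PS = UNIV \<rightarrow> carrier R" "c \<oplus>\<^bsub>PS\<^esub> d = (\<lambda>m. c m \<oplus> d m)" "\<zero>\<^bsub>PS\<^esub> = (\<lambda>m. \<zero>)"
  "\<one>\<^bsub>PS\<^esub> = (\<lambda>m. if m = 0 then \<one> else \<zero>)" "c \<otimes>\<^bsub>PS\<^esub> d = (\<lambda>m. \<Oplus>i\<in>{..m}. c i \<otimes> d (m - i))"
  by (simp_all add: power_series_ring_def)

lemma PS_mem: "c \<in> carrier PS \<longleftrightarrow> (\<forall>m. c m \<in> carrier R)"
  by (auto simp: PS_simps)

definition truncate :: "nat \<Rightarrow> (nat \<Rightarrow> 'a) \<Rightarrow> nat \<Rightarrow> 'a" where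
  "truncate N c = (\<lambda>m. if m \<le> N then c m else \<zero>)"

lemma truncate_up: "c \<in> carrier PS \<Longrightarrow> truncate N c \<in> carrier (UP R)"
  unfolding UP_def up_def truncate_def by (auto simp: PS_simps intro!: exI[of _ N] bound.intro)

lemma PS_mult_up:
  assumes "c \<in> carrier PS" "d \<in> carrier PS" "p \<in> carrier (UP R)" "q \<in> carrier (UP R)"
    "\<And>i. i \<le> n \<Longrightarrow> p i = c i" "\<And>i. i \<le> n \<Longrightarrow> q i = d i"
  shows "(p \<otimes>\<^bsub>UP R\<^esub> q) n = (c \<otimes>\<^bsub>PS\<^esub> d) n"
proof -
  have "(p \<otimes>\<^bsub>UP R\<^esub> q) n = (\<Oplus>i\<in>{..n}. p i \<otimes> q (n - i))"
    using assms(3,4) by (simp add: UP_def)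
  also have "\<dots> = (c \<otimes>\<^bsub>PS\<^esub> d) n"
    unfolding PS_simps using assms by (intro finsum_cong') (auto simp: PS_mem)
  finally show ?thesis .
qed

text \<open>The coefficient \<open>n\<close> of a product involves only coefficients up to
  \<open>n\<close>, so the laws of multiplication can be checked on truncations, that is, in the
  polynomial ring \<open>UP R\<close>.\<close>

lemma PS_cring: "cring PS"
proof -
  interpret U: cring "UP R"
    using UP_cring.UP_cring[of R] by (simp add: UP_cring_def cring_axioms)
  note t = truncate_up
  have tr: "i \<le> n \<Longrightarrow> truncate n c i = c i" for i n c by (simp add: truncate_def)
  have ab: "abelian_group PS"
  proof (rule abelian_groupI)
    fix x assume x: "x \<in> carrier PS"
    show "\<exists>y\<in>carrier PS. y \<oplus>\<^bsub>PS\<^esub> x = \<zero>\<^bsub>PS\<^esub>"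
      using x by (intro bexI[of _ "\<lambda>m. \<ominus> x m"]) (auto simp: PS_simps l_neg Pi_iff)
  qed (auto simp: PS_simps a_ac Pi_iff)
  have mult_closed: "x \<otimes>\<^bsub>PS\<^esub> y \<in> carrier PS" if "x \<in> carrier PS" "y \<in> carrier PS" for x y
    using that by (auto simp: PS_simps intro!: finsum_closed)
  have eq: "(x \<otimes>\<^bsub>PS\<^esub> y) n = (truncate N x \<otimes>\<^bsub>UP R\<^esub> truncate N y) n"
    if "x \<in> carrier PS" "y \<in> carrier PS" "n \<le> N" for x y n N
    using that by (intro PS_mult_up[symmetric] t) (simp_all add: truncate_def)
  have comm: "x \<otimes>\<^bsub>PS\<^esub> y = y \<otimes>\<^bsub>PS\<^esub> x" if x: "x \<in> carrier PS" and y: "y \<in> carrier PS" for x y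
  proof
    fix n
    show "(x \<otimes>\<^bsub>PS\<^esub> y) n = (y \<otimes>\<^bsub>PS\<^esub> x) n"
      using eq[OF x y, of n n] eq[OF y x, of n n] U.m_comm[OF t[OF x, of n] t[OF y, of n]] by simp
  qed
  have "comm_monoid PS"
  proof (rule comm_monoidI)
    fix x y z assume x: "x \<in> carrier PS" and y: "y \<in> carrier PS" and z: "z \<in> carrier PS"
    show "x \<otimes>\<^bsub>PS\<^esub> y \<otimes>\<^bsub>PS\<^esub> z = x \<otimes>\<^bsub>PS\<^esub> (y \<otimes>\<^bsub>PS\<^esub> z)"
    proof
      fix n
      have "(x \<otimes>\<^bsub>PS\<^esub> y \<otimes>\<^bsub>PS\<^esub> z) n
          = (truncate n x \<otimes>\<^bsub>UP R\<^esub> truncate n y \<otimes>\<^bsub>UP R\<^esub> truncate n z) n"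
        using x y z by (intro PS_mult_up[symmetric]) (simp_all add: t mult_closed eq tr)
      also have "\<dots> = (truncate n x \<otimes>\<^bsub>UP R\<^esub> (truncate n y \<otimes>\<^bsub>UP R\<^esub> truncate n z)) n"
        using x y z by (simp add: U.m_assoc t)
      also have "\<dots> = (x \<otimes>\<^bsub>PS\<^esub> (y \<otimes>\<^bsub>PS\<^esub> z)) n"
        using x y z by (intro PS_mult_up) (simp_all add: t mult_closed eq tr)
      finally show "(x \<otimes>\<^bsub>PS\<^esub> y \<otimes>\<^bsub>PS\<^esub> z) n = (x \<otimes>\<^bsub>PS\<^esub> (y \<otimes>\<^bsub>PS\<^esub> z)) n" .
    qed
    show "\<one>\<^bsub>PS\<^esub> \<otimes>\<^bsub>PS\<^esub> x = x"
    proof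
      fix n
      have one: "\<one>\<^bsub>PS\<^esub> \<in> carrier PS" "\<one>\<^bsub>UP R\<^esub> = \<one>\<^bsub>PS\<^esub>" by (auto simp: PS_simps UP_def)
      have "(\<one>\<^bsub>PS\<^esub> \<otimes>\<^bsub>PS\<^esub> x) n = (\<one>\<^bsub>UP R\<^esub> \<otimes>\<^bsub>UP R\<^esub> truncate n x) n"
        using x one(1) by (intro PS_mult_up[symmetric]) (simp_all add: t tr one(2) U.one_closed[unfolded one(2)])
      then show "(\<one>\<^bsub>PS\<^esub> \<otimes>\<^bsub>PS\<^esub> x) n = x n" using x by (simp add: t tr)
    qed
  qed (use mult_closed comm in \<open>auto simp: PS_simps(1,4)\<close>)
  then show ?thesis
  proof (rule cringI[OF ab])
    fix x y z assume x: "x \<in> carrier PS" and y: "y \<in> carrier PS" and z: "z \<in> carrier PS"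
    then show "(x \<oplus>\<^bsub>PS\<^esub> y) \<otimes>\<^bsub>PS\<^esub> z = x \<otimes>\<^bsub>PS\<^esub> z \<oplus>\<^bsub>PS\<^esub> y \<otimes>\<^bsub>PS\<^esub> z"
      unfolding PS_simps
      by (intro ext) (subst finsum_addf[symmetric], auto simp: Pi_iff l_distr intro!: finsum_cong')
  qed
qed

lemma const_series_closed [simp]: "c \<in> carrier R \<Longrightarrow> const_series R c \<in> carrier PS"
  by (simp add: PS_mem const_series_def)

lemma hbar_closed [simp]: "hbar R \<in> carrier PS"
  by (simp add: PS_mem hbar_def)

lemma const_series_mult_at:
  assumes "c \<in> carrier R" "d \<in> carrier PS"
  shows "(const_series R c \<otimes>\<^bsub>PS\<^esub> d) m = c \<otimes> d m"
proof -
  have "(\<Oplus>i\<in>{..m}. const_series R c i \<otimes> d (m - i)) = (\<Oplus>i\<in>{..m}. if 0 = i then c \<otimes> d (m - i) else \<zero>)"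
    using assms by (intro finsum_cong') (auto simp: const_series_def PS_mem)
  also have "\<dots> = c \<otimes> d m"
    using assms finsum_singleton[of 0 "{..m}" "\<lambda>i. c \<otimes> d (m - i)"] by (auto simp: PS_mem)
  finally show ?thesis by (simp add: PS_simps)
qed

lemma hbar_mult_at:
  assumes "d \<in> carrier PS"
  shows "(hbar R \<otimes>\<^bsub>PS\<^esub> d) 0 = \<zero>" "(hbar R \<otimes>\<^bsub>PS\<^esub> d) (Suc m) = d m"
proof -
  have d: "d i \<in> carrier R" for i using assms by (simp add: PS_mem)
  then show "(hbar R \<otimes>\<^bsub>PS\<^esub> d) 0 = \<zero>" by (simp add: PS_simps hbar_def)
  have "(\<Oplus>i\<in>{..Suc m}. hbar R i \<otimes> d (Suc m - i)) = (\<Oplus>i\<in>{..Suc m}. if 1 = i then d (Suc m - i) else \<zero>)"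
    using d by (intro finsum_cong') (auto simp: hbar_def)
  also have "\<dots> = d m"
    using d finsum_singleton[of 1 "{..Suc m}" "\<lambda>i. d (Suc m - i)"] by simp
  finally show "(hbar R \<otimes>\<^bsub>PS\<^esub> d) (Suc m) = d m" by (simp add: PS_simps)
qed

lemma PS_decompose:
  assumes "c \<in> carrier PS"
  shows "c = const_series R (c 0) \<oplus>\<^bsub>PS\<^esub> hbar R \<otimes>\<^bsub>PS\<^esub> (\<lambda>m. c (Suc m))"
proof
  fix m
  have 1: "(\<lambda>m. c (Suc m)) \<in> carrier PS" "\<And>m. c m \<in> carrier R" using assms by (simp_all add: PS_mem)
  have "(const_series R (c 0) \<oplus>\<^bsub>PS\<^esub> hbar R \<otimes>\<^bsub>PS\<^esub> (\<lambda>m. c (Suc m))) m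
      = const_series R (c 0) m \<oplus> (hbar R \<otimes>\<^bsub>PS\<^esub> (\<lambda>m. c (Suc m))) m"
    by (simp only: PS_simps(2))
  then show "c m = (const_series R (c 0) \<oplus>\<^bsub>PS\<^esub> hbar R \<otimes>\<^bsub>PS\<^esub> (\<lambda>m. c (Suc m))) m"
    using hbar_mult_at[OF 1(1)] 1(2) by (cases m) (simp_all add: const_series_def)
qed

lemma const_series_hom: "const_series R \<in> ring_hom R PS"
proof (rule ring_hom_memI)
  show "const_series R (c \<otimes> d) = const_series R c \<otimes>\<^bsub>PS\<^esub> const_series R d"
    if "c \<in> carrier R" "d \<in> carrier R" for c d
    using that by (intro ext) (simp add: const_series_mult_at, simp add: const_series_def)
qed (auto simp: PS_simps const_series_def)

lemma PS_zero_coeff_hom: "(\<lambda>c. c 0) \<in> ring_hom PS R"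
  by (rule ring_hom_memI) (auto simp: PS_simps Pi_iff)

end

lemma (in module) submodule_Union_chain:
  assumes "CC \<noteq> {}" "\<And>H. H \<in> CC \<Longrightarrow> submodule H R M" "\<And>H H'. H \<in> CC \<Longrightarrow> H' \<in> CC \<Longrightarrow> H \<subseteq> H' \<or> H' \<subseteq> H"
  shows "submodule (\<Union>CC) R M"
proof (rule submoduleI)
  note E = submoduleE[OF assms(2)]
  show "\<Union>CC \<subseteq> carrier M" using E(1) by blast
  show "\<zero>\<^bsub>M\<^esub> \<in> \<Union>CC"
  proof -
    obtain H where H: "H \<in> CC" using assms(1) by blast
    then have "\<zero>\<^bsub>M\<^esub> \<in> H" using subgroup.one_closed[OF submodule.axioms(1)[OF assms(2)[OF H]]] by simp
    then show ?thesis using H by blast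
  qed
  show "\<ominus>\<^bsub>M\<^esub> a \<in> \<Union>CC" if "a \<in> \<Union>CC" for a using that E(3) by blast
  show "r \<odot>\<^bsub>M\<^esub> a \<in> \<Union>CC" if "r \<in> carrier R" "a \<in> \<Union>CC" for r a using that E(4) by blast
  show "a \<oplus>\<^bsub>M\<^esub> b \<in> \<Union>CC" if ab: "a \<in> \<Union>CC" "b \<in> \<Union>CC" for a b
  proof -
    obtain H H' where H: "H \<in> CC" "H' \<in> CC" "a \<in> H" "b \<in> H'" using ab by blast
    then consider "a \<in> H'" | "b \<in> H" using assms(3) by blast
    then show ?thesis using E(5)[OF H(1), of a b] E(5)[OF H(2), of a b] H by cases blast+
  qed
qed

lemma (in module) submodule_zero: "submodule H R M \<Longrightarrow> \<zero>\<^bsub>M\<^esub> \<in> H"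
  using subgroup.one_closed[OF submodule.axioms(1)] by fastforce

text \<open>Zorn's lemma gives a maximal \<open>G\<close> containing \<open>W\<close> and meeting
  \<open>U\<close> in zero. If \<open>x\<close> were outside \<open>G + U\<close>, then
  \<open>G\<close> together with the multiples of \<open>x\<close> would be larger and still meet
  \<open>U\<close> in zero, since a nonzero coefficient of \<open>x\<close> could be
  inverted.\<close>

lemma (in module) complement_exists:
  assumes k: "field R" and W: "submodule W R M" and U: "submodule U R M" and WU: "W \<inter> U = {\<zero>\<^bsub>M\<^esub>}"
  obtains G where "submodule G R M" "W \<subseteq> G" "G \<inter> U = {\<zero>\<^bsub>M\<^esub>}"
    "\<And>x. x \<in> carrier M \<Longrightarrow> \<exists>g\<in>G. \<exists>u\<in>U. x = g \<oplus>\<^bsub>M\<^esub> u"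
proof -
  interpret k: field R by (rule k)
  define AA where "AA = {H. submodule H R M \<and> W \<subseteq> H \<and> H \<inter> U = {\<zero>\<^bsub>M\<^esub>}}"
  have "\<exists>V\<in>AA. \<forall>H\<in>CC. H \<subseteq> V" if C: "CC \<in> chains AA" for CC
  proof (cases "CC = {}")
    case True
    then show ?thesis using W WU by (auto simp: AA_def)
  next
    case False
    have sub: "CC \<subseteq> AA" and lin: "\<And>H H'. H \<in> CC \<Longrightarrow> H' \<in> CC \<Longrightarrow> H \<subseteq> H' \<or> H' \<subseteq> H"
      using C by (auto simp: chains_def chain_subset_def)
    have "submodule (\<Union>CC) R M"
      using submodule_Union_chain[OF False _ lin] sub by (auto simp: AA_def)
    moreover have "W \<subseteq> \<Union>CC" "\<Union>CC \<inter> U = {\<zero>\<^bsub>M\<^esub>}" using False sub by (auto simp: AA_def)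
    ultimately have "\<Union>CC \<in> AA" by (simp add: AA_def)
    then show ?thesis by blast
  qed
  then have "\<exists>M\<in>AA. \<forall>H\<in>AA. M \<subseteq> H \<longrightarrow> H = M" by (intro Zorn_Lemma2 ballI)
  then obtain G where G: "G \<in> AA" and max: "\<forall>H\<in>AA. G \<subseteq> H \<longrightarrow> H = G" by (elim bexE)
  from G have G1: "submodule G R M" "W \<subseteq> G" "G \<inter> U = {\<zero>\<^bsub>M\<^esub>}" by (auto simp: AA_def)
  note g = submoduleE[OF G1(1)] submodule_zero[OF G1(1)]
  note u = submoduleE[OF U] submodule_zero[OF U]
  have "\<exists>g\<in>G. \<exists>u\<in>U. x = g \<oplus>\<^bsub>M\<^esub> u" if x: "x \<in> carrier M" for x
  proof (rule ccontr)
    assume no: "\<not> (\<exists>g\<in>G. \<exists>u\<in>U. x = g \<oplus>\<^bsub>M\<^esub> u)"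
    define H where "H = {a \<oplus>\<^bsub>M\<^esub> c \<odot>\<^bsub>M\<^esub> x | a c. a \<in> G \<and> c \<in> carrier R}"
    have HI: "a \<oplus>\<^bsub>M\<^esub> c \<odot>\<^bsub>M\<^esub> x \<in> H" if "a \<in> G" "c \<in> carrier R" for a c using that by (auto simp: H_def)
    have Gc: "\<And>a. a \<in> G \<Longrightarrow> a \<in> carrier M" using g(1) by blast
    have "submodule H R M"
    proof (rule submoduleI)
      show "H \<subseteq> carrier M" using Gc x by (auto simp: H_def)
      show "\<zero>\<^bsub>M\<^esub> \<in> H" using HI[OF g(7) R.zero_closed] x by simp
      fix a b assume "a \<in> H"
      then obtain a1 c1 where a: "a1 \<in> G" "c1 \<in> carrier R" "a = a1 \<oplus>\<^bsub>M\<^esub> c1 \<odot>\<^bsub>M\<^esub> x" by (auto simp: H_def)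
      show "\<ominus>\<^bsub>M\<^esub> a \<in> H"
        using HI[OF g(3)[OF a(1)] R.a_inv_closed[OF a(2)]] a Gc x by (simp add: smult_l_minus M.minus_add)
      { fix r assume r: "r \<in> carrier R"
        show "r \<odot>\<^bsub>M\<^esub> a \<in> H"
          using HI[OF g(4)[OF r a(1)], of "r \<otimes> c1"] a Gc x r by (simp add: smult_r_distr smult_assoc1) }
      assume "b \<in> H"
      then obtain b1 d1 where b: "b1 \<in> G" "d1 \<in> carrier R" "b = b1 \<oplus>\<^bsub>M\<^esub> d1 \<odot>\<^bsub>M\<^esub> x" by (auto simp: H_def)
      show "a \<oplus>\<^bsub>M\<^esub> b \<in> H"
        using HI[OF g(5)[OF a(1) b(1)], of "c1 \<oplus> d1"] a b Gc x by (simp add: smult_l_distr M.a_ac)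
    qed
    moreover have GH: "G \<subseteq> H"
    proof
      fix a assume "a \<in> G"
      then show "a \<in> H" using HI[of a \<zero>] Gc x by simp
    qed
    moreover have "H \<inter> U = {\<zero>\<^bsub>M\<^esub>}"
    proof -
      have "y = \<zero>\<^bsub>M\<^esub>" if "y \<in> H" and yU: "y \<in> U" for y
      proof -
        obtain a c where a: "a \<in> G" "c \<in> carrier R" "y = a \<oplus>\<^bsub>M\<^esub> c \<odot>\<^bsub>M\<^esub> x" using \<open>y \<in> H\<close> by (auto simp: H_def)
        have ac: "a \<in> carrier M" using Gc a by simp
        have cx: "c \<odot>\<^bsub>M\<^esub> x = \<ominus>\<^bsub>M\<^esub> a \<oplus>\<^bsub>M\<^esub> y" using a ac x by (simp add: M.r_neg1)
        have "c = \<zero>"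
        proof (rule ccontr)
          assume c: "c \<noteq> \<zero>"
          then have ci: "inv c \<in> carrier R" "inv c \<otimes> c = \<one>"
            using k.field_Units a(2) by (simp_all add: R.Units_inv_closed R.Units_l_inv)
          have "x = inv c \<odot>\<^bsub>M\<^esub> (c \<odot>\<^bsub>M\<^esub> x)" using ci a(2) x by (simp add: smult_assoc1[symmetric])
          also have "\<dots> = inv c \<odot>\<^bsub>M\<^esub> (\<ominus>\<^bsub>M\<^esub> a) \<oplus>\<^bsub>M\<^esub> inv c \<odot>\<^bsub>M\<^esub> y"
            unfolding cx using ci ac u(1) yU by (intro smult_r_distr) auto
          finally show False using no g(4)[OF ci(1) g(3)[OF a(1)]] u(4)[OF ci(1) yU] by blast
        qed
        then have "y = a" using a ac x by simp
        then show ?thesis using a(1) yU G1(3) by blast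
      qed
      then show ?thesis using GH g(7) u(7) by blast
    qed
    ultimately have "H \<in> AA" using G1(2) by (auto simp: AA_def)
    then have "H = G" using max GH by simp
    then have "x \<in> G" using HI[OF g(7) R.one_closed] x by simp
    moreover have "x = x \<oplus>\<^bsub>M\<^esub> \<zero>\<^bsub>M\<^esub>" using x by simp
    ultimately show False using no u(7) by blast
  qed
  then show thesis using that G1 by blast
qed

section \<open>Quantizations from complete rings\<close>

text \<open>Read \<open>a = x/s\<close> and \<open>b = y/t\<close> as fractions and the other
  letters as brackets: \<open>d = {a, b}\<close>, \<open>dS = {s, b}\<close>,
  \<open>dX = {x, b}\<close>, \<open>XU = {x, t}\<close>, \<open>SU = {s, t}\<close>,
  \<open>XY = {x, y}\<close>, \<open>SY = {s, y}\<close>. The last three assumptions are Leibniz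
  rules, and the conclusion is the quotient formula of \<open>frac_field\<close> with denominators
  cleared.\<close>

lemma (in cring) bracket_fraction_identity:
  assumes c: "d \<in> carrier R" "dS \<in> carrier R" "a \<in> carrier R" "b \<in> carrier R" "s \<in> carrier R" "t \<in> carrier R"
    "XU \<in> carrier R" "SU \<in> carrier R"
  assumes x: "x = a \<otimes> s" and y: "y = b \<otimes> t"
    and dX: "dX = d \<otimes> s \<oplus> a \<otimes> dS"
    and XY: "XY = dX \<otimes> t \<oplus> b \<otimes> XU" and SY: "SY = dS \<otimes> t \<oplus> b \<otimes> SU"
  shows "((s \<otimes> t \<otimes> XY \<ominus> s \<otimes> y \<otimes> XU) \<ominus> x \<otimes> t \<otimes> SY) \<oplus> x \<otimes> y \<otimes> SU = d \<otimes> ((s \<otimes> s) \<otimes> (t \<otimes> t))"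
proof -
  define P where "P = d \<otimes> ((s \<otimes> s) \<otimes> (t \<otimes> t))"
  define E where "E = a \<otimes> s \<otimes> dS \<otimes> t \<otimes> t"
  define W where "W = s \<otimes> y \<otimes> XU"
  define V where "V = x \<otimes> y \<otimes> SU"
  have cl: "P \<in> carrier R" "E \<in> carrier R" "W \<in> carrier R" "V \<in> carrier R"
    using c by (simp_all add: P_def E_def W_def V_def x y)
  have 1: "s \<otimes> t \<otimes> XY = (P \<oplus> E) \<oplus> W"
    unfolding XY dX P_def E_def W_def y using c by (simp add: l_distr r_distr m_ac)
  have 2: "x \<otimes> t \<otimes> SY = E \<oplus> V"
    unfolding SY E_def V_def x y using c by (simp add: l_distr r_distr m_ac)
  have "(((P \<oplus> E) \<oplus> W \<ominus> W) \<ominus> (E \<oplus> V)) \<oplus> V = P"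
  proof -
    have "(P \<oplus> E) \<oplus> W \<ominus> W = P \<oplus> E" using cl by (simp add: a_minus_def a_assoc r_neg)
    moreover have "(P \<oplus> E) \<ominus> (E \<oplus> V) = P \<ominus> V"
      using cl by (simp add: a_minus_def a_assoc minus_add r_neg1 r_neg2)
    moreover have "P \<ominus> V \<oplus> V = P" using cl by (simp add: a_minus_def a_assoc l_neg)
    ultimately show ?thesis by simp
  qed
  then show ?thesis unfolding 1 2 W_def[symmetric] V_def[symmetric] P_def[symmetric] .
qed

context hadic_ring
begin

lemmas red_simps [simp] =
  ring_hom_closed[OF red_hom] ring_hom_mult[OF red_hom] ring_hom_add[OF red_hom] ring_hom_one[OF red_hom]

lemma red_zero [simp]: "red \<zero> = \<zero>\<^bsub>K\<^esub>"
  by (rule ring_hom_zero[OF red_hom]) (unfold_locales)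

lemma red_a_inv [simp]: "x \<in> carrier Q \<Longrightarrow> red (\<ominus> x) = \<ominus>\<^bsub>K\<^esub> red x"
  by (metis Q.a_inv_closed Q.l_neg K.minus_equality red_simps(1,3) red_zero)

lemma red_minus [simp]: "x \<in> carrier Q \<Longrightarrow> y \<in> carrier Q \<Longrightarrow> red (x \<ominus> y) = red x \<ominus>\<^bsub>K\<^esub> red y"
  by (simp add: a_minus_def)

lemma h_cancel:
  assumes "x \<in> carrier Q" "y \<in> carrier Q" "h \<otimes> x = h \<otimes> y"
  shows "x = y"
proof -
  have "h \<otimes> (x \<ominus> y) = h \<otimes> x \<ominus> h \<otimes> y" using assms(1,2) by (simp add: a_minus_def r_distr r_minus)
  also have "\<dots> = \<zero>" using assms by (simp add: Q.r_right_minus_eq)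
  finally have "x \<ominus> y = \<zero>" using h_torsion_free assms by simp
  then show ?thesis using assms by (simp add: Q.r_right_minus_eq)
qed

lemma h_lcomm: "x \<in> carrier Q \<Longrightarrow> y \<in> carrier Q \<Longrightarrow> x \<otimes> (h \<otimes> y) = h \<otimes> (x \<otimes> y)"
  using h_central by (simp add: m_assoc[symmetric])

definition comm_quot :: "'q \<Rightarrow> 'q \<Rightarrow> 'q" where
  "comm_quot a b = (THE c. c \<in> carrier Q \<and> a \<otimes> b = b \<otimes> a \<oplus> h \<otimes> c)"

lemma comm_quotI:
  assumes "a \<in> carrier Q" "b \<in> carrier Q" "c \<in> carrier Q" "a \<otimes> b = b \<otimes> a \<oplus> h \<otimes> c"
  shows "comm_quot a b = c"
  unfolding comm_quot_def
proof (rule the_equality)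
  fix d assume d: "d \<in> carrier Q \<and> a \<otimes> b = b \<otimes> a \<oplus> h \<otimes> d"
  then have "b \<otimes> a \<oplus> h \<otimes> d = b \<otimes> a \<oplus> h \<otimes> c" using assms(4) by simp
  then have "h \<otimes> d = h \<otimes> c" using assms(1-3) d by simp
  then show "d = c" using h_cancel assms d by blast
qed (use assms in simp)

text \<open>The commutator reduces to zero in the field \<open>K\<close>, so it is divisible by
  \<open>h\<close>; the quotient is unique because \<open>h\<close> has no torsion.\<close>

lemma comm_quot:
  assumes a: "a \<in> carrier Q" and b: "b \<in> carrier Q"
  shows "comm_quot a b \<in> carrier Q" "a \<otimes> b = b \<otimes> a \<oplus> h \<otimes> comm_quot a b"
proof -
  have "red (a \<otimes> b \<ominus> b \<otimes> a) = \<zero>\<^bsub>K\<^esub>" using a b by (simp add: K.m_comm K.r_right_minus_eq)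
  then obtain c where c: "c \<in> carrier Q" "a \<otimes> b \<ominus> b \<otimes> a = h \<otimes> c" using red_kernel[of "a \<otimes> b \<ominus> b \<otimes> a"] a b by auto
  have "a \<otimes> b = b \<otimes> a \<oplus> h \<otimes> c"
    unfolding c(2)[symmetric] using a b by (simp add: a_minus_def a_ac r_neg1 r_neg)
  then show "comm_quot a b \<in> carrier Q" "a \<otimes> b = b \<otimes> a \<oplus> h \<otimes> comm_quot a b"
    using comm_quotI[OF a b c(1)] c(1) by simp_all
qed

text \<open>The bracket on \<open>K\<close> induced by commutators, evaluated on lifts. It depends
  only on the reductions of its arguments; its comparison with the bracket of a fraction field rests
  on \<open>D_fraction\<close>.\<close>

definition D where "D a b = red (comm_quot a b)"

lemma D_closed [simp]: "a \<in> carrier Q \<Longrightarrow> b \<in> carrier Q \<Longrightarrow> D a b \<in> carrier K"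
  by (simp add: D_def comm_quot)

text \<open>The identity \<open>[a s, b] = [a, b] s + a [s, b]\<close> divided by
  \<open>h\<close>.\<close>

lemma D_leibniz_left:
  assumes a: "a \<in> carrier Q" and s: "s \<in> carrier Q" and b: "b \<in> carrier Q"
  shows "D (a \<otimes> s) b = D a b \<otimes>\<^bsub>K\<^esub> red s \<oplus>\<^bsub>K\<^esub> red a \<otimes>\<^bsub>K\<^esub> D s b"
proof -
  note 1 = comm_quot[OF a b] and 2 = comm_quot[OF s b]
  have "a \<otimes> s \<otimes> b = a \<otimes> (b \<otimes> s) \<oplus> h \<otimes> (a \<otimes> comm_quot s b)"
    using a s b 2(1) by (simp add: m_assoc 2(2) r_distr h_lcomm)
  also have "a \<otimes> (b \<otimes> s) = (b \<otimes> a \<oplus> h \<otimes> comm_quot a b) \<otimes> s"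
    using a s b 1(2) by (simp add: m_assoc[symmetric])
  finally have "a \<otimes> s \<otimes> b = b \<otimes> (a \<otimes> s) \<oplus> h \<otimes> (comm_quot a b \<otimes> s \<oplus> a \<otimes> comm_quot s b)"
    using a s b 1(1) 2(1) by (simp add: l_distr r_distr m_assoc a_assoc)
  then have "comm_quot (a \<otimes> s) b = comm_quot a b \<otimes> s \<oplus> a \<otimes> comm_quot s b"
    using a s b 1(1) 2(1) by (intro comm_quotI) simp_all
  then show ?thesis using a s b 1(1) 2(1) by (simp add: D_def)
qed

lemma D_leibniz_right:
  assumes a: "a \<in> carrier Q" and b: "b \<in> carrier Q" and t: "t \<in> carrier Q"
  shows "D a (b \<otimes> t) = D a b \<otimes>\<^bsub>K\<^esub> red t \<oplus>\<^bsub>K\<^esub> red b \<otimes>\<^bsub>K\<^esub> D a t"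
proof -
  note 1 = comm_quot[OF a b] and 2 = comm_quot[OF a t]
  have "a \<otimes> (b \<otimes> t) = b \<otimes> (a \<otimes> t) \<oplus> h \<otimes> (comm_quot a b \<otimes> t)"
    unfolding m_assoc[OF a b t, symmetric] 1(2) using a b t 1(1) by (simp add: m_assoc l_distr)
  also have "b \<otimes> (a \<otimes> t) = b \<otimes> t \<otimes> a \<oplus> h \<otimes> (b \<otimes> comm_quot a t)"
    using a b t 2(1) by (simp add: m_assoc 2(2) r_distr h_lcomm)
  finally have "a \<otimes> (b \<otimes> t) = b \<otimes> t \<otimes> a \<oplus> h \<otimes> (comm_quot a b \<otimes> t \<oplus> b \<otimes> comm_quot a t)"
    using a b t 1(1) 2(1) by (simp add: r_distr a_ac)
  then have "comm_quot a (b \<otimes> t) = comm_quot a b \<otimes> t \<oplus> b \<otimes> comm_quot a t"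
    using a b t 1(1) 2(1) by (intro comm_quotI) simp_all
  then show ?thesis using a b t 1(1) 2(1) by (simp add: D_def)
qed

text \<open>Two lifts differ by \<open>h d\<close>, and \<open>[h d, b] = h [d, b]\<close> is
  divisible by \<open>h^2\<close>, so the quotient by \<open>h\<close> changes by a multiple of
  \<open>h\<close>.\<close>

lemma D_cong_left:
  assumes a: "a \<in> carrier Q" and a': "a' \<in> carrier Q" and b: "b \<in> carrier Q" and e: "red a = red a'"
  shows "D a b = D a' b"
proof -
  have "red (a \<ominus> a') = \<zero>\<^bsub>K\<^esub>" using a a' e by (simp add: K.r_right_minus_eq)
  then obtain d where d: "d \<in> carrier Q" "a \<ominus> a' = h \<otimes> d" using red_kernel[of "a \<ominus> a'"] a a' by auto
  have ad: "a = a' \<oplus> h \<otimes> d" unfolding d(2)[symmetric] using a a' by (simp add: a_minus_def a_ac r_neg1 r_neg)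
  note 1 = comm_quot[OF a' b] and 2 = comm_quot[OF d(1) b]
  have "a \<otimes> b = a' \<otimes> b \<oplus> h \<otimes> (d \<otimes> b)"
    unfolding ad using a' b d(1) by (simp add: l_distr m_assoc)
  also have "\<dots> = (b \<otimes> a' \<oplus> h \<otimes> comm_quot a' b) \<oplus> h \<otimes> (b \<otimes> d \<oplus> h \<otimes> comm_quot d b)"
    by (subst 1(2), subst 2(2), rule refl)
  also have "\<dots> = b \<otimes> a \<oplus> h \<otimes> (comm_quot a' b \<oplus> h \<otimes> comm_quot d b)"
    unfolding ad using a' b d(1) 1(1) 2(1) by (simp add: r_distr h_lcomm[OF b d(1)] a_ac)
  finally have "comm_quot a b = comm_quot a' b \<oplus> h \<otimes> comm_quot d b"
    using a b 1(1) 2(1) by (intro comm_quotI) simp_all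
  then show ?thesis using a b 1(1) 2(1) by (simp add: D_def red_h)
qed

lemma D_swap:
  assumes a: "a \<in> carrier Q" and b: "b \<in> carrier Q"
  shows "D b a = \<ominus>\<^bsub>K\<^esub> D a b"
proof -
  note 1 = comm_quot[OF a b]
  have "b \<otimes> a = a \<otimes> b \<oplus> h \<otimes> (\<ominus> comm_quot a b)"
    unfolding 1(2) using a b 1(1) by (simp add: r_minus a_assoc r_neg)
  then have "comm_quot b a = \<ominus> comm_quot a b" using a b 1(1) by (intro comm_quotI) simp_all
  then show ?thesis using 1(1) by (simp add: D_def)
qed

lemma D_cong_right:
  assumes "a \<in> carrier Q" "b \<in> carrier Q" "b' \<in> carrier Q" "red b = red b'"
  shows "D a b = D a b'"
  using D_cong_left[OF assms(2,3,1,4)] D_swap assms by (metis K.minus_minus D_closed)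

text \<open>A biderivation is determined on fractions by its values on numerators and denominators.
  Here \<open>a\<close> and \<open>b\<close> reduce to the fractions with numerators
  \<open>V\<close>, \<open>W\<close> and denominators \<open>S\<close>, \<open>U\<close>, up to
  reduction.\<close>

lemma D_fraction:
  assumes q: "a \<in> carrier Q" "b \<in> carrier Q" "S \<in> carrier Q" "U \<in> carrier Q" "V \<in> carrier Q" "W \<in> carrier Q"
    and V: "red a \<otimes>\<^bsub>K\<^esub> red S = red V" and W: "red b \<otimes>\<^bsub>K\<^esub> red U = red W"
  shows "D a b \<otimes>\<^bsub>K\<^esub> ((red S \<otimes>\<^bsub>K\<^esub> red S) \<otimes>\<^bsub>K\<^esub> (red U \<otimes>\<^bsub>K\<^esub> red U)) =
    ((red S \<otimes>\<^bsub>K\<^esub> red U \<otimes>\<^bsub>K\<^esub> D V W \<ominus>\<^bsub>K\<^esub> red S \<otimes>\<^bsub>K\<^esub> red W \<otimes>\<^bsub>K\<^esub> D V U) \<ominus>\<^bsub>K\<^esub> red V \<otimes>\<^bsub>K\<^esub> red U \<otimes>\<^bsub>K\<^esub> D S W)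
      \<oplus>\<^bsub>K\<^esub> red V \<otimes>\<^bsub>K\<^esub> red W \<otimes>\<^bsub>K\<^esub> D S U"
proof (rule K.bracket_fraction_identity[symmetric, where dS = "D S b" and dX = "D V b" and a = "red a" and b = "red b"])
  have "D V b = D (a \<otimes> S) b" using q V by (intro D_cong_left) simp_all
  then show "D V b = D a b \<otimes>\<^bsub>K\<^esub> red S \<oplus>\<^bsub>K\<^esub> red a \<otimes>\<^bsub>K\<^esub> D S b" using q by (simp add: D_leibniz_left)
  have 1: "D x W = D x b \<otimes>\<^bsub>K\<^esub> red U \<oplus>\<^bsub>K\<^esub> red b \<otimes>\<^bsub>K\<^esub> D x U" if x: "x \<in> carrier Q" for x
  proof -
    have "D x W = D x (b \<otimes> U)" using q W x by (intro D_cong_right) simp_all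
    then show ?thesis using q x by (simp add: D_leibniz_right)
  qed
  show "D V W = D V b \<otimes>\<^bsub>K\<^esub> red U \<oplus>\<^bsub>K\<^esub> red b \<otimes>\<^bsub>K\<^esub> D V U" "D S W = D S b \<otimes>\<^bsub>K\<^esub> red U \<oplus>\<^bsub>K\<^esub> red b \<otimes>\<^bsub>K\<^esub> D S U"
    using 1 q by simp_all
qed (use q V W in simp_all)

end

text \<open>All the data of a quantization except the required form of the carrier, which in the end
  has to consist of sequences in \<open>K\<close>.\<close>

locale quantizing = hadic_ring Q K h red + k: field k
  for Q :: "('q, 'x) ring_scheme" (structure) and K :: "('k, 'v, 'y) poisson_scheme" and h red
    and k :: "('k, 'm) ring_scheme" +
  fixes \<iota> :: "(nat \<Rightarrow> 'k) \<Rightarrow> 'q"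
  assumes iota_hom: "\<iota> \<in> ring_hom (power_series_ring k) Q"
    and iota_central: "d \<in> carrier (power_series_ring k) \<Longrightarrow> x \<in> carrier Q \<Longrightarrow> x \<otimes> \<iota> d = \<iota> d \<otimes> x"
    and iota_hbar: "\<iota> (hbar k) = h"
    and red_smult: "c \<in> carrier k \<Longrightarrow> x \<in> carrier Q \<Longrightarrow> red (\<iota> (const_series k c) \<otimes> x) = c \<odot>\<^bsub>K\<^esub> red x"
    and commutator: "a \<in> carrier Q \<Longrightarrow> b \<in> carrier Q \<Longrightarrow>
      \<exists>e\<in>carrier Q. a \<otimes> b \<ominus> b \<otimes> a = h \<otimes> e \<and> red e = \<lbrace>red a, red b\<rbrace>\<^bsub>K\<^esub>"
begin

definition cst :: "'k \<Rightarrow> 'q" where "cst c = \<iota> (const_series k c)"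

lemma iota_closed [simp]: "c \<in> carrier k.PS \<Longrightarrow> \<iota> c \<in> carrier Q"
  by (rule ring_hom_closed[OF iota_hom])

lemma cst_hom: "cst \<in> ring_hom k Q"
proof -
  have "cst = \<iota> \<circ> const_series k" by (auto simp: cst_def)
  then show ?thesis using ring_hom_trans[OF k.const_series_hom iota_hom] by simp
qed

lemma cst_closed [simp]: "c \<in> carrier k \<Longrightarrow> cst c \<in> carrier Q"
  by (rule ring_hom_closed[OF cst_hom])

lemma red_cst: "c \<in> carrier k \<Longrightarrow> x \<in> carrier Q \<Longrightarrow> red (cst c \<otimes> x) = c \<odot>\<^bsub>K\<^esub> red x"
  unfolding cst_def by (rule red_smult)

lemma smult_K: "c \<in> carrier k \<Longrightarrow> v \<in> carrier K \<Longrightarrow> c \<odot>\<^bsub>K\<^esub> v = red (cst c) \<otimes>\<^bsub>K\<^esub> v"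
proof -
  assume c: "c \<in> carrier k" and "v \<in> carrier K"
  then have "v \<in> red ` carrier Q" by (simp only: red_surj)
  then obtain x where "x \<in> carrier Q" "v = red x" by blast
  then show ?thesis using red_cst[OF c, of x] c by simp
qed

lemma module_Q: "module k \<lparr>carrier = carrier Q, monoid.mult = (\<otimes>), one = \<one>, ring.zero = \<zero>, add = (\<oplus>),
    smult = (\<lambda>c x. cst c \<otimes> x)\<rparr>" (is "module k ?M")
proof (rule moduleI)
  show "abelian_group ?M"
  proof (rule abelian_groupI)
    show "\<exists>y\<in>carrier ?M. y \<oplus>\<^bsub>?M\<^esub> x = \<zero>\<^bsub>?M\<^esub>" if "x \<in> carrier ?M" for x
      using that by (intro bexI[of _ "\<ominus> x"]) (simp_all add: l_neg)
  qed (simp_all add: a_ac)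
qed (use k.cring_axioms in \<open>simp_all add: ring_hom_add[OF cst_hom] ring_hom_mult[OF cst_hom]
      ring_hom_one[OF cst_hom] l_distr r_distr m_assoc\<close>)

text \<open>A linear section of the reduction is provided by a complement of \<open>hQ\<close>.\<close>

lemma section_exists:
  obtains \<sigma> where "\<And>v. v \<in> carrier K \<Longrightarrow> \<sigma> v \<in> carrier Q" "\<And>v. v \<in> carrier K \<Longrightarrow> red (\<sigma> v) = v"
    "\<And>v w. v \<in> carrier K \<Longrightarrow> w \<in> carrier K \<Longrightarrow> \<sigma> (v \<oplus>\<^bsub>K\<^esub> w) = \<sigma> v \<oplus> \<sigma> w"
    "\<And>c v. c \<in> carrier k \<Longrightarrow> v \<in> carrier K \<Longrightarrow> \<sigma> (c \<odot>\<^bsub>K\<^esub> v) = cst c \<otimes> \<sigma> v"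
proof -
  define M where "M = \<lparr>carrier = carrier Q, monoid.mult = (\<otimes>), one = \<one>, ring.zero = \<zero>, add = (\<oplus>),
    smult = (\<lambda>c x. cst c \<otimes> x)\<rparr>"
  have M: "carrier M = carrier Q" "\<zero>\<^bsub>M\<^esub> = \<zero>" "\<And>x y. x \<oplus>\<^bsub>M\<^esub> y = x \<oplus> y" "\<And>c x. c \<odot>\<^bsub>M\<^esub> x = cst c \<otimes> x"
    by (simp_all add: M_def)
  interpret M: module k M using module_Q by (simp add: M_def)
  have inv: "\<ominus>\<^bsub>M\<^esub> x = \<ominus> x" if "x \<in> carrier Q" for x
    using that by (intro M.minus_equality) (simp_all add: M l_neg)
  define U where "U = (\<lambda>y. h \<otimes> y) ` carrier Q"
  have "submodule U k M"
  proof (rule M.submoduleI, unfold M)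
    show "U \<subseteq> carrier Q" by (auto simp: U_def)
    show "\<zero> \<in> U" unfolding U_def by (rule image_eqI[of _ _ \<zero>]) simp_all
    fix a assume "a \<in> U"
    then obtain a' where a: "a' \<in> carrier Q" "a = h \<otimes> a'" by (auto simp: U_def)
    show "\<ominus>\<^bsub>M\<^esub> a \<in> U" using a inv[of a] by (auto simp: U_def r_minus[symmetric])
    show "cst r \<otimes> a \<in> U" if "r \<in> carrier k" for r using a that h_lcomm[of "cst r" a'] by (auto simp: U_def)
    fix b assume "b \<in> U"
    then obtain b' where b: "b' \<in> carrier Q" "b = h \<otimes> b'" by (auto simp: U_def)
    show "a \<oplus> b \<in> U" using a b by (auto simp: U_def r_distr[symmetric])
  qed
  moreover have "submodule {\<zero>\<^bsub>M\<^esub>} k M"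
    by (rule M.submoduleI) (simp_all add: M.smult_r_null)
  moreover have "{\<zero>\<^bsub>M\<^esub>} \<inter> U = {\<zero>\<^bsub>M\<^esub>}"
    unfolding U_def M by (auto intro: image_eqI[of _ _ \<zero>])
  ultimately obtain G where G: "submodule G k M" "G \<inter> U = {\<zero>\<^bsub>M\<^esub>}"
    and sum: "\<And>x. x \<in> carrier M \<Longrightarrow> \<exists>g\<in>G. \<exists>u\<in>U. x = g \<oplus>\<^bsub>M\<^esub> u"
    using M.complement_exists[OF k.field_axioms, of "{\<zero>\<^bsub>M\<^esub>}" U] by metis
  note g = M.submoduleE[OF G(1), unfolded M]
  have gc: "x \<in> G \<Longrightarrow> x \<in> carrier Q" for x using g(1) by blast
  have unique: "x = y" if x: "x \<in> G" and y: "y \<in> G" and xy: "red x = red y" for x y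
  proof -
    have "red (x \<ominus> y) = \<zero>\<^bsub>K\<^esub>" using gc[OF x] gc[OF y] xy by (simp add: K.r_right_minus_eq)
    then have "x \<ominus> y \<in> U" using red_kernel[of "x \<ominus> y"] gc[OF x] gc[OF y] by (auto simp: U_def)
    moreover have "x \<ominus> y \<in> G" unfolding a_minus_def inv[OF gc[OF y], symmetric] using g(5)[OF x g(3)[OF y]] .
    ultimately have "x \<ominus> y \<in> G \<inter> U" by (intro IntI)
    then have "x \<ominus> y = \<zero>" unfolding G(2) M(2) by simp
    then show ?thesis using gc[OF x] gc[OF y] by (simp add: Q.r_right_minus_eq)
  qed
  have "\<exists>x\<in>G. red x = v" if "v \<in> carrier K" for v
  proof -
    have "v \<in> red ` carrier Q" using that by (simp only: red_surj)
    then obtain x where x: "x \<in> carrier Q" "v = red x" by blast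
    then obtain a y where "a \<in> G" "y \<in> carrier Q" "x = a \<oplus> h \<otimes> y" using sum[of x] by (auto simp: M U_def)
    then show ?thesis using x gc by (intro bexI[of _ a]) (simp_all add: red_h)
  qed
  then obtain \<sigma> where \<sigma>: "\<And>v. v \<in> carrier K \<Longrightarrow> \<sigma> v \<in> G \<and> red (\<sigma> v) = v" by metis
  show thesis
  proof (rule that)
    fix v assume v: "v \<in> carrier K"
    show "\<sigma> v \<in> carrier Q" "red (\<sigma> v) = v" using \<sigma>[OF v] gc by simp_all
    { fix c assume c: "c \<in> carrier k"
      have cv: "c \<odot>\<^bsub>K\<^esub> v \<in> carrier K" using c v by (simp add: smult_K)
      show "\<sigma> (c \<odot>\<^bsub>K\<^esub> v) = cst c \<otimes> \<sigma> v"
        using \<sigma>[OF v] \<sigma>[OF cv] g(4)[OF c] gc smult_K[OF c v] c by (intro unique) simp_all }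
    fix w assume w: "w \<in> carrier K"
    show "\<sigma> (v \<oplus>\<^bsub>K\<^esub> w) = \<sigma> v \<oplus> \<sigma> w"
      using \<sigma>[OF v] \<sigma>[OF w] \<sigma>[of "v \<oplus>\<^bsub>K\<^esub> w"] g(5) gc v w by (intro unique) simp_all
  qed
qed

end

locale quantizing_section = quantizing Q K h red k \<iota>
  for Q :: "('q, 'x) ring_scheme" (structure) and K :: "('k, 'v, 'y) poisson_scheme" and h red
    and k :: "('k, 'm) ring_scheme" and \<iota> +
  fixes \<sigma> :: "'v \<Rightarrow> 'q"
  assumes sec_closed [simp]: "v \<in> carrier K \<Longrightarrow> \<sigma> v \<in> carrier Q"
    and red_sec [simp]: "v \<in> carrier K \<Longrightarrow> red (\<sigma> v) = v"
    and sec_add: "v \<in> carrier K \<Longrightarrow> w \<in> carrier K \<Longrightarrow> \<sigma> (v \<oplus>\<^bsub>K\<^esub> w) = \<sigma> v \<oplus> \<sigma> w"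
    and sec_smult: "c \<in> carrier k \<Longrightarrow> v \<in> carrier K \<Longrightarrow> \<sigma> (c \<odot>\<^bsub>K\<^esub> v) = cst c \<otimes> \<sigma> v"
begin

text \<open>Splits off the leading term in an expansion of \<open>x\<close> as the sum of the terms
  \<open>h^m \<sigma> (v m)\<close>; iterating it yields the \<open>v m\<close>, collected in
  \<open>digits\<close>.\<close>

definition step where "step x = (THE y. y \<in> carrier Q \<and> x = \<sigma> (red x) \<oplus> h \<otimes> y)"

lemma stepI:
  assumes v: "v \<in> carrier K" and y: "y \<in> carrier Q" and x: "x = \<sigma> v \<oplus> h \<otimes> y"
  shows "red x = v" "step x = y"
proof -
  show r: "red x = v" using assms by (simp add: red_h)
  show "step x = y"
    unfolding step_def
  proof (rule the_equality)
    fix z assume z: "z \<in> carrier Q \<and> x = \<sigma> (red x) \<oplus> h \<otimes> z"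
    then have "\<sigma> v \<oplus> h \<otimes> z = \<sigma> v \<oplus> h \<otimes> y" using x r by simp
    then have "h \<otimes> z = h \<otimes> y" using z v y by simp
    then show "z = y" using h_cancel z y by blast
  qed (use x y r in simp)
qed

lemma step:
  assumes x: "x \<in> carrier Q"
  shows "step x \<in> carrier Q" "x = \<sigma> (red x) \<oplus> h \<otimes> step x"
proof -
  have "red (x \<ominus> \<sigma> (red x)) = \<zero>\<^bsub>K\<^esub>" using x by (simp add: K.r_right_minus_eq)
  then obtain y where y: "y \<in> carrier Q" "x \<ominus> \<sigma> (red x) = h \<otimes> y"
    using red_kernel[of "x \<ominus> \<sigma> (red x)"] x by auto
  have e: "x = \<sigma> (red x) \<oplus> h \<otimes> y"
    unfolding y(2)[symmetric] using x by (simp add: a_minus_def a_ac r_neg1 r_neg)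
  show "step x \<in> carrier Q" "x = \<sigma> (red x) \<oplus> h \<otimes> step x"
    using stepI(2)[OF _ y(1) e] x y(1) e by simp_all
qed

lemma step_add:
  assumes x: "x \<in> carrier Q" and y: "y \<in> carrier Q"
  shows "step (x \<oplus> y) = step x \<oplus> step y"
proof (rule stepI(2)[of "red x \<oplus>\<^bsub>K\<^esub> red y"])
  note s = step(1)[OF x] step(1)[OF y]
  have "x \<oplus> y = (\<sigma> (red x) \<oplus> h \<otimes> step x) \<oplus> (\<sigma> (red y) \<oplus> h \<otimes> step y)"
    using step(2)[OF x] step(2)[OF y] by simp
  also have "\<dots> = \<sigma> (red x \<oplus>\<^bsub>K\<^esub> red y) \<oplus> h \<otimes> (step x \<oplus> step y)"
    using s x y by (simp add: sec_add r_distr a_ac)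
  finally show "x \<oplus> y = \<sigma> (red x \<oplus>\<^bsub>K\<^esub> red y) \<oplus> h \<otimes> (step x \<oplus> step y)" .
qed (use x y step(1) in simp_all)

text \<open>Multiply out the product of \<open>c_0 + h c'\<close> and
  \<open>\<sigma> (red x) + h (step x)\<close>, where \<open>c'\<close> is \<open>c\<close> shifted
  by one place. Since \<open>\<sigma>\<close> commutes with the scalars of \<open>k\<close>, the
  leading term is again a value of \<open>\<sigma>\<close>, and no carry to higher digits
  arises.\<close>

lemma step_iota:
  assumes c: "c \<in> carrier k.PS" and x: "x \<in> carrier Q"
  shows "red (\<iota> c \<otimes> x) = c 0 \<odot>\<^bsub>K\<^esub> red x" "step (\<iota> c \<otimes> x) = \<iota> (\<lambda>m. c (Suc m)) \<otimes> x \<oplus> cst (c 0) \<otimes> step x"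
proof -
  define c' where "c' = (\<lambda>m. c (Suc m))"
  have c': "c' \<in> carrier k.PS" and c0: "c 0 \<in> carrier k" using c by (simp_all add: c'_def k.PS_mem)
  note s = step[OF x]
  have kv: "c 0 \<odot>\<^bsub>K\<^esub> red x \<in> carrier K" using c0 x by (simp add: smult_K)
  interpret PS: cring k.PS by (rule k.PS_cring)
  have "\<iota> c = cst (c 0) \<oplus> h \<otimes> \<iota> c'"
    unfolding cst_def iota_hbar[symmetric]
    using arg_cong[OF k.PS_decompose[OF c], of \<iota>] c' c0
    by (simp add: c'_def[symmetric] ring_hom_add[OF iota_hom] ring_hom_mult[OF iota_hom])
  then have "\<iota> c \<otimes> x = cst (c 0) \<otimes> x \<oplus> h \<otimes> (\<iota> c' \<otimes> x)"
    using c0 c' x by (simp add: l_distr m_assoc)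
  also have "cst (c 0) \<otimes> x = cst (c 0) \<otimes> (\<sigma> (red x) \<oplus> h \<otimes> step x)" using s(2) by simp
  also have "\<dots> = \<sigma> (c 0 \<odot>\<^bsub>K\<^esub> red x) \<oplus> h \<otimes> (cst (c 0) \<otimes> step x)"
    using c0 s(1) x by (simp add: r_distr sec_smult h_lcomm)
  finally have "\<iota> c \<otimes> x = \<sigma> (c 0 \<odot>\<^bsub>K\<^esub> red x) \<oplus> h \<otimes> (\<iota> c' \<otimes> x \<oplus> cst (c 0) \<otimes> step x)"
    using c0 c' s(1) x kv by (simp add: r_distr a_ac)
  from stepI[OF kv _ this]
  show "red (\<iota> c \<otimes> x) = c 0 \<odot>\<^bsub>K\<^esub> red x" "step (\<iota> c \<otimes> x) = \<iota> (\<lambda>m. c (Suc m)) \<otimes> x \<oplus> cst (c 0) \<otimes> step x"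
    using c0 c' s(1) x by (simp_all add: c'_def)
qed

lemma step_cst:
  assumes c: "c \<in> carrier k" and x: "x \<in> carrier Q"
  shows "step (cst c \<otimes> x) = cst c \<otimes> step x"
proof -
  have 1: "(\<lambda>m. const_series k c (Suc m)) = \<zero>\<^bsub>k.PS\<^esub>" "const_series k c 0 = c" by (simp_all add: const_series_def k.PS_simps)
  have 2: "\<iota> \<zero>\<^bsub>k.PS\<^esub> = \<zero>"
    by (rule ring_hom_zero[OF iota_hom]) (use k.PS_cring in \<open>simp_all add: cring.axioms(1) Q.ring_axioms\<close>)
  show ?thesis
    using step_iota(2)[OF k.const_series_closed[OF c] x, unfolded 1 2] c x step(1)[OF x] by (simp add: cst_def[symmetric])
qed

definition digits where "digits x = (\<lambda>m. red ((step ^^ m) x))"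

lemma step_pow_closed [simp]: "x \<in> carrier Q \<Longrightarrow> (step ^^ m) x \<in> carrier Q"
  by (induction m) (simp_all add: step)

lemma digits_0: "digits x 0 = red x" and digits_Suc: "digits x (Suc m) = digits (step x) m"
  by (simp_all add: digits_def funpow_swap1)

lemma digits_closed [simp]: "x \<in> carrier Q \<Longrightarrow> digits x m \<in> carrier K"
  by (simp add: digits_def)

lemma digits_add: "x \<in> carrier Q \<Longrightarrow> y \<in> carrier Q \<Longrightarrow> digits (x \<oplus> y) m = digits x m \<oplus>\<^bsub>K\<^esub> digits y m"
  by (induction m arbitrary: x y) (simp_all add: digits_0 digits_Suc step_add step)

lemma digits_cst: "c \<in> carrier k \<Longrightarrow> x \<in> carrier Q \<Longrightarrow> digits (cst c \<otimes> x) m = c \<odot>\<^bsub>K\<^esub> digits x m"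
  by (induction m arbitrary: x) (simp_all add: digits_0 digits_Suc step_cst step smult_K)

lemma digits_inj: "inj_on digits (carrier Q)"
proof (rule inj_onI)
  fix x y assume x: "x \<in> carrier Q" and y: "y \<in> carrier Q" and e: "digits x = digits y"
  have "x \<ominus> y = h [^] N \<otimes> ((step ^^ N) x \<ominus> (step ^^ N) y)" for N :: nat
  proof (induction N)
    case (Suc N)
    define u v where "u = (step ^^ N) x" and "v = (step ^^ N) y"
    have uv: "u \<in> carrier Q" "v \<in> carrier Q" "red u = red v"
      using x y fun_cong[OF e, of N] by (simp_all add: u_def v_def digits_def)
    have "u \<ominus> v = (\<sigma> (red v) \<oplus> h \<otimes> step u) \<ominus> (\<sigma> (red v) \<oplus> h \<otimes> step v)"
      using step(2)[OF uv(1)] step(2)[OF uv(2)] uv(3) by simp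
    also have "\<dots> = h \<otimes> (step u \<ominus> step v)"
      using uv(1,2) step(1) by (simp add: a_minus_def minus_add r_distr r_minus a_ac r_neg1 r_neg2)
    finally have "x \<ominus> y = h [^] N \<otimes> (h \<otimes> (step u \<ominus> step v))" using Suc by (simp add: u_def v_def)
    then show ?case using uv step(1) by (simp add: u_def[symmetric] v_def[symmetric] m_assoc)
  qed (use x y in simp)
  note eq = this
  have "x \<ominus> y = \<zero>"
  proof (rule separated)
    show "\<exists>z\<in>carrier Q. x \<ominus> y = h [^] N \<otimes> z" for N :: nat
      using x y eq[of N] by (intro bexI[of _ "(step ^^ N) x \<ominus> (step ^^ N) y"]) simp_all
  qed (use x y in simp)
  then show "x = y" using x y by (simp add: Q.r_right_minus_eq)
qed

lemma digits_surj:
  assumes v: "v \<in> UNIV \<rightarrow> carrier K"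
  shows "\<exists>x\<in>carrier Q. digits x = v"
proof -
  obtain \<Sigma> where \<Sigma>: "\<And>g. (\<forall>m. g m \<in> carrier Q) \<Longrightarrow>
        \<Sigma> g \<in> carrier Q \<and> \<Sigma> g = g 0 \<oplus> h \<otimes> \<Sigma> (\<lambda>m::nat. g (Suc m))" using complete by metis
  \<comment> \<open>\<open>G j\<close> is the series with the digits of \<open>v\<close> from the
    place \<open>j\<close> on; its leading digit is \<open>v j\<close>, and \<open>step\<close>
    leads to \<open>G (Suc j)\<close>.\<close>
  define G where "G j = \<Sigma> (\<lambda>i. \<sigma> (v (j + i)))" for j
  have vc: "v j \<in> carrier K" for j using v by auto
  have G: "G j \<in> carrier Q" "G j = \<sigma> (v j) \<oplus> h \<otimes> G (Suc j)" for j
  proof -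
    have 1: "\<forall>i. \<sigma> (v (j + i)) \<in> carrier Q" using vc by simp
    show "G j \<in> carrier Q" using conjunct1[OF \<Sigma>[OF 1]] by (simp only: G_def)
    show "G j = \<sigma> (v j) \<oplus> h \<otimes> G (Suc j)"
      using conjunct2[OF \<Sigma>[OF 1]] by (simp only: G_def add_0_right add_Suc_right add_Suc)
  qed
  have "digits (G j) m = v (j + m)" for j m
  proof (induction m arbitrary: j)
    case 0
    show ?case using stepI(1)[OF vc G(1) G(2)[of j]] by (simp only: digits_0 add_0_right)
  next
    case (Suc m)
    show ?case using Suc.IH[of "Suc j"] stepI(2)[OF vc G(1) G(2)[of j]] by (simp only: digits_Suc add_Suc add_Suc_right)
  qed
  from this[of 0] have "digits (G 0) = v" by (intro ext) (simp only: add_0)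
  then show ?thesis using G(1) by blast
qed

lemma digits_bij: "bij_betw digits (carrier Q) (UNIV \<rightarrow> carrier K)"
  unfolding bij_betw_def
proof (intro conjI equalityI subsetI)
  show "v \<in> digits ` carrier Q" if "v \<in> UNIV \<rightarrow> carrier K" for v using digits_surj[OF that] by auto
qed (use digits_inj in auto)

end

section \<open>Transport of the ring structure to sequences in \<open>K\<close>\<close>

context quantizing_section
begin

definition undigits where "undigits = inv_into (carrier Q) digits"

definition Kh :: "(nat \<Rightarrow> 'k, nat \<Rightarrow> 'v) module" where
  "Kh = \<lparr>carrier = UNIV \<rightarrow> carrier K,
     monoid.mult = (\<lambda>a b. digits (undigits a \<otimes> undigits b)), one = digits \<one>,
     ring.zero = digits \<zero>, add = (\<lambda>a b. digits (undigits a \<oplus> undigits b)),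
     smult = (\<lambda>c a. digits (\<iota> c \<otimes> undigits a))\<rparr>"

lemma undigits [simp]: "x \<in> carrier Q \<Longrightarrow> undigits (digits x) = x"
  unfolding undigits_def by (rule inv_into_f_f[OF digits_inj])

lemma Kh_ops [simp]:
  assumes "x \<in> carrier Q" "y \<in> carrier Q"
  shows "digits x \<otimes>\<^bsub>Kh\<^esub> digits y = digits (x \<otimes> y)" "digits x \<oplus>\<^bsub>Kh\<^esub> digits y = digits (x \<oplus> y)"
    "c \<odot>\<^bsub>Kh\<^esub> digits x = digits (\<iota> c \<otimes> x)"
  using assms by (simp_all add: Kh_def)

lemma Kh_one: "\<one>\<^bsub>Kh\<^esub> = digits \<one>" and Kh_zero: "\<zero>\<^bsub>Kh\<^esub> = digits \<zero>"
  by (simp_all add: Kh_def)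

lemma Kh_carrier: "carrier Kh = digits ` carrier Q"
  using digits_bij by (simp add: bij_betw_def Kh_def)

lemma Kh_cases:
  assumes "a \<in> carrier Kh"
  obtains x where "x \<in> carrier Q" "a = digits x"
  using assms unfolding Kh_carrier by blast

lemma digits_in_Kh [simp]: "x \<in> carrier Q \<Longrightarrow> digits x \<in> carrier Kh"
  unfolding Kh_carrier by blast

lemma digits_iso: "digits \<in> ring_iso Q Kh"
  by (rule ring_iso_memI) (use digits_bij in \<open>simp_all add: Kh_one, simp add: Kh_def\<close>)

lemma ring_Kh: "ring Kh"
  using Q.ring_iso_imp_img_ring[OF digits_iso] by (simp add: Kh_def)

lemma digits_hom: "ring_hom_ring Q Kh digits"
  using digits_iso ring_Kh Q.ring_axioms by (auto intro: ring_hom_ringI2 simp: ring_iso_def)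

lemma module_Kh: "module k.PS Kh"
proof (rule moduleI)
  interpret PS: cring k.PS by (rule k.PS_cring)
  show "cring k.PS" by (rule k.PS_cring)
  show "abelian_group Kh" by (rule ring.is_abelian_group[OF ring_Kh])
  note hom = ring_hom_add[OF iota_hom] ring_hom_mult[OF iota_hom] ring_hom_one[OF iota_hom]
  fix c d a b assume c: "c \<in> carrier k.PS" and d: "d \<in> carrier k.PS" and a: "a \<in> carrier Kh" and b: "b \<in> carrier Kh"
  obtain x where x: "x \<in> carrier Q" "a = digits x" by (rule Kh_cases[OF a])
  obtain y where y: "y \<in> carrier Q" "b = digits y" by (rule Kh_cases[OF b])
  show "c \<odot>\<^bsub>Kh\<^esub> a \<in> carrier Kh" using c x by simp
  show "(c \<oplus>\<^bsub>k.PS\<^esub> d) \<odot>\<^bsub>Kh\<^esub> a = c \<odot>\<^bsub>Kh\<^esub> a \<oplus>\<^bsub>Kh\<^esub> d \<odot>\<^bsub>Kh\<^esub> a" using c d x by (simp add: hom l_distr)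
  show "c \<odot>\<^bsub>Kh\<^esub> (a \<oplus>\<^bsub>Kh\<^esub> b) = c \<odot>\<^bsub>Kh\<^esub> a \<oplus>\<^bsub>Kh\<^esub> c \<odot>\<^bsub>Kh\<^esub> b" using c x y by (simp add: r_distr)
  show "(c \<otimes>\<^bsub>k.PS\<^esub> d) \<odot>\<^bsub>Kh\<^esub> a = c \<odot>\<^bsub>Kh\<^esub> (d \<odot>\<^bsub>Kh\<^esub> a)" using c d x by (simp add: hom m_assoc)
next
  show "\<one>\<^bsub>k.PS\<^esub> \<odot>\<^bsub>Kh\<^esub> a = a" if "a \<in> carrier Kh" for a
    by (rule Kh_cases[OF that]) (simp add: ring_hom_one[OF iota_hom])
qed

lemma assoc_algebra_Kh: "assoc_algebra k.PS Kh"
proof (rule assoc_algebra.intro[OF module_Kh ring_Kh], unfold_locales)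
  fix c a b assume c: "c \<in> carrier k.PS" and a: "a \<in> carrier Kh" and b: "b \<in> carrier Kh"
  obtain x where x: "x \<in> carrier Q" "a = digits x" by (rule Kh_cases[OF a])
  obtain y where y: "y \<in> carrier Q" "b = digits y" by (rule Kh_cases[OF b])
  show "c \<odot>\<^bsub>Kh\<^esub> a \<otimes>\<^bsub>Kh\<^esub> b = c \<odot>\<^bsub>Kh\<^esub> (a \<otimes>\<^bsub>Kh\<^esub> b)" using c x y by (simp add: m_assoc)
  have "x \<otimes> (\<iota> c \<otimes> y) = \<iota> c \<otimes> (x \<otimes> y)"
    using iota_central[OF c x(1)] c x(1) y(1) by (simp add: m_assoc[symmetric])
  then show "a \<otimes>\<^bsub>Kh\<^esub> (c \<odot>\<^bsub>Kh\<^esub> b) = c \<odot>\<^bsub>Kh\<^esub> (a \<otimes>\<^bsub>Kh\<^esub> b)" using c x y by simp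
qed

text \<open>In \<open>topologically_free\<close> the module \<open>V\<close> must have the element
  type of \<open>Kh\<close>, which is a type of sequences, so \<open>K\<close> enters as the module
  of constant sequences.\<close>

definition K_module :: "('k, nat \<Rightarrow> 'v) module" where
  "K_module = \<lparr>carrier = (\<lambda>v _. v) ` carrier K, monoid.mult = undefined, one = undefined,
     ring.zero = (\<lambda>_. \<zero>\<^bsub>K\<^esub>), add = (\<lambda>a b _. a 0 \<oplus>\<^bsub>K\<^esub> b 0), smult = (\<lambda>c a _. c \<odot>\<^bsub>K\<^esub> a 0)\<rparr>"

lemma K_module_simps:
  "carrier K_module = (\<lambda>v _. v) ` carrier K" "\<zero>\<^bsub>K_module\<^esub> = (\<lambda>_. \<zero>\<^bsub>K\<^esub>)"
  "a \<oplus>\<^bsub>K_module\<^esub> b = (\<lambda>_. a 0 \<oplus>\<^bsub>K\<^esub> b 0)" "c \<odot>\<^bsub>K_module\<^esub> a = (\<lambda>_. c \<odot>\<^bsub>K\<^esub> a 0)"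
  by (simp_all add: K_module_def)

lemma smult_K_closed [simp]: "c \<in> carrier k \<Longrightarrow> v \<in> carrier K \<Longrightarrow> c \<odot>\<^bsub>K\<^esub> v \<in> carrier K"
  by (simp add: smult_K)

lemma module_K_module: "module k K_module"
proof (rule moduleI)
  show "abelian_group K_module"
  proof (rule abelian_groupI)
    show "\<exists>b\<in>carrier K_module. b \<oplus>\<^bsub>K_module\<^esub> a = \<zero>\<^bsub>K_module\<^esub>" if "a \<in> carrier K_module" for a
      using that by (auto simp: K_module_simps K.l_neg intro!: bexI[of _ "\<ominus>\<^bsub>K\<^esub> _"])
  qed (auto simp: K_module_simps K.a_ac)
  have hom: "red (cst (c \<oplus>\<^bsub>k\<^esub> d)) = red (cst c) \<oplus>\<^bsub>K\<^esub> red (cst d)" "red (cst (c \<otimes>\<^bsub>k\<^esub> d)) = red (cst c) \<otimes>\<^bsub>K\<^esub> red (cst d)"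
    if "c \<in> carrier k" "d \<in> carrier k" for c d
    using that by (simp_all add: ring_hom_add[OF cst_hom] ring_hom_mult[OF cst_hom])
  fix c d a b assume c: "c \<in> carrier k" and d: "d \<in> carrier k" and a: "a \<in> carrier K_module" and b: "b \<in> carrier K_module"
  obtain x where x: "x \<in> carrier K" "a = (\<lambda>_. x)" using a by (auto simp: K_module_simps)
  obtain y where y: "y \<in> carrier K" "b = (\<lambda>_. y)" using b by (auto simp: K_module_simps)
  show "c \<odot>\<^bsub>K_module\<^esub> a \<in> carrier K_module" using c x by (simp add: K_module_simps)
  show "(c \<oplus>\<^bsub>k\<^esub> d) \<odot>\<^bsub>K_module\<^esub> a = c \<odot>\<^bsub>K_module\<^esub> a \<oplus>\<^bsub>K_module\<^esub> d \<odot>\<^bsub>K_module\<^esub> a"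
    using c d x by (simp add: K_module_simps smult_K hom K.l_distr)
  show "c \<odot>\<^bsub>K_module\<^esub> (a \<oplus>\<^bsub>K_module\<^esub> b) = c \<odot>\<^bsub>K_module\<^esub> a \<oplus>\<^bsub>K_module\<^esub> c \<odot>\<^bsub>K_module\<^esub> b"
    using c x y by (simp add: K_module_simps smult_K K.r_distr)
  show "(c \<otimes>\<^bsub>k\<^esub> d) \<odot>\<^bsub>K_module\<^esub> a = c \<odot>\<^bsub>K_module\<^esub> (d \<odot>\<^bsub>K_module\<^esub> a)"
    using c d x by (simp add: K_module_simps smult_K hom K.m_assoc)
next
  show "\<one>\<^bsub>k\<^esub> \<odot>\<^bsub>K_module\<^esub> a = a" if "a \<in> carrier K_module" for a
    using that by (auto simp: K_module_simps smult_K ring_hom_one[OF cst_hom])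
qed (rule k.is_cring)

text \<open>By \<open>step_iota\<close>, the digit \<open>m + 1\<close> of \<open>c x\<close> is the
  digit \<open>m\<close> of \<open>c' x\<close> plus \<open>c_0\<close> times the digit
  \<open>m + 1\<close> of \<open>x\<close>, where \<open>c'\<close> is \<open>c\<close> shifted by
  one place; this is the recursion for a Cauchy product.\<close>

lemma digits_iota:
  assumes "c \<in> carrier k.PS" "x \<in> carrier Q"
  shows "(\<lambda>_. digits (\<iota> c \<otimes> x) m) =
    (\<Oplus>\<^bsub>K_module\<^esub>i\<in>{..m}. c i \<odot>\<^bsub>K_module\<^esub> (\<lambda>_. digits x (m - i)))"
  using assms
proof (induction m arbitrary: c x)
  interpret V: module k K_module by (rule module_K_module)
  have V: "v \<in> carrier K \<Longrightarrow> (\<lambda>_. v) \<in> carrier K_module" for v by (simp add: K_module_simps)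
  {
    case 0
    then have "c 0 \<in> carrier k" by (simp add: k.PS_mem)
    then show ?case
      using 0 V step_iota(1)[OF 0] by (simp add: digits_0) (simp add: K_module_simps)
  next
    case (Suc m)
    define c' where "c' = (\<lambda>m. c (Suc m))"
    have ci: "c i \<in> carrier k" for i using Suc.prems(1) by (simp add: k.PS_mem)
    have c': "c' \<in> carrier k.PS" using ci by (simp add: c'_def k.PS_mem)
    note x = Suc.prems(2) and s = step(1)[OF Suc.prems(2)]
    have "digits (\<iota> c \<otimes> x) (Suc m) = digits (\<iota> c' \<otimes> x) m \<oplus>\<^bsub>K\<^esub> c 0 \<odot>\<^bsub>K\<^esub> digits x (Suc m)"
      unfolding digits_Suc step_iota(2)[OF Suc.prems] c'_def[symmetric]
      using c' ci x s by (simp add: digits_add digits_cst)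
    then have "(\<lambda>_. digits (\<iota> c \<otimes> x) (Suc m)) =
        (\<lambda>_. digits (\<iota> c' \<otimes> x) m) \<oplus>\<^bsub>K_module\<^esub> c 0 \<odot>\<^bsub>K_module\<^esub> (\<lambda>_. digits x (Suc m))"
      by (simp add: K_module_simps)
    also have "\<dots> = (\<Oplus>\<^bsub>K_module\<^esub>i\<in>{..m}. c (Suc i) \<odot>\<^bsub>K_module\<^esub> (\<lambda>_. digits x (Suc m - Suc i)))
        \<oplus>\<^bsub>K_module\<^esub> c 0 \<odot>\<^bsub>K_module\<^esub> (\<lambda>_. digits x (Suc m - 0))"
      unfolding Suc.IH[OF c' x] by (simp add: c'_def)
    also have "\<dots> = (\<Oplus>\<^bsub>K_module\<^esub>i\<in>{..Suc m}. c i \<odot>\<^bsub>K_module\<^esub> (\<lambda>_. digits x (Suc m - i)))"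
      using ci x V by (subst V.finsum_Suc2) auto
    finally show ?case .
  }
qed

lemma top_free_Kh: "topologically_free k Kh"
  unfolding topologically_free_def
proof (intro exI[of _ K_module] exI[of _ "\<lambda>a m _. a m"] conjI ballI allI module_K_module)
  show "bij_betw (\<lambda>a m _. a m) (carrier Kh) (UNIV \<rightarrow> carrier K_module)"
  proof (rule bij_betwI[where g = "\<lambda>b m. b m 0"])
    show "(\<lambda>a m _. a m) \<in> carrier Kh \<rightarrow> UNIV \<rightarrow> carrier K_module"
      by (auto simp: Kh_def K_module_simps Pi_iff)
    show "(\<lambda>b m. b m 0) \<in> (UNIV \<rightarrow> carrier K_module) \<rightarrow> carrier Kh"
    proof (rule Pi_I)
      fix b :: "nat \<Rightarrow> nat \<Rightarrow> 'v" assume b: "b \<in> UNIV \<rightarrow> carrier K_module"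
      have "b m 0 \<in> carrier K" for m
      proof -
        have "b m \<in> carrier K_module" using b by auto
        then show ?thesis by (auto simp: K_module_simps)
      qed
      then show "(\<lambda>m. b m 0) \<in> carrier Kh" by (simp add: Kh_def)
    qed
    show "(\<lambda>m _. b m 0) = b" if b: "b \<in> UNIV \<rightarrow> carrier K_module" for b :: "nat \<Rightarrow> nat \<Rightarrow> 'v"
    proof (intro ext)
      fix m i
      have "b m \<in> carrier K_module" using b by auto
      then show "b m 0 = b m i" by (auto simp: K_module_simps)
    qed
  qed simp
  fix a m assume a: "a \<in> carrier Kh"
  obtain x where x: "x \<in> carrier Q" "a = digits x" by (rule Kh_cases[OF a])
  { fix b assume b: "b \<in> carrier Kh"
    obtain y where y: "y \<in> carrier Q" "b = digits y" by (rule Kh_cases[OF b])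
    show "(\<lambda>_. (a \<oplus>\<^bsub>Kh\<^esub> b) m) = (\<lambda>_. a m) \<oplus>\<^bsub>K_module\<^esub> (\<lambda>_. b m)"
      using x y by (simp add: K_module_simps digits_add) }
  fix c assume "c \<in> carrier k.PS"
  then show "(\<lambda>_. (c \<odot>\<^bsub>Kh\<^esub> a) m) = (\<Oplus>\<^bsub>K_module\<^esub>i\<in>{..m}. c i \<odot>\<^bsub>K_module\<^esub> (\<lambda>_. a (m - i)))"
    using digits_iota x by simp
qed

lemma head_hom: "ring_hom_ring Kh K (\<lambda>a. a 0)"
proof (rule ring_hom_ringI2[OF ring_Kh K.ring_axioms])
  show "(\<lambda>a. a 0) \<in> ring_hom Kh K"
  proof (rule ring_hom_memI)
    fix a b assume a: "a \<in> carrier Kh" and b: "b \<in> carrier Kh"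
    obtain x where x: "x \<in> carrier Q" "a = digits x" by (rule Kh_cases[OF a])
    obtain y where y: "y \<in> carrier Q" "b = digits y" by (rule Kh_cases[OF b])
    show "(a \<otimes>\<^bsub>Kh\<^esub> b) 0 = a 0 \<otimes>\<^bsub>K\<^esub> b 0" "(a \<oplus>\<^bsub>Kh\<^esub> b) 0 = a 0 \<oplus>\<^bsub>K\<^esub> b 0"
      using x y by (simp_all add: digits_0)
  qed (auto simp: Kh_carrier Kh_one digits_0)
qed

lemma hbar_ideal_Kh: "hbar_ideal k Kh = a_kernel Kh K (\<lambda>a. a 0)"
proof -
  have "hbar_ideal k Kh = {digits (h \<otimes> x) | x. x \<in> carrier Q}"
    unfolding hbar_ideal_def Kh_carrier image_image by (auto simp: iota_hbar)
  also have "\<dots> = {digits x | x. x \<in> carrier Q \<and> red x = \<zero>\<^bsub>K\<^esub>}"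
    using red_kernel by (auto simp: red_h)
  also have "\<dots> = a_kernel Kh K (\<lambda>a. a 0)"
    by (auto simp: a_kernel_def' Kh_carrier digits_0)
  finally show ?thesis .
qed

text \<open>A coset of \<open>hbar_ideal k Kh\<close> consists of the sequences with one fixed entry
  at 0; \<open>the_elem\<close> extracts that entry.\<close>

definition head_iso :: "(nat \<Rightarrow> 'v) set \<Rightarrow> 'v" where "head_iso U = the_elem ((\<lambda>a. a 0) ` U)"

lemma reduction_digits:
  assumes x: "x \<in> carrier Q"
  shows "reduction k Kh head_iso (digits x) = red x"
proof -
  interpret H: ring_hom_ring Kh K "\<lambda>a. a 0" by (rule head_hom)
  show ?thesis
    unfolding reduction_def hbar_ideal_Kh head_iso_def
    using H.the_elem_simp[OF digits_in_Kh[OF x]] by (simp add: digits_0)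
qed

lemma quantization_Kh: "quantization k K Kh head_iso"
proof -
  interpret A: assoc_algebra k.PS Kh by (rule assoc_algebra_Kh)
  interpret H: ring_hom_ring Kh K "\<lambda>a. a 0" by (rule head_hom)
  interpret G: ring_hom_ring Q Kh digits by (rule digits_hom)
  show ?thesis
  proof unfold_locales
    show "topologically_free k Kh" by (rule top_free_Kh)
    have "(\<lambda>a. a 0) ` carrier Kh = carrier K"
      unfolding Kh_carrier image_image digits_0 by (rule red_surj)
    from H.FactRing_iso_set[OF this]
    show "head_iso \<in> ring_iso (Kh Quot hbar_ideal k Kh) K"
      unfolding hbar_ideal_Kh head_iso_def[abs_def] .
    show "reduction k Kh head_iso (const_series k c \<odot>\<^bsub>Kh\<^esub> a) = c \<odot>\<^bsub>K\<^esub> reduction k Kh head_iso a"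
      if c: "c \<in> carrier k" and a: "a \<in> carrier Kh" for c a
    proof -
      obtain x where x: "x \<in> carrier Q" "a = digits x" by (rule Kh_cases[OF a])
      have "const_series k c \<odot>\<^bsub>Kh\<^esub> a = digits (cst c \<otimes> x)"
        unfolding x(2) cst_def by (rule Kh_ops(3)[OF x(1) x(1)])
      moreover have "red (cst c \<otimes> x) = c \<odot>\<^bsub>K\<^esub> red x" by (rule red_cst[OF c x(1)])
      ultimately show ?thesis using c x(1) unfolding x(2) by (simp only: reduction_digits cst_closed m_closed)
    qed
    fix a b assume a: "a \<in> carrier Kh" and b: "b \<in> carrier Kh"
    obtain x where x: "x \<in> carrier Q" "a = digits x" by (rule Kh_cases[OF a])
    obtain y where y: "y \<in> carrier Q" "b = digits y" by (rule Kh_cases[OF b])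
    obtain e where e: "e \<in> carrier Q" "x \<otimes> y \<ominus> y \<otimes> x = h \<otimes> e" "red e = \<lbrace>red x, red y\<rbrace>\<^bsub>K\<^esub>"
      using commutator[OF x(1) y(1)] by (elim bexE conjE)
    have "a \<otimes>\<^bsub>Kh\<^esub> b \<ominus>\<^bsub>Kh\<^esub> b \<otimes>\<^bsub>Kh\<^esub> a = digits (x \<otimes> y \<ominus> y \<otimes> x)"
      unfolding a_minus_def x(2) y(2)
      by (simp only: Kh_ops[OF x(1) y(1)] Kh_ops[OF y(1) x(1)] G.hom_a_inv[symmetric, OF m_closed[OF y(1) x(1)]]
          Kh_ops(2)[OF m_closed[OF x(1) y(1)] a_inv_closed[OF m_closed[OF y(1) x(1)]]])
    also have "\<dots> = hbar k \<odot>\<^bsub>Kh\<^esub> digits e" by (simp only: e(2) Kh_ops(3)[OF e(1) e(1)] iota_hbar)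
    finally show "\<exists>c\<in>carrier Kh. a \<otimes>\<^bsub>Kh\<^esub> b \<ominus>\<^bsub>Kh\<^esub> b \<otimes>\<^bsub>Kh\<^esub> a = hbar k \<odot>\<^bsub>Kh\<^esub> c \<and>
        reduction k Kh head_iso c = \<lbrace>reduction k Kh head_iso a, reduction k Kh head_iso b\<rbrace>\<^bsub>K\<^esub>"
      unfolding x(2) y(2) reduction_digits[OF x(1)] reduction_digits[OF y(1)] e(3)[symmetric]
      using reduction_digits[OF e(1)] digits_in_Kh[OF e(1)] by (intro bexI[of _ "digits e"] conjI)
  qed
qed

end

theorem (in quantizing) quantization_exists:
  obtains Kh :: "(nat \<Rightarrow> 'k, nat \<Rightarrow> 'v) module" and \<phi> \<Phi> where
    "quantization k K Kh \<phi>" "\<Phi> \<in> ring_hom Q Kh" "\<And>x. x \<in> carrier Q \<Longrightarrow> reduction k Kh \<phi> (\<Phi> x) = red x"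
proof -
  obtain \<sigma> where \<sigma>: "\<And>v. v \<in> carrier K \<Longrightarrow> \<sigma> v \<in> carrier Q" "\<And>v. v \<in> carrier K \<Longrightarrow> red (\<sigma> v) = v"
    "\<And>v w. v \<in> carrier K \<Longrightarrow> w \<in> carrier K \<Longrightarrow> \<sigma> (v \<oplus>\<^bsub>K\<^esub> w) = \<sigma> v \<oplus> \<sigma> w"
    "\<And>c v. c \<in> carrier k \<Longrightarrow> v \<in> carrier K \<Longrightarrow> \<sigma> (c \<odot>\<^bsub>K\<^esub> v) = cst c \<otimes> \<sigma> v"
    by (rule section_exists) blast
  interpret quantizing_section Q K h red k \<iota> \<sigma>
    by unfold_locales (use \<sigma> in simp_all)
  show thesis
    using that[OF quantization_Kh ring_hom_ring.homh[OF digits_hom] reduction_digits] .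
qed

section \<open>Tensor powers\<close>

text \<open>The algebra is associative only, so that the same construction serves for
  \<open>A\<close> over \<open>k\<close> and for its quantization over
  \<open>k[[\<hbar>]]\<close>.\<close>

locale tensor = A?: assoc_algebra k A
  for k :: "('k, 'm) ring_scheme" and A :: "('k, 'a, 'z) poisson_scheme" (structure) +
  fixes n :: nat
begin

abbreviation F where "F \<equiv> tuple_algebra k A n"
abbreviation N where "N \<equiv> tensor_ideal k A n"
abbreviation T where "T \<equiv> tensor_power k A n"
abbreviation tup where "tup \<equiv> tuples A n"
abbreviation tmul (infixl \<open>\<star>\<close> 70) where "x \<star> y \<equiv> tuple_mult A n x y"

lemma tuples_closed [simp]: "x \<in> tup \<Longrightarrow> i \<in> {1..n} \<Longrightarrow> x i \<in> carrier A"
  by (auto simp: tuples_def)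

lemma tuple_mult_closed [simp]: "x \<in> tup \<Longrightarrow> y \<in> tup \<Longrightarrow> x \<star> y \<in> tup"
  by (auto simp: tuples_def tuple_mult_def)

lemma tuple_mult_assoc: "x \<in> tup \<Longrightarrow> y \<in> tup \<Longrightarrow> z \<in> tup \<Longrightarrow> x \<star> y \<star> z = x \<star> (y \<star> z)"
  by (auto simp: tuples_def tuple_mult_def B.m_assoc PiE_iff intro!: restrict_ext)

definition tone where "tone = (\<lambda>i\<in>{1..n}. \<one>)"

lemma tone [simp]: "tone \<in> tup" "x \<in> tup \<Longrightarrow> tone \<star> x = x" "x \<in> tup \<Longrightarrow> x \<star> tone = x"
  by (auto simp: tone_def tuples_def tuple_mult_def PiE_iff extensional_def fun_eq_iff)

lemma tuple_upd [simp]: "x \<in> tup \<Longrightarrow> i \<in> {1..n} \<Longrightarrow> a \<in> carrier A \<Longrightarrow> x(i := a) \<in> tup"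
  by (auto simp: tuples_def PiE_iff extensional_def)

lemma tuple_mult_upd:
  assumes "x \<in> tup" "i \<in> {1..n}"
  shows "x \<star> (y(i := a)) = (x \<star> y)(i := x i \<otimes> a)" "(y(i := a)) \<star> x = (y \<star> x)(i := a \<otimes> x i)"
  using assms by (auto simp: tuple_mult_def fun_eq_iff)

lemma F_simps:
  "carrier F = {p. range p \<subseteq> carrier k \<and> finite (supp k p) \<and> supp k p \<subseteq> tup}"
  "\<one>\<^bsub>F\<^esub> = single k tone" "\<zero>\<^bsub>F\<^esub> = (\<lambda>x. \<zero>\<^bsub>k\<^esub>)" "p \<oplus>\<^bsub>F\<^esub> q = (\<lambda>x. p x \<oplus>\<^bsub>k\<^esub> q x)"
  "c \<odot>\<^bsub>F\<^esub> p = (\<lambda>x. c \<otimes>\<^bsub>k\<^esub> p x)"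
  "p \<otimes>\<^bsub>F\<^esub> q = (\<lambda>z. \<Oplus>\<^bsub>k\<^esub>x\<in>supp k p. \<Oplus>\<^bsub>k\<^esub>y\<in>supp k q. if x \<star> y = z then p x \<otimes>\<^bsub>k\<^esub> q y else \<zero>\<^bsub>k\<^esub>)"
  by (simp_all add: tuple_algebra_def tone_def)

lemma F_at [simp]: "p \<in> carrier F \<Longrightarrow> p x \<in> carrier k"
  by (auto simp: F_simps)

lemma F_mem: "p \<in> carrier F \<longleftrightarrow> (\<forall>x. p x \<in> carrier k) \<and> finite {x. p x \<noteq> \<zero>\<^bsub>k\<^esub>} \<and> (\<forall>x. p x \<noteq> \<zero>\<^bsub>k\<^esub> \<longrightarrow> x \<in> tup)"
  by (auto simp: F_simps supp_def)

lemma finite_supp [simp]: "p \<in> carrier F \<Longrightarrow> finite (supp k p)"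
  and supp_tup: "p \<in> carrier F \<Longrightarrow> supp k p \<subseteq> tup"
  by (auto simp: F_simps)

lemma F_add_closed: "p \<in> carrier F \<Longrightarrow> q \<in> carrier F \<Longrightarrow> p \<oplus>\<^bsub>F\<^esub> q \<in> carrier F"
proof -
  assume p: "p \<in> carrier F" and q: "q \<in> carrier F"
  have s: "{x. p x \<oplus>\<^bsub>k\<^esub> q x \<noteq> \<zero>\<^bsub>k\<^esub>} \<subseteq> supp k p \<union> supp k q" by (auto simp: supp_def)
  have "finite {x. p x \<oplus>\<^bsub>k\<^esub> q x \<noteq> \<zero>\<^bsub>k\<^esub>}" by (rule finite_subset[OF s]) (use p q in simp)
  moreover have "supp k p \<union> supp k q \<subseteq> tup" using supp_tup[OF p] supp_tup[OF q] by simp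
  ultimately show ?thesis
    using p q s unfolding F_simps(4) F_mem[of "\<lambda>x. p x \<oplus>\<^bsub>k\<^esub> q x"] by auto
qed

lemma F_smult_closed: "c \<in> carrier k \<Longrightarrow> p \<in> carrier F \<Longrightarrow> c \<odot>\<^bsub>F\<^esub> p \<in> carrier F"
proof -
  assume c: "c \<in> carrier k" and p: "p \<in> carrier F"
  have s: "{x. c \<otimes>\<^bsub>k\<^esub> p x \<noteq> \<zero>\<^bsub>k\<^esub>} \<subseteq> supp k p" using c by (auto simp: supp_def)
  have "finite {x. c \<otimes>\<^bsub>k\<^esub> p x \<noteq> \<zero>\<^bsub>k\<^esub>}" by (rule finite_subset[OF s]) (use p in simp)
  then show ?thesis
    using c p s supp_tup[OF p] unfolding F_simps(5) F_mem[of "\<lambda>x. c \<otimes>\<^bsub>k\<^esub> p x"] by auto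
qed

lemma module_F: "module k F"
proof (rule moduleI)
  have z: "\<zero>\<^bsub>F\<^esub> \<in> carrier F" by (simp add: F_mem F_simps(3))
  show "abelian_group F"
  proof (rule abelian_groupI)
    fix p assume p: "p \<in> carrier F"
    have "(\<ominus>\<^bsub>k\<^esub> \<one>\<^bsub>k\<^esub>) \<odot>\<^bsub>F\<^esub> p \<oplus>\<^bsub>F\<^esub> p = \<zero>\<^bsub>F\<^esub>"
      using p by (simp add: F_simps(3-5) R.l_minus R.l_neg)
    then show "\<exists>q\<in>carrier F. q \<oplus>\<^bsub>F\<^esub> p = \<zero>\<^bsub>F\<^esub>" using F_smult_closed[OF _ p, of "\<ominus>\<^bsub>k\<^esub> \<one>\<^bsub>k\<^esub>"] by auto
    show "\<zero>\<^bsub>F\<^esub> \<oplus>\<^bsub>F\<^esub> p = p" using p by (simp add: F_simps(3,4))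
  qed (simp_all add: z F_add_closed, simp_all add: F_simps(4) R.a_ac)
qed (simp_all add: F_smult_closed R.is_cring, simp_all add: F_simps(4,5) R.l_distr R.r_distr R.m_assoc)

sublocale F: module k F by (rule module_F)

lemma single_closed [simp]: "x \<in> tup \<Longrightarrow> single k x \<in> carrier F"
  by (auto simp: F_mem single_def)

lemma F_finsum_at:
  "finite I \<Longrightarrow> f \<in> I \<rightarrow> carrier F \<Longrightarrow> (\<Oplus>\<^bsub>F\<^esub>i\<in>I. f i) z = (\<Oplus>\<^bsub>k\<^esub>i\<in>I. f i z)"
proof (induction I rule: finite_induct)
  case (insert i I)
  then have "f i \<in> carrier F" "f \<in> I \<rightarrow> carrier F" by auto
  then show ?case using insert by (simp add: F_simps(4) Pi_iff)
qed (simp add: F_simps(3))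

lemma F_induct [consumes 1, case_names zero add]:
  assumes p: "p \<in> carrier F" and zero: "P \<zero>\<^bsub>F\<^esub>"
    and add: "\<And>c x p. \<lbrakk>c \<in> carrier k; x \<in> tup; p \<in> carrier F; P p\<rbrakk> \<Longrightarrow> P (c \<odot>\<^bsub>F\<^esub> single k x \<oplus>\<^bsub>F\<^esub> p)"
  shows "P p"
proof -
  have "finite I \<Longrightarrow> p \<in> carrier F \<Longrightarrow> supp k p \<subseteq> I \<Longrightarrow> P p" for I p
  proof (induction I arbitrary: p rule: finite_induct)
    case empty
    then have "p = \<zero>\<^bsub>F\<^esub>" by (auto simp: F_simps(3) supp_def)
    then show ?case using zero by simp
  next
    case (insert x I)
    define q where "q = p(x := \<zero>\<^bsub>k\<^esub>)"
    have s: "{y. q y \<noteq> \<zero>\<^bsub>k\<^esub>} \<subseteq> supp k p" by (auto simp: q_def supp_def)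
    have "finite {y. q y \<noteq> \<zero>\<^bsub>k\<^esub>}" by (rule finite_subset[OF s]) (use insert.prems(1) in simp)
    then have q: "q \<in> carrier F"
      using insert.prems(1) unfolding F_mem by (auto simp: q_def)
    have "supp k q \<subseteq> I" using insert.prems(2) by (auto simp: q_def supp_def)
    then have Pq: "P q" using insert.IH q by blast
    show ?case
    proof (cases "x \<in> tup")
      case True
      have "p = p x \<odot>\<^bsub>F\<^esub> single k x \<oplus>\<^bsub>F\<^esub> q"
        using insert.prems(1) by (intro ext) (simp add: F_simps(4,5) q_def single_def)
      then show ?thesis using add[OF F_at[OF insert.prems(1)] True q Pq, of x] by simp
    next
      case False
      then have "p x = \<zero>\<^bsub>k\<^esub>" using insert.prems(1) by (auto simp: F_mem)
      then have "q = p" by (auto simp: q_def)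
      then show ?thesis using Pq by simp
    qed
  qed
  then show ?thesis using p finite_supp by blast
qed

text \<open>The linear extension to \<open>F\<close> of a function on tuples. Products and brackets
  in \<open>F\<close> are iterated extensions of functions of two tuples, and their bilinearity
  follows from the linearity of \<open>ext\<close>.\<close>

definition ext :: "('k, 'g, 'w) module_scheme \<Rightarrow> ((nat \<Rightarrow> 'a) \<Rightarrow> 'g) \<Rightarrow> ((nat \<Rightarrow> 'a) \<Rightarrow> 'k) \<Rightarrow> 'g" where
  "ext G g p = (\<Oplus>\<^bsub>G\<^esub>x\<in>supp k p. p x \<odot>\<^bsub>G\<^esub> g x)"

context
  fixes G :: "('k, 'g, 'w) module_scheme"
  assumes G: "module k G"
begin

interpretation G: module k G by (rule G)

lemma ext_superset:
  assumes g: "g \<in> tup \<rightarrow> carrier G" and p: "p \<in> carrier F" and I: "finite I" "supp k p \<subseteq> I" "I \<subseteq> tup"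
  shows "ext G g p = (\<Oplus>\<^bsub>G\<^esub>x\<in>I. p x \<odot>\<^bsub>G\<^esub> g x)"
  unfolding ext_def
proof (rule G.M.add.finprod_mono_neutral_cong_left[OF I(1,2)])
  show "p i \<odot>\<^bsub>G\<^esub> g i = \<zero>\<^bsub>G\<^esub>" if "i \<in> I - supp k p" for i
  proof -
    have "p i = \<zero>\<^bsub>k\<^esub>" "g i \<in> carrier G" using that I(3) g by (auto simp: supp_def)
    then show ?thesis by simp
  qed
  show "(\<lambda>x. p x \<odot>\<^bsub>G\<^esub> g x) \<in> I \<rightarrow> carrier G" using p g I(3) by (auto simp: Pi_iff)
qed simp

lemma ext_closed [simp]: "g \<in> tup \<rightarrow> carrier G \<Longrightarrow> p \<in> carrier F \<Longrightarrow> ext G g p \<in> carrier G"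
  unfolding ext_def using supp_tup[of p] by (intro G.M.finsum_closed) (auto simp: Pi_iff)

lemma ext_add:
  assumes g: "g \<in> tup \<rightarrow> carrier G" and p: "p \<in> carrier F" and q: "q \<in> carrier F"
  shows "ext G g (p \<oplus>\<^bsub>F\<^esub> q) = ext G g p \<oplus>\<^bsub>G\<^esub> ext G g q"
proof -
  define I where "I = supp k p \<union> supp k q"
  have I: "finite I" "I \<subseteq> tup" "supp k p \<subseteq> I" "supp k q \<subseteq> I"
    using supp_tup[OF p] supp_tup[OF q] p q by (auto simp: I_def)
  have "supp k (p \<oplus>\<^bsub>F\<^esub> q) \<subseteq> I" by (auto simp: I_def supp_def F_simps(4))
  then have "ext G g (p \<oplus>\<^bsub>F\<^esub> q) = (\<Oplus>\<^bsub>G\<^esub>x\<in>I. (p \<oplus>\<^bsub>F\<^esub> q) x \<odot>\<^bsub>G\<^esub> g x)"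
    using I g F_add_closed[OF p q] by (intro ext_superset) auto
  also have "\<dots> = (\<Oplus>\<^bsub>G\<^esub>x\<in>I. p x \<odot>\<^bsub>G\<^esub> g x \<oplus>\<^bsub>G\<^esub> q x \<odot>\<^bsub>G\<^esub> g x)"
    using I(2) g p q by (intro G.M.finsum_cong') (auto simp: F_simps(4) G.smult_l_distr Pi_iff)
  also have "\<dots> = ext G g p \<oplus>\<^bsub>G\<^esub> ext G g q"
    using I g p q unfolding ext_superset[OF g p I(1,3,2)] ext_superset[OF g q I(1,4,2)]
    by (intro G.M.finsum_addf) (auto simp: Pi_iff)
  finally show ?thesis .
qed

lemma ext_smult:
  assumes g: "g \<in> tup \<rightarrow> carrier G" and c: "c \<in> carrier k" and p: "p \<in> carrier F"
  shows "ext G g (c \<odot>\<^bsub>F\<^esub> p) = c \<odot>\<^bsub>G\<^esub> ext G g p"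
proof -
  have s: "supp k (c \<odot>\<^bsub>F\<^esub> p) \<subseteq> supp k p" using c by (auto simp: supp_def F_simps(5))
  have "ext G g (c \<odot>\<^bsub>F\<^esub> p) = (\<Oplus>\<^bsub>G\<^esub>x\<in>supp k p. (c \<odot>\<^bsub>F\<^esub> p) x \<odot>\<^bsub>G\<^esub> g x)"
    by (rule ext_superset[OF g F_smult_closed[OF c p] finite_supp[OF p] s supp_tup[OF p]])
  also have "\<dots> = (\<Oplus>\<^bsub>G\<^esub>x\<in>supp k p. c \<odot>\<^bsub>G\<^esub> (p x \<odot>\<^bsub>G\<^esub> g x))"
    using supp_tup[OF p] g c p by (intro G.M.finsum_cong') (auto simp: F_simps(5) G.smult_assoc1 Pi_iff)
  also have "\<dots> = c \<odot>\<^bsub>G\<^esub> ext G g p"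
    unfolding ext_def using supp_tup[OF p] g c p
    by (intro G.finsum_smult_ldistr[symmetric]) (auto simp: Pi_iff)
  finally show ?thesis .
qed

lemma ext_zero [simp]: "ext G g \<zero>\<^bsub>F\<^esub> = \<zero>\<^bsub>G\<^esub>"
  by (simp add: ext_def supp_def F_simps(3))

lemma ext_single [simp]:
  assumes g: "g \<in> tup \<rightarrow> carrier G" and x: "x \<in> tup"
  shows "ext G g (single k x) = g x"
proof -
  have gx: "g x \<in> carrier G" using g x by auto
  have "ext G g (single k x) = (\<Oplus>\<^bsub>G\<^esub>y\<in>{x}. single k x y \<odot>\<^bsub>G\<^esub> g y)"
    using x g by (intro ext_superset[OF g single_closed[OF x]]) (auto simp: supp_def single_def)
  then show ?thesis using gx by (simp add: single_def)
qed

lemma ext_step: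
  assumes "g \<in> tup \<rightarrow> carrier G" "c \<in> carrier k" "x \<in> tup" "p \<in> carrier F"
  shows "ext G g (c \<odot>\<^bsub>F\<^esub> single k x \<oplus>\<^bsub>F\<^esub> p) = c \<odot>\<^bsub>G\<^esub> g x \<oplus>\<^bsub>G\<^esub> ext G g p"
  using assms by (simp add: ext_add ext_smult F_smult_closed)

lemma ext_fun_add:
  assumes g: "g \<in> tup \<rightarrow> carrier G" and g': "g' \<in> tup \<rightarrow> carrier G" and p: "p \<in> carrier F"
  shows "ext G (\<lambda>x. g x \<oplus>\<^bsub>G\<^esub> g' x) p = ext G g p \<oplus>\<^bsub>G\<^esub> ext G g' p"
  using p
proof (induction rule: F_induct)
  case (add c x p)
  have gx: "g x \<in> carrier G" "g' x \<in> carrier G" "(\<lambda>x. g x \<oplus>\<^bsub>G\<^esub> g' x) \<in> tup \<rightarrow> carrier G" using g g' add by auto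
  show ?case using add gx g g' by (simp add: ext_step G.smult_r_distr G.M.a_ac)
qed simp

lemma ext_fun_smult:
  assumes g: "g \<in> tup \<rightarrow> carrier G" and d: "d \<in> carrier k" and p: "p \<in> carrier F"
  shows "ext G (\<lambda>x. d \<odot>\<^bsub>G\<^esub> g x) p = d \<odot>\<^bsub>G\<^esub> ext G g p"
  using p
proof (induction rule: F_induct)
  case (add c x p)
  have gx: "g x \<in> carrier G" "(\<lambda>x. d \<odot>\<^bsub>G\<^esub> g x) \<in> tup \<rightarrow> carrier G" using g d add by auto
  show ?case using add gx g d by (simp add: ext_step G.smult_r_distr G.smult_assoc1[symmetric] R.m_comm)
qed (use d in simp)

lemma ext_fun_cong:
  assumes "g \<in> tup \<rightarrow> carrier G" "\<And>x. x \<in> tup \<Longrightarrow> g x = g' x" "p \<in> carrier F"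
  shows "ext G g p = ext G g' p"
  unfolding ext_def using assms supp_tup[OF assms(3)]
  by (intro G.M.finsum_cong') (auto simp: Pi_iff subset_iff)

end

text \<open>Both sides are double sums over the supports. Written as an iterated \<open>ext\<close>,
  the product is visibly bilinear, and the ring laws reduce to tuples by
  \<open>F_induct\<close>.\<close>

lemma F_mult_ext:
  assumes p: "p \<in> carrier F" and q: "q \<in> carrier F"
  shows "p \<otimes>\<^bsub>F\<^esub> q = ext F (\<lambda>x. ext F (\<lambda>y. single k (x \<star> y)) q) p"
proof
  fix z
  have in1: "(\<lambda>y. single k (x \<star> y)) \<in> tup \<rightarrow> carrier F" if "x \<in> tup" for x using that by simp
  have at: "ext F g r z = (\<Oplus>\<^bsub>k\<^esub>x\<in>supp k r. r x \<otimes>\<^bsub>k\<^esub> g x z)" if "g \<in> tup \<rightarrow> carrier F" "r \<in> carrier F" for g r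
    unfolding ext_def using that supp_tup[OF that(2)]
    by (subst F_finsum_at) (auto simp: F_simps(5) Pi_iff intro!: F_smult_closed[unfolded F_simps(5)])
  have "ext F (\<lambda>x. ext F (\<lambda>y. single k (x \<star> y)) q) p z
      = (\<Oplus>\<^bsub>k\<^esub>x\<in>supp k p. p x \<otimes>\<^bsub>k\<^esub> ext F (\<lambda>y. single k (x \<star> y)) q z)"
    using p q ext_closed[OF module_F in1 q] by (intro at) auto
  also have "\<dots> = (\<Oplus>\<^bsub>k\<^esub>x\<in>supp k p. \<Oplus>\<^bsub>k\<^esub>y\<in>supp k q. if x \<star> y = z then p x \<otimes>\<^bsub>k\<^esub> q y else \<zero>\<^bsub>k\<^esub>)"
  proof (rule R.finsum_cong')
    fix x assume "x \<in> supp k p"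
    then have x: "x \<in> tup" using supp_tup[OF p] by auto
    have "p x \<otimes>\<^bsub>k\<^esub> ext F (\<lambda>y. single k (x \<star> y)) q z
        = (\<Oplus>\<^bsub>k\<^esub>y\<in>supp k q. p x \<otimes>\<^bsub>k\<^esub> (q y \<otimes>\<^bsub>k\<^esub> single k (x \<star> y) z))"
      unfolding at[OF in1[OF x] q] using p q by (intro R.finsum_rdistr) (auto simp: single_def)
    also have "\<dots> = (\<Oplus>\<^bsub>k\<^esub>y\<in>supp k q. if x \<star> y = z then p x \<otimes>\<^bsub>k\<^esub> q y else \<zero>\<^bsub>k\<^esub>)"
      using p q by (intro R.finsum_cong') (auto simp: single_def)
    finally show "p x \<otimes>\<^bsub>k\<^esub> ext F (\<lambda>y. single k (x \<star> y)) q z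
      = (\<Oplus>\<^bsub>k\<^esub>y\<in>supp k q. if x \<star> y = z then p x \<otimes>\<^bsub>k\<^esub> q y else \<zero>\<^bsub>k\<^esub>)" .
  qed (use p q in \<open>auto intro!: R.finsum_closed\<close>)
  finally show "(p \<otimes>\<^bsub>F\<^esub> q) z = ext F (\<lambda>x. ext F (\<lambda>y. single k (x \<star> y)) q) p z"
    by (simp add: F_simps(6))
qed

lemma mult_in1: "x \<in> tup \<Longrightarrow> (\<lambda>y. single k (x \<star> y)) \<in> tup \<rightarrow> carrier F" by simp

lemma mult_in2: "q \<in> carrier F \<Longrightarrow> (\<lambda>x. ext F (\<lambda>y. single k (x \<star> y)) q) \<in> tup \<rightarrow> carrier F"
  using ext_closed[OF module_F mult_in1] by auto

lemma F_mult_closed [simp]: "p \<in> carrier F \<Longrightarrow> q \<in> carrier F \<Longrightarrow> p \<otimes>\<^bsub>F\<^esub> q \<in> carrier F"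
  by (simp add: F_mult_ext ext_closed[OF module_F mult_in2])

lemma F_l_distr: "p \<in> carrier F \<Longrightarrow> p' \<in> carrier F \<Longrightarrow> q \<in> carrier F \<Longrightarrow>
    (p \<oplus>\<^bsub>F\<^esub> p') \<otimes>\<^bsub>F\<^esub> q = p \<otimes>\<^bsub>F\<^esub> q \<oplus>\<^bsub>F\<^esub> p' \<otimes>\<^bsub>F\<^esub> q"
  by (simp add: F_mult_ext F_add_closed ext_add[OF module_F mult_in2])

lemma F_l_smult: "c \<in> carrier k \<Longrightarrow> p \<in> carrier F \<Longrightarrow> q \<in> carrier F \<Longrightarrow>
    (c \<odot>\<^bsub>F\<^esub> p) \<otimes>\<^bsub>F\<^esub> q = c \<odot>\<^bsub>F\<^esub> (p \<otimes>\<^bsub>F\<^esub> q)"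
  by (simp add: F_mult_ext F_smult_closed ext_smult[OF module_F mult_in2])

lemma F_r_distr:
  assumes "p \<in> carrier F" "q \<in> carrier F" "q' \<in> carrier F"
  shows "p \<otimes>\<^bsub>F\<^esub> (q \<oplus>\<^bsub>F\<^esub> q') = p \<otimes>\<^bsub>F\<^esub> q \<oplus>\<^bsub>F\<^esub> p \<otimes>\<^bsub>F\<^esub> q'"
proof -
  have "ext F (\<lambda>x. ext F (\<lambda>y. single k (x \<star> y)) (q \<oplus>\<^bsub>F\<^esub> q')) p
      = ext F (\<lambda>x. ext F (\<lambda>y. single k (x \<star> y)) q \<oplus>\<^bsub>F\<^esub> ext F (\<lambda>y. single k (x \<star> y)) q') p"
    using assms F_add_closed by (intro ext_fun_cong[OF module_F mult_in2] ext_add[OF module_F mult_in1])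
  then show ?thesis
    using assms by (simp add: F_mult_ext F_add_closed ext_fun_add[OF module_F mult_in2 mult_in2])
qed

lemma F_r_smult:
  assumes "c \<in> carrier k" "p \<in> carrier F" "q \<in> carrier F"
  shows "p \<otimes>\<^bsub>F\<^esub> (c \<odot>\<^bsub>F\<^esub> q) = c \<odot>\<^bsub>F\<^esub> (p \<otimes>\<^bsub>F\<^esub> q)"
proof -
  have "ext F (\<lambda>x. ext F (\<lambda>y. single k (x \<star> y)) (c \<odot>\<^bsub>F\<^esub> q)) p
      = ext F (\<lambda>x. c \<odot>\<^bsub>F\<^esub> ext F (\<lambda>y. single k (x \<star> y)) q) p"
    using assms F_smult_closed by (intro ext_fun_cong[OF module_F mult_in2] ext_smult[OF module_F mult_in1])
  then show ?thesis
    using assms by (simp add: F_mult_ext F_smult_closed ext_fun_smult[OF module_F mult_in2])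
qed

lemma single_mult: "x \<in> tup \<Longrightarrow> y \<in> tup \<Longrightarrow> single k x \<otimes>\<^bsub>F\<^esub> single k y = single k (x \<star> y)"
  by (simp add: F_mult_ext ext_single[OF module_F mult_in2] ext_single[OF module_F mult_in1])

lemma F_zero_mult: "q \<in> carrier F \<Longrightarrow> \<zero>\<^bsub>F\<^esub> \<otimes>\<^bsub>F\<^esub> q = \<zero>\<^bsub>F\<^esub>" "p \<in> carrier F \<Longrightarrow> p \<otimes>\<^bsub>F\<^esub> \<zero>\<^bsub>F\<^esub> = \<zero>\<^bsub>F\<^esub>"
proof -
  show "\<zero>\<^bsub>F\<^esub> \<otimes>\<^bsub>F\<^esub> q = \<zero>\<^bsub>F\<^esub>" if "q \<in> carrier F"
    using that by (simp add: F_mult_ext ext_zero[OF module_F])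
  show "p \<otimes>\<^bsub>F\<^esub> \<zero>\<^bsub>F\<^esub> = \<zero>\<^bsub>F\<^esub>" if p: "p \<in> carrier F"
    using F_r_smult[OF R.zero_closed p, of "\<zero>\<^bsub>F\<^esub>"] p by simp
qed

lemmas F_bilinear = F_l_distr F_r_distr F_l_smult F_r_smult F_zero_mult F_smult_closed F_add_closed

lemma F_assoc:
  assumes p: "p \<in> carrier F" and q: "q \<in> carrier F" and r: "r \<in> carrier F"
  shows "p \<otimes>\<^bsub>F\<^esub> q \<otimes>\<^bsub>F\<^esub> r = p \<otimes>\<^bsub>F\<^esub> (q \<otimes>\<^bsub>F\<^esub> r)"
proof -
  have 1: "single k x \<otimes>\<^bsub>F\<^esub> single k y \<otimes>\<^bsub>F\<^esub> r = single k x \<otimes>\<^bsub>F\<^esub> (single k y \<otimes>\<^bsub>F\<^esub> r)"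
    if "x \<in> tup" "y \<in> tup" for x y
    using r by (induction rule: F_induct) (use that in \<open>simp_all add: F_bilinear single_mult tuple_mult_assoc\<close>)
  have 2: "single k x \<otimes>\<^bsub>F\<^esub> q \<otimes>\<^bsub>F\<^esub> r = single k x \<otimes>\<^bsub>F\<^esub> (q \<otimes>\<^bsub>F\<^esub> r)" if "x \<in> tup" for x
    using q by (induction rule: F_induct) (use that r 1 in \<open>simp_all add: F_bilinear\<close>)
  show ?thesis
    using p by (induction rule: F_induct) (use q r 2 in \<open>simp_all add: F_bilinear\<close>)
qed

lemma ring_F: "ring F"
proof (rule ringI[OF F.abelian_group_axioms monoidI])
  show "\<one>\<^bsub>F\<^esub> \<otimes>\<^bsub>F\<^esub> p = p" if p: "p \<in> carrier F" for p
    using p by (induction rule: F_induct) (simp_all add: F_bilinear F_simps(2) single_mult)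
  show "p \<otimes>\<^bsub>F\<^esub> \<one>\<^bsub>F\<^esub> = p" if p: "p \<in> carrier F" for p
    using p by (induction rule: F_induct) (simp_all add: F_bilinear F_simps(2) single_mult)
qed (simp_all add: F_assoc F_bilinear, simp add: F_simps(2))

end

section \<open>The tensor power as a quotient and its universal property\<close>

context tensor
begin

lemma F_minus_mem: "p \<in> carrier F \<Longrightarrow> q \<in> carrier F \<Longrightarrow> p \<ominus>\<^bsub>F\<^esub> q \<in> carrier F"
  by (rule F.M.minus_closed)

lemma multilinear_relations_F: "multilinear_relations k A n \<subseteq> carrier F"
  unfolding multilinear_relations_def Let_def
  by (auto intro!: F_minus_mem F_add_closed F_smult_closed single_closed tuple_upd)

lemma ideal_N: "ideal N F"
  unfolding tensor_ideal_def by (rule ring.genideal_ideal[OF ring_F multilinear_relations_F])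

sublocale I: ideal N F by (rule ideal_N)

text \<open>Multiplying by \<open>c\<close> amounts to multiplying by the element
  \<open>c \<odot> 1\<close> of \<open>F\<close>, so an ideal is a submodule.\<close>

lemma N_smult:
  assumes c: "c \<in> carrier k" and p: "p \<in> N"
  shows "c \<odot>\<^bsub>F\<^esub> p \<in> N"
proof -
  have pF: "p \<in> carrier F" using p by (rule I.Icarr)
  have "c \<odot>\<^bsub>F\<^esub> p = (c \<odot>\<^bsub>F\<^esub> \<one>\<^bsub>F\<^esub>) \<otimes>\<^bsub>F\<^esub> p"
    using c pF by (simp add: F_l_smult I.one_closed I.l_one)
  then show ?thesis using I.I_l_closed[OF p] c by (simp add: F_smult_closed I.one_closed)
qed

definition \<pi> where "\<pi> p = N +>\<^bsub>F\<^esub> p"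

lemma T_simps:
  "carrier T = carrier (F Quot N)" "monoid.mult T = monoid.mult (F Quot N)" "\<one>\<^bsub>T\<^esub> = \<one>\<^bsub>F Quot N\<^esub>"
  "\<zero>\<^bsub>T\<^esub> = \<zero>\<^bsub>F Quot N\<^esub>" "add T = add (F Quot N)"
  by (simp_all add: tensor_power_def Let_def)

lemma ring_T: "ring T"
proof -
  have "id \<in> ring_iso (F Quot N) T"
    by (rule ring_iso_memI) (auto simp: T_simps)
  from ring.ring_iso_imp_img_ring[OF I.quotient_is_ring this]
  show ?thesis by (simp add: T_simps(4)[symmetric])
qed

lemma pi_hom: "\<pi> \<in> ring_hom F T"
  using I.rcos_ring_hom unfolding ring_hom_def by (auto simp: T_simps \<pi>_def[abs_def])

lemma pi_closed [simp]: "p \<in> carrier F \<Longrightarrow> \<pi> p \<in> carrier T"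
  by (rule ring_hom_closed[OF pi_hom])

lemma T_cases:
  assumes "U \<in> carrier T"
  obtains p where "p \<in> carrier F" "U = \<pi> p"
proof -
  have "\<exists>p\<in>carrier F. U = \<pi> p"
    using assms by (simp add: T_simps FactRing_def A_RCOSETS_def' \<pi>_def)
  then show thesis using that by (elim bexE)
qed

lemma pi_eq_iff:
  assumes "p \<in> carrier F" "q \<in> carrier F"
  shows "\<pi> p = \<pi> q \<longleftrightarrow> p \<ominus>\<^bsub>F\<^esub> q \<in> N"
  unfolding \<pi>_def using I.quotient_eq_iff_same_a_r_cos[OF ideal_N assms] by simp

lemma pi_mem:
  assumes "p' \<in> \<pi> p" "p \<in> carrier F"
  shows "p' \<in> carrier F" "\<pi> p' = \<pi> p"
proof -
  obtain r where r: "r \<in> N" "p' = r \<oplus>\<^bsub>F\<^esub> p" using assms(1) unfolding \<pi>_def a_r_coset_def' by auto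
  have rF: "r \<in> carrier F" using r(1) by (rule I.Icarr)
  show p': "p' \<in> carrier F" unfolding r(2) using rF assms(2) by (rule F_add_closed)
  have "p' \<ominus>\<^bsub>F\<^esub> p = r"
    unfolding r(2) using rF assms(2) by (simp add: a_minus_def F.M.a_assoc F.M.r_neg)
  then show "\<pi> p' = \<pi> p" using pi_eq_iff[OF p' assms(2)] r(1) by simp
qed

lemma pi_self: "p \<in> carrier F \<Longrightarrow> p \<in> \<pi> p"
  unfolding \<pi>_def by (rule I.a_rcos_self)

lemma T_smult: 
  assumes c: "c \<in> carrier k" and p: "p \<in> carrier F"
  shows "c \<odot>\<^bsub>T\<^esub> \<pi> p = \<pi> (c \<odot>\<^bsub>F\<^esub> p)"
proof -
  have "\<pi> (c \<odot>\<^bsub>F\<^esub> p') = \<pi> (c \<odot>\<^bsub>F\<^esub> p)" if "p' \<in> \<pi> p" for p'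
  proof -
    note p' = pi_mem[OF that p]
    have "c \<odot>\<^bsub>F\<^esub> p' \<ominus>\<^bsub>F\<^esub> c \<odot>\<^bsub>F\<^esub> p = c \<odot>\<^bsub>F\<^esub> (p' \<ominus>\<^bsub>F\<^esub> p)"
      using c p p' by (simp add: a_minus_def F.smult_r_distr F.smult_r_minus)
    then have "c \<odot>\<^bsub>F\<^esub> p' \<ominus>\<^bsub>F\<^esub> c \<odot>\<^bsub>F\<^esub> p \<in> N"
      using N_smult[OF c] pi_eq_iff[OF p'(1) p] p'(2) by simp
    then show ?thesis using pi_eq_iff[of "c \<odot>\<^bsub>F\<^esub> p'" "c \<odot>\<^bsub>F\<^esub> p"] c p p'(1) by (simp add: F_smult_closed)
  qed
  then have "(\<Union>p'\<in>\<pi> p. \<pi> (c \<odot>\<^bsub>F\<^esub> p')) = (\<Union>p'\<in>\<pi> p. \<pi> (c \<odot>\<^bsub>F\<^esub> p))" by simp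
  then show ?thesis using pi_self[OF p] by (auto simp: tensor_power_def Let_def \<pi>_def[symmetric])
qed

lemma assoc_algebra_T: "assoc_algebra k T"
proof -
  interpret T: ring T by (rule ring_T)
  note h = ring_hom_add[OF pi_hom, symmetric] ring_hom_mult[OF pi_hom, symmetric]
  have "module k T"
  proof (rule moduleI)
    fix c d U V assume c: "c \<in> carrier k" and d: "d \<in> carrier k" and U: "U \<in> carrier T" and V: "V \<in> carrier T"
    obtain p where p: "p \<in> carrier F" "U = \<pi> p" by (rule T_cases[OF U])
    obtain q where q: "q \<in> carrier F" "V = \<pi> q" by (rule T_cases[OF V])
    show "c \<odot>\<^bsub>T\<^esub> U \<in> carrier T" using c p by (simp add: T_smult)
    show "(c \<oplus>\<^bsub>k\<^esub> d) \<odot>\<^bsub>T\<^esub> U = c \<odot>\<^bsub>T\<^esub> U \<oplus>\<^bsub>T\<^esub> d \<odot>\<^bsub>T\<^esub> U"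
      using c d p by (simp add: T_smult h F.smult_l_distr)
    show "c \<odot>\<^bsub>T\<^esub> (U \<oplus>\<^bsub>T\<^esub> V) = c \<odot>\<^bsub>T\<^esub> U \<oplus>\<^bsub>T\<^esub> c \<odot>\<^bsub>T\<^esub> V"
      using c p q by (simp add: T_smult h F.smult_r_distr)
    show "(c \<otimes>\<^bsub>k\<^esub> d) \<odot>\<^bsub>T\<^esub> U = c \<odot>\<^bsub>T\<^esub> (d \<odot>\<^bsub>T\<^esub> U)"
      using c d p by (simp add: T_smult F.smult_assoc1)
  next
    show "\<one>\<^bsub>k\<^esub> \<odot>\<^bsub>T\<^esub> U = U" if "U \<in> carrier T" for U
      by (rule T_cases[OF that]) (simp add: T_smult)
  qed (use R.is_cring T.is_abelian_group in simp_all)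
  then show ?thesis
  proof (rule assoc_algebra.intro[OF _ ring_T], unfold_locales)
    fix c U V assume c: "c \<in> carrier k" and U: "U \<in> carrier T" and V: "V \<in> carrier T"
    obtain p where p: "p \<in> carrier F" "U = \<pi> p" by (rule T_cases[OF U])
    obtain q where q: "q \<in> carrier F" "V = \<pi> q" by (rule T_cases[OF V])
    show "c \<odot>\<^bsub>T\<^esub> U \<otimes>\<^bsub>T\<^esub> V = c \<odot>\<^bsub>T\<^esub> (U \<otimes>\<^bsub>T\<^esub> V)" "U \<otimes>\<^bsub>T\<^esub> (c \<odot>\<^bsub>T\<^esub> V) = c \<odot>\<^bsub>T\<^esub> (U \<otimes>\<^bsub>T\<^esub> V)"
      using c p q by (simp_all add: T_smult h F_l_smult F_r_smult)
  qed
qed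

sublocale T: assoc_algebra k T by (rule assoc_algebra_T)

definition pt where "pt x = \<pi> (single k x)"

lemma pt_closed [simp]: "x \<in> tup \<Longrightarrow> pt x \<in> carrier T"
  by (simp add: pt_def)

lemma pt_mult: "x \<in> tup \<Longrightarrow> y \<in> tup \<Longrightarrow> pt x \<otimes>\<^bsub>T\<^esub> pt y = pt (x \<star> y)"
  by (simp add: pt_def ring_hom_mult[OF pi_hom, symmetric] single_mult)

lemma pt_one: "pt tone = \<one>\<^bsub>T\<^esub>"
  using ring_hom_one[OF pi_hom] by (simp add: pt_def F_simps(2))

lemma pure_tensor_pt: "pure_tensor k A n g = pt (restrict g {1..n})"
  by (simp add: pure_tensor_def pt_def \<pi>_def)

definition multilinear :: "('k, 'g, 'w) module_scheme \<Rightarrow> ((nat \<Rightarrow> 'a) \<Rightarrow> 'g) \<Rightarrow> bool" where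
  "multilinear G g \<longleftrightarrow> g \<in> tup \<rightarrow> carrier G \<and>
    (\<forall>x\<in>tup. \<forall>i\<in>{1..n}. \<forall>a\<in>carrier A. \<forall>b\<in>carrier A. g (x(i := a \<oplus> b)) = g (x(i := a)) \<oplus>\<^bsub>G\<^esub> g (x(i := b))) \<and>
    (\<forall>x\<in>tup. \<forall>i\<in>{1..n}. \<forall>c\<in>carrier k. \<forall>a\<in>carrier A. g (x(i := c \<odot> a)) = c \<odot>\<^bsub>G\<^esub> g (x(i := a)))"

lemma multilinearD:
  assumes "multilinear G g"
  shows "g \<in> tup \<rightarrow> carrier G"
    "\<lbrakk>x \<in> tup; i \<in> {1..n}; a \<in> carrier A; b \<in> carrier A\<rbrakk> \<Longrightarrow> g (x(i := a \<oplus> b)) = g (x(i := a)) \<oplus>\<^bsub>G\<^esub> g (x(i := b))"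
    "\<lbrakk>x \<in> tup; i \<in> {1..n}; c \<in> carrier k; a \<in> carrier A\<rbrakk> \<Longrightarrow> g (x(i := c \<odot> a)) = c \<odot>\<^bsub>G\<^esub> g (x(i := a))"
  using assms unfolding multilinear_def by simp_all

lemma multilinear_mult_left:
  assumes g: "multilinear G g" and y: "y \<in> tup"
  shows "multilinear G (\<lambda>x. g (y \<star> x))"
  unfolding multilinear_def
  using y multilinearD[OF g]
  by (auto simp: tuple_mult_upd B.r_distr smult_mult_right Pi_iff)

lemma multilinear_mult_right:
  assumes g: "multilinear G g" and y: "y \<in> tup"
  shows "multilinear G (\<lambda>x. g (x \<star> y))"
  unfolding multilinear_def
  using y multilinearD[OF g]
  by (auto simp: tuple_mult_upd B.l_distr smult_mult_left Pi_iff)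

lemma pt_multilinear: "multilinear T pt"
  unfolding multilinear_def
proof (intro conjI ballI)
  show "pt \<in> tup \<rightarrow> carrier T" by simp
  fix x i a assume x: "x \<in> tup" and i: "i \<in> {1..n}" and a: "a \<in> carrier A"
  note s = single_closed[OF tuple_upd[OF x i]]
  note rel = ring.genideal_self[OF ring_F multilinear_relations_F, folded tensor_ideal_def]
  { fix b assume b: "b \<in> carrier A"
    have "single k (x(i := a \<oplus> b)) \<ominus>\<^bsub>F\<^esub> (single k (x(i := a)) \<oplus>\<^bsub>F\<^esub> single k (x(i := b))) \<in> multilinear_relations k A n"
      unfolding multilinear_relations_def Let_def using x i a b by blast
    then have "\<pi> (single k (x(i := a \<oplus> b))) = \<pi> (single k (x(i := a)) \<oplus>\<^bsub>F\<^esub> single k (x(i := b)))"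
      using s a b rel by (subst pi_eq_iff) (auto simp: F_add_closed)
    then show "pt (x(i := a \<oplus> b)) = pt (x(i := a)) \<oplus>\<^bsub>T\<^esub> pt (x(i := b))"
      unfolding pt_def using s a b by (simp add: ring_hom_add[OF pi_hom]) }
  fix c assume c: "c \<in> carrier k"
  have "single k (x(i := c \<odot> a)) \<ominus>\<^bsub>F\<^esub> c \<odot>\<^bsub>F\<^esub> single k (x(i := a)) \<in> multilinear_relations k A n"
    unfolding multilinear_relations_def Let_def using x i a c by blast
  then have "\<pi> (single k (x(i := c \<odot> a))) = \<pi> (c \<odot>\<^bsub>F\<^esub> single k (x(i := a)))"
    using s a c rel by (subst pi_eq_iff) (auto simp: F_smult_closed)
  then show "pt (x(i := c \<odot> a)) = c \<odot>\<^bsub>T\<^esub> pt (x(i := a))"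
    unfolding pt_def using s a c by (simp add: T_smult)
next
qed

text \<open>Since \<open>n\<close> is at least 1, a scalar can be absorbed into the first entry of a
  pure tensor; sums of pure tensors therefore exhaust \<open>T\<close>, and the induction needs no
  case for scalar multiples.\<close>

lemma T_induct [consumes 2, case_names zero pure add]:
  assumes n: "n \<ge> 1" and U: "U \<in> carrier T" and zero: "P \<zero>\<^bsub>T\<^esub>" and pure: "\<And>x. x \<in> tup \<Longrightarrow> P (pt x)"
    and add: "\<And>U V. \<lbrakk>U \<in> carrier T; V \<in> carrier T; P U; P V\<rbrakk> \<Longrightarrow> P (U \<oplus>\<^bsub>T\<^esub> V)"
  shows "P U"
proof -
  have "P (\<pi> p)" if "p \<in> carrier F" for p
    using that
  proof (induction rule: F_induct)
    case zero
    then show ?case using assms(3) ring_hom_zero[OF pi_hom ring_F ring_T] by simp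
  next
    case (add c x p)
    have 1: "(1::nat) \<in> {1..n}" using n by simp
    have "c \<odot>\<^bsub>T\<^esub> pt x = pt (x(1 := c \<odot> x 1))"
      using multilinearD(3)[OF pt_multilinear add(2) 1 add(1) tuples_closed[OF add(2) 1]] by simp
    then have "P (c \<odot>\<^bsub>T\<^esub> pt x)" using pure tuple_upd[OF add(2) 1] tuples_closed[OF add(2) 1] add(1) by simp
    then have "P (c \<odot>\<^bsub>T\<^esub> pt x \<oplus>\<^bsub>T\<^esub> \<pi> p)" using add by (intro assms(5)) simp_all
    moreover have "\<pi> (c \<odot>\<^bsub>F\<^esub> single k x \<oplus>\<^bsub>F\<^esub> p) = c \<odot>\<^bsub>T\<^esub> pt x \<oplus>\<^bsub>T\<^esub> \<pi> p"
      using add by (simp add: ring_hom_add[OF pi_hom] F_smult_closed pt_def T_smult)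
    ultimately show ?case by simp
  qed
  note * = this
  obtain p where "p \<in> carrier F" "U = \<pi> p" by (rule T_cases[OF U])
  then show ?thesis using * by simp
qed

text \<open>The elements annihilated by all multilinear maps at once form a two-sided ideal, because
  \<open>g (x \<star> y)\<close> is multilinear in \<open>y\<close> for fixed \<open>x\<close> and
  in \<open>x\<close> for fixed \<open>y\<close>. This ideal contains the relations, hence
  \<open>N\<close>. For one fixed \<open>g\<close> the annihilated elements need not form an
  ideal.\<close>

lemma ext_vanishes:
  assumes G: "module k G" and g: "multilinear G g" and p: "p \<in> N"
  shows "ext G g p = \<zero>\<^bsub>G\<^esub>"
proof -
  interpret G: module k G by (rule G)
  note in_G = multilinearD(1)
  note lin = ext_add[OF G] ext_smult[OF G] ext_step[OF G] ext_closed[OF G] ext_zero[OF G] ext_single[OF G]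
  define J where "J = {p \<in> carrier F. \<forall>g. multilinear G g \<longrightarrow> ext G g p = \<zero>\<^bsub>G\<^esub>}"
  have neg: "ext G g (p \<ominus>\<^bsub>F\<^esub> q) = ext G g p \<ominus>\<^bsub>G\<^esub> ext G g q"
    if "multilinear G g" "p \<in> carrier F" "q \<in> carrier F" for g p q
  proof -
    have "\<ominus>\<^bsub>F\<^esub> q = (\<ominus>\<^bsub>k\<^esub> \<one>\<^bsub>k\<^esub>) \<odot>\<^bsub>F\<^esub> q" using that by (simp add: F.smult_l_minus)
    then show ?thesis
      using that in_G[OF that(1)] by (simp add: a_minus_def lin F_smult_closed G.smult_l_minus)
  qed
  have mult1: "ext G g (single k x \<otimes>\<^bsub>F\<^esub> p) = ext G (\<lambda>y. g (x \<star> y)) p"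
    "ext G g (p \<otimes>\<^bsub>F\<^esub> single k x) = ext G (\<lambda>y. g (y \<star> x)) p"
    if g: "multilinear G g" and x: "x \<in> tup" and p: "p \<in> carrier F" for g x p
  proof -
    note i = in_G[OF g] in_G[OF multilinear_mult_left[OF g x]] in_G[OF multilinear_mult_right[OF g x]]
    show "ext G g (single k x \<otimes>\<^bsub>F\<^esub> p) = ext G (\<lambda>y. g (x \<star> y)) p"
      using p by (induction rule: F_induct) (use x i in \<open>simp_all add: F_bilinear single_mult lin\<close>)
    show "ext G g (p \<otimes>\<^bsub>F\<^esub> single k x) = ext G (\<lambda>y. g (y \<star> x)) p"
      using p by (induction rule: F_induct) (use x i in \<open>simp_all add: F_bilinear single_mult lin\<close>)
  qed
  have J: "p \<in> carrier F" "\<And>g. multilinear G g \<Longrightarrow> ext G g p = \<zero>\<^bsub>G\<^esub>" if "p \<in> J" for p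
    using that by (simp_all add: J_def)
  have "ideal J F"
  proof (rule idealI[OF ring_F])
    show "subgroup J (add_monoid F)"
    proof (rule F.M.add.subgroupI)
      show "J \<subseteq> carrier F" by (auto simp: J_def)
      show "J \<noteq> {}" using lin(5) by (auto simp: J_def intro!: exI[of _ "\<zero>\<^bsub>F\<^esub>"])
      fix p q assume p: "p \<in> J" and q: "q \<in> J"
      show "p \<oplus>\<^bsub>F\<^esub> q \<in> J" using J[OF p] J[OF q] by (simp add: J_def lin in_G F_add_closed)
      have "\<ominus>\<^bsub>F\<^esub> p = (\<ominus>\<^bsub>k\<^esub> \<one>\<^bsub>k\<^esub>) \<odot>\<^bsub>F\<^esub> p" using J(1)[OF p] by (simp add: F.smult_l_minus)
      then show "\<ominus>\<^bsub>F\<^esub> p \<in> J" using J[OF p] by (simp add: J_def lin in_G F_smult_closed)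
    qed
    fix p q assume p: "p \<in> J" and q: "q \<in> carrier F"
    have "ext G g (q \<otimes>\<^bsub>F\<^esub> p) = \<zero>\<^bsub>G\<^esub>" if g: "multilinear G g" for g
      using q
    proof (induction rule: F_induct)
      case (add c x q)
      have "ext G g (single k x \<otimes>\<^bsub>F\<^esub> p) = \<zero>\<^bsub>G\<^esub>"
        using mult1(1)[OF g add(2) J(1)[OF p]] J(2)[OF p multilinear_mult_left[OF g add(2)]] by simp
      then show ?case using add J(1)[OF p] by (simp add: F_bilinear lin in_G[OF g])
    qed (use J(1)[OF p] lin(5) in \<open>simp add: F_bilinear\<close>)
    then show "q \<otimes>\<^bsub>F\<^esub> p \<in> J" using q J(1)[OF p] by (simp add: J_def)
    have "ext G g (p \<otimes>\<^bsub>F\<^esub> q) = \<zero>\<^bsub>G\<^esub>" if g: "multilinear G g" for g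
      using q
    proof (induction rule: F_induct)
      case (add c x q)
      have "ext G g (p \<otimes>\<^bsub>F\<^esub> single k x) = \<zero>\<^bsub>G\<^esub>"
        using mult1(2)[OF g add(2) J(1)[OF p]] J(2)[OF p multilinear_mult_right[OF g add(2)]] by simp
      then show ?case using add J(1)[OF p] by (simp add: F_bilinear lin in_G[OF g])
    qed (use J(1)[OF p] lin(5) in \<open>simp add: F_bilinear\<close>)
    then show "p \<otimes>\<^bsub>F\<^esub> q \<in> J" using q J(1)[OF p] by (simp add: J_def)
  qed
  moreover have "multilinear_relations k A n \<subseteq> J"
  proof
    fix r assume r: "r \<in> multilinear_relations k A n"
    then have rF: "r \<in> carrier F" using multilinear_relations_F by blast
    have "ext G g r = \<zero>\<^bsub>G\<^esub>" if g: "multilinear G g" for g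
    proof -
      note gG = in_G[OF g]
      consider x i a b where "r = single k (x(i := a \<oplus> b)) \<ominus>\<^bsub>F\<^esub> (single k (x(i := a)) \<oplus>\<^bsub>F\<^esub> single k (x(i := b)))"
          "x \<in> tup" "i \<in> {1..n}" "a \<in> carrier A" "b \<in> carrier A"
        | x i c a where "r = single k (x(i := c \<odot> a)) \<ominus>\<^bsub>F\<^esub> c \<odot>\<^bsub>F\<^esub> single k (x(i := a))"
          "x \<in> tup" "i \<in> {1..n}" "c \<in> carrier k" "a \<in> carrier A"
        using r unfolding multilinear_relations_def Let_def by blast
      then show ?thesis
      proof cases
        case 1
        have u: "x(i := a) \<in> tup" "x(i := b) \<in> tup" "x(i := a \<oplus> b) \<in> tup" using 1 by simp_all
        then have gu: "g (x(i := a)) \<in> carrier G" "g (x(i := b)) \<in> carrier G" using gG by auto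
        show ?thesis
          unfolding 1(1) using u gu multilinearD(2)[OF g 1(2-5)]
          by (simp add: neg[OF g] lin gG F_add_closed del: fun_upd_apply)
            (simp add: a_minus_def G.M.r_neg)
      next
        case 2
        have u: "x(i := a) \<in> tup" "x(i := c \<odot> a) \<in> tup" using 2 by simp_all
        then have gu: "g (x(i := a)) \<in> carrier G" using gG by auto
        show ?thesis
          unfolding 2(1) using u gu 2(4) multilinearD(3)[OF g 2(2-5)]
          by (simp add: neg[OF g] lin gG F_smult_closed del: fun_upd_apply)
            (simp add: a_minus_def G.M.r_neg)
      qed
    qed
    then show "r \<in> J" using rF by (simp add: J_def)
  qed
  ultimately have "N \<subseteq> J" unfolding tensor_ideal_def by (rule ring.genideal_minimal[OF ring_F])
  then show ?thesis using p g by (auto simp: J_def)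
qed

text \<open>Any representative in \<open>F\<close> may be used to define the map, since
  \<open>ext G g\<close> vanishes on \<open>N\<close>. The target \<open>G\<close> is an arbitrary
  module; later it is a ring with scalars acting through a homomorphism.\<close>

lemma universal:
  assumes G: "module k G" and g: "multilinear G g"
  obtains \<Lambda> where "\<And>U. U \<in> carrier T \<Longrightarrow> \<Lambda> U \<in> carrier G"
    "\<And>U V. U \<in> carrier T \<Longrightarrow> V \<in> carrier T \<Longrightarrow> \<Lambda> (U \<oplus>\<^bsub>T\<^esub> V) = \<Lambda> U \<oplus>\<^bsub>G\<^esub> \<Lambda> V"
    "\<And>c U. c \<in> carrier k \<Longrightarrow> U \<in> carrier T \<Longrightarrow> \<Lambda> (c \<odot>\<^bsub>T\<^esub> U) = c \<odot>\<^bsub>G\<^esub> \<Lambda> U"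
    "\<And>x. x \<in> tup \<Longrightarrow> \<Lambda> (pt x) = g x"
    "\<And>p. p \<in> carrier F \<Longrightarrow> \<Lambda> (\<pi> p) = ext G g p"
proof -
  interpret G: module k G by (rule G)
  note gG = multilinearD(1)[OF g]
  note lin = ext_add[OF G gG] ext_smult[OF G gG] ext_closed[OF G gG] ext_single[OF G gG]
  define \<Lambda> where "\<Lambda> U = ext G g (SOME p. p \<in> carrier F \<and> U = \<pi> p)" for U
  have pi: "\<Lambda> (\<pi> p) = ext G g p" if p: "p \<in> carrier F" for p
  proof -
    define q where "q = (SOME q. q \<in> carrier F \<and> \<pi> p = \<pi> q)"
    have q: "q \<in> carrier F" "\<pi> p = \<pi> q"
      using someI[of "\<lambda>q. q \<in> carrier F \<and> \<pi> p = \<pi> q" p] p by (simp_all add: q_def)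
    then have "p \<ominus>\<^bsub>F\<^esub> q \<in> N" using pi_eq_iff p by blast
    then have "ext G g (p \<ominus>\<^bsub>F\<^esub> q) = \<zero>\<^bsub>G\<^esub>" by (rule ext_vanishes[OF G g])
    moreover have "p = (p \<ominus>\<^bsub>F\<^esub> q) \<oplus>\<^bsub>F\<^esub> q" using p q by (simp add: a_minus_def F.M.a_assoc F.M.l_neg)
    ultimately have "ext G g p = ext G g q"
      using lin(1)[of "p \<ominus>\<^bsub>F\<^esub> q" q] lin(3)[OF q(1)] F_minus_mem[OF p q(1)] q(1) by simp
    then show ?thesis by (simp add: \<Lambda>_def q_def)
  qed
  show thesis
  proof (rule that)
    fix U assume U: "U \<in> carrier T"
    obtain p where p: "p \<in> carrier F" "U = \<pi> p" by (rule T_cases[OF U])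
    show "\<Lambda> U \<in> carrier G" using p pi lin(3) by simp
    show "\<Lambda> (c \<odot>\<^bsub>T\<^esub> U) = c \<odot>\<^bsub>G\<^esub> \<Lambda> U" if "c \<in> carrier k" for c
      using p that by (simp add: T_smult pi F_smult_closed lin(2))
    fix V assume V: "V \<in> carrier T"
    obtain q where q: "q \<in> carrier F" "V = \<pi> q" by (rule T_cases[OF V])
    show "\<Lambda> (U \<oplus>\<^bsub>T\<^esub> V) = \<Lambda> U \<oplus>\<^bsub>G\<^esub> \<Lambda> V"
      using p q by (simp add: ring_hom_add[OF pi_hom, symmetric] pi F_add_closed lin(1))
  next
    show "\<Lambda> (pt x) = g x" if "x \<in> tup" for x using that by (simp add: pt_def pi lin(4))
  qed (rule pi)
qed

end

section \<open>Elements placed in one tensor factor\<close>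

context tensor
begin

definition slot :: "nat \<Rightarrow> 'a \<Rightarrow> ((nat \<Rightarrow> 'a) \<Rightarrow> 'k) set" where "slot i a = pt (tone(i := a))"

lemma slot_closed [simp]: "i \<in> {1..n} \<Longrightarrow> a \<in> carrier A \<Longrightarrow> slot i a \<in> carrier T"
  by (simp add: slot_def)

lemma slot_add: "i \<in> {1..n} \<Longrightarrow> a \<in> carrier A \<Longrightarrow> b \<in> carrier A \<Longrightarrow> slot i (a \<oplus> b) = slot i a \<oplus>\<^bsub>T\<^esub> slot i b"
  unfolding slot_def by (rule multilinearD(2)[OF pt_multilinear tone(1)])

lemma slot_smult: "i \<in> {1..n} \<Longrightarrow> c \<in> carrier k \<Longrightarrow> a \<in> carrier A \<Longrightarrow> slot i (c \<odot> a) = c \<odot>\<^bsub>T\<^esub> slot i a"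
  unfolding slot_def by (rule multilinearD(3)[OF pt_multilinear tone(1)])

lemma slot_commute:
  assumes "i \<in> {1..n}" "j \<in> {1..n}" "i \<noteq> j" "a \<in> carrier A" "b \<in> carrier A"
  shows "slot i a \<otimes>\<^bsub>T\<^esub> slot j b = slot j b \<otimes>\<^bsub>T\<^esub> slot i a"
proof -
  have "tone(i := a) \<star> tone(j := b) = tone(j := b) \<star> tone(i := a)"
    using assms by (auto simp: tuple_mult_def tone_def fun_eq_iff)
  then show ?thesis using assms by (simp add: slot_def pt_mult)
qed

lemma slot_linear_finsum:
  assumes i: "i \<in> {1..n}" and "finite I" "f \<in> I \<rightarrow> carrier A"
  shows "slot i (\<Oplus>l\<in>I. f l) = (\<Oplus>\<^bsub>T\<^esub>l\<in>I. slot i (f l))"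
  using assms(2,3)
proof (induction I rule: finite_induct)
  case empty
  have "slot i \<zero> = \<zero>\<^bsub>k\<^esub> \<odot>\<^bsub>T\<^esub> slot i \<zero>"
    using slot_smult[OF i R.zero_closed M.zero_closed] i by simp
  then show ?case using i by simp
next
  case (insert l I)
  then have "f l \<in> carrier A" "f \<in> I \<rightarrow> carrier A" by auto
  then show ?case using insert i by (simp add: slot_add Pi_iff)
qed

lemma pt_eq_finprod:
  assumes cr: "cring T" and x: "x \<in> tup"
  shows "pt x = (\<Otimes>\<^bsub>T\<^esub>i\<in>{1..n}. slot i (x i))"
proof -
  interpret C: cring T by (rule cr)
  \<comment> \<open>The entries are put in place one at a time; \<open>J\<close> is the set of
    places already filled, and the others hold 1.\<close>
  have *: "(\<Otimes>\<^bsub>T\<^esub>i\<in>J. slot i (x i)) = pt (\<lambda>i\<in>{1..n}. if i \<in> J then x i else \<one>)"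
    if "finite J" "J \<subseteq> {1..n}" for J
    using that
  proof (induction J rule: finite_induct)
    case empty
    then show ?case using pt_one by (simp add: tone_def restrict_def)
  next
    case (insert j J)
    have J: "J \<subseteq> {1..n}" using insert.prems by simp
    have "(\<Otimes>\<^bsub>T\<^esub>i\<in>insert j J. slot i (x i)) = slot j (x j) \<otimes>\<^bsub>T\<^esub> (\<Otimes>\<^bsub>T\<^esub>i\<in>J. slot i (x i))"
      using insert x by (intro C.finprod_insert) auto
    also have "\<dots> = pt (tone(j := x j)) \<otimes>\<^bsub>T\<^esub> pt (\<lambda>i\<in>{1..n}. if i \<in> J then x i else \<one>)"
      by (simp only: insert.IH[OF J] slot_def[of j])
    also have "\<dots> = pt (tone(j := x j) \<star> (\<lambda>i\<in>{1..n}. if i \<in> J then x i else \<one>))"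
      using insert x by (intro pt_mult) (auto simp: tuples_def PiE_iff tone_def extensional_def)
    also have "tone(j := x j) \<star> (\<lambda>i\<in>{1..n}. if i \<in> J then x i else \<one>) = (\<lambda>i\<in>{1..n}. if i \<in> insert j J then x i else \<one>)"
      using insert x by (auto simp: tuple_mult_def tone_def fun_eq_iff)
    finally show ?case .
  qed
  have "(\<lambda>i\<in>{1..n}. if i \<in> {1..n} then x i else \<one>) = x"
    using x by (auto simp: tuples_def PiE_iff extensional_def fun_eq_iff)
  then show ?thesis using *[OF finite_atLeastAtMost order_refl] by (simp only:)
qed

lemma pi_ext:
  assumes g: "g \<in> tup \<rightarrow> carrier F" and p: "p \<in> carrier F"
  shows "\<pi> (ext F g p) = ext T (\<lambda>x. \<pi> (g x)) p"
proof -
  have pg: "(\<lambda>x. \<pi> (g x)) \<in> tup \<rightarrow> carrier T" by (intro Pi_I pi_closed funcset_mem[OF g])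
  show ?thesis
    using p
  proof (induction rule: F_induct)
    case zero
    then show ?case
      using ring_hom_zero[OF pi_hom ring_F ring_T]
      by (simp add: ext_zero[OF module_F] ext_zero[OF T.module_axioms])
  next
    case (add c x p)
    then have "g x \<in> carrier F" using g by auto
    then show ?case
      using add g pg by (simp add: ext_step[OF module_F] ext_step[OF T.module_axioms]
          ring_hom_add[OF pi_hom] F_smult_closed ext_closed[OF module_F] T_smult)
  qed
qed

end

section \<open>The bracket of the tensor power\<close>

locale tensor_bracket = tensor k A n
  for k :: "('k, 'm) ring_scheme" and A :: "('k, 'a, 'z) poisson_scheme" (structure) and n +
  assumes bracket_closed: "\<lbrakk>a \<in> carrier A; b \<in> carrier A\<rbrakk> \<Longrightarrow> \<lbrace>a, b\<rbrace> \<in> carrier A"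
    and bracket_add_left: "\<lbrakk>a \<in> carrier A; b \<in> carrier A; c \<in> carrier A\<rbrakk> \<Longrightarrow> \<lbrace>a \<oplus> b, c\<rbrace> = \<lbrace>a, c\<rbrace> \<oplus> \<lbrace>b, c\<rbrace>"
    and bracket_add_right: "\<lbrakk>a \<in> carrier A; b \<in> carrier A; c \<in> carrier A\<rbrakk> \<Longrightarrow> \<lbrace>a, b \<oplus> c\<rbrace> = \<lbrace>a, b\<rbrace> \<oplus> \<lbrace>a, c\<rbrace>"
    and bracket_smult_left: "\<lbrakk>r \<in> carrier k; a \<in> carrier A; b \<in> carrier A\<rbrakk> \<Longrightarrow> \<lbrace>r \<odot> a, b\<rbrace> = r \<odot> \<lbrace>a, b\<rbrace>"
    and bracket_smult_right: "\<lbrakk>r \<in> carrier k; a \<in> carrier A; b \<in> carrier A\<rbrakk> \<Longrightarrow> \<lbrace>a, r \<odot> b\<rbrace> = r \<odot> \<lbrace>a, b\<rbrace>"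
begin

definition br_tuple :: "nat \<Rightarrow> (nat \<Rightarrow> 'a) \<Rightarrow> (nat \<Rightarrow> 'a) \<Rightarrow> nat \<Rightarrow> 'a" where
  "br_tuple i x y = (x \<star> y)(i := \<lbrace>x i, y i\<rbrace>)"

lemma br_tuple_closed [simp]: "i \<in> {1..n} \<Longrightarrow> x \<in> tup \<Longrightarrow> y \<in> tup \<Longrightarrow> br_tuple i x y \<in> tup"
  by (simp add: br_tuple_def bracket_closed)

definition pt_bracket where
  "pt_bracket x y = (\<Oplus>\<^bsub>T\<^esub>i\<in>{1..n}. pt (br_tuple i x y))"

lemma pt_bracket_closed [simp]: "x \<in> tup \<Longrightarrow> y \<in> tup \<Longrightarrow> pt_bracket x y \<in> carrier T"
  unfolding pt_bracket_def by (intro T.M.finsum_closed) auto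

lemma multilinear_finsum:
  assumes "\<And>i. i \<in> {1..n} \<Longrightarrow> multilinear T (g i)"
  shows "multilinear T (\<lambda>x. \<Oplus>\<^bsub>T\<^esub>i\<in>{1..n}. g i x)"
proof -
  have c: "g i x \<in> carrier T" if "i \<in> {1..n}" "x \<in> tup" for i x
    using multilinearD(1)[OF assms[OF that(1)]] that(2) by auto
  show ?thesis
    unfolding multilinear_def
  proof (intro conjI ballI)
    show "(\<lambda>x. \<Oplus>\<^bsub>T\<^esub>i\<in>{1..n}. g i x) \<in> tup \<rightarrow> carrier T"
      using c by (auto intro!: T.M.finsum_closed)
    fix x j a assume x: "x \<in> tup" and j: "j \<in> {1..n}" and a: "a \<in> carrier A"
    note u = tuple_upd[OF x j]
    { fix b assume b: "b \<in> carrier A"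
      have "(\<Oplus>\<^bsub>T\<^esub>i\<in>{1..n}. g i (x(j := a \<oplus> b))) = (\<Oplus>\<^bsub>T\<^esub>i\<in>{1..n}. g i (x(j := a)) \<oplus>\<^bsub>T\<^esub> g i (x(j := b)))"
        using c u a b by (intro T.M.finsum_cong' refl multilinearD(2)[OF assms _ j a b] x) auto
      also have "\<dots> = (\<Oplus>\<^bsub>T\<^esub>i\<in>{1..n}. g i (x(j := a))) \<oplus>\<^bsub>T\<^esub> (\<Oplus>\<^bsub>T\<^esub>i\<in>{1..n}. g i (x(j := b)))"
        using c u a b by (intro T.M.finsum_addf) auto
      finally show "(\<Oplus>\<^bsub>T\<^esub>i\<in>{1..n}. g i (x(j := a \<oplus> b))) =
          (\<Oplus>\<^bsub>T\<^esub>i\<in>{1..n}. g i (x(j := a))) \<oplus>\<^bsub>T\<^esub> (\<Oplus>\<^bsub>T\<^esub>i\<in>{1..n}. g i (x(j := b)))" . }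
    fix d assume d: "d \<in> carrier k"
    have "(\<Oplus>\<^bsub>T\<^esub>i\<in>{1..n}. g i (x(j := d \<odot> a))) = (\<Oplus>\<^bsub>T\<^esub>i\<in>{1..n}. d \<odot>\<^bsub>T\<^esub> g i (x(j := a)))"
      using c u a d by (intro T.M.finsum_cong' refl multilinearD(3)[OF assms _ j d a] x) auto
    also have "\<dots> = d \<odot>\<^bsub>T\<^esub> (\<Oplus>\<^bsub>T\<^esub>i\<in>{1..n}. g i (x(j := a)))"
      using c u a d by (intro T.finsum_smult_ldistr[symmetric]) auto
    finally show "(\<Oplus>\<^bsub>T\<^esub>i\<in>{1..n}. g i (x(j := d \<odot> a))) = d \<odot>\<^bsub>T\<^esub> (\<Oplus>\<^bsub>T\<^esub>i\<in>{1..n}. g i (x(j := a)))" .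
  qed
qed

lemma br_tuple_upd_left:
  assumes "x \<in> tup" "y \<in> tup" "j \<in> {1..n}"
  shows "br_tuple i (x(j := a)) y = (if i = j then (x \<star> y)(j := \<lbrace>a, y j\<rbrace>) else (br_tuple i x y)(j := a \<otimes> y j))"
  using assms by (auto simp: br_tuple_def tuple_mult_upd fun_upd_twist)

lemma br_tuple_upd_right:
  assumes "x \<in> tup" "y \<in> tup" "j \<in> {1..n}"
  shows "br_tuple i x (y(j := a)) = (if i = j then (x \<star> y)(j := \<lbrace>x j, a\<rbrace>) else (br_tuple i x y)(j := x j \<otimes> a))"
  using assms by (auto simp: br_tuple_def tuple_mult_upd fun_upd_twist)

text \<open>The entry \<open>j\<close> of \<open>br_tuple i x y\<close> is \<open>{x_j, y_j}\<close>
  for \<open>j = i\<close> and \<open>x_j y_j\<close> otherwise, which is linear in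
  \<open>x_j\<close> and in \<open>y_j\<close>; the other entries do not involve them.\<close>

lemma pt_bracket_multilinear:
  assumes y: "y \<in> tup"
  shows "multilinear T (\<lambda>x. pt_bracket x y)" "multilinear T (\<lambda>x. pt_bracket y x)"
proof -
  note pm = multilinearD(2,3)[OF pt_multilinear]
  show "multilinear T (\<lambda>x. pt_bracket x y)"
    unfolding pt_bracket_def
  proof (rule multilinear_finsum)
    fix i assume i: "i \<in> {1..n}"
    show "multilinear T (\<lambda>x. pt (br_tuple i x y))"
      unfolding multilinear_def
      using i y by (auto simp: br_tuple_upd_left bracket_add_left bracket_smult_left bracket_closed
          B.l_distr smult_mult_left pm simp del: atLeastAtMost_iff)
  qed
  show "multilinear T (\<lambda>x. pt_bracket y x)"
    unfolding pt_bracket_def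
  proof (rule multilinear_finsum)
    fix i assume i: "i \<in> {1..n}"
    show "multilinear T (\<lambda>x. pt (br_tuple i y x))"
      unfolding multilinear_def
      using i y by (auto simp: br_tuple_upd_right bracket_add_right bracket_smult_right bracket_closed
          B.r_distr smult_mult_right pm simp del: atLeastAtMost_iff)
  qed
qed

definition br_sum where "br_sum x y = (\<Oplus>\<^bsub>F\<^esub>i\<in>{1..n}. single k (br_tuple i x y))"

lemma br_sum_closed [simp]: "x \<in> tup \<Longrightarrow> y \<in> tup \<Longrightarrow> br_sum x y \<in> carrier F"
  unfolding br_sum_def by (intro F.M.finsum_closed) auto

lemma tuple_bracket_ext:
  assumes p: "p \<in> carrier F" and q: "q \<in> carrier F"
  shows "tuple_bracket k A n p q = ext F (\<lambda>x. ext F (br_sum x) q) p"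
proof
  fix z
  have in1: "br_sum x \<in> tup \<rightarrow> carrier F" if "x \<in> tup" for x using that by simp
  have at: "ext F g r z = (\<Oplus>\<^bsub>k\<^esub>x\<in>supp k r. r x \<otimes>\<^bsub>k\<^esub> g x z)" if "g \<in> tup \<rightarrow> carrier F" "r \<in> carrier F" for g r
    unfolding ext_def using that supp_tup[OF that(2)]
    by (subst F_finsum_at) (auto simp: F_simps(5) Pi_iff intro!: F_smult_closed[unfolded F_simps(5)])
  have "ext F (\<lambda>x. ext F (br_sum x) q) p z = (\<Oplus>\<^bsub>k\<^esub>x\<in>supp k p. p x \<otimes>\<^bsub>k\<^esub> ext F (br_sum x) q z)"
    using p q ext_closed[OF module_F in1 q] by (intro at) auto
  also have "\<dots> = (\<Oplus>\<^bsub>k\<^esub>x\<in>supp k p. \<Oplus>\<^bsub>k\<^esub>y\<in>supp k q. \<Oplus>\<^bsub>k\<^esub>i\<in>{1..n}.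
      if br_tuple i x y = z then p x \<otimes>\<^bsub>k\<^esub> q y else \<zero>\<^bsub>k\<^esub>)"
  proof (rule R.finsum_cong')
    fix x assume "x \<in> supp k p"
    then have x: "x \<in> tup" using supp_tup[OF p] by auto
    have sz: "br_sum x y z = (\<Oplus>\<^bsub>k\<^esub>i\<in>{1..n}. single k (br_tuple i x y) z)" if "y \<in> tup" for y
      unfolding br_sum_def using x that by (intro F_finsum_at) auto
    have "p x \<otimes>\<^bsub>k\<^esub> ext F (br_sum x) q z = (\<Oplus>\<^bsub>k\<^esub>y\<in>supp k q. p x \<otimes>\<^bsub>k\<^esub> (q y \<otimes>\<^bsub>k\<^esub> br_sum x y z))"
      unfolding at[OF in1[OF x] q] using p q supp_tup[OF q] x by (intro R.finsum_rdistr) auto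
    also have "\<dots> = (\<Oplus>\<^bsub>k\<^esub>y\<in>supp k q. \<Oplus>\<^bsub>k\<^esub>i\<in>{1..n}. if br_tuple i x y = z then p x \<otimes>\<^bsub>k\<^esub> q y else \<zero>\<^bsub>k\<^esub>)"
    proof (rule R.finsum_cong')
      fix y assume "y \<in> supp k q"
      then have y: "y \<in> tup" using supp_tup[OF q] by auto
      have "p x \<otimes>\<^bsub>k\<^esub> (q y \<otimes>\<^bsub>k\<^esub> br_sum x y z)
          = (\<Oplus>\<^bsub>k\<^esub>i\<in>{1..n}. p x \<otimes>\<^bsub>k\<^esub> q y \<otimes>\<^bsub>k\<^esub> single k (br_tuple i x y) z)"
        unfolding sz[OF y] using p q by (subst R.finsum_rdistr[symmetric]) (auto simp: single_def R.m_assoc)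
      also have "\<dots> = (\<Oplus>\<^bsub>k\<^esub>i\<in>{1..n}. if br_tuple i x y = z then p x \<otimes>\<^bsub>k\<^esub> q y else \<zero>\<^bsub>k\<^esub>)"
        using p q by (intro R.finsum_cong') (auto simp: single_def)
      finally show "p x \<otimes>\<^bsub>k\<^esub> (q y \<otimes>\<^bsub>k\<^esub> br_sum x y z)
          = (\<Oplus>\<^bsub>k\<^esub>i\<in>{1..n}. if br_tuple i x y = z then p x \<otimes>\<^bsub>k\<^esub> q y else \<zero>\<^bsub>k\<^esub>)" .
    qed (use p q in \<open>auto intro!: R.finsum_closed\<close>)
    finally show "p x \<otimes>\<^bsub>k\<^esub> ext F (br_sum x) q z
      = (\<Oplus>\<^bsub>k\<^esub>y\<in>supp k q. \<Oplus>\<^bsub>k\<^esub>i\<in>{1..n}. if br_tuple i x y = z then p x \<otimes>\<^bsub>k\<^esub> q y else \<zero>\<^bsub>k\<^esub>)" .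
  qed (use p q in \<open>auto intro!: R.finsum_closed\<close>)
  finally show "tuple_bracket k A n p q z = ext F (\<lambda>x. ext F (br_sum x) q) p z"
    by (simp add: tuple_bracket_def br_tuple_def)
qed

definition brT where "brT p q = ext T (\<lambda>x. ext T (pt_bracket x) q) p"

lemma pi_br_sum: "x \<in> tup \<Longrightarrow> y \<in> tup \<Longrightarrow> \<pi> (br_sum x y) = pt_bracket x y"
proof -
  assume x: "x \<in> tup" and y: "y \<in> tup"
  have "\<pi> (\<Oplus>\<^bsub>F\<^esub>i\<in>I. single k (br_tuple i x y)) = (\<Oplus>\<^bsub>T\<^esub>i\<in>I. pt (br_tuple i x y))"
    if "finite I" "I \<subseteq> {1..n}" for I
    using that
  proof (induction I rule: finite_induct)
    case empty
    then show ?case using ring_hom_zero[OF pi_hom ring_F ring_T] by simp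
  next
    case (insert i I)
    have "(\<lambda>i. single k (br_tuple i x y)) \<in> I \<rightarrow> carrier F" "(\<lambda>i. pt (br_tuple i x y)) \<in> I \<rightarrow> carrier T"
      using insert.prems x y by auto
    then show ?case using insert x y by (simp add: ring_hom_add[OF pi_hom] pt_def[symmetric] F.M.finsum_closed)
  qed
  then show ?thesis by (simp add: br_sum_def pt_bracket_def)
qed

lemma pi_tuple_bracket:
  assumes p: "p \<in> carrier F" and q: "q \<in> carrier F"
  shows "\<pi> (tuple_bracket k A n p q) = brT p q"
proof -
  have in1: "br_sum x \<in> tup \<rightarrow> carrier F" if "x \<in> tup" for x using that by simp
  have in2: "(\<lambda>x. ext F (br_sum x) q) \<in> tup \<rightarrow> carrier F" using ext_closed[OF module_F in1 q] by auto
  have "\<pi> (tuple_bracket k A n p q) = ext T (\<lambda>x. \<pi> (ext F (br_sum x) q)) p"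
    unfolding tuple_bracket_ext[OF p q] by (rule pi_ext[OF in2 p])
  also have "\<dots> = brT p q"
    unfolding brT_def
  proof (rule ext_fun_cong[OF T.module_axioms _ _ p])
    show "(\<lambda>x. \<pi> (ext F (br_sum x) q)) \<in> tup \<rightarrow> carrier T" by (intro Pi_I pi_closed funcset_mem[OF in2])
    fix x assume x: "x \<in> tup"
    have "(\<lambda>y. \<pi> (br_sum x y)) \<in> tup \<rightarrow> carrier T" by (intro Pi_I pi_closed funcset_mem[OF in1[OF x]])
    then show "\<pi> (ext F (br_sum x) q) = ext T (pt_bracket x) q"
      unfolding pi_ext[OF in1[OF x] q] using x q by (intro ext_fun_cong[OF T.module_axioms]) (auto simp: pi_br_sum)
  qed
  finally show ?thesis .
qed

lemma pt_bracket_in: "x \<in> tup \<Longrightarrow> pt_bracket x \<in> tup \<rightarrow> carrier T"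
  by simp

lemma brT_in: "q \<in> carrier F \<Longrightarrow> (\<lambda>x. ext T (pt_bracket x) q) \<in> tup \<rightarrow> carrier T"
  using ext_closed[OF T.module_axioms pt_bracket_in] by auto

lemma brT_closed [simp]: "p \<in> carrier F \<Longrightarrow> q \<in> carrier F \<Longrightarrow> brT p q \<in> carrier T"
  unfolding brT_def by (rule ext_closed[OF T.module_axioms brT_in])

lemma brT_add_left: "p \<in> carrier F \<Longrightarrow> p' \<in> carrier F \<Longrightarrow> q \<in> carrier F \<Longrightarrow>
    brT (p \<oplus>\<^bsub>F\<^esub> p') q = brT p q \<oplus>\<^bsub>T\<^esub> brT p' q"
  unfolding brT_def by (rule ext_add[OF T.module_axioms brT_in])

lemma brT_add_right:
  assumes "p \<in> carrier F" "q \<in> carrier F" "q' \<in> carrier F"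
  shows "brT p (q \<oplus>\<^bsub>F\<^esub> q') = brT p q \<oplus>\<^bsub>T\<^esub> brT p q'"
proof -
  have "brT p (q \<oplus>\<^bsub>F\<^esub> q') = ext T (\<lambda>x. ext T (pt_bracket x) q \<oplus>\<^bsub>T\<^esub> ext T (pt_bracket x) q') p"
    unfolding brT_def using assms F_add_closed
    by (intro ext_fun_cong[OF T.module_axioms brT_in] ext_add[OF T.module_axioms pt_bracket_in])
  then show ?thesis
    unfolding brT_def using assms by (simp add: ext_fun_add[OF T.module_axioms brT_in brT_in])
qed

lemma brT_single:
  assumes "x \<in> tup" "y \<in> tup"
  shows "brT (single k x) (single k y) = pt_bracket x y"
  unfolding brT_def using assms
  by (simp add: ext_single[OF T.module_axioms brT_in] ext_single[OF T.module_axioms pt_bracket_in])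

lemma ext_pt_bracket_vanishes:
  assumes "q \<in> N" "x \<in> tup"
  shows "ext T (pt_bracket x) q = \<zero>\<^bsub>T\<^esub>"
  using ext_vanishes[OF T.module_axioms pt_bracket_multilinear(2)[OF assms(2)] assms(1)] .

lemma brT_vanishes:
  assumes p: "p \<in> carrier F" and q: "q \<in> carrier F"
  shows "q \<in> N \<Longrightarrow> brT p q = \<zero>\<^bsub>T\<^esub>" "p \<in> N \<Longrightarrow> brT p q = \<zero>\<^bsub>T\<^esub>"
proof -
  assume qN: "q \<in> N"
  show "brT p q = \<zero>\<^bsub>T\<^esub>"
    using p
  proof (induction rule: F_induct)
    case (add c x p)
    then show ?case
      using ext_pt_bracket_vanishes[OF qN add(2)] q
      by (simp add: brT_def ext_step[OF T.module_axioms brT_in])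
  qed (simp add: brT_def ext_zero[OF T.module_axioms])
next
  assume pN: "p \<in> N"
  \<comment> \<open>The extensions in the two arguments are exchanged, so that the inner one runs
    over the argument in \<open>N\<close>, where \<open>pt_bracket\<close> is multilinear for each
    fixed \<open>y\<close>.\<close>
  have "brT p q = ext T (\<lambda>y. ext T (\<lambda>x. pt_bracket x y) p) q"
    using q
  proof (induction rule: F_induct)
    case zero
    have "brT p \<zero>\<^bsub>F\<^esub> = ext T (\<lambda>x. \<zero>\<^bsub>k\<^esub> \<odot>\<^bsub>T\<^esub> \<zero>\<^bsub>T\<^esub>) p"
      unfolding brT_def by (simp add: ext_zero[OF T.module_axioms])
    also have "\<dots> = \<zero>\<^bsub>k\<^esub> \<odot>\<^bsub>T\<^esub> ext T (\<lambda>x. \<zero>\<^bsub>T\<^esub>) p"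
      by (rule ext_fun_smult[OF T.module_axioms]) (use p in auto)
    also have "\<dots> = \<zero>\<^bsub>T\<^esub>" using ext_closed[OF T.module_axioms, of "\<lambda>x. \<zero>\<^bsub>T\<^esub>" p] p by simp
    finally show ?case by (simp add: ext_zero[OF T.module_axioms])
  next
    case (add c y q)
    have in1: "(\<lambda>x. pt_bracket x y) \<in> tup \<rightarrow> carrier T" if "y \<in> tup" for y using that by simp
    have in2: "(\<lambda>y. ext T (\<lambda>x. pt_bracket x y) p) \<in> tup \<rightarrow> carrier T"
      using ext_closed[OF T.module_axioms in1 p] by auto
    have in3: "(\<lambda>x. c \<odot>\<^bsub>T\<^esub> pt_bracket x y) \<in> tup \<rightarrow> carrier T" using add by auto
    have "brT p (c \<odot>\<^bsub>F\<^esub> single k y \<oplus>\<^bsub>F\<^esub> q)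
        = ext T (\<lambda>x. c \<odot>\<^bsub>T\<^esub> pt_bracket x y \<oplus>\<^bsub>T\<^esub> ext T (pt_bracket x) q) p"
      unfolding brT_def using add p
      by (intro ext_fun_cong[OF T.module_axioms brT_in] ext_step[OF T.module_axioms pt_bracket_in])
        (simp_all add: F_smult_closed F_add_closed)
    also have "\<dots> = c \<odot>\<^bsub>T\<^esub> ext T (\<lambda>x. pt_bracket x y) p \<oplus>\<^bsub>T\<^esub> brT p q"
      unfolding brT_def using add p
      by (simp add: ext_fun_add[OF T.module_axioms in3 brT_in] ext_fun_smult[OF T.module_axioms in1])
    also have "\<dots> = ext T (\<lambda>y. ext T (\<lambda>x. pt_bracket x y) p) (c \<odot>\<^bsub>F\<^esub> single k y \<oplus>\<^bsub>F\<^esub> q)"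
      using add by (simp add: ext_step[OF T.module_axioms in2])
    finally show ?case .
  qed
  also have "\<dots> = \<zero>\<^bsub>T\<^esub>"
    using q
  proof (induction rule: F_induct)
    case (add c y q)
    have in2: "(\<lambda>y. ext T (\<lambda>x. pt_bracket x y) p) \<in> tup \<rightarrow> carrier T"
      by (intro Pi_I ext_closed[OF T.module_axioms _ p]) simp
    show ?case
      using ext_vanishes[OF T.module_axioms pt_bracket_multilinear(1)[OF add(2)] pN] add
      by (simp add: ext_step[OF T.module_axioms in2])
  qed (simp add: ext_zero[OF T.module_axioms])
  finally show "brT p q = \<zero>\<^bsub>T\<^esub>" .
qed

lemma brT_cong:
  assumes p: "p \<in> carrier F" "p' \<in> carrier F" and q: "q \<in> carrier F" "q' \<in> carrier F"
    and "\<pi> p = \<pi> p'" "\<pi> q = \<pi> q'"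
  shows "brT p q = brT p' q'"
proof -
  have d: "p = (p \<ominus>\<^bsub>F\<^esub> p') \<oplus>\<^bsub>F\<^esub> p'" "q = (q \<ominus>\<^bsub>F\<^esub> q') \<oplus>\<^bsub>F\<^esub> q'"
    using p q by (simp_all add: a_minus_def F.M.a_assoc F.M.l_neg)
  have N: "p \<ominus>\<^bsub>F\<^esub> p' \<in> N" "q \<ominus>\<^bsub>F\<^esub> q' \<in> N" using assms pi_eq_iff by simp_all
  have "brT p q = brT p' q"
    using brT_add_left[of "p \<ominus>\<^bsub>F\<^esub> p'" p' q] brT_vanishes(2)[OF _ q(1) N(1)] p q F_minus_mem d(1) by simp
  also have "\<dots> = brT p' q'"
    using brT_add_right[of p' "q \<ominus>\<^bsub>F\<^esub> q'" q'] brT_vanishes(1)[OF p(2) _ N(2)] p q F_minus_mem d(2) by simp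
  finally show ?thesis .
qed

text \<open>The bracket of two cosets is a union over representatives; by \<open>brT_cong\<close>
  its members coincide.\<close>

lemma T_bracket_pi:
  assumes p: "p \<in> carrier F" and q: "q \<in> carrier F"
  shows "\<lbrace>\<pi> p, \<pi> q\<rbrace>\<^bsub>T\<^esub> = brT p q"
proof -
  have "\<lbrace>\<pi> p, \<pi> q\<rbrace>\<^bsub>T\<^esub> = (\<Union>p'\<in>\<pi> p. \<Union>q'\<in>\<pi> q. \<pi> (tuple_bracket k A n p' q'))"
    by (simp add: tensor_power_def Let_def \<pi>_def)
  also have "\<dots> = (\<Union>p'\<in>\<pi> p. \<Union>q'\<in>\<pi> q. brT p q)"
  proof (intro SUP_cong refl)
    fix p' q' assume "p' \<in> \<pi> p" "q' \<in> \<pi> q"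
    note a = pi_mem[OF this(1) p] and b = pi_mem[OF this(2) q]
    show "\<pi> (tuple_bracket k A n p' q') = brT p q"
      unfolding pi_tuple_bracket[OF a(1) b(1)] by (rule brT_cong[OF a(1) p b(1) q a(2) b(2)])
  qed
  also have "\<dots> = brT p q" using pi_self[OF p] pi_self[OF q] by auto
  finally show ?thesis .
qed

lemma T_bracket_closed: "U \<in> carrier T \<Longrightarrow> V \<in> carrier T \<Longrightarrow> \<lbrace>U, V\<rbrace>\<^bsub>T\<^esub> \<in> carrier T"
  by (metis T_bracket_pi T_cases brT_closed)

lemma T_bracket_pt: "x \<in> tup \<Longrightarrow> y \<in> tup \<Longrightarrow> \<lbrace>pt x, pt y\<rbrace>\<^bsub>T\<^esub> = pt_bracket x y"
  by (simp add: pt_def T_bracket_pi brT_single)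

lemma T_bracket_add:
  assumes U: "U \<in> carrier T" and V: "V \<in> carrier T" and W: "W \<in> carrier T"
  shows "\<lbrace>U \<oplus>\<^bsub>T\<^esub> V, W\<rbrace>\<^bsub>T\<^esub> = \<lbrace>U, W\<rbrace>\<^bsub>T\<^esub> \<oplus>\<^bsub>T\<^esub> \<lbrace>V, W\<rbrace>\<^bsub>T\<^esub>"
    "\<lbrace>W, U \<oplus>\<^bsub>T\<^esub> V\<rbrace>\<^bsub>T\<^esub> = \<lbrace>W, U\<rbrace>\<^bsub>T\<^esub> \<oplus>\<^bsub>T\<^esub> \<lbrace>W, V\<rbrace>\<^bsub>T\<^esub>"
proof -
  obtain p where p: "p \<in> carrier F" "U = \<pi> p" by (rule T_cases[OF U])
  obtain q where q: "q \<in> carrier F" "V = \<pi> q" by (rule T_cases[OF V])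
  obtain r where r: "r \<in> carrier F" "W = \<pi> r" by (rule T_cases[OF W])
  show "\<lbrace>U \<oplus>\<^bsub>T\<^esub> V, W\<rbrace>\<^bsub>T\<^esub> = \<lbrace>U, W\<rbrace>\<^bsub>T\<^esub> \<oplus>\<^bsub>T\<^esub> \<lbrace>V, W\<rbrace>\<^bsub>T\<^esub>"
    "\<lbrace>W, U \<oplus>\<^bsub>T\<^esub> V\<rbrace>\<^bsub>T\<^esub> = \<lbrace>W, U\<rbrace>\<^bsub>T\<^esub> \<oplus>\<^bsub>T\<^esub> \<lbrace>W, V\<rbrace>\<^bsub>T\<^esub>"
    using p q r by (simp_all add: ring_hom_add[OF pi_hom, symmetric] T_bracket_pi F_add_closed
        brT_add_left brT_add_right)
qed

lemma T_bracket_zero: "W \<in> carrier T \<Longrightarrow> \<lbrace>\<zero>\<^bsub>T\<^esub>, W\<rbrace>\<^bsub>T\<^esub> = \<zero>\<^bsub>T\<^esub>" "W \<in> carrier T \<Longrightarrow> \<lbrace>W, \<zero>\<^bsub>T\<^esub>\<rbrace>\<^bsub>T\<^esub> = \<zero>\<^bsub>T\<^esub>"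
proof -
  assume W: "W \<in> carrier T"
  show "\<lbrace>\<zero>\<^bsub>T\<^esub>, W\<rbrace>\<^bsub>T\<^esub> = \<zero>\<^bsub>T\<^esub>"
    using T_bracket_add(1)[of "\<zero>\<^bsub>T\<^esub>" "\<zero>\<^bsub>T\<^esub>" W] T_bracket_closed[of "\<zero>\<^bsub>T\<^esub>" W] W by (simp add: T.M.add.r_cancel_one')
  show "\<lbrace>W, \<zero>\<^bsub>T\<^esub>\<rbrace>\<^bsub>T\<^esub> = \<zero>\<^bsub>T\<^esub>"
    using T_bracket_add(2)[of "\<zero>\<^bsub>T\<^esub>" "\<zero>\<^bsub>T\<^esub>" W] T_bracket_closed[of W "\<zero>\<^bsub>T\<^esub>"] W by (simp add: T.M.add.r_cancel_one')
qed

end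

section \<open>Deformations of tensor powers\<close>

text \<open>Makes a ring into a module over \<open>k\<close> through a homomorphism
  \<open>f\<close>, as a target for the universal property of the tensor power.\<close>

definition scalars_by :: "('s, 'z) ring_scheme \<Rightarrow> ('k \<Rightarrow> 's) \<Rightarrow> ('k, 's) module" where
  "scalars_by S f = \<lparr>carrier = carrier S, monoid.mult = monoid.mult S, one = one S, ring.zero = ring.zero S,
     add = add S, smult = (\<lambda>c x. f c \<otimes>\<^bsub>S\<^esub> x)\<rparr>"

lemma scalars_by_simps [simp]:
  "carrier (scalars_by S f) = carrier S" "x \<oplus>\<^bsub>scalars_by S f\<^esub> y = x \<oplus>\<^bsub>S\<^esub> y"
  "\<zero>\<^bsub>scalars_by S f\<^esub> = \<zero>\<^bsub>S\<^esub>" "c \<odot>\<^bsub>scalars_by S f\<^esub> x = f c \<otimes>\<^bsub>S\<^esub> x"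
  by (simp_all add: scalars_by_def)

lemma module_scalars_by:
  assumes "cring k" "ring S" "f \<in> ring_hom k S"
  shows "module k (scalars_by S f)"
proof -
  interpret S: ring S by (rule assms(2))
  note f = ring_hom_closed[OF assms(3)] ring_hom_add[OF assms(3)] ring_hom_mult[OF assms(3)] ring_hom_one[OF assms(3)]
  show ?thesis
  proof (rule moduleI)
    show "abelian_group (scalars_by S f)"
    proof (rule abelian_groupI)
      show "\<exists>y\<in>carrier (scalars_by S f). y \<oplus>\<^bsub>scalars_by S f\<^esub> x = \<zero>\<^bsub>scalars_by S f\<^esub>"
        if "x \<in> carrier (scalars_by S f)" for x
        using that by (intro bexI[of _ "\<ominus>\<^bsub>S\<^esub> x"]) (simp_all add: S.l_neg)
    qed (simp_all add: S.a_ac)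
  qed (simp_all add: assms(1) f S.l_distr S.r_distr S.m_assoc)
qed

context assoc_algebra
begin

lemma smult_one_hom: "(\<lambda>d. d \<odot> \<one>) \<in> ring_hom R B"
  by (rule ring_hom_memI) (simp_all add: smult_l_distr smult_assoc1 smult_mult_left)

lemma smult_conv: "d \<in> carrier R \<Longrightarrow> x \<in> carrier B \<Longrightarrow> d \<odot> x = (d \<odot> \<one>) \<otimes> x"
  by (simp add: smult_mult_left)

lemma smult_one_central: "d \<in> carrier R \<Longrightarrow> x \<in> carrier B \<Longrightarrow> x \<otimes> (d \<odot> \<one>) = (d \<odot> \<one>) \<otimes> x"
  by (simp add: smult_mult_left smult_mult_right)

end

lemma power_series_map_hom:
  assumes k: "cring k" and S: "cring S" and f: "f \<in> ring_hom k S"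
  shows "(\<lambda>d m. f (d m)) \<in> ring_hom (power_series_ring k) (power_series_ring S)"
proof -
  interpret k: cring k by (rule k)
  interpret S: cring S by (rule S)
  interpret f: ring_hom_cring k S f by unfold_locales (rule f)
  have k: "\<And>d m. d \<in> carrier k.PS \<Longrightarrow> d m \<in> carrier k" by (simp add: k.PS_mem)
  show ?thesis
  proof (rule ring_hom_memI)
    fix d e assume d: "d \<in> carrier k.PS" and e: "e \<in> carrier k.PS"
    show "(\<lambda>m. f (d m)) \<in> carrier S.PS" using k[OF d] by (simp add: S.PS_mem)
    show "(\<lambda>m. f ((d \<oplus>\<^bsub>k.PS\<^esub> e) m)) = (\<lambda>m. f (d m)) \<oplus>\<^bsub>S.PS\<^esub> (\<lambda>m. f (e m))"
      using k[OF d] k[OF e] by (simp add: k.PS_simps S.PS_simps)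
    show "(\<lambda>m. f ((d \<otimes>\<^bsub>k.PS\<^esub> e) m)) = (\<lambda>m. f (d m)) \<otimes>\<^bsub>S.PS\<^esub> (\<lambda>m. f (e m))"
    proof
      fix m
      have "f (\<Oplus>\<^bsub>k\<^esub>i\<in>{..m}. d i \<otimes>\<^bsub>k\<^esub> e (m - i)) = (\<Oplus>\<^bsub>S\<^esub>i\<in>{..m}. (f \<circ> (\<lambda>i. d i \<otimes>\<^bsub>k\<^esub> e (m - i))) i)"
        using k[OF d] k[OF e] by (subst f.hom_finsum) (auto simp: comp_def)
      also have "\<dots> = (\<Oplus>\<^bsub>S\<^esub>i\<in>{..m}. f (d i) \<otimes>\<^bsub>S\<^esub> f (e (m - i)))"
        using k[OF d] k[OF e] by (intro S.finsum_cong') auto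
      finally show "f ((d \<otimes>\<^bsub>k.PS\<^esub> e) m) = ((\<lambda>m. f (d m)) \<otimes>\<^bsub>S.PS\<^esub> (\<lambda>m. f (e m))) m"
        by (simp add: k.PS_simps S.PS_simps)
    qed
  qed (auto simp: k.PS_simps S.PS_simps)
qed

text \<open>\<open>\<chi> x m\<close> is meant as the coefficient of \<open>\<hbar>^m\<close> in
  \<open>x\<close> under an isomorphism of modules between the quantization and
  \<open>A[[\<hbar>]]\<close>. All coefficients are additive and follow the convolution rule for
  scalars; the zeroth one is the reduction and is multiplicative.\<close>

locale tensor_deformation = TA: tensor_bracket k A n + TB: tensor "power_series_ring k" B n
    + T: "domain" "tensor_power k A n"
  for k :: "('k, 'm) ring_scheme" and A :: "('k, 'a, 'z) poisson_scheme" and n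
    and B :: "(nat \<Rightarrow> 'k, 'b, 'w) poisson_scheme" +
  fixes \<chi> :: "'b \<Rightarrow> nat \<Rightarrow> 'a"
  assumes n: "n \<ge> 1"
    and coeff_closed [simp]: "x \<in> carrier B \<Longrightarrow> \<chi> x m \<in> carrier A"
    and coeff_add: "x \<in> carrier B \<Longrightarrow> y \<in> carrier B \<Longrightarrow> \<chi> (x \<oplus>\<^bsub>B\<^esub> y) m = \<chi> x m \<oplus>\<^bsub>A\<^esub> \<chi> y m"
    and coeff_smult: "d \<in> carrier (power_series_ring k) \<Longrightarrow> x \<in> carrier B \<Longrightarrow>
      \<chi> (d \<odot>\<^bsub>B\<^esub> x) m = (\<Oplus>\<^bsub>A\<^esub>i\<in>{..m}. d i \<odot>\<^bsub>A\<^esub> \<chi> x (m - i))"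
    and head_hom: "(\<lambda>x. \<chi> x 0) \<in> ring_hom B A"
    and head_surj: "a \<in> carrier A \<Longrightarrow> \<exists>x\<in>carrier B. \<chi> x 0 = a"
    and head_kernel: "x \<in> carrier B \<Longrightarrow> \<chi> x 0 = \<zero>\<^bsub>A\<^esub> \<Longrightarrow> \<exists>y\<in>carrier B. x = hbar k \<odot>\<^bsub>B\<^esub> y"
    and head_commutator: "x \<in> carrier B \<Longrightarrow> y \<in> carrier B \<Longrightarrow>
      \<exists>c\<in>carrier B. x \<otimes>\<^bsub>B\<^esub> y = y \<otimes>\<^bsub>B\<^esub> x \<oplus>\<^bsub>B\<^esub> hbar k \<odot>\<^bsub>B\<^esub> c \<and> \<chi> c 0 = \<lbrace>\<chi> x 0, \<chi> y 0\<rbrace>\<^bsub>A\<^esub>"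
begin

abbreviation kh where "kh \<equiv> power_series_ring k"
abbreviation T where "T \<equiv> TA.T"
abbreviation R where "R \<equiv> TB.T"

definition heads :: "(nat \<Rightarrow> 'b) \<Rightarrow> nat \<Rightarrow> 'a" where "heads x = (\<lambda>i\<in>{1..n}. \<chi> (x i) 0)"

lemma heads_closed [simp]: "x \<in> TB.tup \<Longrightarrow> heads x \<in> TA.tup"
  unfolding heads_def tuples_def by (auto simp: PiE_iff)

lemma heads_upd: "i \<in> {1..n} \<Longrightarrow> heads (x(i := a)) = (heads x)(i := \<chi> a 0)"
  by (auto simp: heads_def fun_eq_iff)

lemma head_add: "x \<in> carrier B \<Longrightarrow> y \<in> carrier B \<Longrightarrow> \<chi> (x \<oplus>\<^bsub>B\<^esub> y) 0 = \<chi> x 0 \<oplus>\<^bsub>A\<^esub> \<chi> y 0"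
  by (rule coeff_add)

lemma head_smult: "d \<in> carrier kh \<Longrightarrow> x \<in> carrier B \<Longrightarrow> \<chi> (d \<odot>\<^bsub>B\<^esub> x) 0 = d 0 \<odot>\<^bsub>A\<^esub> \<chi> x 0"
  by (simp add: coeff_smult TA.R.PS_mem)

lemma heads_mult: "x \<in> TB.tup \<Longrightarrow> y \<in> TB.tup \<Longrightarrow> heads (tuple_mult B n x y) = tuple_mult A n (heads x) (heads y)"
  using ring_hom_mult[OF head_hom] by (auto simp: heads_def tuple_mult_def fun_eq_iff)

lemma heads_one: "heads TB.tone = TA.tone"
  using ring_hom_one[OF head_hom] by (auto simp: heads_def TB.tone_def TA.tone_def fun_eq_iff)

lemma hbar_mem [simp]: "hbar k \<in> carrier kh" and const_mem [simp]: "c \<in> carrier k \<Longrightarrow> const_series k c \<in> carrier kh"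
  by (rule TA.R.hbar_closed, rule TA.R.const_series_closed)

text \<open>The universal property of \<open>R\<close>, applied to \<open>T\<close> as a module over
  \<open>k[[\<hbar>]]\<close> on which a series acts through its constant term.\<close>

lemma reduction_exists:
  obtains \<rho> where "\<And>U. U \<in> carrier R \<Longrightarrow> \<rho> U \<in> carrier T"
    "\<And>U V. U \<in> carrier R \<Longrightarrow> V \<in> carrier R \<Longrightarrow> \<rho> (U \<oplus>\<^bsub>R\<^esub> V) = \<rho> U \<oplus>\<^bsub>T\<^esub> \<rho> V"
    "\<And>d U. d \<in> carrier kh \<Longrightarrow> U \<in> carrier R \<Longrightarrow> \<rho> (d \<odot>\<^bsub>R\<^esub> U) = d 0 \<odot>\<^bsub>T\<^esub> \<rho> U"
    "\<And>x. x \<in> TB.tup \<Longrightarrow> \<rho> (TB.pt x) = TA.pt (heads x)"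
proof -
  define f where "f = (\<lambda>d :: nat \<Rightarrow> 'k. d 0 \<odot>\<^bsub>T\<^esub> \<one>\<^bsub>T\<^esub>)"
  have f: "f \<in> ring_hom kh T"
    using ring_hom_trans[OF TA.R.PS_zero_coeff_hom TA.T.smult_one_hom] by (simp add: f_def comp_def)
  have fx: "f d \<otimes>\<^bsub>T\<^esub> U = d 0 \<odot>\<^bsub>T\<^esub> U" if "d \<in> carrier kh" "U \<in> carrier T" for d U
    using that TA.T.smult_conv[of "d 0" U] by (simp add: f_def TA.R.PS_mem)
  have m: "module kh (scalars_by T f)" by (rule module_scalars_by[OF TB.R.is_cring TA.ring_T f])
  have ml: "TB.multilinear (scalars_by T f) (\<lambda>x. TA.pt (heads x))"
    unfolding TB.multilinear_def
    by (auto simp: heads_upd head_add head_smult fx TA.R.PS_mem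
        TA.multilinearD(2,3)[OF TA.pt_multilinear] simp del: atLeastAtMost_iff)
  obtain \<Lambda> where \<Lambda>: "\<And>U. U \<in> carrier R \<Longrightarrow> \<Lambda> U \<in> carrier (scalars_by T f)"
    "\<And>U V. U \<in> carrier R \<Longrightarrow> V \<in> carrier R \<Longrightarrow> \<Lambda> (U \<oplus>\<^bsub>R\<^esub> V) = \<Lambda> U \<oplus>\<^bsub>scalars_by T f\<^esub> \<Lambda> V"
    "\<And>d U. d \<in> carrier kh \<Longrightarrow> U \<in> carrier R \<Longrightarrow> \<Lambda> (d \<odot>\<^bsub>R\<^esub> U) = d \<odot>\<^bsub>scalars_by T f\<^esub> \<Lambda> U"
    "\<And>x. x \<in> TB.tup \<Longrightarrow> \<Lambda> (TB.pt x) = TA.pt (heads x)"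
    by (rule TB.universal[OF m ml]) blast
  show thesis
    using \<Lambda> by (intro that[of \<Lambda>]) (simp_all add: fx)
qed

end

locale tensor_reduction = tensor_deformation k A n B \<chi>
  for k :: "('k, 'm) ring_scheme" and A :: "('k, 'a, 'z) poisson_scheme" and n
    and B :: "(nat \<Rightarrow> 'k, 'b, 'w) poisson_scheme" and \<chi> +
  fixes \<rho>
  assumes rho_closed [simp]: "U \<in> carrier R \<Longrightarrow> \<rho> U \<in> carrier T"
    and rho_add: "U \<in> carrier R \<Longrightarrow> V \<in> carrier R \<Longrightarrow> \<rho> (U \<oplus>\<^bsub>R\<^esub> V) = \<rho> U \<oplus>\<^bsub>T\<^esub> \<rho> V"
    and rho_smult: "d \<in> carrier kh \<Longrightarrow> U \<in> carrier R \<Longrightarrow> \<rho> (d \<odot>\<^bsub>R\<^esub> U) = d 0 \<odot>\<^bsub>T\<^esub> \<rho> U"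
    and rho_pt: "x \<in> TB.tup \<Longrightarrow> \<rho> (TB.pt x) = TA.pt (heads x)"
begin

lemma rho_zero: "\<rho> \<zero>\<^bsub>R\<^esub> = \<zero>\<^bsub>T\<^esub>"
  using rho_add[of "\<zero>\<^bsub>R\<^esub>" "\<zero>\<^bsub>R\<^esub>"] rho_closed[of "\<zero>\<^bsub>R\<^esub>"] by (simp add: TA.T.M.add.r_cancel_one')

lemma rho_hom: "\<rho> \<in> ring_hom R T"
proof (rule ring_hom_memI)
  have 1: "\<rho> (TB.pt x \<otimes>\<^bsub>R\<^esub> V) = \<rho> (TB.pt x) \<otimes>\<^bsub>T\<^esub> \<rho> V" if x: "x \<in> TB.tup" and V: "V \<in> carrier R" for x V
    using n V
  proof (induction V rule: TB.T_induct)
    case (pure y)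
    then show ?case using x by (simp add: TB.pt_mult rho_pt heads_mult TA.pt_mult)
  qed (use x in \<open>simp_all add: rho_zero TB.T.B.r_distr rho_add TA.T.B.r_distr\<close>)
  show "\<rho> (U \<otimes>\<^bsub>R\<^esub> V) = \<rho> U \<otimes>\<^bsub>T\<^esub> \<rho> V" if "U \<in> carrier R" and V: "V \<in> carrier R" for U V
    using n that(1)
  proof (induction U rule: TB.T_induct)
    case (pure y)
    then show ?case using 1 V by simp
  qed (use V in \<open>simp_all add: rho_zero TB.T.B.l_distr rho_add TA.T.B.l_distr\<close>)
  show "\<rho> \<one>\<^bsub>R\<^esub> = \<one>\<^bsub>T\<^esub>"
    by (simp add: TB.pt_one[symmetric] rho_pt heads_one TA.pt_one)
qed (simp_all add: rho_add)

lemma lift_exists: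
  assumes "x \<in> TA.tup"
  shows "\<exists>y\<in>TB.tup. heads y = x"
proof -
  have "\<exists>b. b \<in> carrier B \<and> \<chi> b 0 = x i" if "i \<in> {1..n}" for i
    using head_surj[of "x i"] TA.tuples_closed[OF assms that] by blast
  then obtain s where s: "\<And>i. i \<in> {1..n} \<Longrightarrow> s i \<in> carrier B \<and> \<chi> (s i) 0 = x i" by metis
  have "heads (restrict s {1..n}) = x"
    using s assms by (auto simp: heads_def fun_eq_iff tuples_def PiE_iff extensional_def)
  then show ?thesis using s by (intro bexI[of _ "restrict s {1..n}"]) (auto simp: tuples_def)
qed

lemma rho_surj: "\<rho> ` carrier R = carrier T"
proof (intro equalityI subsetI)
  fix U assume "U \<in> carrier T"
  with n show "U \<in> \<rho> ` carrier R"
  proof (induction U rule: TA.T_induct)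
    case zero
    show ?case by (rule image_eqI[of _ _ "\<zero>\<^bsub>R\<^esub>"]) (simp_all add: rho_zero)
  next
    case (pure x)
    then obtain y where "y \<in> TB.tup" "heads y = x" using lift_exists by blast
    then show ?case by (intro image_eqI[of _ _ "TB.pt y"]) (simp_all add: rho_pt)
  next
    case (add U V)
    then obtain U' V' where "U' \<in> carrier R" "U = \<rho> U'" "V' \<in> carrier R" "V = \<rho> V'" by blast
    then show ?case by (intro image_eqI[of _ _ "U' \<oplus>\<^bsub>R\<^esub> V'"]) (simp_all add: rho_add)
  qed
qed auto

definition h where "h = hbar k \<odot>\<^bsub>R\<^esub> \<one>\<^bsub>R\<^esub>"

lemma h_closed [simp]: "h \<in> carrier R"
  by (simp add: h_def)

lemma h_mult: "U \<in> carrier R \<Longrightarrow> h \<otimes>\<^bsub>R\<^esub> U = hbar k \<odot>\<^bsub>R\<^esub> U"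
  unfolding h_def by (rule TB.T.smult_conv[symmetric]) simp_all

lemma h_central: "U \<in> carrier R \<Longrightarrow> U \<otimes>\<^bsub>R\<^esub> h = h \<otimes>\<^bsub>R\<^esub> U"
  unfolding h_def by (rule TB.T.smult_one_central) simp_all

definition H where "H = (\<lambda>U. hbar k \<odot>\<^bsub>R\<^esub> U) ` carrier R"

lemma ideal_H: "ideal H R"
proof (rule idealI[OF TB.ring_T])
  show "subgroup H (add_monoid R)"
  proof (rule TB.T.M.add.subgroupI)
    show "H \<noteq> {}" using TB.T.M.zero_closed by (auto simp: H_def)
    fix U V assume "U \<in> H" "V \<in> H"
    then obtain U' V' where *: "U' \<in> carrier R" "V' \<in> carrier R" "U = hbar k \<odot>\<^bsub>R\<^esub> U'" "V = hbar k \<odot>\<^bsub>R\<^esub> V'"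
      by (auto simp: H_def)
    show "U \<oplus>\<^bsub>R\<^esub> V \<in> H" using * by (auto simp: H_def TB.T.smult_r_distr[symmetric])
    show "\<ominus>\<^bsub>R\<^esub> U \<in> H" using * by (auto simp: H_def TB.T.smult_r_minus[symmetric])
  qed (auto simp: H_def)
  fix U V assume "U \<in> H" and V: "V \<in> carrier R"
  then obtain U' where *: "U' \<in> carrier R" "U = hbar k \<odot>\<^bsub>R\<^esub> U'" by (auto simp: H_def)
  show "V \<otimes>\<^bsub>R\<^esub> U \<in> H" "U \<otimes>\<^bsub>R\<^esub> V \<in> H"
    using * V by (auto simp: H_def TB.T.smult_mult_left TB.T.smult_mult_right)
qed

text \<open>The map from \<open>R/\<hbar>R\<close> to \<open>T\<close> induced by
  \<open>\<rho>\<close> has a left inverse, built from the universal property of \<open>T\<close>: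
  lift the entries of a tuple to \<open>B\<close>, form their tensor in \<open>R\<close>, and pass
  to \<open>R/\<hbar>R\<close>.\<close>

lemma rho_kernel:
  assumes U: "U \<in> carrier R" and 0: "\<rho> U = \<zero>\<^bsub>T\<^esub>"
  shows "\<exists>V\<in>carrier R. U = h \<otimes>\<^bsub>R\<^esub> V"
proof -
  interpret H: ideal H R by (rule ideal_H)
  define q where "q = (+>\<^bsub>R\<^esub>) H"
  have q: "q \<in> ring_hom R (R Quot H)" unfolding q_def by (rule H.rcos_ring_hom)
  interpret RQ: ring "R Quot H" by (rule H.quotient_is_ring)
  have q0: "q U = \<zero>\<^bsub>R Quot H\<^esub> \<longleftrightarrow> U \<in> H" if "U \<in> carrier R" for U
    unfolding q_def using H.a_rcos_const H.rcos_const_imp_mem[OF that] by (auto simp: FactRing_def)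
  have qh: "q (hbar k \<odot>\<^bsub>R\<^esub> V) = \<zero>\<^bsub>R Quot H\<^esub>" if "V \<in> carrier R" for V
    using that q0[of "hbar k \<odot>\<^bsub>R\<^esub> V"] by (auto simp: H_def)
  note qs = ring_hom_closed[OF q] ring_hom_add[OF q] ring_hom_mult[OF q]
  define f where "f c = q (const_series k c \<odot>\<^bsub>R\<^esub> \<one>\<^bsub>R\<^esub>)" for c
  have "q \<circ> ((\<lambda>d. d \<odot>\<^bsub>R\<^esub> \<one>\<^bsub>R\<^esub>) \<circ> const_series k) = f" by (auto simp: f_def)
  then have f: "f \<in> ring_hom k (R Quot H)"
    using ring_hom_trans[OF ring_hom_trans[OF TA.R.const_series_hom TB.T.smult_one_hom] q] by simp
  have fq: "f c \<otimes>\<^bsub>R Quot H\<^esub> q V = q (const_series k c \<odot>\<^bsub>R\<^esub> V)" if "c \<in> carrier k" "V \<in> carrier R" for c V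
    using that TB.T.smult_conv[of "const_series k c" V] by (simp add: f_def qs)
  define G where "G = scalars_by (R Quot H) f"
  have G: "module k G" unfolding G_def by (rule module_scalars_by[OF TA.R.is_cring RQ.ring_axioms f])
  \<comment> \<open>Modulo \<hbar> a tensor depends only on the reductions of its entries. The
    entries of \<open>y\<close> are exchanged for those of \<open>x\<close> one at a time, and each
    exchange adds a multiple of \<hbar>.\<close>
  have pt_cong: "q (TB.pt x) = q (TB.pt y)"
    if x: "x \<in> TB.tup" and y: "y \<in> TB.tup" and xy: "heads x = heads y" for x y
  proof -
    have e: "\<chi> (x i) 0 = \<chi> (y i) 0" if "i \<in> {1..n}" for i
      using fun_cong[OF xy, of i] that by (simp add: heads_def)
    define Z where "Z J = (\<lambda>i\<in>{1..n}. if i \<in> J then x i else y i)" for J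
    have Z: "Z J \<in> TB.tup" for J using x y by (auto simp: Z_def tuples_def)
    have "q (TB.pt (Z J)) = q (TB.pt y)" if "finite J" "J \<subseteq> {1..n}" for J
      using that
    proof (induction J rule: finite_induct)
      case empty
      have "Z {} = y" using y by (auto simp: Z_def tuples_def PiE_iff extensional_def fun_eq_iff)
      then show ?case by simp
    next
      case (insert j J)
      have j: "j \<in> {1..n}" using insert.prems by simp
      have xc: "x j \<in> carrier B" "y j \<in> carrier B" using x y j by simp_all
      have "\<chi> (x j \<ominus>\<^bsub>B\<^esub> y j) 0 = \<zero>\<^bsub>A\<^esub>"
      proof -
        have "\<chi> (x j) 0 = \<chi> ((x j \<ominus>\<^bsub>B\<^esub> y j) \<oplus>\<^bsub>B\<^esub> y j) 0"
          using xc by (simp add: a_minus_def TB.M.a_assoc TB.M.l_neg)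
        also have "\<dots> = \<chi> (x j \<ominus>\<^bsub>B\<^esub> y j) 0 \<oplus>\<^bsub>A\<^esub> \<chi> (x j) 0" using xc e[OF j] by (simp add: head_add)
        finally have eq: "\<chi> (x j) 0 = \<chi> (x j \<ominus>\<^bsub>B\<^esub> y j) 0 \<oplus>\<^bsub>A\<^esub> \<chi> (x j) 0" .
        show ?thesis
          by (rule iffD1[OF TA.M.add.r_cancel_one'[OF coeff_closed coeff_closed] eq]) (use xc in simp_all)
      qed
      then obtain b where b: "b \<in> carrier B" "x j \<ominus>\<^bsub>B\<^esub> y j = hbar k \<odot>\<^bsub>B\<^esub> b"
        using head_kernel[of "x j \<ominus>\<^bsub>B\<^esub> y j"] xc by auto
      have xj: "x j = y j \<oplus>\<^bsub>B\<^esub> hbar k \<odot>\<^bsub>B\<^esub> b"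
        unfolding b(2)[symmetric] using xc by (simp add: a_minus_def TB.M.a_ac TB.M.r_neg1 TB.M.r_neg)
      have zj: "Z (insert j J) = (Z J)(j := x j)" "Z J = (Z J)(j := y j)"
        using j insert.hyps(2) by (auto simp: Z_def fun_eq_iff)
      have "TB.pt (Z (insert j J)) = TB.pt (Z J) \<oplus>\<^bsub>R\<^esub> hbar k \<odot>\<^bsub>R\<^esub> TB.pt ((Z J)(j := b))"
        unfolding zj(1) xj using xc b(1) TB.multilinearD(2)[OF TB.pt_multilinear Z j xc(2), of "hbar k \<odot>\<^bsub>B\<^esub> b"]
          TB.multilinearD(3)[OF TB.pt_multilinear Z j hbar_mem b(1)] zj(2)[symmetric] by simp
      then have "q (TB.pt (Z (insert j J))) = q (TB.pt (Z J))"
        using Z j b(1) by (simp add: qs qh)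
      then show ?case using insert by simp
    qed
    note * = this
    have "Z {1..n} = x" using x by (auto simp: Z_def tuples_def PiE_iff extensional_def fun_eq_iff)
    then show ?thesis using *[OF finite_atLeastAtMost order_refl] by (simp only:)
  qed
  obtain s where s: "\<And>a. a \<in> carrier A \<Longrightarrow> s a \<in> carrier B \<and> \<chi> (s a) 0 = a" using head_surj by metis
  define L where "L x = (\<lambda>i\<in>{1..n}. s (x i))" for x :: "nat \<Rightarrow> 'a"
  have L: "L x \<in> TB.tup" "heads (L x) = x" if x: "x \<in> TA.tup" for x
  proof -
    have "s (x i) \<in> carrier B \<and> \<chi> (s (x i)) 0 = x i" if "i \<in> {1..n}" for i using s x that by simp
    then show "L x \<in> TB.tup" "heads (L x) = x"
      using x by (auto simp: L_def heads_def tuples_def PiE_iff extensional_def fun_eq_iff)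
  qed
  have Lq: "q (TB.pt (L x)) = q (TB.pt y)" if "x \<in> TA.tup" "y \<in> TB.tup" "heads y = x" for x y
    using that L by (intro pt_cong) simp_all
  \<comment> \<open>The lifts \<open>s\<close> are chosen without any linearity. By
    \<open>pt_cong\<close> the result does not depend on them, so a sum may be lifted to the sum of
    the lifts, and likewise for scalar multiples.\<close>
  have ml: "TA.multilinear G (\<lambda>x. q (TB.pt (L x)))"
    unfolding TA.multilinear_def
  proof (intro conjI ballI)
    show "(\<lambda>x. q (TB.pt (L x))) \<in> TA.tup \<rightarrow> carrier G" using L qs by (auto simp: G_def)
    fix x i a assume x: "x \<in> TA.tup" and i: "i \<in> {1..n}" and a: "a \<in> carrier A"
    note u = TA.tuple_upd[OF x i] and v = TB.tuple_upd[OF L(1)[OF x] i]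
    have h1: "heads ((L x)(i := b)) = x(i := \<chi> b 0)" for b using L(2)[OF x] i by (simp add: heads_upd)
    { fix b assume b: "b \<in> carrier A"
      have "q (TB.pt (L (x(i := a \<oplus>\<^bsub>A\<^esub> b)))) = q (TB.pt ((L x)(i := s a \<oplus>\<^bsub>B\<^esub> s b)))"
        using u v s a b h1 by (intro Lq) (simp_all add: head_add)
      also have "\<dots> = q (TB.pt ((L x)(i := s a))) \<oplus>\<^bsub>G\<^esub> q (TB.pt ((L x)(i := s b)))"
        using TB.multilinearD(2)[OF TB.pt_multilinear L(1)[OF x] i, of "s a" "s b"] s a b v by (simp add: qs G_def)
      also have "q (TB.pt ((L x)(i := s a))) = q (TB.pt (L (x(i := a))))"
        using u v s a h1 by (intro Lq[symmetric]) simp_all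
      also have "q (TB.pt ((L x)(i := s b))) = q (TB.pt (L (x(i := b))))"
        using u v s b h1 by (intro Lq[symmetric]) simp_all
      finally show "q (TB.pt (L (x(i := a \<oplus>\<^bsub>A\<^esub> b)))) = q (TB.pt (L (x(i := a)))) \<oplus>\<^bsub>G\<^esub> q (TB.pt (L (x(i := b))))" . }
    fix c assume c: "c \<in> carrier k"
    have c0: "const_series k c 0 = c" by (simp add: const_series_def)
    have "q (TB.pt (L (x(i := c \<odot>\<^bsub>A\<^esub> a)))) = q (TB.pt ((L x)(i := const_series k c \<odot>\<^bsub>B\<^esub> s a)))"
      using u v s a c h1 by (intro Lq) (simp_all add: head_smult c0)
    also have "\<dots> = c \<odot>\<^bsub>G\<^esub> q (TB.pt ((L x)(i := s a)))"
      using TB.multilinearD(3)[OF TB.pt_multilinear L(1)[OF x] i, of "const_series k c" "s a"] s a c v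
      by (simp add: G_def fq)
    also have "q (TB.pt ((L x)(i := s a))) = q (TB.pt (L (x(i := a))))"
      using u v s a h1 by (intro Lq[symmetric]) simp_all
    finally show "q (TB.pt (L (x(i := c \<odot>\<^bsub>A\<^esub> a)))) = c \<odot>\<^bsub>G\<^esub> q (TB.pt (L (x(i := a))))" .
  qed
  obtain \<Lambda> where \<Lambda>: "\<And>U. U \<in> carrier T \<Longrightarrow> \<Lambda> U \<in> carrier G"
    "\<And>U V. U \<in> carrier T \<Longrightarrow> V \<in> carrier T \<Longrightarrow> \<Lambda> (U \<oplus>\<^bsub>T\<^esub> V) = \<Lambda> U \<oplus>\<^bsub>G\<^esub> \<Lambda> V"
    "\<And>x. x \<in> TA.tup \<Longrightarrow> \<Lambda> (TA.pt x) = q (TB.pt (L x))"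
    by (rule TA.universal[OF G ml]) blast
  have \<Lambda>0: "\<Lambda> \<zero>\<^bsub>T\<^esub> = \<zero>\<^bsub>R Quot H\<^esub>"
    using \<Lambda>(2)[of "\<zero>\<^bsub>T\<^esub>" "\<zero>\<^bsub>T\<^esub>"] \<Lambda>(1)[of "\<zero>\<^bsub>T\<^esub>"] by (simp add: G_def RQ.add.r_cancel_one')
  have "\<Lambda> (\<rho> V) = q V" if "V \<in> carrier R" for V
    using n that
  proof (induction V rule: TB.T_induct)
    case zero
    have "q \<zero>\<^bsub>R\<^esub> = \<zero>\<^bsub>R Quot H\<^esub>" by (rule ring_hom_zero[OF q TB.ring_T RQ.ring_axioms])
    then show ?case using \<Lambda>0 rho_zero by simp
  next
    case (pure x)
    then show ?case using Lq[of "heads x" x] by (simp add: rho_pt \<Lambda>(3))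
  next
    case (add U V)
    then show ?case by (simp add: rho_add \<Lambda>(2) qs G_def)
  qed
  then have "q U = \<zero>\<^bsub>R Quot H\<^esub>" using U 0 \<Lambda>0 by metis
  then have "U \<in> H" using q0 U by simp
  then show ?thesis by (auto simp: H_def h_mult)
qed

abbreviation TP where "TP \<equiv> power_series_ring T"

definition slots where "slots i x = (\<lambda>m. TA.slot i (\<chi> x m))"

lemma slots_closed [simp]: "i \<in> {1..n} \<Longrightarrow> x \<in> carrier B \<Longrightarrow> slots i x \<in> carrier TP"
  by (simp add: slots_def T.PS_mem)

definition ts where "ts d = (\<lambda>m :: nat. d m \<odot>\<^bsub>T\<^esub> \<one>\<^bsub>T\<^esub>)"

lemma ts_hom: "ts \<in> ring_hom kh TP"
  using power_series_map_hom[OF TA.R.is_cring T.is_cring TA.T.smult_one_hom] by (simp add: ts_def[abs_def])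

lemma slots_add: "i \<in> {1..n} \<Longrightarrow> x \<in> carrier B \<Longrightarrow> y \<in> carrier B \<Longrightarrow> slots i (x \<oplus>\<^bsub>B\<^esub> y) = slots i x \<oplus>\<^bsub>TP\<^esub> slots i y"
  by (simp add: slots_def T.PS_simps coeff_add TA.slot_add)

text \<open>The convolution rule \<open>coeff_smult\<close> is the multiplication of two power
  series, here carried into one tensor factor.\<close>

lemma slots_smult:
  assumes i: "i \<in> {1..n}" and d: "d \<in> carrier kh" and x: "x \<in> carrier B"
  shows "slots i (d \<odot>\<^bsub>B\<^esub> x) = ts d \<otimes>\<^bsub>TP\<^esub> slots i x"
proof
  fix m
  have dc: "d j \<in> carrier k" for j using d by (simp add: TA.R.PS_mem)
  have "slots i (d \<odot>\<^bsub>B\<^esub> x) m = (\<Oplus>\<^bsub>T\<^esub>j\<in>{..m}. TA.slot i (d j \<odot>\<^bsub>A\<^esub> \<chi> x (m - j)))"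
    unfolding slots_def coeff_smult[OF d x] using dc x by (intro TA.slot_linear_finsum i) auto
  also have "\<dots> = (\<Oplus>\<^bsub>T\<^esub>j\<in>{..m}. (d j \<odot>\<^bsub>T\<^esub> \<one>\<^bsub>T\<^esub>) \<otimes>\<^bsub>T\<^esub> TA.slot i (\<chi> x (m - j)))"
  proof (rule TA.T.M.finsum_cong')
    show "TA.slot i (d j \<odot>\<^bsub>A\<^esub> \<chi> x (m - j)) = (d j \<odot>\<^bsub>T\<^esub> \<one>\<^bsub>T\<^esub>) \<otimes>\<^bsub>T\<^esub> TA.slot i (\<chi> x (m - j))" for j
      using TA.T.smult_conv[OF dc, of "TA.slot i (\<chi> x (m - j))" j] dc x i by (simp add: TA.slot_smult)
  qed (use dc x i in auto)
  finally show "slots i (d \<odot>\<^bsub>B\<^esub> x) m = (ts d \<otimes>\<^bsub>TP\<^esub> slots i x) m"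
    by (simp add: T.PS_simps ts_def slots_def)
qed

text \<open>\<open>P\<close> sends a pure tensor to the product in \<open>T[[\<hbar>]]\<close> of
  the coefficient series of its entries, each placed in its tensor factor. It is linear over
  \<open>k[[\<hbar>]]\<close> and takes values in a ring where \<hbar> can be cancelled, so it tests
  divisibility by \<hbar> in \<open>R\<close>.\<close>

lemma rho_graded_aux:
  obtains P where "\<And>U. U \<in> carrier R \<Longrightarrow> P U \<in> carrier TP" "\<And>U. U \<in> carrier R \<Longrightarrow> P U 0 = \<rho> U"
    "\<And>U. U \<in> carrier R \<Longrightarrow> P (h \<otimes>\<^bsub>R\<^esub> U) = hbar T \<otimes>\<^bsub>TP\<^esub> P U"
proof -
  interpret TP: cring TP by (rule T.PS_cring)
  define g where "g x = (\<Otimes>\<^bsub>TP\<^esub>i\<in>{1..n}. slots i (x i))" for x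
  define G where "G = scalars_by TP ts"
  have G: "module kh G" unfolding G_def by (rule module_scalars_by[OF TB.R.is_cring TP.ring_axioms ts_hom])
  \<comment> \<open>The factor that belongs to the entry \<open>i\<close> is split off;
    \<open>g\<close> is linear in it because \<open>slots i\<close> is.\<close>
  have upd: "g (x(i := a)) = slots i a \<otimes>\<^bsub>TP\<^esub> (\<Otimes>\<^bsub>TP\<^esub>j\<in>{1..n} - {i}. slots j (x j))"
    if x: "x \<in> TB.tup" and i: "i \<in> {1..n}" and a: "a \<in> carrier B" for x i a
  proof -
    have "g (x(i := a)) = (\<Otimes>\<^bsub>TP\<^esub>j\<in>insert i ({1..n} - {i}). slots j ((x(i := a)) j))"
      unfolding g_def using i by (simp add: insert_absorb)
    also have "\<dots> = slots i ((x(i := a)) i) \<otimes>\<^bsub>TP\<^esub> (\<Otimes>\<^bsub>TP\<^esub>j\<in>{1..n} - {i}. slots j ((x(i := a)) j))"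
      using x i a by (intro TP.finprod_insert) auto
    also have "(\<Otimes>\<^bsub>TP\<^esub>j\<in>{1..n} - {i}. slots j ((x(i := a)) j)) = (\<Otimes>\<^bsub>TP\<^esub>j\<in>{1..n} - {i}. slots j (x j))"
      using x by (intro TP.finprod_cong') auto
    finally show ?thesis by (simp only: fun_upd_same)
  qed
  have g_closed: "g x \<in> carrier TP" if "x \<in> TB.tup" for x
    unfolding g_def using that by (intro TP.finprod_closed) auto
  have rest: "(\<Otimes>\<^bsub>TP\<^esub>j\<in>{1..n} - {i}. slots j (x j)) \<in> carrier TP" if "x \<in> TB.tup" for x i
    using that by (intro TP.finprod_closed) auto
  have ml: "TB.multilinear G g"
    unfolding TB.multilinear_def
  proof (intro conjI ballI)
    show "g \<in> TB.tup \<rightarrow> carrier G" using g_closed by (simp add: G_def)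
    fix x i a assume x: "x \<in> TB.tup" and i: "i \<in> {1..n}" and a: "a \<in> carrier B"
    show "g (x(i := a \<oplus>\<^bsub>B\<^esub> b)) = g (x(i := a)) \<oplus>\<^bsub>G\<^esub> g (x(i := b))" if b: "b \<in> carrier B" for b
      using upd[OF x i a] upd[OF x i b] upd[OF x i, of "a \<oplus>\<^bsub>B\<^esub> b"] rest[OF x, of i] i a b
      by (simp add: G_def slots_add TP.l_distr)
    show "g (x(i := d \<odot>\<^bsub>B\<^esub> a)) = d \<odot>\<^bsub>G\<^esub> g (x(i := a))" if d: "d \<in> carrier kh" for d
      using upd[OF x i a] upd[OF x i, of "d \<odot>\<^bsub>B\<^esub> a"] rest[OF x, of i] i a d ring_hom_closed[OF ts_hom d]
      by (simp add: G_def slots_smult TP.m_assoc)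
  qed
  obtain P where P: "\<And>U. U \<in> carrier R \<Longrightarrow> P U \<in> carrier G"
    "\<And>U V. U \<in> carrier R \<Longrightarrow> V \<in> carrier R \<Longrightarrow> P (U \<oplus>\<^bsub>R\<^esub> V) = P U \<oplus>\<^bsub>G\<^esub> P V"
    "\<And>d U. d \<in> carrier kh \<Longrightarrow> U \<in> carrier R \<Longrightarrow> P (d \<odot>\<^bsub>R\<^esub> U) = d \<odot>\<^bsub>G\<^esub> P U"
    "\<And>x. x \<in> TB.tup \<Longrightarrow> P (TB.pt x) = g x"
    by (rule TB.universal[OF G ml]) blast
  interpret c0: ring_hom_cring TP T "\<lambda>c. c 0"
    by (intro ring_hom_cring.intro T.PS_cring T.is_cring ring_hom_cring_axioms.intro T.PS_zero_coeff_hom)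
  have P0: "P U 0 = \<rho> U" if "U \<in> carrier R" for U
    using n that
  proof (induction U rule: TB.T_induct)
    case zero
    have "P \<zero>\<^bsub>R\<^esub> = \<zero>\<^bsub>TP\<^esub>"
      using P(2)[of "\<zero>\<^bsub>R\<^esub>" "\<zero>\<^bsub>R\<^esub>"] P(1)[of "\<zero>\<^bsub>R\<^esub>"] by (simp add: G_def TP.add.r_cancel_one')
    then show ?case by (simp add: rho_zero T.PS_simps)
  next
    case (pure x)
    have "P (TB.pt x) 0 = (\<Otimes>\<^bsub>T\<^esub>i\<in>{1..n}. ((\<lambda>c. c 0) \<circ> (\<lambda>i. slots i (x i))) i)"
      unfolding P(4)[OF pure] g_def using pure by (subst c0.hom_finprod) (auto simp: comp_def)
    also have "\<dots> = (\<Otimes>\<^bsub>T\<^esub>i\<in>{1..n}. TA.slot i (heads x i))"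
      using pure by (intro T.finprod_cong') (auto simp: slots_def heads_def)
    also have "\<dots> = \<rho> (TB.pt x)"
      using TA.pt_eq_finprod[OF T.is_cring heads_closed[OF pure]] rho_pt[OF pure] by simp
    finally show ?case .
  next
    case (add U V)
    then show ?case by (simp add: P(2) G_def rho_add) (simp add: T.PS_simps)
  qed
  have "ts (hbar k) = hbar T"
    by (simp add: ts_def hbar_def fun_eq_iff)
  then have "P (h \<otimes>\<^bsub>R\<^esub> U) = hbar T \<otimes>\<^bsub>TP\<^esub> P U" if "U \<in> carrier R" for U
    using that by (simp add: h_mult P(3) G_def)
  then show thesis using that[of P] P(1) P0 by (simp add: G_def)
qed

text \<open>Applying \<open>P\<close> and cancelling \<open>\<hbar>^N\<close> in
  \<open>T[[\<hbar>]]\<close> gives that \<open>P U\<close> is \<hbar> times \<open>P V\<close>; the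
  constant term of \<open>P U\<close> is \<open>\<rho> U\<close>.\<close>

lemma rho_graded:
  assumes U: "U \<in> carrier R" and V: "V \<in> carrier R" and UV: "h [^]\<^bsub>R\<^esub> N \<otimes>\<^bsub>R\<^esub> U = h [^]\<^bsub>R\<^esub> Suc N \<otimes>\<^bsub>R\<^esub> V"
  shows "\<rho> U = \<zero>\<^bsub>T\<^esub>"
proof -
  obtain P where P: "\<And>U. U \<in> carrier R \<Longrightarrow> P U \<in> carrier TP" "\<And>U. U \<in> carrier R \<Longrightarrow> P U 0 = \<rho> U"
    "\<And>U. U \<in> carrier R \<Longrightarrow> P (h \<otimes>\<^bsub>R\<^esub> U) = hbar T \<otimes>\<^bsub>TP\<^esub> P U" by (rule rho_graded_aux) blast
  have inj: "P U = P W" if "P (h [^]\<^bsub>R\<^esub> N \<otimes>\<^bsub>R\<^esub> U) = P (h [^]\<^bsub>R\<^esub> N \<otimes>\<^bsub>R\<^esub> W)" "U \<in> carrier R" "W \<in> carrier R"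
    for N :: nat and U W
    using that
  proof (induction N)
    case (Suc N)
    define U' W' where "U' = h [^]\<^bsub>R\<^esub> N \<otimes>\<^bsub>R\<^esub> U" and "W' = h [^]\<^bsub>R\<^esub> N \<otimes>\<^bsub>R\<^esub> W"
    have c: "U' \<in> carrier R" "W' \<in> carrier R" using Suc.prems by (simp_all add: U'_def W'_def)
    have e: "h [^]\<^bsub>R\<^esub> Suc N \<otimes>\<^bsub>R\<^esub> V = h \<otimes>\<^bsub>R\<^esub> (h [^]\<^bsub>R\<^esub> N \<otimes>\<^bsub>R\<^esub> V)" if "V \<in> carrier R" for V
      using that TB.T.B.nat_pow_Suc2[OF h_closed, of N] by (simp add: TB.T.B.m_assoc)
    have "hbar T \<otimes>\<^bsub>TP\<^esub> P U' = hbar T \<otimes>\<^bsub>TP\<^esub> P W'"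
      using Suc.prems c by (simp only: e U'_def[symmetric] W'_def[symmetric] P(3))
    then have "P U' m = P W' m" for m
      using T.hbar_mult_at(2)[OF P(1)[OF c(1)], of m] T.hbar_mult_at(2)[OF P(1)[OF c(2)], of m] by simp
    then have "P U' = P W'" by auto
    then show ?case using Suc.IH Suc.prems by (simp add: U'_def W'_def)
  qed simp
  have hV: "h \<otimes>\<^bsub>R\<^esub> V \<in> carrier R" using V by simp
  have "h [^]\<^bsub>R\<^esub> N \<otimes>\<^bsub>R\<^esub> U = h [^]\<^bsub>R\<^esub> N \<otimes>\<^bsub>R\<^esub> (h \<otimes>\<^bsub>R\<^esub> V)"
    unfolding UV using V by (simp add: TB.T.B.m_assoc)
  from inj[OF arg_cong[OF this, of P] U hV] have "P U = P (h \<otimes>\<^bsub>R\<^esub> V)" .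
  then have "P U 0 = (hbar T \<otimes>\<^bsub>TP\<^esub> P V) 0" using P(3)[OF V] by simp
  then show ?thesis using P(2)[OF U] T.hbar_mult_at(1)[OF P(1)[OF V]] by simp
qed

text \<open>The passage from \<open>y x\<close> to \<open>x y\<close> is made one tensor factor at a
  time: \<open>Z J\<close> has the factors \<open>x_i y_i\<close> for \<open>i\<close> in
  \<open>J\<close> and \<open>y_i x_i\<close> elsewhere. Adding \<open>j\<close> to \<open>J\<close>
  contributes \<hbar> times the tensor with \<open>c_j\<close> at the place \<open>j\<close>, whose
  reduction is the term number \<open>j\<close> of the bracket.\<close>

lemma commutator_pt:
  assumes x: "x \<in> TB.tup" and y: "y \<in> TB.tup"
  shows "\<exists>W\<in>carrier R. TB.pt x \<otimes>\<^bsub>R\<^esub> TB.pt y = TB.pt y \<otimes>\<^bsub>R\<^esub> TB.pt x \<oplus>\<^bsub>R\<^esub> h \<otimes>\<^bsub>R\<^esub> W \<and>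
    \<rho> W = \<lbrace>\<rho> (TB.pt x), \<rho> (TB.pt y)\<rbrace>\<^bsub>T\<^esub>"
proof -
  have "\<exists>c. c \<in> carrier B \<and> x i \<otimes>\<^bsub>B\<^esub> y i = y i \<otimes>\<^bsub>B\<^esub> x i \<oplus>\<^bsub>B\<^esub> hbar k \<odot>\<^bsub>B\<^esub> c \<and> \<chi> c 0 = \<lbrace>\<chi> (x i) 0, \<chi> (y i) 0\<rbrace>\<^bsub>A\<^esub>"
    if "i \<in> {1..n}" for i
    using head_commutator[OF TB.tuples_closed[OF x that] TB.tuples_closed[OF y that]] by blast
  then obtain c where c: "\<And>i. i \<in> {1..n} \<Longrightarrow> c i \<in> carrier B \<and>
      x i \<otimes>\<^bsub>B\<^esub> y i = y i \<otimes>\<^bsub>B\<^esub> x i \<oplus>\<^bsub>B\<^esub> hbar k \<odot>\<^bsub>B\<^esub> c i \<and> \<chi> (c i) 0 = \<lbrace>\<chi> (x i) 0, \<chi> (y i) 0\<rbrace>\<^bsub>A\<^esub>"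
    by metis
  define Z where "Z J = (\<lambda>i\<in>{1..n}. if i \<in> J then x i \<otimes>\<^bsub>B\<^esub> y i else y i \<otimes>\<^bsub>B\<^esub> x i)" for J
  have Z: "Z J \<in> TB.tup" for J using x y by (auto simp: Z_def tuples_def PiE_iff)
  have hZ: "heads (Z J) = tuple_mult A n (heads x) (heads y)" for J
  proof
    fix i
    \<comment> \<open>The two products differ by a multiple of \<hbar>, so they have the same
      reduction; this is how commutativity of \<open>A\<close> enters.\<close>
    have "\<chi> (y i \<otimes>\<^bsub>B\<^esub> x i) 0 = \<chi> (x i) 0 \<otimes>\<^bsub>A\<^esub> \<chi> (y i) 0" if i: "i \<in> {1..n}"
    proof -
      have c0: "x i \<in> carrier B" "y i \<in> carrier B" using x y i by simp_all
      have ci: "c i \<in> carrier B" "x i \<otimes>\<^bsub>B\<^esub> y i = y i \<otimes>\<^bsub>B\<^esub> x i \<oplus>\<^bsub>B\<^esub> hbar k \<odot>\<^bsub>B\<^esub> c i"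
        using c[OF i] by simp_all
      have "\<chi> (x i \<otimes>\<^bsub>B\<^esub> y i) 0 = \<chi> (y i \<otimes>\<^bsub>B\<^esub> x i) 0 \<oplus>\<^bsub>A\<^esub> hbar k 0 \<odot>\<^bsub>A\<^esub> \<chi> (c i) 0"
        unfolding ci(2) using c0 ci(1) by (simp add: head_add head_smult)
      also have "\<dots> = \<chi> (y i \<otimes>\<^bsub>B\<^esub> x i) 0" using c0 ci(1) by (simp add: hbar_def)
      finally show ?thesis using ring_hom_mult[OF head_hom c0] by simp
    qed
    then show "heads (Z J) i = tuple_mult A n (heads x) (heads y) i"
      using x y ring_hom_mult[OF head_hom] by (simp add: heads_def Z_def tuple_mult_def)
  qed
  have br: "heads ((Z J)(i := c i)) = TA.br_tuple i (heads x) (heads y)" if "i \<in> {1..n}" for i J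
    using that c[OF that] by (simp add: heads_upd hZ TA.br_tuple_def) (simp add: heads_def)
  have "\<exists>W\<in>carrier R. TB.pt (Z J) = TB.pt (Z {}) \<oplus>\<^bsub>R\<^esub> h \<otimes>\<^bsub>R\<^esub> W \<and>
      \<rho> W = (\<Oplus>\<^bsub>T\<^esub>i\<in>J. TA.pt (TA.br_tuple i (heads x) (heads y)))" if "finite J" "J \<subseteq> {1..n}" for J
    using that
  proof (induction J rule: finite_induct)
    case empty
    then show ?case by (intro bexI[of _ "\<zero>\<^bsub>R\<^esub>"]) (simp_all add: rho_zero Z)
  next
    case (insert j J)
    then obtain W where W: "W \<in> carrier R" "TB.pt (Z J) = TB.pt (Z {}) \<oplus>\<^bsub>R\<^esub> h \<otimes>\<^bsub>R\<^esub> W"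
      "\<rho> W = (\<Oplus>\<^bsub>T\<^esub>i\<in>J. TA.pt (TA.br_tuple i (heads x) (heads y)))" by auto
    have j: "j \<in> {1..n}" using insert.prems by simp
    have xy: "x j \<in> carrier B" "y j \<in> carrier B" using x y j by simp_all
    define V where "V = TB.pt ((Z J)(j := c j))"
    have V: "V \<in> carrier R" unfolding V_def using Z j c[OF j] by simp
    have zj: "Z (insert j J) = (Z J)(j := x j \<otimes>\<^bsub>B\<^esub> y j)" "Z J = (Z J)(j := y j \<otimes>\<^bsub>B\<^esub> x j)"
      using j insert.hyps(2) by (auto simp: Z_def fun_eq_iff)
    have cj: "c j \<in> carrier B" "x j \<otimes>\<^bsub>B\<^esub> y j = y j \<otimes>\<^bsub>B\<^esub> x j \<oplus>\<^bsub>B\<^esub> hbar k \<odot>\<^bsub>B\<^esub> c j" using c[OF j] by simp_all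
    have "TB.pt (Z (insert j J)) = TB.pt ((Z J)(j := y j \<otimes>\<^bsub>B\<^esub> x j)) \<oplus>\<^bsub>R\<^esub> TB.pt ((Z J)(j := hbar k \<odot>\<^bsub>B\<^esub> c j))"
      unfolding zj(1) cj(2) using xy cj(1) by (intro TB.multilinearD(2)[OF TB.pt_multilinear Z j]) simp_all
    also have "TB.pt ((Z J)(j := y j \<otimes>\<^bsub>B\<^esub> x j)) = TB.pt (Z J)" by (simp only: zj(2)[symmetric])
    also have "TB.pt ((Z J)(j := hbar k \<odot>\<^bsub>B\<^esub> c j)) = h \<otimes>\<^bsub>R\<^esub> V"
      using TB.multilinearD(3)[OF TB.pt_multilinear Z j hbar_mem cj(1)] V by (simp add: V_def h_mult)
    also have "TB.pt (Z J) \<oplus>\<^bsub>R\<^esub> h \<otimes>\<^bsub>R\<^esub> V = TB.pt (Z {}) \<oplus>\<^bsub>R\<^esub> h \<otimes>\<^bsub>R\<^esub> (V \<oplus>\<^bsub>R\<^esub> W)"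
      unfolding W(2) using W(1) V Z[of "{}"] by (simp add: TB.T.B.r_distr TB.T.M.a_ac)
    finally have 1: "TB.pt (Z (insert j J)) = TB.pt (Z {}) \<oplus>\<^bsub>R\<^esub> h \<otimes>\<^bsub>R\<^esub> (V \<oplus>\<^bsub>R\<^esub> W)" .
    have "\<rho> V = TA.pt (TA.br_tuple j (heads x) (heads y))"
      unfolding V_def using Z j cj(1) br[OF j] by (simp add: rho_pt)
    then have "\<rho> (V \<oplus>\<^bsub>R\<^esub> W) = (\<Oplus>\<^bsub>T\<^esub>i\<in>insert j J. TA.pt (TA.br_tuple i (heads x) (heads y)))"
      using V W insert x y by (subst TA.T.M.finsum_insert) (auto simp: rho_add subset_iff)
    then show ?case using 1 V W(1) by (intro bexI[of _ "V \<oplus>\<^bsub>R\<^esub> W"]) simp_all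
  qed
  from this[OF finite_atLeastAtMost order_refl]
  obtain W where W: "W \<in> carrier R" "TB.pt (Z {1..n}) = TB.pt (Z {}) \<oplus>\<^bsub>R\<^esub> h \<otimes>\<^bsub>R\<^esub> W"
    "\<rho> W = (\<Oplus>\<^bsub>T\<^esub>i\<in>{1..n}. TA.pt (TA.br_tuple i (heads x) (heads y)))" by (elim bexE conjE)
  have "Z {1..n} = tuple_mult B n x y" "Z {} = tuple_mult B n y x"
    by (auto simp: Z_def tuple_mult_def fun_eq_iff)
  then have "TB.pt x \<otimes>\<^bsub>R\<^esub> TB.pt y = TB.pt y \<otimes>\<^bsub>R\<^esub> TB.pt x \<oplus>\<^bsub>R\<^esub> h \<otimes>\<^bsub>R\<^esub> W"
    using W(2) x y by (simp add: TB.pt_mult)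
  moreover have "\<rho> W = \<lbrace>\<rho> (TB.pt x), \<rho> (TB.pt y)\<rbrace>\<^bsub>T\<^esub>"
    using x y W(3) by (simp add: rho_pt TA.T_bracket_pt TA.pt_bracket_def)
  ultimately show ?thesis using W(1) by blast
qed

text \<open>Commutator and bracket are additive in both arguments, so the case of pure tensors
  extends first in \<open>V\<close> and then in \<open>U\<close>; the elements \<open>W\<close> add
  up.\<close>

lemma commutator:
  assumes U: "U \<in> carrier R" and V: "V \<in> carrier R"
  shows "\<exists>W\<in>carrier R. U \<otimes>\<^bsub>R\<^esub> V = V \<otimes>\<^bsub>R\<^esub> U \<oplus>\<^bsub>R\<^esub> h \<otimes>\<^bsub>R\<^esub> W \<and> \<rho> W = \<lbrace>\<rho> U, \<rho> V\<rbrace>\<^bsub>T\<^esub>"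
proof -
  have 1: "\<exists>W\<in>carrier R. TB.pt x \<otimes>\<^bsub>R\<^esub> V = V \<otimes>\<^bsub>R\<^esub> TB.pt x \<oplus>\<^bsub>R\<^esub> h \<otimes>\<^bsub>R\<^esub> W \<and> \<rho> W = \<lbrace>\<rho> (TB.pt x), \<rho> V\<rbrace>\<^bsub>T\<^esub>"
    if x: "x \<in> TB.tup" and V: "V \<in> carrier R" for x V
    using n V
  proof (induction V rule: TB.T_induct)
    case zero
    then show ?case using x by (intro bexI[of _ "\<zero>\<^bsub>R\<^esub>"]) (simp_all add: rho_zero TA.T_bracket_zero)
  next
    case (pure y)
    then show ?case using commutator_pt x by simp
  next
    case (add V V')
    then obtain W W' where W: "W \<in> carrier R" "TB.pt x \<otimes>\<^bsub>R\<^esub> V = V \<otimes>\<^bsub>R\<^esub> TB.pt x \<oplus>\<^bsub>R\<^esub> h \<otimes>\<^bsub>R\<^esub> W"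
      "\<rho> W = \<lbrace>\<rho> (TB.pt x), \<rho> V\<rbrace>\<^bsub>T\<^esub>" "W' \<in> carrier R"
      "TB.pt x \<otimes>\<^bsub>R\<^esub> V' = V' \<otimes>\<^bsub>R\<^esub> TB.pt x \<oplus>\<^bsub>R\<^esub> h \<otimes>\<^bsub>R\<^esub> W'" "\<rho> W' = \<lbrace>\<rho> (TB.pt x), \<rho> V'\<rbrace>\<^bsub>T\<^esub>"
      by (elim bexE conjE)
    have "TB.pt x \<otimes>\<^bsub>R\<^esub> (V \<oplus>\<^bsub>R\<^esub> V') = (V \<otimes>\<^bsub>R\<^esub> TB.pt x \<oplus>\<^bsub>R\<^esub> h \<otimes>\<^bsub>R\<^esub> W) \<oplus>\<^bsub>R\<^esub> (V' \<otimes>\<^bsub>R\<^esub> TB.pt x \<oplus>\<^bsub>R\<^esub> h \<otimes>\<^bsub>R\<^esub> W')"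
      using x add(1,2) by (simp add: TB.T.B.r_distr W(2,5))
    also have "\<dots> = (V \<oplus>\<^bsub>R\<^esub> V') \<otimes>\<^bsub>R\<^esub> TB.pt x \<oplus>\<^bsub>R\<^esub> h \<otimes>\<^bsub>R\<^esub> (W \<oplus>\<^bsub>R\<^esub> W')"
      using x add(1,2) W(1,4) by (simp add: TB.T.B.r_distr TB.T.B.l_distr TB.T.M.a_ac)
    finally show ?case
      using W(1,3,4,6) add(1,2) x by (intro bexI[of _ "W \<oplus>\<^bsub>R\<^esub> W'"]) (simp_all add: rho_add TA.T_bracket_add)
  qed
  show ?thesis
    using n U
  proof (induction U rule: TB.T_induct)
    case zero
    then show ?case using V by (intro bexI[of _ "\<zero>\<^bsub>R\<^esub>"]) (simp_all add: rho_zero TA.T_bracket_zero)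
  next
    case (pure y)
    then show ?case using 1 V by simp
  next
    case (add U U')
    then obtain W W' where W: "W \<in> carrier R" "U \<otimes>\<^bsub>R\<^esub> V = V \<otimes>\<^bsub>R\<^esub> U \<oplus>\<^bsub>R\<^esub> h \<otimes>\<^bsub>R\<^esub> W"
      "\<rho> W = \<lbrace>\<rho> U, \<rho> V\<rbrace>\<^bsub>T\<^esub>" "W' \<in> carrier R"
      "U' \<otimes>\<^bsub>R\<^esub> V = V \<otimes>\<^bsub>R\<^esub> U' \<oplus>\<^bsub>R\<^esub> h \<otimes>\<^bsub>R\<^esub> W'" "\<rho> W' = \<lbrace>\<rho> U', \<rho> V\<rbrace>\<^bsub>T\<^esub>"
      by (elim bexE conjE)
    have "(U \<oplus>\<^bsub>R\<^esub> U') \<otimes>\<^bsub>R\<^esub> V = (V \<otimes>\<^bsub>R\<^esub> U \<oplus>\<^bsub>R\<^esub> h \<otimes>\<^bsub>R\<^esub> W) \<oplus>\<^bsub>R\<^esub> (V \<otimes>\<^bsub>R\<^esub> U' \<oplus>\<^bsub>R\<^esub> h \<otimes>\<^bsub>R\<^esub> W')"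
      using V add(1,2) by (simp add: TB.T.B.l_distr W(2,5))
    also have "\<dots> = V \<otimes>\<^bsub>R\<^esub> (U \<oplus>\<^bsub>R\<^esub> U') \<oplus>\<^bsub>R\<^esub> h \<otimes>\<^bsub>R\<^esub> (W \<oplus>\<^bsub>R\<^esub> W')"
      using V add(1,2) W(1,4) by (simp add: TB.T.B.r_distr TB.T.B.l_distr TB.T.M.a_ac)
    finally show ?case
      using W(1,3,4,6) add(1,2) V by (intro bexI[of _ "W \<oplus>\<^bsub>R\<^esub> W'"]) (simp_all add: rho_add TA.T_bracket_add)
  qed
qed

lemma formal_domain: "formal_domain R T h \<rho>"
proof -
  interpret R: ring R by (rule TB.ring_T)
  show ?thesis
    by unfold_locales (use h_central rho_hom rho_surj rho_kernel rho_graded in simp_all)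
qed

end

section \<open>Determinants\<close>

lemma (in abelian_monoid) finsum_swap:
  assumes "finite A" "finite B" "\<And>a b. a \<in> A \<Longrightarrow> b \<in> B \<Longrightarrow> f a b \<in> carrier G"
  shows "(\<Oplus>a\<in>A. \<Oplus>b\<in>B. f a b) = (\<Oplus>b\<in>B. \<Oplus>a\<in>A. f a b)"
  using assms(1,3)
proof (induction A rule: finite_induct)
  case empty
  then show ?case by simp
next
  case (insert x A)
  have 1: "(\<lambda>b. f x b) \<in> B \<rightarrow> carrier G" using insert.prems by auto
  have 2: "(\<lambda>b. \<Oplus>a\<in>A. f a b) \<in> B \<rightarrow> carrier G" using insert.prems by (auto intro!: finsum_closed)
  have "(\<Oplus>a\<in>insert x A. \<Oplus>b\<in>B. f a b) = (\<Oplus>b\<in>B. f x b) \<oplus> (\<Oplus>a\<in>A. \<Oplus>b\<in>B. f a b)"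
    using insert by (intro finsum_insert) (auto intro!: finsum_closed)
  also have "(\<Oplus>a\<in>A. \<Oplus>b\<in>B. f a b) = (\<Oplus>b\<in>B. \<Oplus>a\<in>A. f a b)" using insert by simp
  also have "(\<Oplus>b\<in>B. f x b) \<oplus> (\<Oplus>b\<in>B. \<Oplus>a\<in>A. f a b) = (\<Oplus>b\<in>B. f x b \<oplus> (\<Oplus>a\<in>A. f a b))"
    by (rule finsum_addf[OF 1 2, symmetric])
  also have "\<dots> = (\<Oplus>b\<in>B. \<Oplus>a\<in>insert x A. f a b)"
    using insert by (intro finsum_cong') (auto intro!: finsum_closed)
  finally show ?case .
qed

lemma (in abelian_group) finsum_a_inv:
  assumes "finite A" "f \<in> A \<rightarrow> carrier G"
  shows "(\<Oplus>a\<in>A. \<ominus> f a) = \<ominus> (\<Oplus>a\<in>A. f a)"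
  using assms
proof (induction A rule: finite_induct)
  case empty
  have "\<ominus> \<zero> = \<zero>" by (rule minus_equality) simp_all
  then show ?case by (simp only: finsum_empty)
next
  case (insert x A)
  then have "f x \<in> carrier G" "f \<in> A \<rightarrow> carrier G" by auto
  then show ?case using insert by (simp add: minus_add Pi_iff)
qed

text \<open>The values of \<open>[m] \<cdot> x\<close> that occur in determinants have \<open>m = sign p = \<plusminus>1\<close>.\<close>

context cring
begin

definition det :: "nat \<Rightarrow> (nat \<Rightarrow> nat \<Rightarrow> 'a) \<Rightarrow> 'a" where
  "det n M = (\<Oplus>p\<in>{p. p permutes {1..n}}. [sign p] \<cdot> (\<Otimes>i\<in>{1..n}. M i (p i)))"

text \<open>The coefficient of \<open>M l a\<close> in the determinant. Written as a sum over the
  permutations with \<open>p l = a\<close>, it involves no submatrices and no renumbering of rows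
  and columns.\<close>

definition cofactor :: "nat \<Rightarrow> (nat \<Rightarrow> nat \<Rightarrow> 'a) \<Rightarrow> nat \<Rightarrow> nat \<Rightarrow> 'a" where
  "cofactor n M a l = (\<Oplus>p\<in>{p. p permutes {1..n}}.
     if p l = a then [sign p] \<cdot> (\<Otimes>i\<in>{1..n} - {l}. M i (p i)) else \<zero>)"

lemma sign_mult_simps:
  fixes p :: "nat \<Rightarrow> nat" and x :: 'a
  assumes "x \<in> carrier R"
  shows "[sign p] \<cdot> x = (if evenperm p then x else \<ominus> x)"
  using assms by (simp add: sign_def add_pow_int_lt add.int_pow_1)

lemma sign_mult_closed [simp]:
  fixes p :: "nat \<Rightarrow> nat" and x :: 'a
  shows "x \<in> carrier R \<Longrightarrow> [sign p] \<cdot> x \<in> carrier R"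
  by (simp add: sign_mult_simps)

lemma sign_mult_assoc:
  fixes p :: "nat \<Rightarrow> nat" and x :: 'a
  shows "x \<in> carrier R \<Longrightarrow> y \<in> carrier R \<Longrightarrow> [sign p] \<cdot> (x \<otimes> y) = [sign p] \<cdot> x \<otimes> y"
  by (simp add: sign_mult_simps l_minus)

lemma finite_perms: "finite {p. p permutes {1..n::nat}}"
  by (rule finite_permutations) simp

lemma perm_in: "p permutes {1..n} \<Longrightarrow> i \<in> {1..n} \<Longrightarrow> p i \<in> {1..n::nat}"
  by (simp only: permutes_in_image)

context
  fixes n :: nat and M :: "nat \<Rightarrow> nat \<Rightarrow> 'a"
  assumes M: "\<And>i j. i \<in> {1..n} \<Longrightarrow> j \<in> {1..n} \<Longrightarrow> M i j \<in> carrier R"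
begin

lemma prod_closed: "p permutes {1..n} \<Longrightarrow> J \<subseteq> {1..n} \<Longrightarrow> (\<Otimes>i\<in>J. M i (p i)) \<in> carrier R"
  using M perm_in[of p n] by (intro finprod_closed) blast

lemma det_closed: "det n M \<in> carrier R"
  unfolding det_def using prod_closed by (intro finsum_closed) auto

lemma cofactor_closed: "cofactor n M a l \<in> carrier R"
  unfolding cofactor_def using prod_closed[of _ "{1..n} - {l}"] by (intro finsum_closed) auto

lemma prod_split:
  assumes "p permutes {1..n}" "l \<in> {1..n}" "\<And>i. i \<in> {1..n} - {l} \<Longrightarrow> f i = M i (p i)" "f l \<in> carrier R"
  shows "(\<Otimes>i\<in>{1..n}. f i) = (\<Otimes>i\<in>{1..n} - {l}. M i (p i)) \<otimes> f l"
proof -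
  have c: "M i (p i) \<in> carrier R" if "i \<in> {1..n} - {l}" for i
    using that M perm_in[OF assms(1), of i] by simp
  have "(\<Otimes>i\<in>insert l ({1..n} - {l}). f i) = f l \<otimes> (\<Otimes>i\<in>{1..n} - {l}. f i)"
    using assms(3,4) c by (intro finprod_insert) auto
  also have "(\<Otimes>i\<in>{1..n} - {l}. f i) = (\<Otimes>i\<in>{1..n} - {l}. M i (p i))"
    using assms(3) c by (intro finprod_cong') auto
  finally show ?thesis
    using assms(2,4) prod_closed[OF assms(1), of "{1..n} - {l}"] by (simp add: insert_absorb m_comm)
qed

text \<open>Each permutation takes the value \<open>a\<close> at exactly one place \<open>m\<close>,
  so collecting the terms by \<open>p\<close> instead of by \<open>l\<close> gives the determinant
  with \<open>v\<close> in the column \<open>a\<close>.\<close>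

lemma cofactor_column:
  assumes a: "a \<in> {1..n}" and v: "\<And>i. i \<in> {1..n} \<Longrightarrow> v i \<in> carrier R"
  shows "(\<Oplus>l\<in>{1..n}. cofactor n M a l \<otimes> v l) = det n (\<lambda>i j. if j = a then v i else M i j)"
proof -
  define t where "t p l = (if p l = a then [sign p] \<cdot> (\<Otimes>i\<in>{1..n} - {l}. M i (p i)) \<otimes> v l else \<zero>)" for p l
  have pc: "(\<Otimes>i\<in>{1..n} - {l}. M i (p i)) \<in> carrier R" if "p permutes {1..n}" for p l
    using that prod_closed by auto
  have t: "t p l \<in> carrier R" if "p permutes {1..n}" "l \<in> {1..n}" for p l using pc that v by (simp add: t_def)
  have "(\<Oplus>l\<in>{1..n}. cofactor n M a l \<otimes> v l) = (\<Oplus>l\<in>{1..n}. \<Oplus>p\<in>{p. p permutes {1..n}}. t p l)"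
  proof (rule finsum_cong')
    fix l assume l: "l \<in> {1..n}"
    have "cofactor n M a l \<otimes> v l = (\<Oplus>p\<in>{p. p permutes {1..n}}.
       (if p l = a then [sign p] \<cdot> (\<Otimes>i\<in>{1..n} - {l}. M i (p i)) else \<zero>) \<otimes> v l)"
      unfolding cofactor_def using pc v[OF l] finite_perms by (intro finsum_ldistr) auto
    also have "\<dots> = (\<Oplus>p\<in>{p. p permutes {1..n}}. t p l)"
      using t l v[OF l] by (intro finsum_cong') (auto simp: t_def)
    finally show "cofactor n M a l \<otimes> v l = (\<Oplus>p\<in>{p. p permutes {1..n}}. t p l)" .
  qed (use t in \<open>auto intro!: finsum_closed\<close>)
  also have "\<dots> = (\<Oplus>p\<in>{p. p permutes {1..n}}. \<Oplus>l\<in>{1..n}. t p l)"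
    using t finite_perms by (intro finsum_swap) auto
  also have "\<dots> = det n (\<lambda>i j. if j = a then v i else M i j)"
    unfolding det_def
  proof (rule finsum_cong')
    fix p assume "p \<in> {p. p permutes {1..n}}"
    then have p: "p permutes {1..n}" by simp
    have "a \<in> p ` {1..n}" using a by (simp only: permutes_image[OF p])
    then obtain m where "a = p m" and m1: "m \<in> {1..n}" by (rule imageE)
    then have m: "m \<in> {1..n}" "p m = a" by simp_all
    have inj: "p l = a \<longleftrightarrow> l = m" for l using permutes_inj[OF p] m(2) by (auto dest: injD)
    have eq: "t p l = (if m = l then t p l else \<zero>)" for l by (auto simp: t_def inj)
    have "(\<Oplus>l\<in>{1..n}. t p l) = (\<Oplus>l\<in>{1..n}. if m = l then t p l else \<zero>)"
      by (rule finsum_cong'[OF refl _ eq]) (use t[OF p] in auto)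
    also have "\<dots> = t p m"
      using t[OF p] m(1) by (intro finsum_singleton) auto
    also have "\<dots> = [sign p] \<cdot> (\<Otimes>i\<in>{1..n}. if p i = a then v i else M i (p i))"
      using prod_split[OF p m(1), of "\<lambda>i. if p i = a then v i else M i (p i)"] m v pc[OF p]
      by (simp add: t_def inj sign_mult_assoc)
    finally show "(\<Oplus>l\<in>{1..n}. t p l) = [sign p] \<cdot> (\<Otimes>i\<in>{1..n}. if p i = a then v i else M i (p i))" .
  next
    show "(\<lambda>p. [sign p] \<cdot> (\<Otimes>i\<in>{1..n}. if p i = a then v i else M i (p i))) \<in> {p. p permutes {1..n}} \<rightarrow> carrier R"
      using M v perm_in by (auto intro!: sign_mult_closed finprod_closed simp del: atLeastAtMost_iff)
  qed simp
  finally show ?thesis .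
qed

text \<open>For a fixed permutation \<open>p\<close> only \<open>a = p l\<close> contributes, which
  puts \<open>w\<close> into the row \<open>l\<close>.\<close>

lemma cofactor_row:
  assumes l: "l \<in> {1..n}" and w: "\<And>j. j \<in> {1..n} \<Longrightarrow> w j \<in> carrier R"
  shows "(\<Oplus>a\<in>{1..n}. w a \<otimes> cofactor n M a l) = det n (\<lambda>i j. if i = l then w j else M i j)"
proof -
  define t where "t p a = (if p l = a then w a \<otimes> [sign p] \<cdot> (\<Otimes>i\<in>{1..n} - {l}. M i (p i)) else \<zero>)" for p a
  have pc: "(\<Otimes>i\<in>{1..n} - {l}. M i (p i)) \<in> carrier R" if "p permutes {1..n}" for p
    using that prod_closed by auto
  have t: "t p a \<in> carrier R" if "p permutes {1..n}" "a \<in> {1..n}" for p a using pc that w by (simp add: t_def)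
  have "(\<Oplus>a\<in>{1..n}. w a \<otimes> cofactor n M a l) = (\<Oplus>a\<in>{1..n}. \<Oplus>p\<in>{p. p permutes {1..n}}. t p a)"
  proof (rule finsum_cong')
    fix a assume a: "a \<in> {1..n}"
    have "w a \<otimes> cofactor n M a l = (\<Oplus>p\<in>{p. p permutes {1..n}}.
       w a \<otimes> (if p l = a then [sign p] \<cdot> (\<Otimes>i\<in>{1..n} - {l}. M i (p i)) else \<zero>))"
      unfolding cofactor_def using pc w[OF a] finite_perms by (intro finsum_rdistr) auto
    also have "\<dots> = (\<Oplus>p\<in>{p. p permutes {1..n}}. t p a)"
      using t a w[OF a] by (intro finsum_cong') (auto simp: t_def)
    finally show "w a \<otimes> cofactor n M a l = (\<Oplus>p\<in>{p. p permutes {1..n}}. t p a)" .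
  qed (use t in \<open>auto intro!: finsum_closed\<close>)
  also have "\<dots> = (\<Oplus>p\<in>{p. p permutes {1..n}}. \<Oplus>a\<in>{1..n}. t p a)"
    using t finite_perms by (intro finsum_swap) auto
  also have "\<dots> = det n (\<lambda>i j. if i = l then w j else M i j)"
    unfolding det_def
  proof (rule finsum_cong')
    fix p assume "p \<in> {p. p permutes {1..n}}"
    then have p: "p permutes {1..n}" by simp
    note sl = perm_in[OF p l]
    have eq: "t p a = (if p l = a then t p a else \<zero>)" for a by (auto simp: t_def )
    have "(\<Oplus>a\<in>{1..n}. t p a) = (\<Oplus>a\<in>{1..n}. if p l = a then t p a else \<zero>)"
      by (rule finsum_cong'[OF refl _ eq]) (use t[OF p] in auto)
    also have "\<dots> = t p (p l)"
      using t[OF p] sl by (intro finsum_singleton) auto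
    also have "\<dots> = [sign p] \<cdot> (\<Otimes>i\<in>{1..n}. if i = l then w (p i) else M i (p i))"
      using prod_split[OF p l, of "\<lambda>i. if i = l then w (p i) else M i (p i)"] w[OF sl] pc[OF p]
      by (simp add: t_def sign_mult_simps l_minus r_minus m_comm)
    finally show "(\<Oplus>a\<in>{1..n}. t p a) = [sign p] \<cdot> (\<Otimes>i\<in>{1..n}. if i = l then w (p i) else M i (p i))" .
  next
    show "(\<lambda>p. [sign p] \<cdot> (\<Otimes>i\<in>{1..n}. if i = l then w (p i) else M i (p i))) \<in> {p. p permutes {1..n}} \<rightarrow> carrier R"
      using M w perm_in by (auto intro!: sign_mult_closed finprod_closed simp del: atLeastAtMost_iff)
  qed simp
  finally show ?thesis .
qed

text \<open>Reindexing by \<open>f\<close> shows that the sum is its own negative, and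
  \<open>two\<close> makes it zero. This is how characteristic different from 2 enters the theory of
  determinants here.\<close>

lemma finsum_antisym:
  assumes two: "\<And>x. x \<in> carrier R \<Longrightarrow> x \<oplus> x = \<zero> \<Longrightarrow> x = \<zero>"
    and A: "finite A" "g \<in> A \<rightarrow> carrier R" and f: "bij_betw f A A" "\<And>a. a \<in> A \<Longrightarrow> g (f a) = \<ominus> g a"
  shows "(\<Oplus>a\<in>A. g a) = \<zero>"
proof -
  have cl: "(\<Oplus>a\<in>A. g a) \<in> carrier R" using A by (intro finsum_closed)
  have "(\<Oplus>a\<in>A. g a) = (\<Oplus>a\<in>f ` A. g a)" using f(1) by (simp add: bij_betw_def)
  also have "\<dots> = (\<Oplus>a\<in>A. g (f a))"
    using f(1) A by (intro finsum_reindex) (auto simp: bij_betw_def)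
  also have "\<dots> = (\<Oplus>a\<in>A. \<ominus> g a)" using A f(2) by (intro finsum_cong') auto
  also have "\<dots> = \<ominus> (\<Oplus>a\<in>A. g a)" by (rule finsum_a_inv[OF A])
  finally have "(\<Oplus>a\<in>A. g a) \<oplus> (\<Oplus>a\<in>A. g a) = (\<Oplus>a\<in>A. g a) \<oplus> \<ominus> (\<Oplus>a\<in>A. g a)" by (rule arg_cong)
  then show ?thesis using two[OF cl] cl by (simp add: r_neg)
qed

text \<open>Composition of \<open>p\<close> with the transposition of the two columns keeps the
  product and reverses the sign.\<close>

lemma det_equal_columns:
  assumes two: "\<And>x. x \<in> carrier R \<Longrightarrow> x \<oplus> x = \<zero> \<Longrightarrow> x = \<zero>"
    and ab: "a \<in> {1..n}" "b \<in> {1..n}" "a \<noteq> b" "\<And>i. i \<in> {1..n} \<Longrightarrow> M i a = M i b"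
  shows "det n M = \<zero>"
  unfolding det_def
proof (rule finsum_antisym[OF two finite_perms])
  let ?\<tau> = "transpose a b"
  have \<tau>: "?\<tau> permutes {1..n}" using ab(1,2) by (rule permutes_swap_id)
  show "bij_betw (\<lambda>p. ?\<tau> \<circ> p) {p. p permutes {1..n}} {p. p permutes {1..n}}"
    using \<tau> by (intro bij_betwI[of _ _ _ "\<lambda>p. ?\<tau> \<circ> p"]) (auto intro: permutes_compose simp: fun_eq_iff)
  fix p assume "p \<in> {p. p permutes {1..n}}"
  then have p: "p permutes {1..n}" by simp
  have "(\<Otimes>i\<in>{1..n}. M i ((?\<tau> \<circ> p) i)) = (\<Otimes>i\<in>{1..n}. M i (p i))"
    using M perm_in[OF p] ab(4) by (intro finprod_cong') (auto simp: transpose_def simp del: atLeastAtMost_iff)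
  moreover have "sign (?\<tau> \<circ> p) = - sign p"
    using sign_compose[OF permutes_imp_permutation[OF _ \<tau>] permutes_imp_permutation[OF _ p]] ab(3)
    by (simp add: sign_swap_id)
  ultimately show "[sign (?\<tau> \<circ> p)] \<cdot> (\<Otimes>i\<in>{1..n}. M i ((?\<tau> \<circ> p) i)) = \<ominus> ([sign p] \<cdot> (\<Otimes>i\<in>{1..n}. M i (p i)))"
    using prod_closed[OF p order_refl] by (simp add: add.int_pow_neg)
qed (use prod_closed in auto)

lemma det_equal_rows:
  assumes two: "\<And>x. x \<in> carrier R \<Longrightarrow> x \<oplus> x = \<zero> \<Longrightarrow> x = \<zero>"
    and ab: "a \<in> {1..n}" "b \<in> {1..n}" "a \<noteq> b" "\<And>j. j \<in> {1..n} \<Longrightarrow> M a j = M b j"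
  shows "det n M = \<zero>"
  unfolding det_def
proof (rule finsum_antisym[OF two finite_perms])
  let ?\<tau> = "transpose a b"
  have \<tau>: "?\<tau> permutes {1..n}" using ab(1,2) by (rule permutes_swap_id)
  show "bij_betw (\<lambda>p. p \<circ> ?\<tau>) {p. p permutes {1..n}} {p. p permutes {1..n}}"
    using \<tau> by (intro bij_betwI[of _ _ _ "\<lambda>p. p \<circ> ?\<tau>"]) (auto intro: permutes_compose simp: fun_eq_iff)
  fix p assume "p \<in> {p. p permutes {1..n}}"
  then have p: "p permutes {1..n}" by simp
  have "(\<Otimes>i\<in>{1..n}. M i (p i)) = (\<Otimes>i\<in>?\<tau> ` {1..n}. M i (p i))" using permutes_image[OF \<tau>] by simp
  also have "\<dots> = (\<Otimes>i\<in>{1..n}. M (?\<tau> i) (p (?\<tau> i)))"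
    using M perm_in[OF p] perm_in[OF \<tau>] permutes_image[OF \<tau>] by (intro finprod_reindex) (auto intro: inj_onI simp del: atLeastAtMost_iff)
  also have "\<dots> = (\<Otimes>i\<in>{1..n}. M i ((p \<circ> ?\<tau>) i))"
    using M perm_in[OF p] ab by (intro finprod_cong') (auto simp: transpose_def simp del: atLeastAtMost_iff)
  finally have "(\<Otimes>i\<in>{1..n}. M i ((p \<circ> ?\<tau>) i)) = (\<Otimes>i\<in>{1..n}. M i (p i))" by simp
  moreover have "sign (p \<circ> ?\<tau>) = - sign p"
    using sign_compose[OF permutes_imp_permutation[OF _ p] permutes_imp_permutation[OF _ \<tau>]] ab(3)
    by (simp add: sign_swap_id)
  ultimately show "[sign (p \<circ> ?\<tau>)] \<cdot> (\<Otimes>i\<in>{1..n}. M i ((p \<circ> ?\<tau>) i)) = \<ominus> ([sign p] \<cdot> (\<Otimes>i\<in>{1..n}. M i (p i)))"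
    using prod_closed[OF p order_refl] by (simp add: add.int_pow_neg)
qed (use prod_closed in auto)

text \<open>The sum is reindexed by \<open>\<pi> \<circ> p\<close>; the sign of \<open>\<pi>\<close>
  comes out because signs are multiplicative.\<close>

lemma det_permute_columns:
  assumes \<pi>: "\<pi> permutes {1..n}"
  shows "det n (\<lambda>i j. M i (\<pi> j)) = [sign \<pi>] \<cdot> det n M"
proof -
  let ?P = "{p. p permutes {1..n}}"
  have inv: "inv_into UNIV \<pi> \<circ> p permutes {1..n}" "\<pi> \<circ> (inv_into UNIV \<pi> \<circ> p) = p" if "p permutes {1..n}" for p
    using permutes_compose[OF that permutes_inv[OF \<pi>]] permutes_inv_o(1)[OF \<pi>] by (simp_all add: o_assoc)
  have img: "(\<lambda>p. \<pi> \<circ> p) ` ?P = ?P"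
  proof (rule equalityI; rule subsetI)
    fix p assume "p \<in> (\<lambda>p. \<pi> \<circ> p) ` ?P"
    then obtain q where "p = \<pi> \<circ> q" "q \<in> ?P" by (rule imageE)
    then show "p \<in> ?P" using permutes_compose[of q "{1..n}" \<pi>] \<pi> by simp
  next
    fix p assume "p \<in> ?P"
    then have p: "p permutes {1..n}" by simp
    show "p \<in> (\<lambda>p. \<pi> \<circ> p) ` ?P" by (rule image_eqI[of _ _ "inv_into UNIV \<pi> \<circ> p"]) (simp_all only: mem_Collect_eq inv[OF p])
  qed
  have inj: "inj_on (\<lambda>p. \<pi> \<circ> p) ?P"
  proof (rule inj_onI)
    fix p q assume "\<pi> \<circ> p = \<pi> \<circ> q"
    then show "p = q" using injD[OF permutes_inj[OF \<pi>]] by (simp add: fun_eq_iff)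
  qed
  have neg: "(\<Oplus>p\<in>?P. [sign \<pi>] \<cdot> g p) = [sign \<pi>] \<cdot> (\<Oplus>p\<in>?P. g p)" if g: "g \<in> ?P \<rightarrow> carrier R" for g
  proof -
    have "(\<Oplus>p\<in>?P. [sign \<pi>] \<cdot> g p) = (\<Oplus>p\<in>?P. if evenperm \<pi> then g p else \<ominus> g p)"
      using g by (intro finsum_cong') (auto simp: sign_mult_simps Pi_iff)
    then show ?thesis using finsum_a_inv[OF finite_perms g] finsum_closed[OF g] by (simp add: sign_mult_simps)
  qed
  have "[sign \<pi>] \<cdot> det n M = [sign \<pi>] \<cdot> (\<Oplus>p\<in>(\<lambda>p. \<pi> \<circ> p) ` ?P. [sign p] \<cdot> (\<Otimes>i\<in>{1..n}. M i (p i)))"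
    by (simp only: det_def img)
  also have "\<dots> = [sign \<pi>] \<cdot> (\<Oplus>p\<in>?P. [sign (\<pi> \<circ> p)] \<cdot> (\<Otimes>i\<in>{1..n}. M i ((\<pi> \<circ> p) i)))"
  proof (rule arg_cong[where f = "\<lambda>x. [sign \<pi>] \<cdot> x"], rule finsum_reindex[OF _ inj])
    show "(\<lambda>p. [sign p] \<cdot> (\<Otimes>i\<in>{1..n}. M i (p i))) \<in> (\<lambda>p. \<pi> \<circ> p) ` ?P \<rightarrow> carrier R"
      unfolding img using prod_closed by auto
  qed
  also have "\<dots> = (\<Oplus>p\<in>?P. [sign \<pi>] \<cdot> ([sign (\<pi> \<circ> p)] \<cdot> (\<Otimes>i\<in>{1..n}. M i ((\<pi> \<circ> p) i))))"
  proof (rule neg[symmetric], rule Pi_I)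
    fix p assume "p \<in> ?P"
    then have "\<pi> \<circ> p permutes {1..n}" using permutes_compose \<pi> by simp
    then show "[sign (\<pi> \<circ> p)] \<cdot> (\<Otimes>i\<in>{1..n}. M i ((\<pi> \<circ> p) i)) \<in> carrier R"
      by (intro sign_mult_closed prod_closed order_refl)
  qed
  also have "\<dots> = det n (\<lambda>i j. M i (\<pi> j))"
    unfolding det_def
  proof (rule finsum_cong')
    fix p assume "p \<in> ?P"
    then have p: "p permutes {1..n}" by simp
    have "evenperm (\<pi> \<circ> p) \<longleftrightarrow> evenperm \<pi> = evenperm p"
      using evenperm_comp[OF permutes_imp_permutation[OF _ \<pi>] permutes_imp_permutation[OF _ p]] by simp
    then show "[sign \<pi>] \<cdot> ([sign (\<pi> \<circ> p)] \<cdot> (\<Otimes>i\<in>{1..n}. M i ((\<pi> \<circ> p) i))) = [sign p] \<cdot> (\<Otimes>i\<in>{1..n}. M i (\<pi> (p i)))"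
      using prod_closed[OF permutes_compose[OF p \<pi>] order_refl] by (simp add: sign_mult_simps comp_def)
  next
    show "(\<lambda>p. [sign p] \<cdot> (\<Otimes>i\<in>{1..n}. M i (\<pi> (p i)))) \<in> ?P \<rightarrow> carrier R"
      using prod_closed[OF permutes_compose[OF _ \<pi>] order_refl] by (simp add: comp_def)
  qed simp
  finally show ?thesis by simp
qed

end

end

lemma (in ring_hom_cring) hom_det:
  assumes M: "\<And>i j. i \<in> {1..n} \<Longrightarrow> j \<in> {1..n} \<Longrightarrow> M i j \<in> carrier R"
  shows "h (R.det n M) = S.det n (\<lambda>i j. h (M i j))"
proof -
  have pc: "(\<Otimes>\<^bsub>R\<^esub>i\<in>{1..n}. M i (p i)) \<in> carrier R" if "p permutes {1..n}" for p
    by (rule R.prod_closed[where n = n and M = M]) (use M that in auto)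
  have "h (R.det n M) = (\<Oplus>\<^bsub>S\<^esub>p\<in>{p. p permutes {1..n}}. (h \<circ> (\<lambda>p. [sign p] \<cdot>\<^bsub>R\<^esub> (\<Otimes>\<^bsub>R\<^esub>i\<in>{1..n}. M i (p i)))) p)"
    unfolding R.det_def using pc by (subst hom_finsum) (auto simp: comp_def)
  also have "\<dots> = S.det n (\<lambda>i j. h (M i j))"
    unfolding S.det_def
  proof (rule S.finsum_cong')
    fix p assume "p \<in> {p. p permutes {1..n}}"
    then have p: "p permutes {1..n}" by simp
    have "h (\<Otimes>\<^bsub>R\<^esub>i\<in>{1..n}. M i (p i)) = (\<Otimes>\<^bsub>S\<^esub>i\<in>{1..n}. (h \<circ> (\<lambda>i. M i (p i))) i)"
      using M R.perm_in[OF p] by (subst hom_finprod) (auto simp: comp_def simp del: atLeastAtMost_iff)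
    then show "(h \<circ> (\<lambda>p. [sign p] \<cdot>\<^bsub>R\<^esub> (\<Otimes>\<^bsub>R\<^esub>i\<in>{1..n}. M i (p i)))) p = [sign p] \<cdot>\<^bsub>S\<^esub> (\<Otimes>\<^bsub>S\<^esub>i\<in>{1..n}. h (M i (p i)))"
      using pc[OF p] hom_closed[OF pc[OF p]] by (simp add: R.sign_mult_simps S.sign_mult_simps comp_def)
  next
    show "(\<lambda>p. [sign p] \<cdot>\<^bsub>S\<^esub> (\<Otimes>\<^bsub>S\<^esub>i\<in>{1..n}. h (M i (p i)))) \<in> {p. p permutes {1..n}} \<rightarrow> carrier S"
      using M R.perm_in by (auto intro!: S.sign_mult_closed S.finprod_closed hom_closed simp del: atLeastAtMost_iff)
  qed simp
  finally show ?thesis .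
qed

context field
begin

context
  fixes n :: nat and M :: "nat \<Rightarrow> nat \<Rightarrow> 'a"
  assumes M: "\<And>i j. i \<in> {1..n} \<Longrightarrow> j \<in> {1..n} \<Longrightarrow> M i j \<in> carrier R"
    and two: "\<And>x. x \<in> carrier R \<Longrightarrow> x \<oplus> x = \<zero> \<Longrightarrow> x = \<zero>"
    and det: "det n M \<noteq> \<zero>"
begin

lemma cofactor_left:
  assumes a: "a \<in> {1..n}" and b: "b \<in> {1..n}"
  shows "(\<Oplus>l\<in>{1..n}. cofactor n M a l \<otimes> M l b) = (if a = b then det n M else \<zero>)"
proof -
  have "(\<Oplus>l\<in>{1..n}. cofactor n M a l \<otimes> M l b) = det n (\<lambda>i j. if j = a then M i b else M i j)"
    using M b by (intro cofactor_column[OF M a]) auto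
  also have "\<dots> = (if a = b then det n M else \<zero>)"
  proof (cases "a = b")
    case True
    then have "(\<lambda>i j. if j = a then M i b else M i j) = M" by (auto simp: fun_eq_iff)
    then show ?thesis using True by simp
  next
    case False
    then have "det n (\<lambda>i j. if j = a then M i b else M i j) = \<zero>"
      using M b by (intro det_equal_columns[OF _ two a b]) auto
    then show ?thesis using False by simp
  qed
  finally show ?thesis .
qed

lemma cofactor_right:
  assumes j: "j \<in> {1..n}" and l: "l \<in> {1..n}"
  shows "(\<Oplus>a\<in>{1..n}. M j a \<otimes> cofactor n M a l) = (if j = l then det n M else \<zero>)"
proof -
  have "(\<Oplus>a\<in>{1..n}. M j a \<otimes> cofactor n M a l) = det n (\<lambda>i b. if i = l then M j b else M i b)"
    using M j by (intro cofactor_row[OF M l]) auto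
  also have "\<dots> = (if j = l then det n M else \<zero>)"
  proof (cases "j = l")
    case True
    then have "(\<lambda>i b. if i = l then M j b else M i b) = M" by (auto simp: fun_eq_iff)
    then show ?thesis using True by simp
  next
    case False
    then have "det n (\<lambda>i b. if i = l then M j b else M i b) = \<zero>"
      using M j by (intro det_equal_rows[OF _ two j l]) auto
    then show ?thesis using False by simp
  qed
  finally show ?thesis .
qed

text \<open>The cofactors of the column \<open>a\<close> combine the equations:
  \<open>cofactor_left\<close> leaves \<open>det n M \<otimes> y a\<close> on one side, and
  \<open>cofactor_column\<close> evaluates the other.\<close>

lemma cramer:
  assumes y: "\<And>a. a \<in> {1..n} \<Longrightarrow> y a \<in> carrier R" and v: "\<And>j. j \<in> {1..n} \<Longrightarrow> v j \<in> carrier R"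
    and eq: "\<And>j. j \<in> {1..n} \<Longrightarrow> (\<Oplus>a\<in>{1..n}. M j a \<otimes> y a) = v j" and a: "a \<in> {1..n}"
  shows "det n M \<otimes> y a = det n (\<lambda>i j. if j = a then v i else M i j)"
proof -
  note c = cofactor_closed[of n M, OF M]
  have "det n (\<lambda>i j. if j = a then v i else M i j) = (\<Oplus>l\<in>{1..n}. cofactor n M a l \<otimes> v l)"
    by (rule cofactor_column[OF M a v, symmetric])
  also have "\<dots> = (\<Oplus>l\<in>{1..n}. \<Oplus>b\<in>{1..n}. cofactor n M a l \<otimes> M l b \<otimes> y b)"
  proof (rule finsum_cong')
    fix l assume l: "l \<in> {1..n}"
    have "cofactor n M a l \<otimes> v l = (\<Oplus>b\<in>{1..n}. cofactor n M a l \<otimes> (M l b \<otimes> y b))"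
      unfolding eq[OF l, symmetric] using c M y l by (intro finsum_rdistr) auto
    also have "\<dots> = (\<Oplus>b\<in>{1..n}. cofactor n M a l \<otimes> M l b \<otimes> y b)"
      using c M y l by (intro finsum_cong') (auto simp: m_assoc)
    finally show "cofactor n M a l \<otimes> v l = (\<Oplus>b\<in>{1..n}. cofactor n M a l \<otimes> M l b \<otimes> y b)" .
  qed (use c M y in \<open>auto intro!: finsum_closed\<close>)
  also have "\<dots> = (\<Oplus>b\<in>{1..n}. \<Oplus>l\<in>{1..n}. cofactor n M a l \<otimes> M l b \<otimes> y b)"
    using c M y by (intro finsum_swap) auto
  also have "\<dots> = (\<Oplus>b\<in>{1..n}. if a = b then det n M \<otimes> y b else \<zero>)"
  proof (rule finsum_cong')
    fix b assume b: "b \<in> {1..n}"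
    have "(\<Oplus>l\<in>{1..n}. cofactor n M a l \<otimes> M l b \<otimes> y b) = (\<Oplus>l\<in>{1..n}. cofactor n M a l \<otimes> M l b) \<otimes> y b"
      using c M y b by (intro finsum_ldistr[symmetric]) auto
    then show "(\<Oplus>l\<in>{1..n}. cofactor n M a l \<otimes> M l b \<otimes> y b) = (if a = b then det n M \<otimes> y b else \<zero>)"
      using cofactor_left[OF a b] y[OF b] by simp
  qed (use det_closed[of n M, OF M] y in auto)
  also have "\<dots> = det n M \<otimes> y a"
    using det_closed[of n M, OF M] y a by (intro finsum_singleton) auto
  finally show ?thesis by simp
qed

lemma nonsingular:
  assumes y: "\<And>a. a \<in> {1..n} \<Longrightarrow> y a \<in> carrier R"
    and eq: "\<And>j. j \<in> {1..n} \<Longrightarrow> (\<Oplus>a\<in>{1..n}. M j a \<otimes> y a) = \<zero>" and a: "a \<in> {1..n}"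
  shows "y a = \<zero>"
proof -
  have "det n M \<otimes> y a = det n (\<lambda>i j. if j = a then \<zero> else M i j)"
    using y eq a by (intro cramer) auto
  also have "\<dots> = (\<Oplus>l\<in>{1..n}. cofactor n M a l \<otimes> \<zero>)"
    by (rule cofactor_column[OF M a, symmetric]) auto
  also have "\<dots> = \<zero>" using cofactor_closed[of n M, OF M] by simp
  finally show ?thesis using det det_closed[of n M, OF M] y[OF a] integral by blast
qed

lemma solvable:
  assumes v: "\<And>j. j \<in> {1..n} \<Longrightarrow> v j \<in> carrier R"
  shows "\<exists>y. (\<forall>a. y a \<in> carrier R) \<and> (\<forall>j\<in>{1..n}. (\<Oplus>a\<in>{1..n}. M j a \<otimes> y a) = v j)"
proof -
  note c = cofactor_closed[of n M, OF M]
  define d where "d = inv (det n M)"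
  have d: "d \<in> carrier R" "det n M \<otimes> d = \<one>"
    using det det_closed[of n M, OF M] field_Units by (simp_all add: d_def Units_inv_closed Units_r_inv)
  \<comment> \<open>The adjugate of \<open>M\<close> applied to \<open>v\<close>, divided by the
    determinant.\<close>
  define y where "y a = (\<Oplus>l\<in>{1..n}. cofactor n M a l \<otimes> (d \<otimes> v l))" for a
  have yc: "y a \<in> carrier R" for a unfolding y_def using c d v by (intro finsum_closed) auto
  have "(\<Oplus>a\<in>{1..n}. M j a \<otimes> y a) = v j" if j: "j \<in> {1..n}" for j
  proof -
    have "(\<Oplus>a\<in>{1..n}. M j a \<otimes> y a) = (\<Oplus>a\<in>{1..n}. \<Oplus>l\<in>{1..n}. M j a \<otimes> cofactor n M a l \<otimes> (d \<otimes> v l))"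
    proof (rule finsum_cong')
      fix a assume a: "a \<in> {1..n}"
      have "M j a \<otimes> y a = (\<Oplus>l\<in>{1..n}. M j a \<otimes> (cofactor n M a l \<otimes> (d \<otimes> v l)))"
        unfolding y_def using c M d v j a by (intro finsum_rdistr) auto
      also have "\<dots> = (\<Oplus>l\<in>{1..n}. M j a \<otimes> cofactor n M a l \<otimes> (d \<otimes> v l))"
        using c M d v j a by (intro finsum_cong') (auto simp: m_assoc)
      finally show "M j a \<otimes> y a = (\<Oplus>l\<in>{1..n}. M j a \<otimes> cofactor n M a l \<otimes> (d \<otimes> v l))" .
    qed (use c M d v j in \<open>auto intro!: finsum_closed\<close>)
    also have "\<dots> = (\<Oplus>l\<in>{1..n}. \<Oplus>a\<in>{1..n}. M j a \<otimes> cofactor n M a l \<otimes> (d \<otimes> v l))"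
      using c M d v j by (intro finsum_swap) auto
    also have "\<dots> = (\<Oplus>l\<in>{1..n}. if j = l then v l else \<zero>)"
    proof (rule finsum_cong')
      fix l assume l: "l \<in> {1..n}"
      have "(\<Oplus>a\<in>{1..n}. M j a \<otimes> cofactor n M a l \<otimes> (d \<otimes> v l)) = (\<Oplus>a\<in>{1..n}. M j a \<otimes> cofactor n M a l) \<otimes> (d \<otimes> v l)"
        using c M d v j l by (intro finsum_ldistr[symmetric]) auto
      also have "\<dots> = (if j = l then v l else \<zero>)"
        unfolding cofactor_right[OF j l] using d v[OF l] det_closed[of n M, OF M] by (simp add: m_assoc[symmetric])
      finally show "(\<Oplus>a\<in>{1..n}. M j a \<otimes> cofactor n M a l \<otimes> (d \<otimes> v l)) = (if j = l then v l else \<zero>)" .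
    qed (use v in auto)
    also have "\<dots> = v j" using v j by (intro finsum_singleton) auto
    finally show ?thesis .
  qed
  then show ?thesis using yc by blast
qed

end

end

section \<open>Commuting solutions of linear systems\<close>

text \<open>Row \<open>j\<close> consists of the right-hand side \<open>B j 0\<close> and the
  coefficients \<open>B j 1\<close>, ..., \<open>B j n\<close> of one equation. Entries of the same
  row may fail to commute with each other.\<close>

locale commuting_rows = hadic_ring Q K h red
  for Q :: "('q, 'x) ring_scheme" (structure) and K :: "('v, 'y) ring_scheme" and h :: 'q and red :: "'q \<Rightarrow> 'v" +
  fixes n :: nat and B :: "nat \<Rightarrow> nat \<Rightarrow> 'q"
  assumes B_closed: "j \<in> {1..n} \<Longrightarrow> a \<le> n \<Longrightarrow> B j a \<in> carrier Q"
    and B_commute: "j \<in> {1..n} \<Longrightarrow> l \<in> {1..n} \<Longrightarrow> j \<noteq> l \<Longrightarrow> a \<le> n \<Longrightarrow> b \<le> n \<Longrightarrow> B j a \<otimes> B l b = B l b \<otimes> B j a"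
    and two: "x \<in> carrier K \<Longrightarrow> x \<oplus>\<^bsub>K\<^esub> x = \<zero>\<^bsub>K\<^esub> \<Longrightarrow> x = \<zero>\<^bsub>K\<^esub>"
    and det_nonzero: "K.det n (\<lambda>j a. red (B j a)) \<noteq> \<zero>\<^bsub>K\<^esub>"
begin

definition L where "L U j = (\<Oplus>a\<in>{1..n}. B j a \<otimes> U a)"

lemma Bc: "j \<in> {1..n} \<Longrightarrow> a \<in> {1..n} \<Longrightarrow> B j a \<in> carrier Q"
  using B_closed by simp

lemma L_term: "(\<And>a. a \<in> {1..n} \<Longrightarrow> U a \<in> carrier Q) \<Longrightarrow> j \<in> {1..n} \<Longrightarrow> (\<lambda>a. B j a \<otimes> U a) \<in> {1..n} \<rightarrow> carrier Q"
  using Bc by (intro Pi_I m_closed)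

lemma L_closed: "(\<And>a. a \<in> {1..n} \<Longrightarrow> U a \<in> carrier Q) \<Longrightarrow> j \<in> {1..n} \<Longrightarrow> L U j \<in> carrier Q"
  unfolding L_def by (intro finsum_closed L_term)

lemma L_cong:
  assumes "\<And>a. a \<in> {1..n} \<Longrightarrow> U a = Y a" "\<And>a. a \<in> {1..n} \<Longrightarrow> Y a \<in> carrier Q" "j \<in> {1..n}"
  shows "L U j = L Y j"
  unfolding L_def by (rule finsum_cong'[OF refl L_term]) (use assms in simp_all)

lemma L_add:
  assumes U: "\<And>a. a \<in> {1..n} \<Longrightarrow> U a \<in> carrier Q" and Y: "\<And>a. a \<in> {1..n} \<Longrightarrow> Y a \<in> carrier Q" and j: "j \<in> {1..n}"
  shows "L (\<lambda>a. U a \<oplus> Y a) j = L U j \<oplus> L Y j"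
proof -
  have "L (\<lambda>a. U a \<oplus> Y a) j = (\<Oplus>a\<in>{1..n}. B j a \<otimes> U a \<oplus> B j a \<otimes> Y a)"
    unfolding L_def using U Y Bc[OF j] by (intro finsum_cong') (auto simp: r_distr)
  then show ?thesis unfolding L_def by (simp only: finsum_addf[OF L_term[of U, OF U j] L_term[of Y, OF Y j]])
qed

lemma L_minus:
  assumes U: "\<And>a. a \<in> {1..n} \<Longrightarrow> U a \<in> carrier Q" and Y: "\<And>a. a \<in> {1..n} \<Longrightarrow> Y a \<in> carrier Q" and j: "j \<in> {1..n}"
  shows "L (\<lambda>a. U a \<ominus> Y a) j = L U j \<ominus> L Y j"
proof -
  have "L (\<lambda>a. \<ominus> Y a) j = (\<Oplus>a\<in>{1..n}. \<ominus> (B j a \<otimes> Y a))"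
    unfolding L_def using Y Bc[OF j] by (intro finsum_cong') (auto simp: r_minus)
  also have "\<dots> = \<ominus> L Y j" unfolding L_def by (rule finsum_a_inv[OF _ L_term[of Y, OF Y j]]) simp_all
  finally show ?thesis using L_add[of U "\<lambda>a. \<ominus> Y a" j] U Y j by (simp add: a_minus_def)
qed

lemma L_right:
  assumes U: "\<And>a. a \<in> {1..n} \<Longrightarrow> U a \<in> carrier Q" and y: "y \<in> carrier Q" and j: "j \<in> {1..n}"
  shows "L (\<lambda>a. U a \<otimes> y) j = L U j \<otimes> y"
proof -
  have "L U j \<otimes> y = (\<Oplus>a\<in>{1..n}. B j a \<otimes> U a \<otimes> y)"
    unfolding L_def using L_term[of U, OF U j] y by (intro finsum_ldistr) auto
  also have "\<dots> = L (\<lambda>a. U a \<otimes> y) j"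
    unfolding L_def using U y Bc[OF j] by (intro finsum_cong') (auto simp: m_assoc)
  finally show ?thesis ..
qed

text \<open>A left factor passes the coefficients of an equation if it commutes with all of them;
  this is applied to the right-hand sides of other equations and to \<open>h\<close>.\<close>

lemma L_left:
  assumes U: "\<And>a. a \<in> {1..n} \<Longrightarrow> U a \<in> carrier Q" and y: "y \<in> carrier Q" and j: "j \<in> {1..n}"
    and comm: "\<And>a. a \<in> {1..n} \<Longrightarrow> B j a \<otimes> y = y \<otimes> B j a"
  shows "L (\<lambda>a. y \<otimes> U a) j = y \<otimes> L U j"
proof -
  have "y \<otimes> L U j = (\<Oplus>a\<in>{1..n}. y \<otimes> (B j a \<otimes> U a))"
    unfolding L_def using L_term[of U, OF U j] y by (intro finsum_rdistr) auto
  also have "\<dots> = L (\<lambda>a. y \<otimes> U a) j"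
    unfolding L_def
  proof (rule finsum_cong')
    fix a assume a: "a \<in> {1..n}"
    have "y \<otimes> (B j a \<otimes> U a) = y \<otimes> B j a \<otimes> U a" using U[OF a] Bc[OF j a] y by (simp only: m_assoc)
    also have "\<dots> = B j a \<otimes> (y \<otimes> U a)" unfolding comm[OF a, symmetric] using U[OF a] Bc[OF j a] y by (simp only: m_assoc)
    finally show "y \<otimes> (B j a \<otimes> U a) = B j a \<otimes> (y \<otimes> U a)" .
  next
    show "(\<lambda>a. B j a \<otimes> (y \<otimes> U a)) \<in> {1..n} \<rightarrow> carrier Q" using U y j by (intro L_term m_closed)
  qed simp
  finally show ?thesis ..
qed

lemma L_h: "(\<And>a. a \<in> {1..n} \<Longrightarrow> U a \<in> carrier Q) \<Longrightarrow> j \<in> {1..n} \<Longrightarrow> L (\<lambda>a. h \<otimes> U a) j = h \<otimes> L U j"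
  by (rule L_left) (use h_central Bc in auto)

lemma L_swap:
  assumes U: "\<And>a b. a \<in> {1..n} \<Longrightarrow> b \<in> {1..n} \<Longrightarrow> U a b \<in> carrier Q" and jl: "j \<in> {1..n}" "l \<in> {1..n}" "j \<noteq> l"
  shows "L (\<lambda>a. L (\<lambda>b. U a b) l) j = L (\<lambda>b. L (\<lambda>a. U a b) j) l"
proof -
  have e: "L (\<lambda>a. L (\<lambda>b. Y a b) m) i = (\<Oplus>a\<in>{1..n}. \<Oplus>b\<in>{1..n}. B i a \<otimes> (B m b \<otimes> Y a b))"
    if Y: "\<And>a b. a \<in> {1..n} \<Longrightarrow> b \<in> {1..n} \<Longrightarrow> Y a b \<in> carrier Q" and im: "i \<in> {1..n}" "m \<in> {1..n}" for Y i m
    unfolding L_def[of _ i]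
  proof (rule finsum_cong')
    fix a assume a: "a \<in> {1..n}"
    show "B i a \<otimes> L (\<lambda>b. Y a b) m = (\<Oplus>b\<in>{1..n}. B i a \<otimes> (B m b \<otimes> Y a b))"
      unfolding L_def using L_term[of "Y a" m] Y[OF a] im Bc[OF im(1) a] by (intro finsum_rdistr) auto
  next
    show "(\<lambda>a. \<Oplus>b\<in>{1..n}. B i a \<otimes> (B m b \<otimes> Y a b)) \<in> {1..n} \<rightarrow> carrier Q"
      using Y im Bc by (intro Pi_I finsum_closed m_closed)
  qed simp
  have "L (\<lambda>a. L (\<lambda>b. U a b) l) j = (\<Oplus>a\<in>{1..n}. \<Oplus>b\<in>{1..n}. B j a \<otimes> (B l b \<otimes> U a b))"
    using U jl by (intro e)
  also have "\<dots> = (\<Oplus>b\<in>{1..n}. \<Oplus>a\<in>{1..n}. B j a \<otimes> (B l b \<otimes> U a b))"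
    using U jl Bc by (intro finsum_swap m_closed finite_atLeastAtMost)
  also have "\<dots> = (\<Oplus>b\<in>{1..n}. \<Oplus>a\<in>{1..n}. B l b \<otimes> (B j a \<otimes> U a b))"
  proof (rule finsum_cong'[OF refl _ finsum_cong'[OF refl]])
    fix a b assume b: "b \<in> {1..n}" and a: "a \<in> {1..n}"
    have "B j a \<otimes> (B l b \<otimes> U a b) = B j a \<otimes> B l b \<otimes> U a b" using U[OF a b] Bc a b jl by (simp only: m_assoc)
    also have "\<dots> = B l b \<otimes> B j a \<otimes> U a b" using B_commute[OF jl, of a b] a b by simp
    also have "\<dots> = B l b \<otimes> (B j a \<otimes> U a b)" using U[OF a b] Bc a b jl by (simp only: m_assoc)
    finally show "B j a \<otimes> (B l b \<otimes> U a b) = B l b \<otimes> (B j a \<otimes> U a b)" .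
  qed (use U jl Bc in \<open>auto intro!: finsum_closed simp del: atLeastAtMost_iff\<close>)
  also have "\<dots> = L (\<lambda>b. L (\<lambda>a. U a b) j) l"
    using U jl by (intro e[symmetric])
  finally show ?thesis .
qed

lemma red_L:
  assumes U: "\<And>a. a \<in> {1..n} \<Longrightarrow> U a \<in> carrier Q" and j: "j \<in> {1..n}"
  shows "red (L U j) = (\<Oplus>\<^bsub>K\<^esub>a\<in>{1..n}. red (B j a) \<otimes>\<^bsub>K\<^esub> red (U a))"
proof -
  have *: "red (\<Oplus>a\<in>I. Y a) = (\<Oplus>\<^bsub>K\<^esub>a\<in>I. red (Y a))" if "finite I" "\<And>a. a \<in> I \<Longrightarrow> Y a \<in> carrier Q" for I and Y :: "nat \<Rightarrow> 'q"
    using that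
  proof (induction I rule: finite_induct)
    case (insert x I)
    have Y: "Y \<in> I \<rightarrow> carrier Q" "(\<lambda>a. red (Y a)) \<in> I \<rightarrow> carrier K" "Y x \<in> carrier Q" using insert.prems by auto
    have "red (\<Oplus>a\<in>insert x I. Y a) = red (Y x) \<oplus>\<^bsub>K\<^esub> red (\<Oplus>a\<in>I. Y a)"
      by (simp only: finsum_insert[OF insert.hyps Y(1,3)] red_simps(3)[OF Y(3) finsum_closed[OF Y(1)]])
    also have "red (\<Oplus>a\<in>I. Y a) = (\<Oplus>\<^bsub>K\<^esub>a\<in>I. red (Y a))" using insert.IH insert.prems by simp
    finally show ?case using K.finsum_insert[OF insert.hyps Y(2)] Y(3) by simp
  qed simp
  have "red (L U j) = (\<Oplus>\<^bsub>K\<^esub>a\<in>{1..n}. red (B j a \<otimes> U a))"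
    unfolding L_def using U Bc[OF j] by (intro * finite_atLeastAtMost m_closed)
  also have "\<dots> = (\<Oplus>\<^bsub>K\<^esub>a\<in>{1..n}. red (B j a) \<otimes>\<^bsub>K\<^esub> red (U a))"
  proof (rule K.finsum_cong')
    fix a assume a: "a \<in> {1..n}"
    show "red (B j a \<otimes> U a) = red (B j a) \<otimes>\<^bsub>K\<^esub> red (U a)" by (rule red_simps(2)[OF Bc[OF j a] U[OF a]])
  qed (use U Bc[OF j] in auto)
  finally show ?thesis .
qed

lemma red_B: "j \<in> {1..n} \<Longrightarrow> a \<in> {1..n} \<Longrightarrow> red (B j a) \<in> carrier K"
  using Bc by simp

lemma red_nonsingular:
  assumes "\<And>a. a \<in> {1..n} \<Longrightarrow> y a \<in> carrier K"
    and "\<And>j. j \<in> {1..n} \<Longrightarrow> (\<Oplus>\<^bsub>K\<^esub>a\<in>{1..n}. red (B j a) \<otimes>\<^bsub>K\<^esub> y a) = \<zero>\<^bsub>K\<^esub>" and "a \<in> {1..n}"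
  shows "y a = \<zero>\<^bsub>K\<^esub>"
  by (rule K.nonsingular[of n "\<lambda>j a. red (B j a)" y]) (fact red_B two det_nonzero assms)+

text \<open>Solve the reduced system in \<open>K\<close>, lift the solution and divide the error by
  \<open>h\<close>: \<open>fst p\<close> is the lifted solution, \<open>snd p\<close> the right-hand
  side that remains.\<close>

lemma lift_solution:
  assumes V: "\<And>j. V j \<in> carrier Q"
  shows "\<exists>p. (\<forall>a. fst p a \<in> carrier Q) \<and> (\<forall>j. snd p j \<in> carrier Q) \<and>
    (\<forall>j\<in>{1..n}. V j = L (fst p) j \<oplus> h \<otimes> snd p j)"
proof -
  have "\<exists>y. (\<forall>a. y a \<in> carrier K) \<and> (\<forall>j\<in>{1..n}. (\<Oplus>\<^bsub>K\<^esub>a\<in>{1..n}. red (B j a) \<otimes>\<^bsub>K\<^esub> y a) = red (V j))"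
    by (rule K.solvable[of n "\<lambda>j a. red (B j a)"]) (fact red_B two det_nonzero | rule red_simps(1), rule V)+
  then obtain y where "(\<forall>a. y a \<in> carrier K) \<and> (\<forall>j\<in>{1..n}. (\<Oplus>\<^bsub>K\<^esub>a\<in>{1..n}. red (B j a) \<otimes>\<^bsub>K\<^esub> y a) = red (V j))" ..
  then have y: "y a \<in> carrier K" "j \<in> {1..n} \<Longrightarrow> (\<Oplus>\<^bsub>K\<^esub>a\<in>{1..n}. red (B j a) \<otimes>\<^bsub>K\<^esub> y a) = red (V j)" for a j by simp_all
  have "\<forall>a. \<exists>g. g \<in> carrier Q \<and> red g = y a"
  proof
    fix a
    have "y a \<in> red ` carrier Q" using y(1) red_surj by simp
    then show "\<exists>g. g \<in> carrier Q \<and> red g = y a" by auto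
  qed
  from choice[OF this] obtain G where G: "\<And>a. G a \<in> carrier Q" "\<And>a. red (G a) = y a" by auto
  have "\<forall>j. \<exists>w. w \<in> carrier Q \<and> (j \<in> {1..n} \<longrightarrow> V j = L G j \<oplus> h \<otimes> w)"
  proof
    fix j
    show "\<exists>w. w \<in> carrier Q \<and> (j \<in> {1..n} \<longrightarrow> V j = L G j \<oplus> h \<otimes> w)"
    proof (cases "j \<in> {1..n}")
      case True
      have c: "L G j \<in> carrier Q" using G True by (intro L_closed)
      have "red (L G j) = red (V j)" unfolding red_L[of G, OF G(1) True] G(2) by (rule y(2)[OF True])
      then have "red (V j \<ominus> L G j) = \<zero>\<^bsub>K\<^esub>" using V c by (simp add: K.r_right_minus_eq)
      then obtain w where w: "w \<in> carrier Q" "V j \<ominus> L G j = h \<otimes> w" using red_kernel[of "V j \<ominus> L G j"] V c by auto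
      have "V j = L G j \<oplus> (V j \<ominus> L G j)" using V[of j] c by (simp add: a_minus_def a_lcomm r_neg)
      then show ?thesis using w by auto
    next
      case False
      then show ?thesis by (intro exI[of _ \<zero>]) auto
    qed
  qed
  from choice[OF this] obtain W where "\<And>j. W j \<in> carrier Q" "\<And>j. j \<in> {1..n} \<Longrightarrow> V j = L G j \<oplus> h \<otimes> W j" by auto
  then show ?thesis using G(1) by (intro exI[of _ "(G, W)"]) simp
qed

lemma solution_exists:
  assumes v: "\<And>j. j \<in> {1..n} \<Longrightarrow> v j \<in> carrier Q"
  obtains H where "\<And>a. H a \<in> carrier Q" "\<And>j. j \<in> {1..n} \<Longrightarrow> L H j = v j"
proof -
  have "\<forall>V. \<exists>p. (\<forall>j. V j \<in> carrier Q) \<longrightarrow> (\<forall>a. fst p a \<in> carrier Q) \<and> (\<forall>j. snd p j \<in> carrier Q) \<and>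
      (\<forall>j\<in>{1..n}. V j = L (fst p) j \<oplus> h \<otimes> snd p j)"
    using lift_solution by auto
  from choice[OF this] obtain p where p: "\<And>V. (\<And>j. V j \<in> carrier Q) \<Longrightarrow> (\<forall>a. fst (p V) a \<in> carrier Q) \<and> (\<forall>j. snd (p V) j \<in> carrier Q) \<and>
      (\<forall>j\<in>{1..n}. V j = L (fst (p V)) j \<oplus> h \<otimes> snd (p V) j)" by auto
  \<comment> \<open>The successive right-hand sides: \<open>V (Suc m)\<close> is what the
    approximate solution \<open>G m\<close> leaves of \<open>V m\<close>, divided by
    \<open>h\<close>. Outside \<open>{1..n}\<close> the value is zero, because \<open>p\<close>
    expects a right-hand side with all entries in the carrier.\<close>
  define V where "V m = ((\<lambda>V. snd (p V)) ^^ m) (\<lambda>j. if j \<in> {1..n} then v j else \<zero>)" for m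
  have V0: "V 0 j = v j" if "j \<in> {1..n}" for j using that by (simp add: V_def)
  have VS: "V (Suc m) = snd (p (V m))" for m by (simp add: V_def)
  have Vc: "V m j \<in> carrier Q" for m j
  proof (induction m arbitrary: j)
    case 0
    then show ?case using v by (simp add: V_def)
  next
    case (Suc m)
    then show ?case unfolding VS using p by simp
  qed
  define G where "G m = fst (p (V m))" for m
  have G: "G m a \<in> carrier Q" for m a using p[of "V m"] Vc by (simp add: G_def)
  have GV: "V m j = L (G m) j \<oplus> h \<otimes> V (Suc m) j" if "j \<in> {1..n}" for m j
    using p[of "V m"] Vc that by (simp add: G_def VS)
  obtain \<Sigma> where \<Sigma>: "\<And>g. (\<And>m. g m \<in> carrier Q) \<Longrightarrow> \<Sigma> g \<in> carrier Q \<and> \<Sigma> g = g 0 \<oplus> h \<otimes> \<Sigma> (\<lambda>m::nat. g (Suc m))"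
    using complete by auto
  \<comment> \<open>The sum of the terms \<open>h^i G (m + i)\<close>; \<open>S 0\<close> will be
    the solution.\<close>
  define S where "S m a = \<Sigma> (\<lambda>i. G (m + i) a)" for m a
  have Sc: "S m a \<in> carrier Q" for m a unfolding S_def by (rule \<Sigma>[THEN conjunct1]) (rule G)
  have S: "S m a = G m a \<oplus> h \<otimes> S (Suc m) a" for m a using \<Sigma>[of "\<lambda>i. G (m + i) a"] G by (simp add: S_def)
  \<comment> \<open>The error of \<open>S m\<close> for the right-hand side \<open>V m\<close> is
    \<open>h\<close> times that of \<open>S (Suc m)\<close> for \<open>V (Suc m)\<close>, so it is
    divisible by every power of \<open>h\<close>.\<close>
  have LS: "L (S m) j \<ominus> V m j = h \<otimes> (L (S (Suc m)) j \<ominus> V (Suc m) j)" if j: "j \<in> {1..n}" for m j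
  proof -
    have c: "L (S (Suc m)) j \<in> carrier Q" "L (G m) j \<in> carrier Q" using Sc G j by (auto intro!: L_closed)
    have "L (S m) j = L (\<lambda>a. G m a \<oplus> h \<otimes> S (Suc m) a) j" by (rule arg_cong[where f = "\<lambda>U. L U j"], rule ext, rule S)
    also have "\<dots> = L (G m) j \<oplus> L (\<lambda>a. h \<otimes> S (Suc m) a) j" using G Sc j by (intro L_add) auto
    also have "\<dots> = L (G m) j \<oplus> h \<otimes> L (S (Suc m)) j" using L_h[of "S (Suc m)" j] Sc j by simp
    finally have 1: "L (S m) j = L (G m) j \<oplus> h \<otimes> L (S (Suc m)) j" .
    show ?thesis unfolding 1 GV[OF j, of m] using c Vc[of "Suc m" j]
      by (simp add: a_minus_def r_distr r_minus minus_add a_ac r_neg r_neg1 r_neg2)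
  qed
  have diff: "\<exists>y\<in>carrier Q. L (S m) j \<ominus> V m j = h [^] N \<otimes> y" if j: "j \<in> {1..n}" for m j and N :: nat
  proof (induction N arbitrary: m)
    case 0
    have "L (S m) j \<in> carrier Q" using Sc j by (auto intro!: L_closed)
    then show ?case using Vc by (intro bexI[of _ "L (S m) j \<ominus> V m j"]) simp_all
  next
    case (Suc N)
    obtain y where y: "y \<in> carrier Q" "L (S (Suc m)) j \<ominus> V (Suc m) j = h [^] N \<otimes> y" using Suc.IH[of "Suc m"] by (rule bexE)
    have "L (S m) j \<ominus> V m j = h [^] Suc N \<otimes> y"
      unfolding LS[OF j, of m] y(2) nat_pow_Suc2[OF h_closed] using y(1) by (simp add: m_assoc del: nat_pow_Suc)
    then show ?case using y(1) by (rule bexI)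
  qed
  show thesis
  proof (rule that[of "S 0"])
    show "S 0 a \<in> carrier Q" for a by (rule Sc)
    fix j assume j: "j \<in> {1..n}"
    have c: "L (S 0) j \<in> carrier Q" using Sc j by (auto intro!: L_closed)
    have "L (S 0) j \<ominus> V 0 j = \<zero>" using diff[OF j] c Vc by (intro separated) simp_all
    then show "L (S 0) j = v j" using c Vc[of 0 j] V0[OF j] by (simp add: r_right_minus_eq)
  qed
qed

text \<open>What is known of the matrix of commutators: it is antisymmetric, and its products with
  two different rows of \<open>B\<close> vanish. Both properties are inherited by
  \<open>c / h\<close>.\<close>

definition flat where
  "flat c \<longleftrightarrow> (\<forall>a\<in>{1..n}. \<forall>b\<in>{1..n}. c a b \<in> carrier Q \<and> c b a = \<ominus> c a b) \<and>
    (\<forall>j\<in>{1..n}. \<forall>l\<in>{1..n}. j \<noteq> l \<longrightarrow> L (\<lambda>a. L (c a) l) j = \<zero>)"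

lemma flatI:
  assumes "\<And>a b. a \<in> {1..n} \<Longrightarrow> b \<in> {1..n} \<Longrightarrow> c a b \<in> carrier Q"
    and "\<And>a b. a \<in> {1..n} \<Longrightarrow> b \<in> {1..n} \<Longrightarrow> c b a = \<ominus> c a b"
    and "\<And>j l. j \<in> {1..n} \<Longrightarrow> l \<in> {1..n} \<Longrightarrow> j \<noteq> l \<Longrightarrow> L (\<lambda>a. L (c a) l) j = \<zero>"
  shows "flat c"
  unfolding flat_def by (intro conjI ballI impI assms)

lemma flatD:
  assumes "flat c"
  shows "a \<in> {1..n} \<Longrightarrow> b \<in> {1..n} \<Longrightarrow> c a b \<in> carrier Q"
    and "a \<in> {1..n} \<Longrightarrow> b \<in> {1..n} \<Longrightarrow> c b a = \<ominus> c a b"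
    and "j \<in> {1..n} \<Longrightarrow> l \<in> {1..n} \<Longrightarrow> j \<noteq> l \<Longrightarrow> L (\<lambda>a. L (c a) l) j = \<zero>"
    apply (rule assms[unfolded flat_def, THEN conjunct1, THEN bspec, THEN bspec, THEN conjunct1]; assumption)
   apply (rule assms[unfolded flat_def, THEN conjunct1, THEN bspec, THEN bspec, THEN conjunct2]; assumption)
  apply (rule assms[unfolded flat_def, THEN conjunct2, THEN bspec, THEN bspec, THEN mp]; assumption)
  done

text \<open>Modulo \<open>h\<close> the antisymmetric matrix \<open>m\<close> satisfies
  \<open>M m M^T = 0\<close> off the diagonal, and also on it, since in characteristic different
  from 2 an antisymmetric form vanishes on equal arguments. As \<open>M\<close> is invertible,
  \<open>m\<close> vanishes.\<close>

lemma flat_divisible: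
  assumes c: "flat c"
  obtains c' where "flat c'" "\<And>a b. a \<in> {1..n} \<Longrightarrow> b \<in> {1..n} \<Longrightarrow> c a b = h \<otimes> c' a b"
proof -
  note cc = flatD(1,2)[OF c]
  have cL: "L (c a) l \<in> carrier Q" if "a \<in> {1..n}" "l \<in> {1..n}" for a l using that cc by (intro L_closed)
  define m where "m a b = red (c a b)" for a b
  define M where "M j a = red (B j a)" for j a
  have mc: "m a b \<in> carrier K" if "a \<in> {1..n}" "b \<in> {1..n}" for a b using cc(1)[OF that] by (simp add: m_def)
  have ma: "m b a = \<ominus>\<^bsub>K\<^esub> m a b" if "a \<in> {1..n}" "b \<in> {1..n}" for a b using cc[OF that] by (simp add: m_def)
  have Mc: "M j a \<in> carrier K" if "j \<in> {1..n}" "a \<in> {1..n}" for j a using red_B[OF that] by (simp add: M_def)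
  \<comment> \<open>\<open>x l\<close> is the column \<open>l\<close> of \<open>m M^T\<close>. It
    solves a homogeneous system with the matrix \<open>M\<close>; once it is known to vanish, so
    does each row of \<open>m\<close>.\<close>
  define x where "x l a = (\<Oplus>\<^bsub>K\<^esub>b\<in>{1..n}. M l b \<otimes>\<^bsub>K\<^esub> m a b)" for l a
  have xc: "x l a \<in> carrier K" if "l \<in> {1..n}" "a \<in> {1..n}" for l a
    unfolding x_def using Mc mc that by (intro K.finsum_closed Pi_I K.m_closed)
  have xL: "x l a = red (L (c a) l)" if "l \<in> {1..n}" "a \<in> {1..n}" for l a
    unfolding x_def M_def m_def by (rule red_L[of "c a" l, symmetric, OF cc(1)[OF that(2)] that(1)])
  have sum0: "(\<Oplus>\<^bsub>K\<^esub>a\<in>{1..n}. M j a \<otimes>\<^bsub>K\<^esub> x l a) = \<zero>\<^bsub>K\<^esub>" if j: "j \<in> {1..n}" and l: "l \<in> {1..n}" for j l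
  proof (cases "j = l")
    case False
    then have "L (\<lambda>a. L (c a) l) j = \<zero>" using flatD(3)[OF c j l] by simp
    then have "(\<Oplus>\<^bsub>K\<^esub>a\<in>{1..n}. red (B j a) \<otimes>\<^bsub>K\<^esub> red (L (c a) l)) = \<zero>\<^bsub>K\<^esub>"
      using red_L[of "\<lambda>a. L (c a) l" j] cL l j by simp
    moreover have "(\<Oplus>\<^bsub>K\<^esub>a\<in>{1..n}. M j a \<otimes>\<^bsub>K\<^esub> x l a) = (\<Oplus>\<^bsub>K\<^esub>a\<in>{1..n}. red (B j a) \<otimes>\<^bsub>K\<^esub> red (L (c a) l))"
      using cL l Bc[OF j] by (intro K.finsum_cong') (auto simp: M_def xL)
    ultimately show ?thesis by simp
  next
    \<comment> \<open>A diagonal entry of \<open>M m M^T\<close>: exchanging the two summation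
      indices turns \<open>?s\<close> into its negative.\<close>
    case True
    let ?s = "\<Oplus>\<^bsub>K\<^esub>a\<in>{1..n}. \<Oplus>\<^bsub>K\<^esub>b\<in>{1..n}. M j a \<otimes>\<^bsub>K\<^esub> (M j b \<otimes>\<^bsub>K\<^esub> m a b)"
    have tc: "M j a \<otimes>\<^bsub>K\<^esub> (M j b \<otimes>\<^bsub>K\<^esub> m a b) \<in> carrier K" if "a \<in> {1..n}" "b \<in> {1..n}" for a b
      using that Mc[OF j] mc by (intro K.m_closed)
    have ic: "(\<Oplus>\<^bsub>K\<^esub>b\<in>{1..n}. M j a \<otimes>\<^bsub>K\<^esub> (M j b \<otimes>\<^bsub>K\<^esub> m a b)) \<in> carrier K" if "a \<in> {1..n}" for a
      using tc that by (intro K.finsum_closed Pi_I)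
    have sc: "?s \<in> carrier K" by (rule K.finsum_closed, rule Pi_I, rule ic)
    have "?s = (\<Oplus>\<^bsub>K\<^esub>b\<in>{1..n}. \<Oplus>\<^bsub>K\<^esub>a\<in>{1..n}. M j a \<otimes>\<^bsub>K\<^esub> (M j b \<otimes>\<^bsub>K\<^esub> m a b))"
      using tc by (intro K.finsum_swap finite_atLeastAtMost)
    also have "\<dots> = (\<Oplus>\<^bsub>K\<^esub>b\<in>{1..n}. \<ominus>\<^bsub>K\<^esub> (\<Oplus>\<^bsub>K\<^esub>a\<in>{1..n}. M j b \<otimes>\<^bsub>K\<^esub> (M j a \<otimes>\<^bsub>K\<^esub> m b a)))"
    proof (rule K.finsum_cong')
      fix b assume b: "b \<in> {1..n}"
      have "(\<Oplus>\<^bsub>K\<^esub>a\<in>{1..n}. M j a \<otimes>\<^bsub>K\<^esub> (M j b \<otimes>\<^bsub>K\<^esub> m a b)) = (\<Oplus>\<^bsub>K\<^esub>a\<in>{1..n}. \<ominus>\<^bsub>K\<^esub> (M j b \<otimes>\<^bsub>K\<^esub> (M j a \<otimes>\<^bsub>K\<^esub> m b a)))"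
      proof (rule K.finsum_cong')
        fix a assume a: "a \<in> {1..n}"
        have "M j a \<otimes>\<^bsub>K\<^esub> (M j b \<otimes>\<^bsub>K\<^esub> m a b) = M j b \<otimes>\<^bsub>K\<^esub> (M j a \<otimes>\<^bsub>K\<^esub> m a b)"
          using Mc[OF j a] Mc[OF j b] mc[OF a b] by (rule K.m_lcomm)
        then show "M j a \<otimes>\<^bsub>K\<^esub> (M j b \<otimes>\<^bsub>K\<^esub> m a b) = \<ominus>\<^bsub>K\<^esub> (M j b \<otimes>\<^bsub>K\<^esub> (M j a \<otimes>\<^bsub>K\<^esub> m b a))"
          unfolding ma[OF a b] using Mc[OF j a] Mc[OF j b] mc[OF a b] by (simp add: K.r_minus)
      next
        show "(\<lambda>a. \<ominus>\<^bsub>K\<^esub> (M j b \<otimes>\<^bsub>K\<^esub> (M j a \<otimes>\<^bsub>K\<^esub> m b a))) \<in> {1..n} \<rightarrow> carrier K"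
          using tc b by (intro Pi_I K.a_inv_closed)
      qed simp
      also have "\<dots> = \<ominus>\<^bsub>K\<^esub> (\<Oplus>\<^bsub>K\<^esub>a\<in>{1..n}. M j b \<otimes>\<^bsub>K\<^esub> (M j a \<otimes>\<^bsub>K\<^esub> m b a))"
        using tc b by (intro K.finsum_a_inv finite_atLeastAtMost Pi_I)
      finally show "(\<Oplus>\<^bsub>K\<^esub>a\<in>{1..n}. M j a \<otimes>\<^bsub>K\<^esub> (M j b \<otimes>\<^bsub>K\<^esub> m a b)) = \<ominus>\<^bsub>K\<^esub> (\<Oplus>\<^bsub>K\<^esub>a\<in>{1..n}. M j b \<otimes>\<^bsub>K\<^esub> (M j a \<otimes>\<^bsub>K\<^esub> m b a))" .
    next
      show "(\<lambda>b. \<ominus>\<^bsub>K\<^esub> (\<Oplus>\<^bsub>K\<^esub>a\<in>{1..n}. M j b \<otimes>\<^bsub>K\<^esub> (M j a \<otimes>\<^bsub>K\<^esub> m b a))) \<in> {1..n} \<rightarrow> carrier K"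
        using ic by (intro Pi_I K.a_inv_closed)
    qed simp
    also have "\<dots> = \<ominus>\<^bsub>K\<^esub> ?s"
      using ic by (intro K.finsum_a_inv finite_atLeastAtMost Pi_I)
    finally have "?s \<oplus>\<^bsub>K\<^esub> ?s = ?s \<oplus>\<^bsub>K\<^esub> \<ominus>\<^bsub>K\<^esub> ?s" by (rule arg_cong)
    then have s0: "?s = \<zero>\<^bsub>K\<^esub>" using two[OF sc] K.r_neg[OF sc] by simp
    have "(\<Oplus>\<^bsub>K\<^esub>a\<in>{1..n}. M j a \<otimes>\<^bsub>K\<^esub> x l a) = ?s"
    proof (rule K.finsum_cong')
      fix a assume a: "a \<in> {1..n}"
      show "M j a \<otimes>\<^bsub>K\<^esub> x l a = (\<Oplus>\<^bsub>K\<^esub>b\<in>{1..n}. M j a \<otimes>\<^bsub>K\<^esub> (M j b \<otimes>\<^bsub>K\<^esub> m a b))"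
        unfolding x_def True[symmetric] using a Mc[OF j] mc by (intro K.finsum_rdistr finite_atLeastAtMost Pi_I K.m_closed)
    next
      show "(\<lambda>a. \<Oplus>\<^bsub>K\<^esub>b\<in>{1..n}. M j a \<otimes>\<^bsub>K\<^esub> (M j b \<otimes>\<^bsub>K\<^esub> m a b)) \<in> {1..n} \<rightarrow> carrier K" using ic by (intro Pi_I)
    qed simp
    then show ?thesis using s0 by simp
  qed
  have x0: "x l a = \<zero>\<^bsub>K\<^esub>" if "l \<in> {1..n}" "a \<in> {1..n}" for l a
    by (rule red_nonsingular[of "x l" a, OF xc[OF that(1)] sum0[OF _ that(1), unfolded M_def] that(2)])
  have m0: "m a b = \<zero>\<^bsub>K\<^esub>" if "a \<in> {1..n}" "b \<in> {1..n}" for a b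
    by (rule red_nonsingular[of "m a" b, OF mc[OF that(1)] x0[OF _ that(1), unfolded x_def M_def] that(2)])
  define c' where "c' a b = (SOME y. y \<in> carrier Q \<and> c a b = h \<otimes> y)" for a b
  have c': "c' a b \<in> carrier Q" "c a b = h \<otimes> c' a b" if ab: "a \<in> {1..n}" "b \<in> {1..n}" for a b
  proof -
    obtain y where "y \<in> carrier Q" "c a b = h \<otimes> y" using red_kernel[OF cc(1)[OF ab]] m0[OF ab] by (auto simp: m_def)
    then have "y \<in> carrier Q \<and> c a b = h \<otimes> y" ..
    from someI[of "\<lambda>y. y \<in> carrier Q \<and> c a b = h \<otimes> y", OF this]
    show "c' a b \<in> carrier Q" "c a b = h \<otimes> c' a b" by (simp_all add: c'_def)
  qed
  have anti: "c' b a = \<ominus> c' a b" if ab: "a \<in> {1..n}" "b \<in> {1..n}" for a b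
  proof -
    have "h \<otimes> c' b a = \<ominus> (h \<otimes> c' a b)" unfolding c'(2)[OF ab, symmetric] c'(2)[OF ab(2,1), symmetric] by (rule cc(2)[OF ab])
    also have "\<dots> = h \<otimes> \<ominus> c' a b" using c'(1)[OF ab] by (simp add: r_minus)
    finally have e: "h \<otimes> c' b a = h \<otimes> \<ominus> c' a b" .
    show ?thesis by (rule h_cancel[OF c'(1)[OF ab(2,1)] a_inv_closed[OF c'(1)[OF ab]] e])
  qed
  have lin: "L (\<lambda>a. L (c' a) l) j = \<zero>" if jl: "j \<in> {1..n}" "l \<in> {1..n}" "j \<noteq> l" for j l
  proof -
    have c'L: "L (c' a) l \<in> carrier Q" if "a \<in> {1..n}" for a using that c' jl by (intro L_closed)
    have 1: "L (c a) l = h \<otimes> L (c' a) l" if a: "a \<in> {1..n}" for a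
    proof -
      have "L (c a) l = L (\<lambda>b. h \<otimes> c' a b) l" using c'[OF a] jl by (intro L_cong) simp_all
      then show ?thesis using L_h[of "c' a" l] c'(1)[OF a] jl by simp
    qed
    have "L (\<lambda>a. L (c a) l) j = L (\<lambda>a. h \<otimes> L (c' a) l) j" using 1 c'L jl by (intro L_cong) simp_all
    then have 2: "h \<otimes> L (\<lambda>a. L (c' a) l) j = \<zero>"
      using L_h[of "\<lambda>a. L (c' a) l" j] c'L jl flatD(3)[OF c jl] by simp
    show ?thesis by (rule h_torsion_free[OF L_closed[of "\<lambda>a. L (c' a) l" j, OF c'L jl(1)] 2])
  qed
  show thesis by (rule that[OF flatI[OF c'(1) anti lin] c'(2)])
qed

text \<open>The commutators of the solution satisfy homogeneous linear equations, and together with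
  antisymmetry these have only the zero solution, already modulo \<open>h\<close>.\<close>

lemma solution_commutes:
  assumes H: "\<And>a. H a \<in> carrier Q" "\<And>j. j \<in> {1..n} \<Longrightarrow> L H j = B j 0" and ab: "a \<in> {1..n}" "b \<in> {1..n}"
  shows "H a \<otimes> H b = H b \<otimes> H a"
proof -
  define c where "c a b = H a \<otimes> H b \<ominus> H b \<otimes> H a" for a b
  have lin: "L (\<lambda>a. L (c a) l) j = \<zero>" if jl: "j \<in> {1..n}" "l \<in> {1..n}" "j \<noteq> l" for j l
  proof -
    have vc: "B j 0 \<in> carrier Q" "B l 0 \<in> carrier Q" using jl B_closed by simp_all
    have 1: "L (c a) l = L (\<lambda>b. H a \<otimes> H b) l \<ominus> B l 0 \<otimes> H a" for a
      unfolding c_def L_minus[of "\<lambda>b. H a \<otimes> H b" "\<lambda>b. H b \<otimes> H a" l, OF m_closed[OF H(1) H(1)] m_closed[OF H(1) H(1)] jl(2)]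
      using L_right[of H "H a" l] H jl by simp
    \<comment> \<open>For the products \<open>H a H b\<close> the sum over \<open>a\<close> is taken
      first: it turns \<open>H a\<close> into \<open>B j 0\<close>, which commutes with the row
      \<open>l\<close>. For the products \<open>H b H a\<close> the sum over \<open>b\<close> has
      already produced \<open>B l 0 H a\<close>. The results, \<open>B j 0 B l 0\<close> and
      \<open>B l 0 B j 0\<close>, agree.\<close>
    have "L (\<lambda>a. L (\<lambda>b. H a \<otimes> H b) l) j = L (\<lambda>b. L (\<lambda>a. H a \<otimes> H b) j) l" using H(1) jl by (intro L_swap m_closed)
    also have "\<dots> = L (\<lambda>b. B j 0 \<otimes> H b) l"
      using L_right[of H _ j] H jl vc by (intro L_cong) simp_all
    also have "\<dots> = B j 0 \<otimes> L H l"
      by (rule L_left[of H]) (use H(1) vc jl B_commute[of l j] in simp_all)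
    finally have 2: "L (\<lambda>a. L (\<lambda>b. H a \<otimes> H b) l) j = B j 0 \<otimes> B l 0" using H(2)[OF jl(2)] by simp
    have "L (\<lambda>a. B l 0 \<otimes> H a) j = B l 0 \<otimes> L H j"
      by (rule L_left[of H]) (use H(1) vc jl B_commute[of j l] in simp_all)
    then have 3: "L (\<lambda>a. B l 0 \<otimes> H a) j = B l 0 \<otimes> B j 0" using H(2)[OF jl(1)] by simp
    have "L (\<lambda>a. L (c a) l) j = L (\<lambda>a. L (\<lambda>b. H a \<otimes> H b) l) j \<ominus> L (\<lambda>a. B l 0 \<otimes> H a) j"
      unfolding 1 using H(1) jl vc by (intro L_minus L_closed m_closed)
    then show ?thesis unfolding 2 3 using B_commute[OF jl, of 0 0] vc by (simp add: r_right_minus_eq)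
  qed
  have flat: "flat c"
  proof (rule flatI[OF _ _ lin])
    show "c a b \<in> carrier Q" "c b a = \<ominus> c a b" for a b using H(1)[of a] H(1)[of b] by (simp_all add: c_def a_minus_def minus_add a_comm)
  qed
  \<comment> \<open>The result of \<open>flat_divisible\<close> is flat again, so the division by
    \<open>h\<close> can be repeated any number of times.\<close>
  have ex: "\<exists>c'. flat c' \<and> (\<forall>a\<in>{1..n}. \<forall>b\<in>{1..n}. c a b = h [^] N \<otimes> c' a b)" for N :: nat
  proof (induction N)
    case 0
    have "c a b \<in> carrier Q" for a b using H(1) by (simp add: c_def)
    then show ?case using flat by (intro exI[of _ c]) simp
  next
    case (Suc N)
    then obtain c' where c': "flat c'" "\<And>a b. a \<in> {1..n} \<Longrightarrow> b \<in> {1..n} \<Longrightarrow> c a b = h [^] N \<otimes> c' a b" by auto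
    obtain c'' where c'': "flat c''" "\<And>a b. a \<in> {1..n} \<Longrightarrow> b \<in> {1..n} \<Longrightarrow> c' a b = h \<otimes> c'' a b"
      by (rule flat_divisible[OF c'(1)]) blast
    have "c a b = h [^] Suc N \<otimes> c'' a b" if ab: "a \<in> {1..n}" "b \<in> {1..n}" for a b
    proof -
      have "c'' a b \<in> carrier Q" by (rule flatD(1)[OF c''(1) ab])
      then show ?thesis unfolding c'(2)[OF ab] c''(2)[OF ab] by (simp add: m_assoc)
    qed
    then show ?case using c''(1) by auto
  qed
  have ex2: "\<exists>y\<in>carrier Q. c a b = h [^] N \<otimes> y" for N :: nat
  proof -
    obtain c' where "flat c'" "c a b = h [^] N \<otimes> c' a b" using ex[of N] ab by auto
    then show ?thesis using flatD(1)[OF _ ab] by (intro bexI[of _ "c' a b"])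
  qed
  have "c a b \<in> carrier Q" using H(1) by (simp add: c_def)
  then have "c a b = \<zero>" by (rule separated[OF _ ex2])
  then show ?thesis using H(1) by (simp add: c_def r_right_minus_eq)
qed

end

section \<open>The quantized commuting family\<close>

context tensor_reduction
begin

text \<open>The ring is the completed localization of \<open>R\<close>. What remains is that its
  commutators induce the given bracket of \<open>frac_field T\<close> and that the scalars reduce
  correctly.\<close>

lemma quantizing_exists:
  assumes k: "field k"
  obtains Q :: "(nat \<Rightarrow> (((nat \<Rightarrow> 'b) \<Rightarrow> nat \<Rightarrow> 'k) set \<times> ((nat \<Rightarrow> 'b) \<Rightarrow> nat \<Rightarrow> 'k) set) set) ring" and \<eta> red emb
  where "quantizing Q (frac_field T) \<eta> red k (\<lambda>d. emb (d \<odot>\<^bsub>R\<^esub> \<one>\<^bsub>R\<^esub>))" "emb \<in> ring_hom R Q"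
    "\<And>r. r \<in> carrier R \<Longrightarrow> red (emb r) = fractions.incl T (\<rho> r)"
proof -
  interpret FD: formal_domain R T h \<rho> by (rule formal_domain)
  interpret Qh: hadic_ring FD.Q "frac_field T" "FD.emb h" FD.red by (rule FD.hadic_ring_Q)
  interpret kk: field k by (rule k)
  interpret inc: ring_hom_ring T "frac_field T" FD.T.incl
    by (rule ring_hom_ringI2[OF TA.ring_T Qh.K.ring_axioms FD.T.incl_hom])
  define \<iota> where "\<iota> d = FD.emb (d \<odot>\<^bsub>R\<^esub> \<one>\<^bsub>R\<^esub>)" for d
  have sc: "d \<odot>\<^bsub>R\<^esub> \<one>\<^bsub>R\<^esub> \<in> carrier R" if "d \<in> carrier kh" for d
    using that by (rule TB.T.smult_closed) (rule TB.T.B.one_closed)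
  have emb_c: "FD.emb r \<in> carrier FD.Q" if "r \<in> carrier R" for r
    by (rule ring_hom_closed[OF FD.emb_hom that])
  \<comment> \<open>On the image of \<open>R\<close> the induced bracket is that of
    \<open>T\<close>, by the commutator formula in the tensor power.\<close>
  have D_emb: "Qh.D (FD.emb r) (FD.emb u) = FD.T.incl \<lbrace>\<rho> r, \<rho> u\<rbrace>\<^bsub>T\<^esub>" if r: "r \<in> carrier R" and u: "u \<in> carrier R" for r u
  proof -
    obtain W where W: "W \<in> carrier R" "r \<otimes>\<^bsub>R\<^esub> u = u \<otimes>\<^bsub>R\<^esub> r \<oplus>\<^bsub>R\<^esub> h \<otimes>\<^bsub>R\<^esub> W" "\<rho> W = \<lbrace>\<rho> r, \<rho> u\<rbrace>\<^bsub>T\<^esub>"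
      using commutator[OF r u] by (elim bexE conjE)
    have c: "u \<otimes>\<^bsub>R\<^esub> r \<in> carrier R" "h \<otimes>\<^bsub>R\<^esub> W \<in> carrier R"
      by (rule TB.T.B.m_closed[OF u r], rule TB.T.B.m_closed[OF h_closed W(1)])
    have "FD.emb r \<otimes>\<^bsub>FD.Q\<^esub> FD.emb u = FD.emb (r \<otimes>\<^bsub>R\<^esub> u)" by (rule ring_hom_mult[OF FD.emb_hom r u, symmetric])
    also have "\<dots> = FD.emb (u \<otimes>\<^bsub>R\<^esub> r) \<oplus>\<^bsub>FD.Q\<^esub> FD.emb (h \<otimes>\<^bsub>R\<^esub> W)"
      unfolding W(2) by (rule ring_hom_add[OF FD.emb_hom c])
    also have "\<dots> = FD.emb u \<otimes>\<^bsub>FD.Q\<^esub> FD.emb r \<oplus>\<^bsub>FD.Q\<^esub> FD.emb h \<otimes>\<^bsub>FD.Q\<^esub> FD.emb W"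
      by (simp only: ring_hom_mult[OF FD.emb_hom u r] ring_hom_mult[OF FD.emb_hom h_closed W(1)])
    finally have "Qh.comm_quot (FD.emb r) (FD.emb u) = FD.emb W"
      by (intro Qh.comm_quotI emb_c r u W(1))
    then show ?thesis unfolding Qh.D_def by (simp only: FD.red_emb[OF W(1)] W(3))
  qed
  \<comment> \<open>All members of the union that defines the bracket of two fractions equal
    \<open>Qh.D a b\<close>: numerators and denominators are lifted to \<open>R\<close>, where
    \<open>D_emb\<close> applies, and \<open>D_fraction\<close> supplies the quotient
    formula.\<close>
  have bracket: "\<lbrace>FD.red a, FD.red b\<rbrace>\<^bsub>frac_field T\<^esub> = Qh.D a b" if a: "a \<in> carrier FD.Q" and b: "b \<in> carrier FD.Q" for a b
  proof -
    \<comment> \<open>A representative enters \<open>D_fraction\<close> in the multiplied form: the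
      fraction times its denominator is the numerator.\<close>
    have repr: "FD.T.incl p = FD.red x \<otimes>\<^bsub>frac_field T\<^esub> FD.T.incl s \<and> p \<in> carrier T \<and> s \<in> FD.T.D"
      if x: "x \<in> carrier FD.Q" and ps: "(p, s) \<in> FD.red x" for x p s
    proof -
      have "FD.red x \<in> carrier (frac_field T)" using x by (rule Qh.red_simps(1))
      then obtain p0 s0 where 0: "p0 \<in> carrier T" "s0 \<in> FD.T.D" "FD.red x = fraction T p0 s0" by (rule FD.T.frac_cases)
      note m = FD.T.fraction_mem[OF ps[unfolded 0(3)] 0(1,2)]
      note mc = TA.T.B.m_closed TA.T.B.one_closed
      have s: "s \<in> carrier T" using m(2) by simp
      have "FD.red x \<otimes>\<^bsub>frac_field T\<^esub> FD.T.incl s = fraction T (p \<otimes>\<^bsub>T\<^esub> s) (s \<otimes>\<^bsub>T\<^esub> \<one>\<^bsub>T\<^esub>)"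
        unfolding 0(3) m(3)[symmetric] FD.T.incl_def by (rule FD.T.frac_mult[OF m(1,2) s FD.T.one_in_D])
      also have "\<dots> = fraction T p \<one>\<^bsub>T\<^esub>"
      proof (rule FD.T.fraction_eq_iff[THEN iffD2])
        show "p \<otimes>\<^bsub>T\<^esub> s \<otimes>\<^bsub>T\<^esub> \<one>\<^bsub>T\<^esub> = p \<otimes>\<^bsub>T\<^esub> (s \<otimes>\<^bsub>T\<^esub> \<one>\<^bsub>T\<^esub>)" by (rule TA.T.B.m_assoc[OF m(1) s mc(2)])
        show "s \<otimes>\<^bsub>T\<^esub> \<one>\<^bsub>T\<^esub> \<in> FD.T.D" by (rule FD.T.D_mult[OF m(2) FD.T.one_in_D])
        show "p \<otimes>\<^bsub>T\<^esub> s \<in> carrier T" by (rule mc(1)[OF m(1) s])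
      qed (rule m(1) FD.T.one_in_D)+
      finally show ?thesis using m(1,2) unfolding FD.T.incl_def by simp
    qed
    have ne: "FD.red x \<noteq> {}" if x: "x \<in> carrier FD.Q" for x
    proof -
      have "FD.red x \<in> carrier (frac_field T)" using x by (rule Qh.red_simps(1))
      then obtain p0 s0 where 0: "p0 \<in> carrier T" "s0 \<in> FD.T.D" "FD.red x = fraction T p0 s0" by (rule FD.T.frac_cases)
      show ?thesis unfolding 0(3) by (rule FD.T.fraction_nonempty[OF 0(1,2)])
    qed
    have br: "p \<in> carrier T \<Longrightarrow> q \<in> carrier T \<Longrightarrow> \<lbrace>p, q\<rbrace>\<^bsub>T\<^esub> \<in> carrier T" for p q
    proof -
      assume "p \<in> carrier T" "q \<in> carrier T"
      then have "p \<in> \<rho> ` carrier R" "q \<in> \<rho> ` carrier R" by (simp_all only: rho_surj)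
      then obtain P U where "p = \<rho> P" "P \<in> carrier R" "q = \<rho> U" "U \<in> carrier R" by (elim imageE)
      moreover obtain W where "W \<in> carrier R" "\<rho> W = \<lbrace>\<rho> P, \<rho> U\<rbrace>\<^bsub>T\<^esub>"
        using commutator[OF \<open>P \<in> carrier R\<close> \<open>U \<in> carrier R\<close>] by (elim bexE conjE)
      ultimately show "\<lbrace>p, q\<rbrace>\<^bsub>T\<^esub> \<in> carrier T" using rho_closed[of W] by simp
    qed
    have "fraction T
         (((s \<otimes>\<^bsub>T\<^esub> t \<otimes>\<^bsub>T\<^esub> \<lbrace>p, q\<rbrace>\<^bsub>T\<^esub> \<ominus>\<^bsub>T\<^esub> s \<otimes>\<^bsub>T\<^esub> q \<otimes>\<^bsub>T\<^esub> \<lbrace>p, t\<rbrace>\<^bsub>T\<^esub>)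
            \<ominus>\<^bsub>T\<^esub> p \<otimes>\<^bsub>T\<^esub> t \<otimes>\<^bsub>T\<^esub> \<lbrace>s, q\<rbrace>\<^bsub>T\<^esub>)
            \<oplus>\<^bsub>T\<^esub> p \<otimes>\<^bsub>T\<^esub> q \<otimes>\<^bsub>T\<^esub> \<lbrace>s, t\<rbrace>\<^bsub>T\<^esub>)
         ((s \<otimes>\<^bsub>T\<^esub> s) \<otimes>\<^bsub>T\<^esub> (t \<otimes>\<^bsub>T\<^esub> t)) = Qh.D a b" (is "fraction T ?num ?den = _")
      if ps: "(p, s) \<in> FD.red a" and qt: "(q, t) \<in> FD.red b" for p s q t
    proof -
      note pa = repr[OF a ps] and qb = repr[OF b qt]
      have c: "p \<in> carrier T" "s \<in> carrier T" "q \<in> carrier T" "t \<in> carrier T" using pa qb by simp_all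
      then have "p \<in> \<rho> ` carrier R" "s \<in> \<rho> ` carrier R" "q \<in> \<rho> ` carrier R" "t \<in> \<rho> ` carrier R" by (simp_all only: rho_surj)
      then obtain P S U V where l: "p = \<rho> P" "P \<in> carrier R" "s = \<rho> S" "S \<in> carrier R" "q = \<rho> U" "U \<in> carrier R" "t = \<rho> V" "V \<in> carrier R"
        by (elim imageE)
      have bc: "\<lbrace>p, q\<rbrace>\<^bsub>T\<^esub> \<in> carrier T" "\<lbrace>p, t\<rbrace>\<^bsub>T\<^esub> \<in> carrier T" "\<lbrace>s, q\<rbrace>\<^bsub>T\<^esub> \<in> carrier T" "\<lbrace>s, t\<rbrace>\<^bsub>T\<^esub> \<in> carrier T"
        using br c by simp_all
      have rd: "FD.red (FD.emb P) = FD.T.incl p" "FD.red (FD.emb S) = FD.T.incl s" "FD.red (FD.emb U) = FD.T.incl q" "FD.red (FD.emb V) = FD.T.incl t"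
        using FD.red_emb l by simp_all
      have De: "Qh.D (FD.emb P) (FD.emb U) = FD.T.incl \<lbrace>p, q\<rbrace>\<^bsub>T\<^esub>" "Qh.D (FD.emb P) (FD.emb V) = FD.T.incl \<lbrace>p, t\<rbrace>\<^bsub>T\<^esub>"
        "Qh.D (FD.emb S) (FD.emb U) = FD.T.incl \<lbrace>s, q\<rbrace>\<^bsub>T\<^esub>" "Qh.D (FD.emb S) (FD.emb V) = FD.T.incl \<lbrace>s, t\<rbrace>\<^bsub>T\<^esub>"
        using D_emb l by simp_all
      have hyp: "FD.red a \<otimes>\<^bsub>frac_field T\<^esub> FD.red (FD.emb S) = FD.red (FD.emb P)" "FD.red b \<otimes>\<^bsub>frac_field T\<^esub> FD.red (FD.emb V) = FD.red (FD.emb U)"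
        unfolding rd using pa qb by simp_all
      note eq = Qh.D_fraction[OF a b emb_c[OF l(4)] emb_c[OF l(8)] emb_c[OF l(2)] emb_c[OF l(6)] hyp, unfolded rd De]
      have nc: "?num \<in> carrier T" using c bc by (simp add: a_minus_def)
      have dc: "?den \<in> FD.T.D" using pa qb by (intro FD.T.D_mult) simp_all
      have "Qh.D a b \<otimes>\<^bsub>frac_field T\<^esub> FD.T.incl ?den = FD.T.incl ?num"
        using eq c bc by (simp add: a_minus_def)
      then show ?thesis using FD.T.frac_unique[OF Qh.D_closed[OF a b] nc dc] by simp
    qed
    then show ?thesis
      unfolding frac_field_def by simp (rule UN_const_eq[OF ne[OF a] ne[OF b]], simp)
  qed
  have "quantizing FD.Q (frac_field T) (FD.emb h) FD.red k \<iota>"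
  proof (rule quantizing.intro[OF FD.hadic_ring_Q k quantizing_axioms.intro])
    have "\<iota> = FD.emb \<circ> (\<lambda>d. d \<odot>\<^bsub>R\<^esub> \<one>\<^bsub>R\<^esub>)" by (simp add: \<iota>_def fun_eq_iff)
    then show "\<iota> \<in> ring_hom kh FD.Q" using ring_hom_trans[OF TB.T.smult_one_hom FD.emb_hom] by simp
    show "x \<otimes>\<^bsub>FD.Q\<^esub> \<iota> d = \<iota> d \<otimes>\<^bsub>FD.Q\<^esub> x" if d: "d \<in> carrier kh" and x: "x \<in> carrier FD.Q" for d x
      unfolding \<iota>_def by (rule FD.emb_central[OF sc[OF d] TB.T.smult_one_central[OF d] x])
    show "\<iota> (hbar k) = FD.emb h" unfolding \<iota>_def h_def ..
    show "FD.red (\<iota> (const_series k c) \<otimes>\<^bsub>FD.Q\<^esub> x) = c \<odot>\<^bsub>frac_field T\<^esub> FD.red x" if c: "c \<in> carrier k" and x: "x \<in> carrier FD.Q" for c x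
    proof -
      note cs = const_mem[OF c]
      have "\<rho> \<one>\<^bsub>R\<^esub> = \<one>\<^bsub>T\<^esub>" by (rule ring_hom_one[OF rho_hom])
      then have "\<rho> (const_series k c \<odot>\<^bsub>R\<^esub> \<one>\<^bsub>R\<^esub>) = c \<odot>\<^bsub>T\<^esub> \<one>\<^bsub>T\<^esub>"
        using rho_smult[OF cs TB.T.B.one_closed] by (simp add: const_series_def)
      then have "FD.red (\<iota> (const_series k c)) = FD.T.incl (c \<odot>\<^bsub>T\<^esub> \<one>\<^bsub>T\<^esub>)"
        unfolding \<iota>_def using FD.red_emb[OF sc[OF cs]] by simp
      moreover have "\<iota> (const_series k c) \<in> carrier FD.Q" unfolding \<iota>_def by (rule emb_c[OF sc[OF cs]])
      ultimately have "FD.red (\<iota> (const_series k c) \<otimes>\<^bsub>FD.Q\<^esub> x) = FD.T.incl (c \<odot>\<^bsub>T\<^esub> \<one>\<^bsub>T\<^esub>) \<otimes>\<^bsub>frac_field T\<^esub> FD.red x"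
        using Qh.red_simps(2) x by simp
      also have "\<dots> = c \<odot>\<^bsub>frac_field T\<^esub> FD.red x"
        by (rule FD.T.frac_smult[OF TA.T.smult_conv[OF c] TA.T.smult_closed[OF c TA.T.B.one_closed] Qh.red_simps(1)[OF x], symmetric])
      finally show ?thesis .
    qed
    show "\<exists>e\<in>carrier FD.Q. a \<otimes>\<^bsub>FD.Q\<^esub> b \<ominus>\<^bsub>FD.Q\<^esub> b \<otimes>\<^bsub>FD.Q\<^esub> a = FD.emb h \<otimes>\<^bsub>FD.Q\<^esub> e \<and> FD.red e = \<lbrace>FD.red a, FD.red b\<rbrace>\<^bsub>frac_field T\<^esub>"
      if a: "a \<in> carrier FD.Q" and b: "b \<in> carrier FD.Q" for a b
    proof (intro bexI conjI)
      note q = Qh.comm_quot[OF a b]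
      show "Qh.comm_quot a b \<in> carrier FD.Q" by (rule q(1))
      show "FD.red (Qh.comm_quot a b) = \<lbrace>FD.red a, FD.red b\<rbrace>\<^bsub>frac_field T\<^esub>" unfolding bracket[OF a b] Qh.D_def ..
      have c: "b \<otimes>\<^bsub>FD.Q\<^esub> a \<in> carrier FD.Q" "FD.emb h \<otimes>\<^bsub>FD.Q\<^esub> Qh.comm_quot a b \<in> carrier FD.Q"
        by (rule Qh.Q.m_closed[OF b a], rule Qh.Q.m_closed[OF Qh.h_closed q(1)])
      show "a \<otimes>\<^bsub>FD.Q\<^esub> b \<ominus>\<^bsub>FD.Q\<^esub> b \<otimes>\<^bsub>FD.Q\<^esub> a = FD.emb h \<otimes>\<^bsub>FD.Q\<^esub> Qh.comm_quot a b"
        unfolding q(2) a_minus_def using c Qh.Q.a_comm[OF c] by (simp add: Qh.Q.a_assoc Qh.Q.r_neg)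
    qed
  qed
  then show thesis unfolding \<iota>_def by (rule that[OF _ FD.emb_hom FD.red_emb])
qed

end

section \<open>Nonvanishing of \<Delta>_0\<close>

context tensor
begin

text \<open>Choose a complement \<open>G\<close> of the span of the \<open>g j\<close>;
  \<open>\<phi> a i\<close> is the coefficient of \<open>g i\<close> in the component of
  \<open>a\<close> in that span.\<close>

lemma coordinates_exist:
  assumes k: "field k" and g: "g \<in> {1..n} \<rightarrow> carrier A" and li: "lin_indep k A {1..n} g"
  obtains \<phi> where "\<And>i a. i \<in> {1..n} \<Longrightarrow> a \<in> carrier A \<Longrightarrow> \<phi> a i \<in> carrier k"
    "\<And>i a b. i \<in> {1..n} \<Longrightarrow> a \<in> carrier A \<Longrightarrow> b \<in> carrier A \<Longrightarrow> \<phi> (a \<oplus> b) i = \<phi> a i \<oplus>\<^bsub>k\<^esub> \<phi> b i"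
    "\<And>i c a. i \<in> {1..n} \<Longrightarrow> c \<in> carrier k \<Longrightarrow> a \<in> carrier A \<Longrightarrow> \<phi> (c \<odot> a) i = c \<otimes>\<^bsub>k\<^esub> \<phi> a i"
    "\<And>i j. i \<in> {1..n} \<Longrightarrow> j \<in> {1..n} \<Longrightarrow> \<phi> (g j) i = (if i = j then \<one>\<^bsub>k\<^esub> else \<zero>\<^bsub>k\<^esub>)"
proof -
  interpret kk: field k by (rule k)
  define C where "C = {1..n} \<rightarrow> carrier k"
  define s where "s c = (\<Oplus>j\<in>{1..n}. c j \<odot> g j)" for c
  have t: "(\<lambda>j. c j \<odot> g j) \<in> {1..n} \<rightarrow> carrier A" if "c \<in> C" for c
    using that g by (auto simp: C_def Pi_iff)
  have sc: "s c \<in> carrier A" if "c \<in> C" for c unfolding s_def by (rule M.finsum_closed[OF t[OF that]])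
  have C_add: "(\<lambda>j. c j \<oplus>\<^bsub>k\<^esub> d j) \<in> C" if "c \<in> C" "d \<in> C" for c d using that by (auto simp: C_def Pi_iff)
  have C_smult: "(\<lambda>j. r \<otimes>\<^bsub>k\<^esub> c j) \<in> C" if "r \<in> carrier k" "c \<in> C" for r c using that by (auto simp: C_def Pi_iff)
  have C_neg: "(\<lambda>j. \<ominus>\<^bsub>k\<^esub> c j) \<in> C" if "c \<in> C" for c using that by (auto simp: C_def Pi_iff)
  have C0: "(\<lambda>j. \<zero>\<^bsub>k\<^esub>) \<in> C" by (auto simp: C_def)
  have C1: "(\<lambda>j. if j = i then \<one>\<^bsub>k\<^esub> else \<zero>\<^bsub>k\<^esub>) \<in> C" for i by (auto simp: C_def)
  have s_add: "s (\<lambda>j. c j \<oplus>\<^bsub>k\<^esub> d j) = s c \<oplus> s d" if c: "c \<in> C" and d: "d \<in> C" for c d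
  proof -
    have "s (\<lambda>j. c j \<oplus>\<^bsub>k\<^esub> d j) = (\<Oplus>j\<in>{1..n}. c j \<odot> g j \<oplus> d j \<odot> g j)"
      unfolding s_def
    proof (rule M.finsum_cong')
      show "(\<lambda>j. c j \<odot> g j \<oplus> d j \<odot> g j) \<in> {1..n} \<rightarrow> carrier A" using t[OF c] t[OF d] by (auto simp: Pi_iff)
      show "(c j \<oplus>\<^bsub>k\<^esub> d j) \<odot> g j = c j \<odot> g j \<oplus> d j \<odot> g j" if "j \<in> {1..n}" for j
        using c d g that by (intro smult_l_distr) (auto simp: C_def Pi_iff)
    qed simp
    then show ?thesis unfolding s_def by (simp only: M.finsum_addf[OF t[OF c] t[OF d]])
  qed
  have s_smult: "s (\<lambda>j. r \<otimes>\<^bsub>k\<^esub> c j) = r \<odot> s c" if r: "r \<in> carrier k" and c: "c \<in> C" for r c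
  proof -
    have "r \<odot> s c = (\<Oplus>j\<in>{1..n}. r \<odot> (c j \<odot> g j))"
      unfolding s_def by (rule finsum_smult_ldistr[OF _ r t[OF c]]) simp
    also have "\<dots> = s (\<lambda>j. r \<otimes>\<^bsub>k\<^esub> c j)"
      unfolding s_def
    proof (rule M.finsum_cong'[OF refl t[OF C_smult[OF r c]]])
      show "r \<odot> (c j \<odot> g j) = (r \<otimes>\<^bsub>k\<^esub> c j) \<odot> g j" if "j \<in> {1..n}" for j
        using c g that r by (intro smult_assoc1[symmetric]) (auto simp: C_def Pi_iff)
    qed
    finally show ?thesis ..
  qed
  have s_zero: "s (\<lambda>j. \<zero>\<^bsub>k\<^esub>) = \<zero>" using s_smult[OF R.zero_closed C0] sc[OF C0] by simp
  have s_neg: "s (\<lambda>j. \<ominus>\<^bsub>k\<^esub> c j) = \<ominus> s c" if c: "c \<in> C" for c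
  proof -
    have "s (\<lambda>j. \<ominus>\<^bsub>k\<^esub> c j) \<oplus> s c = s (\<lambda>j. \<ominus>\<^bsub>k\<^esub> c j \<oplus>\<^bsub>k\<^esub> c j)" using s_add[OF C_neg[OF c] c] by simp
    also have "\<dots> = s (\<lambda>j. \<zero>\<^bsub>k\<^esub>)" unfolding s_def
      by (rule M.finsum_cong'[OF refl t[OF C0]]) (use c in \<open>auto simp: C_def Pi_iff R.l_neg\<close>)
    finally show ?thesis using s_zero sc[OF c] sc[OF C_neg[OF c]] M.minus_equality by simp
  qed
  have s_single: "s (\<lambda>j. if j = i then \<one>\<^bsub>k\<^esub> else \<zero>\<^bsub>k\<^esub>) = g i" if i: "i \<in> {1..n}" for i
  proof -
    have gi: "g i \<in> carrier A" using g i by (auto simp: Pi_iff)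
    have "s (\<lambda>j. if j = i then \<one>\<^bsub>k\<^esub> else \<zero>\<^bsub>k\<^esub>) = (\<Oplus>j\<in>{1..n}. if i = j then g j else \<zero>)"
      unfolding s_def by (rule M.finsum_cong'[OF refl]) (use g in \<open>auto simp: Pi_iff\<close>)
    also have "\<dots> = g i" using i g by (intro M.finsum_singleton) auto
    finally show ?thesis .
  qed
  have s_inj: "c j = \<zero>\<^bsub>k\<^esub>" if "c \<in> C" "s c = \<zero>" "j \<in> {1..n}" for c j
    using li that unfolding lin_indep_def s_def C_def by simp
  have U: "submodule (s ` C) k A"
  proof (rule submoduleI)
    show "s ` C \<subseteq> carrier A" using sc by auto
    show "\<zero> \<in> s ` C" by (rule image_eqI[where x = "\<lambda>j. \<zero>\<^bsub>k\<^esub>"]) (simp_all only: s_zero C0)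
    show "\<ominus> a \<in> s ` C" if "a \<in> s ` C" for a
      using that by (rule imageE) (simp only: s_neg[symmetric] image_eqI[OF refl C_neg])
    show "a \<oplus> b \<in> s ` C" if a: "a \<in> s ` C" and b: "b \<in> s ` C" for a b
    proof -
      obtain c d where "a = s c" "c \<in> C" "b = s d" "d \<in> C" using a b by (elim imageE)
      then show ?thesis using s_add C_add by (intro image_eqI[of _ _ "\<lambda>j. c j \<oplus>\<^bsub>k\<^esub> d j"]) simp_all
    qed
    show "r \<odot> x \<in> s ` C" if r: "r \<in> carrier k" and x: "x \<in> s ` C" for r x
    proof -
      obtain c where "x = s c" "c \<in> C" using x by (elim imageE)
      then show ?thesis using s_smult[OF r] C_smult[OF r] by (intro image_eqI[of _ _ "\<lambda>j. r \<otimes>\<^bsub>k\<^esub> c j"]) simp_all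
    qed
  qed
  have W: "submodule {\<zero>} k A" by (rule submoduleI) auto
  have WU: "{\<zero>} \<inter> s ` C = {\<zero>}" using submodule_zero[OF U] by auto
  obtain G where G: "submodule G k A" "G \<inter> s ` C = {\<zero>}" "\<And>x. x \<in> carrier A \<Longrightarrow> \<exists>y\<in>G. \<exists>u\<in>s ` C. x = y \<oplus> u"
    using complement_exists[OF k W U WU] by metis
  interpret G: submodule G k A by (rule G(1))
  have Gc: "y \<in> carrier A" if "y \<in> G" for y using G.subset that by auto
  have G_add: "y \<oplus> z \<in> G" if "y \<in> G" "z \<in> G" for y z using G.m_closed[OF that] by simp
  have G_neg: "\<ominus> y \<in> G" if "y \<in> G" for y using G.m_inv_closed[OF that] by (simp add: a_inv_def)
  \<comment> \<open>The difference of two decompositions lies in \<open>G\<close> and in the span,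
    hence is zero; linear independence then gives equal coefficients.\<close>
  have unique: "c i = d i" if c: "c \<in> C" and d: "d \<in> C" and y: "y \<in> G" "z \<in> G" and eq: "y \<oplus> s c = z \<oplus> s d" and i: "i \<in> {1..n}" for c d y z i
  proof -
    note e = C_add[OF c C_neg[OF d]]
    have "s (\<lambda>j. c j \<oplus>\<^bsub>k\<^esub> \<ominus>\<^bsub>k\<^esub> d j) = s c \<ominus> s d"
      using s_add[OF c C_neg[OF d]] s_neg[OF d] by (simp add: a_minus_def)
    also have "\<dots> = \<ominus> y \<oplus> (y \<oplus> s c) \<ominus> s d" using sc[OF c] sc[OF d] Gc[OF y(1)] by (simp add: M.r_neg1)
    also have "\<dots> = (\<ominus> y \<oplus> z) \<oplus> (s d \<oplus> \<ominus> s d)" unfolding eq using sc[OF d] Gc[OF y(1)] Gc[OF y(2)]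
      by (simp add: a_minus_def M.a_assoc)
    also have "\<dots> = z \<oplus> \<ominus> y" using sc[OF d] Gc[OF y(1)] Gc[OF y(2)] by (simp add: M.r_neg M.a_comm)
    finally have z: "s (\<lambda>j. c j \<oplus>\<^bsub>k\<^esub> \<ominus>\<^bsub>k\<^esub> d j) = z \<oplus> \<ominus> y" .
    have "s (\<lambda>j. c j \<oplus>\<^bsub>k\<^esub> \<ominus>\<^bsub>k\<^esub> d j) \<in> G \<inter> s ` C"
      using G_add[OF y(2) G_neg[OF y(1)]] e by (intro IntI imageI) (simp_all only: z)
    then have "s (\<lambda>j. c j \<oplus>\<^bsub>k\<^esub> \<ominus>\<^bsub>k\<^esub> d j) = \<zero>" unfolding G(2) by simp
    then have "c i \<oplus>\<^bsub>k\<^esub> \<ominus>\<^bsub>k\<^esub> d i = \<zero>\<^bsub>k\<^esub>" using s_inj[OF e _ i] by simp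
    moreover have "c i \<in> carrier k" "d i \<in> carrier k" using c d i by (auto simp: C_def Pi_iff)
    ultimately show ?thesis using R.r_right_minus_eq[of "c i" "d i"] by (simp add: a_minus_def)
  qed
  define \<phi> where "\<phi> x = (SOME c. c \<in> C \<and> (\<exists>y\<in>G. x = y \<oplus> s c))" for x
  have \<phi>: "\<phi> x \<in> C \<and> (\<exists>y\<in>G. x = y \<oplus> s (\<phi> x))" if x: "x \<in> carrier A" for x
  proof -
    obtain y c where "y \<in> G" "c \<in> C" "x = y \<oplus> s c" using G(3)[OF x] by (elim bexE imageE) simp
    then have "c \<in> C \<and> (\<exists>y\<in>G. x = y \<oplus> s c)" by auto
    then show ?thesis unfolding \<phi>_def by (rule someI[of "\<lambda>c. c \<in> C \<and> (\<exists>y\<in>G. x = y \<oplus> s c)"])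
  qed
  have \<phi>I: "\<phi> x i = c i" if c: "c \<in> C" and y: "y \<in> G" and x: "x = y \<oplus> s c" and i: "i \<in> {1..n}" for x c y i
  proof -
    have "x \<in> carrier A" unfolding x using sc[OF c] Gc[OF y] by simp
    from \<phi>[OF this] obtain z where z: "\<phi> x \<in> C" "z \<in> G" "x = z \<oplus> s (\<phi> x)" by (elim conjE bexE)
    show ?thesis by (rule unique[OF z(1) c z(2) y trans[OF z(3)[symmetric] x] i])
  qed
  show thesis
  proof (rule that[of \<phi>])
    show "\<phi> a i \<in> carrier k" if "i \<in> {1..n}" "a \<in> carrier A" for i a using \<phi>[OF that(2)] that(1) by (auto simp: C_def Pi_iff)
    show "\<phi> (a \<oplus> b) i = \<phi> a i \<oplus>\<^bsub>k\<^esub> \<phi> b i" if i: "i \<in> {1..n}" and a: "a \<in> carrier A" and b: "b \<in> carrier A" for i a b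
    proof -
      obtain y where y: "\<phi> a \<in> C" "y \<in> G" "a = y \<oplus> s (\<phi> a)" using \<phi>[OF a] by (elim conjE bexE)
      obtain z where z: "\<phi> b \<in> C" "z \<in> G" "b = z \<oplus> s (\<phi> b)" using \<phi>[OF b] by (elim conjE bexE)
      have "a \<oplus> b = (y \<oplus> s (\<phi> a)) \<oplus> (z \<oplus> s (\<phi> b))" by (simp only: y(3)[symmetric] z(3)[symmetric])
      also have "\<dots> = (y \<oplus> z) \<oplus> s (\<lambda>j. \<phi> a j \<oplus>\<^bsub>k\<^esub> \<phi> b j)"
        using Gc[OF y(2)] Gc[OF z(2)] sc[OF y(1)] sc[OF z(1)] by (simp add: s_add[OF y(1) z(1)] M.a_ac)
      finally show ?thesis by (rule \<phi>I[OF C_add[OF y(1) z(1)] G_add[OF y(2) z(2)] _ i])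
    qed
    show "\<phi> (c \<odot> a) i = c \<otimes>\<^bsub>k\<^esub> \<phi> a i" if i: "i \<in> {1..n}" and c: "c \<in> carrier k" and a: "a \<in> carrier A" for i c a
    proof -
      obtain y where y: "\<phi> a \<in> C" "y \<in> G" "a = y \<oplus> s (\<phi> a)" using \<phi>[OF a] by (elim conjE bexE)
      have "c \<odot> a = c \<odot> (y \<oplus> s (\<phi> a))" by (simp only: y(3)[symmetric])
      also have "\<dots> = c \<odot> y \<oplus> s (\<lambda>j. c \<otimes>\<^bsub>k\<^esub> \<phi> a j)"
        unfolding s_smult[OF c y(1)] by (rule smult_r_distr[OF c Gc[OF y(2)] sc[OF y(1)]])
      finally show ?thesis by (rule \<phi>I[OF C_smult[OF c y(1)] G.smult_closed[OF c y(2)] _ i])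
    qed
    show "\<phi> (g j) i = (if i = j then \<one>\<^bsub>k\<^esub> else \<zero>\<^bsub>k\<^esub>)" if i: "i \<in> {1..n}" and j: "j \<in> {1..n}" for i j
    proof -
      have "g j = \<zero> \<oplus> s (\<lambda>i. if i = j then \<one>\<^bsub>k\<^esub> else \<zero>\<^bsub>k\<^esub>)" unfolding s_single[OF j] using g j by (auto simp: Pi_iff)
      then show ?thesis by (rule \<phi>I[OF C1 submodule_zero[OF G(1)] _ i])
    qed
  qed
qed

text \<open>The linear form on \<open>T\<close> given by the product of the coordinates, the
  coordinate number \<open>i\<close> being applied to the tensor factor number \<open>i\<close>,
  maps the term of a permutation \<open>p\<close> to 1 if \<open>p\<close> is the identity and to 0
  otherwise. So it takes the value 1 on the determinant.\<close>

lemma det_slots_nonzero: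
  assumes k: "field k" and cr: "cring T" and g: "g \<in> {1..n} \<rightarrow> carrier A" and li: "lin_indep k A {1..n} g"
  shows "cring.det T n (\<lambda>i j. slot i (g j)) \<noteq> \<zero>\<^bsub>T\<^esub>"
proof -
  interpret kk: field k by (rule k)
  interpret Tc: cring T by (rule cr)
  obtain \<phi> where \<phi>: "\<And>i a. i \<in> {1..n} \<Longrightarrow> a \<in> carrier A \<Longrightarrow> \<phi> a i \<in> carrier k"
    "\<And>i a b. i \<in> {1..n} \<Longrightarrow> a \<in> carrier A \<Longrightarrow> b \<in> carrier A \<Longrightarrow> \<phi> (a \<oplus> b) i = \<phi> a i \<oplus>\<^bsub>k\<^esub> \<phi> b i"
    "\<And>i c a. i \<in> {1..n} \<Longrightarrow> c \<in> carrier k \<Longrightarrow> a \<in> carrier A \<Longrightarrow> \<phi> (c \<odot> a) i = c \<otimes>\<^bsub>k\<^esub> \<phi> a i"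
    "\<And>i j. i \<in> {1..n} \<Longrightarrow> j \<in> {1..n} \<Longrightarrow> \<phi> (g j) i = (if i = j then \<one>\<^bsub>k\<^esub> else \<zero>\<^bsub>k\<^esub>)"
    by (rule coordinates_exist[OF k g li]) blast
  \<comment> \<open>The field as a module over itself, the target of the linear form.\<close>
  define G where "G = scalars_by k (\<lambda>x. x)"
  have G: "module k G" unfolding G_def
    by (rule module_scalars_by[OF R.is_cring R.ring_axioms]) (rule ring_hom_memI; simp)
  define F where "F x = (\<Otimes>\<^bsub>k\<^esub>i\<in>{1..n}. \<phi> (x i) i)" for x
  have xc: "x i \<in> carrier A" if "x \<in> tup" "i \<in> {1..n}" for x i using that by (auto simp: tuples_def)
  have pc: "(\<Otimes>\<^bsub>k\<^esub>i\<in>J. \<phi> (x i) i) \<in> carrier k" if "x \<in> tup" "J \<subseteq> {1..n}" for x J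
    using \<phi>(1) xc[OF that(1)] that(2) by (intro R.finprod_closed) auto
  have upd: "F (x(i := a)) = \<phi> a i \<otimes>\<^bsub>k\<^esub> (\<Otimes>\<^bsub>k\<^esub>l\<in>{1..n} - {i}. \<phi> (x l) l)"
    if x: "x \<in> tup" and i: "i \<in> {1..n}" and a: "a \<in> carrier A" for x i a
  proof -
    have c: "\<phi> (x l) l \<in> carrier k" if "l \<in> {1..n} - {i}" for l using that \<phi>(1) xc[OF x, of l] by simp
    have "(\<Otimes>\<^bsub>k\<^esub>l\<in>insert i ({1..n} - {i}). \<phi> ((x(i := a)) l) l)
      = \<phi> ((x(i := a)) i) i \<otimes>\<^bsub>k\<^esub> (\<Otimes>\<^bsub>k\<^esub>l\<in>{1..n} - {i}. \<phi> ((x(i := a)) l) l)"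
      using c \<phi>(1)[OF i a] by (intro R.finprod_insert) auto
    also have "(\<Otimes>\<^bsub>k\<^esub>l\<in>{1..n} - {i}. \<phi> ((x(i := a)) l) l) = (\<Otimes>\<^bsub>k\<^esub>l\<in>{1..n} - {i}. \<phi> (x l) l)"
      using c by (intro R.finprod_cong') auto
    finally show ?thesis unfolding F_def using i by (simp add: insert_absorb)
  qed
  have F: "multilinear G F"
    unfolding multilinear_def
  proof (intro conjI ballI Pi_I)
    show "F x \<in> carrier G" if "x \<in> tup" for x using pc[OF that order_refl] by (simp add: F_def G_def)
    fix x i assume x: "x \<in> tup" and i: "i \<in> {1..n}"
    note P = pc[OF x, of "{1..n} - {i}"]
    show "F (x(i := a \<oplus> b)) = F (x(i := a)) \<oplus>\<^bsub>G\<^esub> F (x(i := b))" if a: "a \<in> carrier A" and b: "b \<in> carrier A" for a b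
      unfolding upd[OF x i a] upd[OF x i b] upd[OF x i M.a_closed[OF a b]] \<phi>(2)[OF i a b]
      using P \<phi>(1)[OF i a] \<phi>(1)[OF i b] by (simp add: G_def R.l_distr)
    show "F (x(i := c \<odot> a)) = c \<odot>\<^bsub>G\<^esub> F (x(i := a))" if c: "c \<in> carrier k" and a: "a \<in> carrier A" for c a
      unfolding upd[OF x i a] upd[OF x i smult_closed[OF c a]] \<phi>(3)[OF i c a]
      using P \<phi>(1)[OF i a] c by (simp add: G_def R.m_assoc)
  qed
  obtain \<Lambda> where \<Lambda>: "\<And>U. U \<in> carrier T \<Longrightarrow> \<Lambda> U \<in> carrier G"
    "\<And>U V. U \<in> carrier T \<Longrightarrow> V \<in> carrier T \<Longrightarrow> \<Lambda> (U \<oplus>\<^bsub>T\<^esub> V) = \<Lambda> U \<oplus>\<^bsub>G\<^esub> \<Lambda> V"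
    "\<And>c U. c \<in> carrier k \<Longrightarrow> U \<in> carrier T \<Longrightarrow> \<Lambda> (c \<odot>\<^bsub>T\<^esub> U) = c \<odot>\<^bsub>G\<^esub> \<Lambda> U"
    "\<And>x. x \<in> tup \<Longrightarrow> \<Lambda> (pt x) = F x"
    "\<And>p. p \<in> carrier (tuple_algebra k A n) \<Longrightarrow> \<Lambda> (\<pi> p) = ext G F p"
    by (rule universal[OF G F]) blast
  have \<Lambda>c: "\<Lambda> U \<in> carrier k" if "U \<in> carrier T" for U using \<Lambda>(1)[OF that] by (simp add: G_def)
  have \<Lambda>add: "\<Lambda> (U \<oplus>\<^bsub>T\<^esub> V) = \<Lambda> U \<oplus>\<^bsub>k\<^esub> \<Lambda> V" if "U \<in> carrier T" "V \<in> carrier T" for U V using \<Lambda>(2)[OF that] by (simp add: G_def)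
  have \<Lambda>0: "\<Lambda> \<zero>\<^bsub>T\<^esub> = \<zero>\<^bsub>k\<^esub>"
    using \<Lambda>add[OF T.M.zero_closed T.M.zero_closed] \<Lambda>c[OF T.M.zero_closed] by simp
  have \<Lambda>neg: "\<Lambda> (\<ominus>\<^bsub>T\<^esub> U) = \<ominus>\<^bsub>k\<^esub> \<Lambda> U" if U: "U \<in> carrier T" for U
    using \<Lambda>add[OF T.M.a_inv_closed[OF U] U] \<Lambda>0 \<Lambda>c[OF U] \<Lambda>c[OF T.M.a_inv_closed[OF U]] U R.minus_equality by (simp add: T.M.l_neg)
  have \<Lambda>sum: "\<Lambda> (\<Oplus>\<^bsub>T\<^esub>a\<in>I. u a) = (\<Oplus>\<^bsub>k\<^esub>a\<in>I. \<Lambda> (u a))" if "finite I" "\<And>a. a \<in> I \<Longrightarrow> u a \<in> carrier T" for I and u :: "(nat \<Rightarrow> nat) \<Rightarrow> _"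
    using that
  proof (induction I rule: finite_induct)
    case empty
    show ?case using \<Lambda>0 by simp
  next
    case (insert x I)
    have u: "u \<in> I \<rightarrow> carrier T" "u x \<in> carrier T" using insert.prems by auto
    have v: "(\<lambda>a. \<Lambda> (u a)) \<in> I \<rightarrow> carrier k" "\<Lambda> (u x) \<in> carrier k" using insert.prems \<Lambda>c by auto
    show ?case
      unfolding T.M.finsum_insert[where F = I and a = x and f = u, OF insert.hyps u] R.finsum_insert[where F = I and a = x and f = "\<lambda>a. \<Lambda> (u a)", OF insert.hyps v] \<Lambda>add[OF u(2) T.M.finsum_closed[OF u(1)]]
      using insert.IH insert.prems by simp
  qed
  define \<tau> where "\<tau> p = (\<Otimes>\<^bsub>T\<^esub>i\<in>{1..n}. slot i (g (p i)))" for p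
  have gp: "g (p i) \<in> carrier A" if "p permutes {1..n}" "i \<in> {1..n}" for p i
    by (rule funcset_mem[OF g Tc.perm_in[OF that]])
  have \<tau>c: "\<tau> p \<in> carrier T" if p: "p permutes {1..n}" for p
    unfolding \<tau>_def by (rule Tc.finprod_closed) (rule Pi_I, rule slot_closed, assumption, rule gp[OF p])
  have \<Lambda>\<tau>: "\<Lambda> (\<tau> p) = (if p = id then \<one>\<^bsub>k\<^esub> else \<zero>\<^bsub>k\<^esub>)" if p: "p permutes {1..n}" for p
  proof -
    let ?x = "\<lambda>i\<in>{1..n}. g (p i)"
    have x: "?x \<in> tup" using gp[OF p] by (simp add: tuples_def)
    have "pt ?x = \<tau> p"
      unfolding pt_eq_finprod[OF cr x] \<tau>_def
      by (rule Tc.finprod_cong'[OF refl]) (rule Pi_I, rule slot_closed, assumption, rule gp[OF p], assumption, simp)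
    then have "\<Lambda> (\<tau> p) = F ?x" using \<Lambda>(4)[OF x] by simp
    also have "\<dots> = (\<Otimes>\<^bsub>k\<^esub>i\<in>{1..n}. if i = p i then \<one>\<^bsub>k\<^esub> else \<zero>\<^bsub>k\<^esub>)"
      unfolding F_def
    proof (rule R.finprod_cong')
      show "\<phi> (?x i) i = (if i = p i then \<one>\<^bsub>k\<^esub> else \<zero>\<^bsub>k\<^esub>)" if i: "i \<in> {1..n}" for i
        using \<phi>(4)[OF i Tc.perm_in[OF p i]] i by simp
    qed auto
    finally have 1: "\<Lambda> (\<tau> p) = (\<Otimes>\<^bsub>k\<^esub>i\<in>{1..n}. if i = p i then \<one>\<^bsub>k\<^esub> else \<zero>\<^bsub>k\<^esub>)" .
    show ?thesis
    proof (cases "p = id")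
      case True
      have "(\<Otimes>\<^bsub>k\<^esub>i\<in>{1..n}. if i = p i then \<one>\<^bsub>k\<^esub> else \<zero>\<^bsub>k\<^esub>) = \<one>\<^bsub>k\<^esub>"
        by (rule R.finprod_one_eqI) (simp add: True)
      from trans[OF 1 this] show ?thesis using True by simp
    next
      case False
      then obtain i where "p i \<noteq> i" by (auto simp: fun_eq_iff)
      then have i: "i \<in> {1..n}" "i \<noteq> p i" using permutes_not_in[OF p, of i] by auto
      have "(\<Otimes>\<^bsub>k\<^esub>l\<in>insert i ({1..n} - {i}). if l = p l then \<one>\<^bsub>k\<^esub> else \<zero>\<^bsub>k\<^esub>) =
          (if i = p i then \<one>\<^bsub>k\<^esub> else \<zero>\<^bsub>k\<^esub>) \<otimes>\<^bsub>k\<^esub> (\<Otimes>\<^bsub>k\<^esub>l\<in>{1..n} - {i}. if l = p l then \<one>\<^bsub>k\<^esub> else \<zero>\<^bsub>k\<^esub>)"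
        by (intro R.finprod_insert) auto
      also have "\<dots> = \<zero>\<^bsub>k\<^esub>"
      proof -
        have "(\<Otimes>\<^bsub>k\<^esub>l\<in>{1..n} - {i}. if l = p l then \<one>\<^bsub>k\<^esub> else \<zero>\<^bsub>k\<^esub>) \<in> carrier k" by (intro R.finprod_closed) auto
        then show ?thesis using i(2) by simp
      qed
      finally show ?thesis unfolding 1 using i(1) False by (simp add: insert_absorb)
    qed
  qed
  have "\<Lambda> (Tc.det n (\<lambda>i j. slot i (g j))) = (\<Oplus>\<^bsub>k\<^esub>p\<in>{p. p permutes {1..n}}. \<Lambda> ([sign p] \<cdot>\<^bsub>T\<^esub> \<tau> p))"
    unfolding Tc.det_def \<tau>_def[symmetric] using \<tau>c Tc.finite_perms by (intro \<Lambda>sum Tc.sign_mult_closed) auto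
  also have "\<dots> = (\<Oplus>\<^bsub>k\<^esub>p\<in>{p. p permutes {1..n}}. if id = p then \<one>\<^bsub>k\<^esub> else \<zero>\<^bsub>k\<^esub>)"
  proof (rule R.finsum_cong')
    show "\<Lambda> ([sign p] \<cdot>\<^bsub>T\<^esub> \<tau> p) = (if id = p then \<one>\<^bsub>k\<^esub> else \<zero>\<^bsub>k\<^esub>)" if "p \<in> {p. p permutes {1..n}}" for p
    proof -
      have p: "p permutes {1..n}" using that by simp
      show ?thesis using \<Lambda>\<tau>[OF p] \<Lambda>neg[OF \<tau>c[OF p]] Tc.sign_mult_simps[OF \<tau>c[OF p], of p] by auto
    qed
  qed auto
  also have "\<dots> = \<one>\<^bsub>k\<^esub>" using R.finite_perms permutes_id by (intro R.finsum_singleton) auto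
  finally have "\<Lambda> (Tc.det n (\<lambda>i j. slot i (g j))) = \<one>\<^bsub>k\<^esub>" .
  then show ?thesis using \<Lambda>0 kk.one_not_zero by auto
qed

end

section \<open>From a quantization of \<open>A\<close> to a deformation of its tensor power\<close>

lemma (in assoc_algebra) smult_image_ideal:
  assumes d: "d \<in> carrier R"
  shows "ideal ((\<lambda>x. d \<odot> x) ` carrier B) B"
proof (rule idealI[OF B.ring_axioms])
  show "subgroup ((\<lambda>x. d \<odot> x) ` carrier B) (add_monoid B)"
  proof (rule M.add.subgroupI)
    show "(\<lambda>x. d \<odot> x) ` carrier B \<noteq> {}" using M.zero_closed by auto
    fix u v assume "u \<in> (\<lambda>x. d \<odot> x) ` carrier B" "v \<in> (\<lambda>x. d \<odot> x) ` carrier B"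
    then obtain x y where *: "u = d \<odot> x" "x \<in> carrier B" "v = d \<odot> y" "y \<in> carrier B" by (elim imageE)
    show "u \<oplus> v \<in> (\<lambda>x. d \<odot> x) ` carrier B"
      unfolding * smult_r_distr[OF d *(2,4), symmetric] by (rule imageI[OF M.a_closed[OF *(2,4)]])
    show "\<ominus> u \<in> (\<lambda>x. d \<odot> x) ` carrier B"
      unfolding * smult_r_minus[OF d *(2), symmetric] by (rule imageI[OF M.a_inv_closed[OF *(2)]])
  qed (use d in auto)
  fix u y assume "u \<in> (\<lambda>x. d \<odot> x) ` carrier B" and y: "y \<in> carrier B"
  then obtain x where *: "u = d \<odot> x" "x \<in> carrier B" by (elim imageE)
  show "y \<otimes> u \<in> (\<lambda>x. d \<odot> x) ` carrier B"
    unfolding *(1) smult_mult_right[OF d y *(2)] by (rule imageI[OF B.m_closed[OF y *(2)]])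
  show "u \<otimes> y \<in> (\<lambda>x. d \<odot> x) ` carrier B"
    unfolding *(1) smult_mult_left[OF d *(2) y] by (rule imageI[OF B.m_closed[OF *(2) y]])
qed

text \<open>Serves to copy a quantization into a record with a bracket field, the form of record
  that \<open>tensor_power\<close> takes.\<close>

lemma assoc_algebra_cong:
  assumes "assoc_algebra R B" "carrier B' = carrier B" "monoid.mult B' = monoid.mult B" "one B' = one B"
    "ring.zero B' = ring.zero B" "add B' = add B" "smult B' = smult B"
  shows "assoc_algebra R B'"
proof -
  interpret S: assoc_algebra R B by (rule assms(1))
  have ag: "abelian_group B'"
  proof (rule abelian_groupI)
    show "\<exists>y\<in>carrier B'. y \<oplus>\<^bsub>B'\<^esub> x = \<zero>\<^bsub>B'\<^esub>" if "x \<in> carrier B'" for x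
      using that S.M.l_neg[of x] by (intro bexI[of _ "\<ominus>\<^bsub>B\<^esub> x"]) (simp_all add: assms(2-))
  qed (simp_all add: assms(2-) S.M.a_ac)
  have "monoid B'"
    by (rule monoidI) (simp_all add: assms(2-) S.B.m_assoc)
  then have rg: "ring B'"
    by (rule ringI[OF ag]) (simp_all add: assms(2-) S.B.l_distr S.B.r_distr)
  have "module R B'"
    by (rule moduleI[OF S.R.is_cring ag])
      (simp_all add: assms(2-) S.smult_l_distr S.smult_r_distr S.smult_assoc1)
  then show ?thesis
    by (rule assoc_algebra.intro[OF _ rg assoc_algebra_axioms.intro])
      (simp_all add: assms(2-) S.smult_mult_left S.smult_mult_right)
qed

lemma (in poisson_algebra) tensor_bracket: "tensor_bracket k A"
proof -
  have r: "x \<otimes> (c \<odot> y) = c \<odot> (x \<otimes> y)" if "c \<in> carrier k" "x \<in> carrier A" "y \<in> carrier A" for c x y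
  proof -
    have "x \<otimes> (c \<odot> y) = (c \<odot> y) \<otimes> x" by (rule m_comm[OF that(2) smult_closed[OF that(1,3)]])
    also have "\<dots> = c \<odot> (y \<otimes> x)" by (rule smult_assoc2[OF that(1,3,2)])
    finally show ?thesis unfolding m_comm[OF that(3,2)] .
  qed
  show ?thesis
    by unfold_locales (fact smult_assoc2 r pbracket_closed pbracket_add_left pbracket_add_right pbracket_smult_left pbracket_smult_right)+
qed

text \<open>Topological freeness provides coefficients in an abstract module \<open>V\<close>. They
  are carried to \<open>A\<close> by \<open>\<theta>\<close>, which sends \<open>v\<close> to the
  reduction of the element with the constant series \<open>v\<close>; the zeroth coefficient then
  becomes the reduction itself.\<close>

lemma quantization_deformation:
  fixes k :: "('k, 'm) ring_scheme" and A :: "('k, 'a, 'z) poisson_scheme" and Ah :: "(nat \<Rightarrow> 'k, 'b) module"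
  assumes k: "field k" and P: "poisson_algebra k A" and q: "quantization k A Ah \<psi>" and n: "n \<ge> 1"
    and dom: "domain (tensor_power k A n)"
  obtains B :: "(nat \<Rightarrow> 'k, 'b) poisson" and \<chi> where "tensor_deformation k A n B \<chi>"
proof -
  interpret kk: field k by (rule k)
  interpret PA: poisson_algebra k A by (rule P)
  have Q1: "assoc_algebra (power_series_ring k) Ah" using q by (rule quantization.axioms(1))
  interpret q: assoc_algebra "power_series_ring k" Ah by (rule Q1)
  have hk: "hbar k \<in> carrier (power_series_ring k)" by (rule kk.hbar_closed)
  define I where "I = hbar_ideal k Ah"
  have I: "ideal I Ah" unfolding I_def hbar_ideal_def by (rule q.smult_image_ideal[OF hk])
  interpret I: ideal I Ah by (rule I)
  define r where "r = reduction k Ah \<psi>"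
  have psi: "\<psi> \<in> ring_hom (Ah Quot I) A" "bij_betw \<psi> (carrier (Ah Quot I)) (carrier A)"
    using quantization.quotient_iso[OF q] by (simp_all add: ring_iso_def I_def)
  have r_eq: "r = \<psi> \<circ> (\<lambda>x. I +>\<^bsub>Ah\<^esub> x)" by (simp add: r_def reduction_def I_def fun_eq_iff)
  have r_hom: "r \<in> ring_hom Ah A" unfolding r_eq by (rule ring_hom_trans[OF I.rcos_ring_hom psi(1)])
  note rc = ring_hom_closed[OF r_hom] and r_add = ring_hom_add[OF r_hom]
  have z0: "\<zero>\<^bsub>Ah Quot I\<^esub> = I" by (simp add: FactRing_def)
  have psi0: "\<psi> I = \<zero>\<^bsub>A\<^esub>"
    using ring_hom_zero[OF psi(1) I.quotient_is_ring PA.ring_axioms] unfolding z0 .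
  have r_h: "r (hbar k \<odot>\<^bsub>Ah\<^esub> y) = \<zero>\<^bsub>A\<^esub>" if y: "y \<in> carrier Ah" for y
  proof -
    have "hbar k \<odot>\<^bsub>Ah\<^esub> y \<in> I" unfolding I_def hbar_ideal_def by (rule imageI[OF y])
    then have "I +>\<^bsub>Ah\<^esub> (hbar k \<odot>\<^bsub>Ah\<^esub> y) = I" by (rule I.a_rcos_const)
    then show ?thesis unfolding r_eq comp_def using psi0 by simp
  qed
  have r_kernel: "\<exists>y\<in>carrier Ah. x = hbar k \<odot>\<^bsub>Ah\<^esub> y" if x: "x \<in> carrier Ah" and 0: "r x = \<zero>\<^bsub>A\<^esub>" for x
  proof -
    have "\<psi> (I +>\<^bsub>Ah\<^esub> x) = \<psi> I" using 0 psi0 unfolding r_eq comp_def by simp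
    moreover have "I +>\<^bsub>Ah\<^esub> x \<in> carrier (Ah Quot I)" by (rule ring_hom_closed[OF I.rcos_ring_hom x])
    moreover have "I \<in> carrier (Ah Quot I)"
      using ring.ring_simprules(2)[OF I.quotient_is_ring] unfolding z0 .
    ultimately have "I +>\<^bsub>Ah\<^esub> x = I" by (rule inj_onD[OF bij_betw_imp_inj_on[OF psi(2)]])
    then have "x \<in> I" using I.rcos_const_imp_mem[OF x] by simp
    then show ?thesis unfolding I_def hbar_ideal_def by auto
  qed
  have r_surj: "\<exists>x\<in>carrier Ah. r x = a" if a: "a \<in> carrier A" for a
  proof -
    have "a \<in> \<psi> ` carrier (Ah Quot I)" using psi(2) a by (simp add: bij_betw_def)
    then obtain U where U: "a = \<psi> U" "U \<in> carrier (Ah Quot I)" by (rule imageE)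
    then obtain x where "x \<in> carrier Ah" "U = I +>\<^bsub>Ah\<^esub> x" by (auto simp: FactRing_def A_RCOSETS_def')
    then show ?thesis using U(1) unfolding r_eq by (intro bexI[of _ x]) simp_all
  qed
  have r_const: "r (const_series k c \<odot>\<^bsub>Ah\<^esub> x) = c \<odot>\<^bsub>A\<^esub> r x" if "c \<in> carrier k" "x \<in> carrier Ah" for c x
    unfolding r_def by (rule quantization.quotient_iso_smult[OF q that])
  obtain V :: "('k, 'b) module" and \<Phi> where V: "module k V" and bij: "bij_betw \<Phi> (carrier Ah) (UNIV \<rightarrow> carrier V)"
    and add0: "\<forall>x\<in>carrier Ah. \<forall>y\<in>carrier Ah. \<forall>m. \<Phi> (x \<oplus>\<^bsub>Ah\<^esub> y) m = \<Phi> x m \<oplus>\<^bsub>V\<^esub> \<Phi> y m"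
    and sm0: "\<forall>c\<in>carrier (power_series_ring k). \<forall>x\<in>carrier Ah. \<forall>m.
        \<Phi> (c \<odot>\<^bsub>Ah\<^esub> x) m = (\<Oplus>\<^bsub>V\<^esub>i\<in>{..m}. c i \<odot>\<^bsub>V\<^esub> \<Phi> x (m - i))"
    using quantization.top_free[OF q] unfolding topologically_free_def by (elim exE conjE)
  note Phi_add = add0[rule_format] and Phi_sm = sm0[rule_format]
  interpret V: module k V by (rule V)
  have Phi_c: "\<Phi> x m \<in> carrier V" if "x \<in> carrier Ah" for x m
  proof -
    have "\<Phi> x \<in> UNIV \<rightarrow> carrier V" using bij_betwE[OF bij] that by (rule bspec)
    then show ?thesis by (rule funcset_mem) simp
  qed
  have Phi_inj: "x = y" if "x \<in> carrier Ah" "y \<in> carrier Ah" "\<And>m. \<Phi> x m = \<Phi> y m" for x y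
    by (rule inj_onD[OF bij_betw_imp_inj_on[OF bij] ext[of "\<Phi> x" "\<Phi> y", OF that(3)] that(1,2)])
  define g where "g = inv_into (carrier Ah) \<Phi>"
  have g: "g w \<in> carrier Ah" "\<Phi> (g w) = w" if w: "\<And>m. w m \<in> carrier V" for w
  proof -
    have "w \<in> \<Phi> ` carrier Ah" using bij w by (simp add: bij_betw_def)
    then show "g w \<in> carrier Ah" "\<Phi> (g w) = w" unfolding g_def by (rule inv_into_into, rule f_inv_into_f)
  qed
  have Phi_const: "\<Phi> (const_series k c \<odot>\<^bsub>Ah\<^esub> x) m = c \<odot>\<^bsub>V\<^esub> \<Phi> x m" if c: "c \<in> carrier k" and x: "x \<in> carrier Ah" for c x m
  proof -
    have "\<Phi> (const_series k c \<odot>\<^bsub>Ah\<^esub> x) m = (\<Oplus>\<^bsub>V\<^esub>i\<in>{..m}. const_series k c i \<odot>\<^bsub>V\<^esub> \<Phi> x (m - i))"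
      by (rule Phi_sm[OF kk.const_series_closed[OF c] x])
    also have "\<dots> = (\<Oplus>\<^bsub>V\<^esub>i\<in>{..m}. if 0 = i then c \<odot>\<^bsub>V\<^esub> \<Phi> x (m - i) else \<zero>\<^bsub>V\<^esub>)"
      using c Phi_c[OF x] by (intro V.M.finsum_cong') (auto simp: const_series_def)
    also have "\<dots> = c \<odot>\<^bsub>V\<^esub> \<Phi> x (m - 0)"
      using c Phi_c[OF x] by (intro V.M.finsum_singleton) auto
    finally show ?thesis by simp
  qed
  have Phi_hbar: "\<Phi> (hbar k \<odot>\<^bsub>Ah\<^esub> x) m = (if m = 0 then \<zero>\<^bsub>V\<^esub> else \<Phi> x (m - 1))" if x: "x \<in> carrier Ah" for x m
  proof -
    have "\<Phi> (hbar k \<odot>\<^bsub>Ah\<^esub> x) m = (\<Oplus>\<^bsub>V\<^esub>i\<in>{..m}. hbar k i \<odot>\<^bsub>V\<^esub> \<Phi> x (m - i))"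
      by (rule Phi_sm[OF hk x])
    also have "\<dots> = (\<Oplus>\<^bsub>V\<^esub>i\<in>{..m}. if 1 = i then \<Phi> x (m - i) else \<zero>\<^bsub>V\<^esub>)"
      using Phi_c[OF x] by (intro V.M.finsum_cong') (auto simp: hbar_def)
    also have "\<dots> = (if m = 0 then \<zero>\<^bsub>V\<^esub> else \<Phi> x (m - 1))"
    proof (cases "m = 0")
      case False
      then have "(\<Oplus>\<^bsub>V\<^esub>i\<in>{..m}. if 1 = i then \<Phi> x (m - i) else \<zero>\<^bsub>V\<^esub>) = \<Phi> x (m - 1)"
        using Phi_c[OF x] by (intro V.M.finsum_singleton) auto
      then show ?thesis using False by simp
    qed simp
    finally show ?thesis .
  qed
  define s where "s v = g (\<lambda>m. if m = 0 then v else \<zero>\<^bsub>V\<^esub>)" for v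
  have s: "s v \<in> carrier Ah" "\<Phi> (s v) m = (if m = 0 then v else \<zero>\<^bsub>V\<^esub>)" if "v \<in> carrier V" for v m
    unfolding s_def using g[of "\<lambda>m. if m = 0 then v else \<zero>\<^bsub>V\<^esub>"] that by simp_all
  define \<theta> where "\<theta> v = r (s v)" for v
  have th_c: "\<theta> v \<in> carrier A" if "v \<in> carrier V" for v unfolding \<theta>_def by (rule rc[OF s(1)[OF that]])
  have th_add: "\<theta> (v \<oplus>\<^bsub>V\<^esub> w) = \<theta> v \<oplus>\<^bsub>A\<^esub> \<theta> w" if v: "v \<in> carrier V" and w: "w \<in> carrier V" for v w
  proof -
    have "s (v \<oplus>\<^bsub>V\<^esub> w) = s v \<oplus>\<^bsub>Ah\<^esub> s w"
    proof (rule Phi_inj)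
      show "\<Phi> (s (v \<oplus>\<^bsub>V\<^esub> w)) m = \<Phi> (s v \<oplus>\<^bsub>Ah\<^esub> s w) m" for m
        unfolding Phi_add[OF s(1)[OF v] s(1)[OF w]] using s(2) v w by simp
    qed (use s(1) v w in simp_all)
    then show ?thesis unfolding \<theta>_def using r_add[OF s(1)[OF v] s(1)[OF w]] by simp
  qed
  have th_sm: "\<theta> (c \<odot>\<^bsub>V\<^esub> v) = c \<odot>\<^bsub>A\<^esub> \<theta> v" if c: "c \<in> carrier k" and v: "v \<in> carrier V" for c v
  proof -
    have "s (c \<odot>\<^bsub>V\<^esub> v) = const_series k c \<odot>\<^bsub>Ah\<^esub> s v"
    proof (rule Phi_inj)
      show "\<Phi> (s (c \<odot>\<^bsub>V\<^esub> v)) m = \<Phi> (const_series k c \<odot>\<^bsub>Ah\<^esub> s v) m" for m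
        unfolding Phi_const[OF c s(1)[OF v]] using s(2) c v by simp
      show "const_series k c \<odot>\<^bsub>Ah\<^esub> s v \<in> carrier Ah"
        by (rule q.smult_closed[OF kk.const_series_closed[OF c] s(1)[OF v]])
    qed (use s(1) c v in simp_all)
    then show ?thesis unfolding \<theta>_def using r_const[OF c s(1)[OF v]] by simp
  qed
  have th_0: "\<theta> \<zero>\<^bsub>V\<^esub> = \<zero>\<^bsub>A\<^esub>"
    using th_add[OF V.M.zero_closed V.M.zero_closed] th_c[OF V.M.zero_closed] by simp
  have th_sum: "\<theta> (\<Oplus>\<^bsub>V\<^esub>i\<in>J. u i) = (\<Oplus>\<^bsub>A\<^esub>i\<in>J. \<theta> (u i))" if "finite J" "\<And>i. i \<in> J \<Longrightarrow> u i \<in> carrier V" for J and u :: "nat \<Rightarrow> 'b"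
    using that
  proof (induction J rule: finite_induct)
    case empty
    show ?case using th_0 by simp
  next
    case (insert x J)
    have u: "u \<in> J \<rightarrow> carrier V" "u x \<in> carrier V" using insert.prems by auto
    have v: "(\<lambda>a. \<theta> (u a)) \<in> J \<rightarrow> carrier A" "\<theta> (u x) \<in> carrier A" using insert.prems th_c by auto
    show ?case
      unfolding V.M.finsum_insert[where F = J and a = x and f = u, OF insert.hyps u] PA.M.finsum_insert[where F = J and a = x and f = "\<lambda>a. \<theta> (u a)", OF insert.hyps v] th_add[OF u(2) V.M.finsum_closed[OF u(1)]]
      using insert.IH insert.prems by simp
  qed
  define \<chi> where "\<chi> x m = \<theta> (\<Phi> x m)" for x m
  have head: "\<chi> x 0 = r x" if x: "x \<in> carrier Ah" for x
  proof -
    define y where "y = g (\<lambda>m. \<Phi> x (Suc m))"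
    have y: "y \<in> carrier Ah" "\<Phi> y = (\<lambda>m. \<Phi> x (Suc m))" unfolding y_def by (rule g[OF Phi_c[OF x]])+
    note sx = s[OF Phi_c[OF x]] and hy = q.smult_closed[OF hk y(1)]
    \<comment> \<open>An element is its constant term plus \<hbar> times the element with the
      shifted series, and the second part reduces to zero.\<close>
    have xeq: "x = s (\<Phi> x 0) \<oplus>\<^bsub>Ah\<^esub> hbar k \<odot>\<^bsub>Ah\<^esub> y"
    proof (rule Phi_inj[OF x q.M.a_closed[OF sx(1) hy]])
      show "\<Phi> x m = \<Phi> (s (\<Phi> x 0) \<oplus>\<^bsub>Ah\<^esub> hbar k \<odot>\<^bsub>Ah\<^esub> y) m" for m
        unfolding Phi_add[OF sx(1) hy] Phi_hbar[OF y(1)] sx(2) y(2) using Phi_c[OF x] by (cases m) simp_all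
    qed
    have "r x = r (s (\<Phi> x 0) \<oplus>\<^bsub>Ah\<^esub> hbar k \<odot>\<^bsub>Ah\<^esub> y)" by (rule arg_cong[where f = r], rule xeq)
    also have "\<dots> = r (s (\<Phi> x 0)) \<oplus>\<^bsub>A\<^esub> r (hbar k \<odot>\<^bsub>Ah\<^esub> y)" by (rule r_add[OF sx(1) hy])
    also have "\<dots> = r (s (\<Phi> x 0))" unfolding r_h[OF y(1)] using rc[OF sx(1)] by simp
    finally show ?thesis unfolding \<chi>_def \<theta>_def ..
  qed
  define B :: "(nat \<Rightarrow> 'k, 'b) poisson" where
    "B = \<lparr>carrier = carrier Ah, monoid.mult = monoid.mult Ah, one = one Ah, ring.zero = ring.zero Ah, add = add Ah,
      smult = smult Ah, pbracket = undefined\<rparr>"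
  have B: "carrier B = carrier Ah" "monoid.mult B = monoid.mult Ah" "one B = one Ah" "ring.zero B = ring.zero Ah"
    "add B = add Ah" "smult B = smult Ah" by (simp_all add: B_def)
  have "tensor_deformation k A n B \<chi>"
  proof (intro tensor_deformation.intro tensor_deformation_axioms.intro)
    show "tensor_bracket k A" by (rule PA.tensor_bracket)
    interpret B: assoc_algebra "power_series_ring k" B by (rule assoc_algebra_cong[OF Q1 B])
    show "tensor (power_series_ring k) B" by unfold_locales
    show "domain (tensor_power k A n)" by (rule dom)
    show "n \<ge> 1" by (rule n)
    show "\<chi> x m \<in> carrier A" if "x \<in> carrier B" for x m
      unfolding \<chi>_def by (rule th_c[OF Phi_c[OF that[unfolded B]]])
    show "\<chi> (x \<oplus>\<^bsub>B\<^esub> y) m = \<chi> x m \<oplus>\<^bsub>A\<^esub> \<chi> y m" if x: "x \<in> carrier B" and y: "y \<in> carrier B" for x y m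
      unfolding \<chi>_def B Phi_add[OF x[unfolded B] y[unfolded B]]
      by (rule th_add[OF Phi_c[OF x[unfolded B]] Phi_c[OF y[unfolded B]]])
    show "\<chi> (d \<odot>\<^bsub>B\<^esub> x) m = (\<Oplus>\<^bsub>A\<^esub>i\<in>{..m}. d i \<odot>\<^bsub>A\<^esub> \<chi> x (m - i))"
      if d: "d \<in> carrier (power_series_ring k)" and x: "x \<in> carrier B" for d x m
    proof -
      note xc = x[unfolded B]
      have dc: "d i \<in> carrier k" for i using d kk.PS_mem by simp
      have "\<chi> (d \<odot>\<^bsub>B\<^esub> x) m = \<theta> (\<Oplus>\<^bsub>V\<^esub>i\<in>{..m}. d i \<odot>\<^bsub>V\<^esub> \<Phi> x (m - i))"
        unfolding \<chi>_def B Phi_sm[OF d xc] ..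
      also have "\<dots> = (\<Oplus>\<^bsub>A\<^esub>i\<in>{..m}. \<theta> (d i \<odot>\<^bsub>V\<^esub> \<Phi> x (m - i)))"
        by (rule th_sum[OF finite_atMost V.smult_closed[OF dc Phi_c[OF xc]]])
      also have "\<dots> = (\<Oplus>\<^bsub>A\<^esub>i\<in>{..m}. d i \<odot>\<^bsub>A\<^esub> \<chi> x (m - i))"
        unfolding \<chi>_def by (simp only: th_sm[OF dc Phi_c[OF xc]])
      finally show ?thesis .
    qed
    show "(\<lambda>x. \<chi> x 0) \<in> ring_hom B A"
    proof (rule ring_hom_memI)
      show "\<chi> x 0 \<in> carrier A" if "x \<in> carrier B" for x using that rc head unfolding B by simp
      show "\<chi> (x \<otimes>\<^bsub>B\<^esub> y) 0 = \<chi> x 0 \<otimes>\<^bsub>A\<^esub> \<chi> y 0" if "x \<in> carrier B" "y \<in> carrier B" for x y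
        using that head ring_hom_mult[OF r_hom] q.B.m_closed unfolding B by simp
      show "\<chi> (x \<oplus>\<^bsub>B\<^esub> y) 0 = \<chi> x 0 \<oplus>\<^bsub>A\<^esub> \<chi> y 0" if "x \<in> carrier B" "y \<in> carrier B" for x y
        using that head r_add q.M.a_closed unfolding B by simp
      show "\<chi> \<one>\<^bsub>B\<^esub> 0 = \<one>\<^bsub>A\<^esub>" using head[OF q.B.one_closed] ring_hom_one[OF r_hom] unfolding B by simp
    qed
    show "\<exists>x\<in>carrier B. \<chi> x 0 = a" if a: "a \<in> carrier A" for a
    proof -
      obtain x where "x \<in> carrier Ah" "r x = a" using r_surj[OF a] by (rule bexE)
      then show ?thesis using head unfolding B by (intro bexI[of _ x]) simp_all
    qed
    show "\<exists>y\<in>carrier B. x = hbar k \<odot>\<^bsub>B\<^esub> y" if "x \<in> carrier B" "\<chi> x 0 = \<zero>\<^bsub>A\<^esub>" for x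
      using r_kernel[of x] head[of x] that unfolding B by simp
    show "\<exists>c\<in>carrier B. x \<otimes>\<^bsub>B\<^esub> y = y \<otimes>\<^bsub>B\<^esub> x \<oplus>\<^bsub>B\<^esub> hbar k \<odot>\<^bsub>B\<^esub> c \<and> \<chi> c 0 = \<lbrace>\<chi> x 0, \<chi> y 0\<rbrace>\<^bsub>A\<^esub>"
      if x: "x \<in> carrier B" and y: "y \<in> carrier B" for x y
    proof -
      note xc = x[unfolded B] and yc = y[unfolded B]
      obtain c where c: "c \<in> carrier Ah" "x \<otimes>\<^bsub>Ah\<^esub> y \<ominus>\<^bsub>Ah\<^esub> y \<otimes>\<^bsub>Ah\<^esub> x = hbar k \<odot>\<^bsub>Ah\<^esub> c"
        "reduction k Ah \<psi> c = \<lbrace>reduction k Ah \<psi> x, reduction k Ah \<psi> y\<rbrace>\<^bsub>A\<^esub>"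
        using quantization.quotient_commutator[OF q xc yc] by (elim bexE conjE)
      note m = q.B.m_closed[OF xc yc] q.B.m_closed[OF yc xc]
      have "y \<otimes>\<^bsub>Ah\<^esub> x \<oplus>\<^bsub>Ah\<^esub> hbar k \<odot>\<^bsub>Ah\<^esub> c = x \<otimes>\<^bsub>Ah\<^esub> y"
        unfolding c(2)[symmetric] using m by (simp add: a_minus_def q.M.a_lcomm q.M.r_neg)
      then show ?thesis using c(1,3) head[OF xc] head[OF yc] head[OF c(1)] unfolding B r_def
        by (intro bexI[of _ c]) simp_all
    qed
  qed
  then show thesis by (rule that)
qed

section \<open>The tensors \<Delta>_a as determinants\<close>

lemma (in cring) det_cong:
  assumes eq: "\<And>i j. i \<in> {1..n} \<Longrightarrow> j \<in> {1..n} \<Longrightarrow> M i j = N i j"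
    and N: "\<And>i j. i \<in> {1..n} \<Longrightarrow> j \<in> {1..n} \<Longrightarrow> N i j \<in> carrier R"
  shows "det n M = det n N"
  unfolding det_def
proof (rule finsum_cong')
  show "[sign p] \<cdot> (\<Otimes>i\<in>{1..n}. M i (p i)) = [sign p] \<cdot> (\<Otimes>i\<in>{1..n}. N i (p i))" if "p \<in> {p. p permutes {1..n}}" for p
  proof -
    have p: "p permutes {1..n}" using that by simp
    have "(\<Otimes>i\<in>{1..n}. M i (p i)) = (\<Otimes>i\<in>{1..n}. N i (p i))"
    proof (rule finprod_cong')
      show "M i (p i) = N i (p i)" if "i \<in> {1..n}" for i by (rule eq[OF that perm_in[OF p that]])
      show "(\<lambda>i. N i (p i)) \<in> {1..n} \<rightarrow> carrier R" by (rule Pi_I) (rule N[OF _ perm_in[OF p]])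
    qed simp
    then show ?thesis by simp
  qed
  show "(\<lambda>p. [sign p] \<cdot> (\<Otimes>i\<in>{1..n}. N i (p i))) \<in> {p. p permutes {1..n}} \<rightarrow> carrier R"
    by (rule Pi_I, rule sign_mult_closed, rule prod_closed[where n = n and M = N]) (use N in simp_all)
qed simp

text \<open>The cycle that moves the first place to the place \<open>a\<close>. The tensor
  \<Delta>_a lists \<open>f 0, ..., f (a - 1), f (a + 1), ..., f n\<close>, while the numerator in
  Cramer's rule has \<open>f 0\<close> at the place of \<open>f a\<close>; the two differ by the
  sign of this cycle.\<close>

definition cycle_to :: "nat \<Rightarrow> nat \<Rightarrow> nat" where
  "cycle_to a j = (if j = 1 then a else if j \<le> a then j - 1 else j)"

lemma cycle_to_permutes:
  assumes "a \<in> {1..n}"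
  shows "cycle_to a permutes {1..n}"
proof (rule bij_imp_permutes)
  show "bij_betw (cycle_to a) {1..n} {1..n}"
    by (rule bij_betw_byWitness[where f' = "\<lambda>j. if j = a then 1 else if j < a then j + 1 else j"])
      (use assms in \<open>auto simp: cycle_to_def split: if_splits\<close>)
  show "cycle_to a x = x" if "x \<notin> {1..n}" for x
    using that assms by (cases "x = 0") (auto simp: cycle_to_def)
qed

context tensor
begin

text \<open>A pure tensor is the product of its entries in their slots, so an antisymmetrization is
  a determinant whose rows are the tensor factors and whose columns are the elements
  \<open>g j\<close>.\<close>

lemma antisym_tensor_det:
  assumes cr: "cring T" and g: "g \<in> {1..n} \<rightarrow> carrier A"
  shows "antisym_tensor k A n g = cring.det T n (\<lambda>i j. slot i (g j))"
proof -
  interpret Tc: cring T by (rule cr)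
  have gp: "g (p i) \<in> carrier A" if "p permutes {1..n}" "i \<in> {1..n}" for p i
    by (rule funcset_mem[OF g Tc.perm_in[OF that]])
  have sl: "slot i (g (p i)) \<in> carrier T" if "p permutes {1..n}" "i \<in> {1..n}" for p i
    by (rule slot_closed[OF that(2) gp[OF that]])
  have pc: "(\<Otimes>\<^bsub>T\<^esub>i\<in>{1..n}. slot i (g (p i))) \<in> carrier T" if "p permutes {1..n}" for p
    by (rule Tc.finprod_closed) (rule Pi_I, rule sl[OF that])
  show ?thesis
    unfolding antisym_tensor_def Tc.det_def
  proof (rule T.M.finsum_cong')
    show "[sign p] \<cdot>\<^bsub>T\<^esub> pure_tensor k A n (\<lambda>i. g (p i)) = [sign p] \<cdot>\<^bsub>T\<^esub> (\<Otimes>\<^bsub>T\<^esub>i\<in>{1..n}. slot i (g (p i)))"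
      if "p \<in> {p. p permutes {1..n}}" for p
    proof -
      have p: "p permutes {1..n}" using that by simp
      let ?x = "\<lambda>i\<in>{1..n}. g (p i)"
      have x: "?x \<in> tup" using gp[OF p] by (simp add: tuples_def)
      have "pure_tensor k A n (\<lambda>i. g (p i)) = (\<Otimes>\<^bsub>T\<^esub>i\<in>{1..n}. slot i (?x i))"
        unfolding pure_tensor_pt by (rule pt_eq_finprod[OF cr x])
      also have "\<dots> = (\<Otimes>\<^bsub>T\<^esub>i\<in>{1..n}. slot i (g (p i)))"
        by (rule Tc.finprod_cong'[OF refl]) (rule Pi_I, rule sl[OF p], simp_all)
      finally show ?thesis by simp
    qed
    show "(\<lambda>p. [sign p] \<cdot>\<^bsub>T\<^esub> (\<Otimes>\<^bsub>T\<^esub>i\<in>{1..n}. slot i (g (p i)))) \<in> {p. p permutes {1..n}} \<rightarrow> carrier T"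
      by (rule Pi_I, rule Tc.sign_mult_closed, rule pc) simp
  qed simp
qed

lemma Delta_det:
  assumes cr: "cring T" and f: "f \<in> {0..n} \<rightarrow> carrier A"
  shows "Delta k A n f 0 = cring.det T n (\<lambda>i j. slot i (f j))"
    and "a \<in> {1..n} \<Longrightarrow> Delta k A n f a =
      [sign (cycle_to a)] \<cdot>\<^bsub>T\<^esub> cring.det T n (\<lambda>i j. slot i (if j = a then f 0 else f j))"
proof -
  interpret Tc: cring T by (rule cr)
  have fc: "f j \<in> carrier A" if "j \<le> n" for j using f that by (auto simp: Pi_iff)
  have sl: "slot i (f j) \<in> carrier T" if "i \<in> {1..n}" "j \<le> n" for i j by (rule slot_closed[OF that(1) fc[OF that(2)]])
  have g: "(\<lambda>j. if j \<le> a then f (j - 1) else f j) \<in> {1..n} \<rightarrow> carrier A" for a using fc by auto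
  show "Delta k A n f 0 = Tc.det n (\<lambda>i j. slot i (f j))"
    unfolding Delta_def antisym_tensor_det[OF cr g] by (rule Tc.det_cong) (use sl in auto)
  assume a: "a \<in> {1..n}"
  let ?M = "\<lambda>i j. slot i (if j = a then f 0 else f j)"
  have Mc: "?M i j \<in> carrier T" if "i \<in> {1..n}" "j \<in> {1..n}" for i j using sl that by auto
  note \<pi> = cycle_to_permutes[OF a]
  have "Delta k A n f a = Tc.det n (\<lambda>i j. ?M i (cycle_to a j))"
    unfolding Delta_def antisym_tensor_det[OF cr g]
  proof (rule Tc.det_cong)
    show "?M i (cycle_to a j) \<in> carrier T" if "i \<in> {1..n}" "j \<in> {1..n}" for i j
      by (rule Mc[OF that(1) Tc.perm_in[OF \<pi> that(2)]])
    show "slot i (if j \<le> a then f (j - 1) else f j) = ?M i (cycle_to a j)" if "i \<in> {1..n}" "j \<in> {1..n}" for i j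
    proof -
      have "(if j \<le> a then f (j - 1) else f j) = (if cycle_to a j = a then f 0 else f (cycle_to a j))"
        using a that by (auto simp: cycle_to_def)
      then show ?thesis by simp
    qed
  qed
  also have "\<dots> = [sign (cycle_to a)] \<cdot>\<^bsub>T\<^esub> Tc.det n ?M"
    by (rule Tc.det_permute_columns[where n = n and M = ?M, OF Mc \<pi>])
  finally show "Delta k A n f a = [sign (cycle_to a)] \<cdot>\<^bsub>T\<^esub> Tc.det n ?M" .
qed

end

text \<open>A relation among \<open>f 1, ..., f n\<close> is a relation among all the
  \<open>f j\<close> in which \<open>f 0\<close> has the coefficient zero.\<close>

lemma (in module) lin_indep_subset:
  assumes li: "lin_indep R M {0..n} f" and f: "f \<in> {0..n::nat} \<rightarrow> carrier M"
  shows "lin_indep R M {1..n} f"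
  unfolding lin_indep_def
proof (intro ballI impI)
  fix c i assume c: "c \<in> {1..n} \<rightarrow> carrier R" and 0: "(\<Oplus>\<^bsub>M\<^esub>i\<in>{1..n}. c i \<odot>\<^bsub>M\<^esub> f i) = \<zero>\<^bsub>M\<^esub>" and i: "i \<in> {1..n}"
  define d where "d j = (if j = 0 then \<zero> else c j)" for j
  have d: "d \<in> {0..n} \<rightarrow> carrier R" using c by (auto simp: d_def Pi_iff)
  have t: "(\<lambda>i. c i \<odot>\<^bsub>M\<^esub> f i) \<in> {1..n} \<rightarrow> carrier M" using c f by (auto simp: Pi_iff)
  have e: "(\<Oplus>\<^bsub>M\<^esub>i\<in>{1..n}. d i \<odot>\<^bsub>M\<^esub> f i) = \<zero>\<^bsub>M\<^esub>"
    unfolding 0[symmetric] by (rule M.finsum_cong'[OF refl t]) (simp add: d_def)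
  have t': "(\<lambda>i. d i \<odot>\<^bsub>M\<^esub> f i) \<in> {1..n} \<rightarrow> carrier M" "d 0 \<odot>\<^bsub>M\<^esub> f 0 \<in> carrier M" using d f by (auto simp: Pi_iff)
  have "{0..n} = insert 0 {1..n}" by auto
  then have "(\<Oplus>\<^bsub>M\<^esub>i\<in>{0..n}. d i \<odot>\<^bsub>M\<^esub> f i) = d 0 \<odot>\<^bsub>M\<^esub> f 0 \<oplus>\<^bsub>M\<^esub> (\<Oplus>\<^bsub>M\<^esub>i\<in>{1..n}. d i \<odot>\<^bsub>M\<^esub> f i)"
    using t' by (simp only:) (intro M.finsum_insert, auto)
  also have "\<dots> = \<zero>\<^bsub>M\<^esub>" unfolding e using f by (simp add: d_def Pi_iff)
  finally have "\<forall>i\<in>{0..n}. d i = \<zero>" using li d unfolding lin_indep_def by simp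
  then have "d i = \<zero>" using i by simp
  then show "c i = \<zero>" using i by (simp add: d_def)
qed

context tensor_reduction
begin

lemma commuting_quantization:
  assumes k: "field k" and two: "[(2::nat)] \<cdot>\<^bsub>k\<^esub> \<one>\<^bsub>k\<^esub> \<noteq> \<zero>\<^bsub>k\<^esub>"
    and f: "f \<in> {0..n} \<rightarrow> carrier A" and li: "lin_indep k A {0..n} f"
  shows "\<exists>(Kh :: (nat \<Rightarrow> 'k, nat \<Rightarrow> (((nat \<Rightarrow> 'a) \<Rightarrow> 'k) set \<times> ((nat \<Rightarrow> 'a) \<Rightarrow> 'k) set) set) module) \<phi> hh.
    quantization k (frac_field T) Kh \<phi> \<and>
    (\<forall>i\<in>{1..n}. hh i \<in> carrier Kh) \<and>
    (\<forall>i\<in>{1..n}. \<forall>j\<in>{1..n}. hh i \<otimes>\<^bsub>Kh\<^esub> hh j = hh j \<otimes>\<^bsub>Kh\<^esub> hh i) \<and>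
    (\<forall>i\<in>{1..n}. reduction k Kh \<phi> (hh i) = fraction T (Delta k A n f i) (Delta k A n f 0))"
proof -
  interpret kk: field k by (rule k)
  obtain Q :: "(nat \<Rightarrow> (((nat \<Rightarrow> 'b) \<Rightarrow> nat \<Rightarrow> 'k) set \<times> ((nat \<Rightarrow> 'b) \<Rightarrow> nat \<Rightarrow> 'k) set) set) ring" and \<eta> red emb
    where qz: "quantizing Q (frac_field T) \<eta> red k (\<lambda>d. emb (d \<odot>\<^bsub>R\<^esub> \<one>\<^bsub>R\<^esub>))" and emb: "emb \<in> ring_hom R Q"
      and red_emb0: "\<And>r. r \<in> carrier R \<Longrightarrow> red (emb r) = fractions.incl T (\<rho> r)"
    by (rule quantizing_exists[OF k]) blast
  interpret qz: quantizing Q "frac_field T" \<eta> red k "\<lambda>d. emb (d \<odot>\<^bsub>R\<^esub> \<one>\<^bsub>R\<^esub>)" by (rule qz)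
  interpret fr: fractions T by unfold_locales
  let ?K = "frac_field T"
  interpret inc: ring_hom_cring T ?K fr.incl
    by (intro ring_hom_cring.intro ring_hom_cring_axioms.intro T.is_cring qz.K.is_cring fr.incl_hom)
  have inc_c: "fr.incl x \<in> carrier ?K" if "x \<in> carrier T" for x by (rule ring_hom_closed[OF fr.incl_hom that])
  have fc: "f j \<in> carrier A" if "j \<le> n" for j using f that by (auto simp: Pi_iff)
  have f1: "f \<in> {1..n} \<rightarrow> carrier A" using fc by auto
  have sl: "TA.slot i (f j) \<in> carrier T" if "i \<in> {1..n}" "j \<le> n" for i j by (rule TA.slot_closed[OF that(1) fc[OF that(2)]])
  define M where "M i j = TA.slot i (f j)" for i j
  have Mc: "M i j \<in> carrier T" if "i \<in> {1..n}" "j \<in> {1..n}" for i j using sl that by (simp add: M_def)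
  define \<Delta> where "\<Delta> = T.det n M"
  have \<Delta>: "Delta k A n f 0 = \<Delta>" unfolding \<Delta>_def M_def by (rule TA.Delta_det(1)[OF T.is_cring f])
  have \<Delta>c: "\<Delta> \<in> carrier T" unfolding \<Delta>_def by (rule T.det_closed[where n = n and M = M]) (rule Mc)
  have "\<Delta> \<noteq> \<zero>\<^bsub>T\<^esub>" unfolding \<Delta>_def M_def
    by (rule TA.det_slots_nonzero[OF k T.is_cring f1 TA.lin_indep_subset[OF li f]])
  then have \<Delta>D: "\<Delta> \<in> fr.D" using \<Delta>c by simp
  have detK: "qz.K.det n (\<lambda>i j. fr.incl (M i j)) = fr.incl \<Delta>"
    unfolding \<Delta>_def by (rule inc.hom_det[where n = n and M = M, symmetric]) (rule Mc)
  have \<Delta>K: "fr.incl \<Delta> \<noteq> \<zero>\<^bsub>?K\<^esub>"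
    unfolding fr.incl_def using fr.frac_eq_zero[OF \<Delta>c fr.one_in_D] \<Delta>D by simp
  \<comment> \<open>2 is invertible in \<open>k\<close>, so \<open>1 + 1\<close> is nonzero in
    \<open>T\<close> and therefore in its fraction field.\<close>
  have twoK: "x = \<zero>\<^bsub>?K\<^esub>" if x: "x \<in> carrier ?K" and 0: "x \<oplus>\<^bsub>?K\<^esub> x = \<zero>\<^bsub>?K\<^esub>" for x
  proof -
    let ?u = "\<one>\<^bsub>k\<^esub> \<oplus>\<^bsub>k\<^esub> \<one>\<^bsub>k\<^esub>"
    have "?u \<noteq> \<zero>\<^bsub>k\<^esub>" using two by (simp add: numeral_2_eq_2 add_pow_def nat_pow_def)
    then have "?u \<in> Units k" by (simp add: kk.field_Units)
    then obtain v where v: "v \<in> carrier k" "v \<otimes>\<^bsub>k\<^esub> ?u = \<one>\<^bsub>k\<^esub>" by (auto simp: Units_def)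
    have uc: "?u \<in> carrier k" by simp
    have e: "?u \<odot>\<^bsub>T\<^esub> \<one>\<^bsub>T\<^esub> = \<one>\<^bsub>T\<^esub> \<oplus>\<^bsub>T\<^esub> \<one>\<^bsub>T\<^esub>"
      using TA.T.smult_l_distr[OF TA.R.one_closed TA.R.one_closed TA.T.B.one_closed] TA.T.smult_one[OF TA.T.B.one_closed] by simp
    have "v \<odot>\<^bsub>T\<^esub> (?u \<odot>\<^bsub>T\<^esub> \<one>\<^bsub>T\<^esub>) = \<one>\<^bsub>T\<^esub>"
      using TA.T.smult_assoc1[OF v(1) uc TA.T.B.one_closed] TA.T.smult_one[OF TA.T.B.one_closed] v(2) by simp
    then have "\<one>\<^bsub>T\<^esub> \<oplus>\<^bsub>T\<^esub> \<one>\<^bsub>T\<^esub> \<noteq> \<zero>\<^bsub>T\<^esub>" unfolding e using TA.T.smult_r_null[OF v(1)] T.one_not_zero by auto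
    then have "fr.incl (\<one>\<^bsub>T\<^esub> \<oplus>\<^bsub>T\<^esub> \<one>\<^bsub>T\<^esub>) \<noteq> \<zero>\<^bsub>?K\<^esub>"
      unfolding fr.incl_def using fr.frac_eq_zero[OF TA.T.M.a_closed[OF TA.T.B.one_closed TA.T.B.one_closed] fr.one_in_D] by simp
    then have 1: "\<one>\<^bsub>?K\<^esub> \<oplus>\<^bsub>?K\<^esub> \<one>\<^bsub>?K\<^esub> \<noteq> \<zero>\<^bsub>?K\<^esub>"
      using ring_hom_add[OF fr.incl_hom TA.T.B.one_closed TA.T.B.one_closed] ring_hom_one[OF fr.incl_hom] by simp
    have "(\<one>\<^bsub>?K\<^esub> \<oplus>\<^bsub>?K\<^esub> \<one>\<^bsub>?K\<^esub>) \<otimes>\<^bsub>?K\<^esub> x = \<zero>\<^bsub>?K\<^esub>"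
      using 0 x by (simp add: qz.K.l_distr)
    then show ?thesis using qz.K.integral[of "\<one>\<^bsub>?K\<^esub> \<oplus>\<^bsub>?K\<^esub> \<one>\<^bsub>?K\<^esub>" x] 1 x by auto
  qed
  have "\<forall>a. \<exists>x. a \<le> n \<longrightarrow> x \<in> carrier B \<and> \<chi> x 0 = f a"
  proof
    fix a
    show "\<exists>x. a \<le> n \<longrightarrow> x \<in> carrier B \<and> \<chi> x 0 = f a"
    proof (cases "a \<le> n")
      case True
      obtain x where "x \<in> carrier B" "\<chi> x 0 = f a" using head_surj[OF fc[OF True]] by (rule bexE)
      then show ?thesis by (intro exI[of _ x]) simp
    qed simp
  qed
  from choice[OF this] obtain l where l: "\<forall>a. a \<le> n \<longrightarrow> l a \<in> carrier B \<and> \<chi> (l a) 0 = f a" ..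
  have lc: "l a \<in> carrier B" "\<chi> (l a) 0 = f a" if "a \<le> n" for a using l that by simp_all
  \<comment> \<open>Row \<open>j\<close> lies in the tensor factor \<open>j\<close> of
    \<open>R\<close>, so different rows commute whatever lifts \<open>l a\<close> are chosen; the
    column 0 is the right-hand side.\<close>
  define Bm where "Bm j a = emb (TB.slot j (l a))" for j a
  have slB: "TB.slot j (l a) \<in> carrier R" if "j \<in> {1..n}" "a \<le> n" for j a by (rule TB.slot_closed[OF that(1) lc(1)[OF that(2)]])
  have rho_slot: "\<rho> (TB.slot j (l a)) = TA.slot j (f a)" if j: "j \<in> {1..n}" and a: "a \<le> n" for j a
  proof -
    have "TB.tone(j := l a) \<in> TB.tup" using j lc(1)[OF a] by simp
    then show ?thesis unfolding TB.slot_def TA.slot_def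
      by (simp only: rho_pt heads_upd[OF j] heads_one lc(2)[OF a])
  qed
  have red_B: "red (Bm j a) = fr.incl (M j a)" if "j \<in> {1..n}" "a \<le> n" for j a
    unfolding Bm_def red_emb0[OF slB[OF that]] rho_slot[OF that] M_def ..
  interpret cr: commuting_rows Q ?K \<eta> red n Bm
  proof (intro commuting_rows.intro commuting_rows_axioms.intro qz.hadic_ring_axioms)
    show "Bm j a \<in> carrier Q" if "j \<in> {1..n}" "a \<le> n" for j a
      unfolding Bm_def by (rule ring_hom_closed[OF emb slB[OF that]])
    show "Bm j a \<otimes>\<^bsub>Q\<^esub> Bm i b = Bm i b \<otimes>\<^bsub>Q\<^esub> Bm j a" if "j \<in> {1..n}" "i \<in> {1..n}" "j \<noteq> i" "a \<le> n" "b \<le> n" for j i a b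
      unfolding Bm_def ring_hom_mult[OF emb slB[OF that(1,4)] slB[OF that(2,5)], symmetric]
        ring_hom_mult[OF emb slB[OF that(2,5)] slB[OF that(1,4)], symmetric]
        TB.slot_commute[OF that(1,2,3) lc(1)[OF that(4)] lc(1)[OF that(5)]] ..
    show "x = \<zero>\<^bsub>?K\<^esub>" if "x \<in> carrier ?K" "x \<oplus>\<^bsub>?K\<^esub> x = \<zero>\<^bsub>?K\<^esub>" for x by (rule twoK[OF that])
    have "qz.K.det n (\<lambda>j a. red (Bm j a)) = qz.K.det n (\<lambda>i j. fr.incl (M i j))"
      by (rule qz.K.det_cong) (simp add: red_B, rule inc_c, rule Mc)
    then show "qz.K.det n (\<lambda>j a. red (Bm j a)) \<noteq> \<zero>\<^bsub>?K\<^esub>" unfolding detK using \<Delta>K by simp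
  qed
  have B0: "Bm j 0 \<in> carrier Q" if "j \<in> {1..n}" for j by (rule cr.B_closed[OF that]) simp
  have "\<exists>H. (\<forall>a. H a \<in> carrier Q) \<and> (\<forall>j\<in>{1..n}. cr.L H j = Bm j 0)"
  proof (rule cr.solution_exists[of "\<lambda>j. Bm j 0", OF B0])
    fix H assume "\<And>a. H a \<in> carrier Q" "\<And>j. j \<in> {1..n} \<Longrightarrow> cr.L H j = Bm j 0"
    then show "\<exists>H. (\<forall>a. H a \<in> carrier Q) \<and> (\<forall>j\<in>{1..n}. cr.L H j = Bm j 0)" by (intro exI[of _ H]) simp
  qed
  then obtain H where "(\<forall>a. H a \<in> carrier Q) \<and> (\<forall>j\<in>{1..n}. cr.L H j = Bm j 0)" ..
  then have H: "H a \<in> carrier Q" "j \<in> {1..n} \<Longrightarrow> cr.L H j = Bm j 0" for a j by simp_all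
  have comm: "H a \<otimes>\<^bsub>Q\<^esub> H b = H b \<otimes>\<^bsub>Q\<^esub> H a" if "a \<in> {1..n}" "b \<in> {1..n}" for a b
    by (rule cr.solution_commutes[OF H(1) _ that]) (rule H(2))
  define N where "N a = T.det n (\<lambda>i j. TA.slot i (if j = a then f 0 else f j))" for a
  have rH: "red (H a) \<in> carrier ?K" for a by (rule ring_hom_closed[OF qz.red_hom H(1)])
  have Nc: "N a \<in> carrier T" for a unfolding N_def
    by (rule T.det_closed[where n = n]) (use sl in auto)
  have redH: "red (H a) \<otimes>\<^bsub>?K\<^esub> fr.incl \<Delta> = fr.incl (N a)" if a: "a \<in> {1..n}" for a
  proof -
    have eq: "(\<Oplus>\<^bsub>?K\<^esub>b\<in>{1..n}. fr.incl (M j b) \<otimes>\<^bsub>?K\<^esub> red (H b)) = fr.incl (M j 0)" if j: "j \<in> {1..n}" for j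
    proof -
      have "(\<Oplus>\<^bsub>?K\<^esub>b\<in>{1..n}. fr.incl (M j b) \<otimes>\<^bsub>?K\<^esub> red (H b)) = (\<Oplus>\<^bsub>?K\<^esub>b\<in>{1..n}. red (Bm j b) \<otimes>\<^bsub>?K\<^esub> red (H b))"
      proof (rule qz.K.finsum_cong'[OF refl])
        show "(\<lambda>b. red (Bm j b) \<otimes>\<^bsub>?K\<^esub> red (H b)) \<in> {1..n} \<rightarrow> carrier ?K"
          by (rule Pi_I, rule qz.K.m_closed, rule cr.red_B[OF j], assumption, rule rH)
        show "fr.incl (M j b) \<otimes>\<^bsub>?K\<^esub> red (H b) = red (Bm j b) \<otimes>\<^bsub>?K\<^esub> red (H b)" if "b \<in> {1..n}" for b
          using red_B[OF j, of b] that by simp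
      qed
      also have "\<dots> = red (cr.L H j)" by (rule cr.red_L[OF H(1) j, symmetric])
      also have "\<dots> = fr.incl (M j 0)" unfolding H(2)[OF j] by (rule red_B[OF j]) simp
      finally show ?thesis .
    qed
    have M0: "fr.incl (M j 0) \<in> carrier ?K" if "j \<in> {1..n}" for j
      unfolding M_def by (rule inc_c[OF sl[OF that]]) simp
    \<comment> \<open>Cramer's rule for the reduced system; replacing the column \<open>a\<close> by
      the right-hand side puts \<open>f 0\<close> in the place of \<open>f a\<close>.\<close>
    have "fr.incl \<Delta> \<otimes>\<^bsub>?K\<^esub> red (H a) = qz.K.det n (\<lambda>i j. if j = a then fr.incl (M i 0) else fr.incl (M i j))"
      unfolding detK[symmetric]
    proof (rule qz.K.cramer[where n = n and M = "\<lambda>i j. fr.incl (M i j)" and v = "\<lambda>i. fr.incl (M i 0)" and y = "\<lambda>a. red (H a)"])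
      show "qz.K.det n (\<lambda>i j. fr.incl (M i j)) \<noteq> \<zero>\<^bsub>?K\<^esub>" unfolding detK by (rule \<Delta>K)
      show "fr.incl (M i j) \<in> carrier ?K" if "i \<in> {1..n}" "j \<in> {1..n}" for i j by (rule inc_c[OF Mc[OF that]])
      show "x = \<zero>\<^bsub>?K\<^esub>" if "x \<in> carrier ?K" "x \<oplus>\<^bsub>?K\<^esub> x = \<zero>\<^bsub>?K\<^esub>" for x by (rule twoK[OF that])
      show "red (H b) \<in> carrier ?K" for b by (rule rH)
      show "fr.incl (M j 0) \<in> carrier ?K" if "j \<in> {1..n}" for j by (rule M0[OF that])
      show "(\<Oplus>\<^bsub>?K\<^esub>b\<in>{1..n}. fr.incl (M j b) \<otimes>\<^bsub>?K\<^esub> red (H b)) = fr.incl (M j 0)" if "j \<in> {1..n}" for j by (rule eq[OF that])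
      show "a \<in> {1..n}" by (rule a)
    qed
    also have "\<dots> = qz.K.det n (\<lambda>i j. fr.incl (TA.slot i (if j = a then f 0 else f j)))"
      by (rule qz.K.det_cong) (use sl in \<open>auto simp: M_def intro!: inc_c\<close>)
    also have "\<dots> = fr.incl (N a)"
      unfolding N_def by (rule inc.hom_det[where n = n and M = "\<lambda>i j. TA.slot i (if j = a then f 0 else f j)", symmetric]) (use sl in auto)
    finally show ?thesis unfolding qz.K.m_comm[OF rH inc_c[OF \<Delta>c]] .
  qed
  \<comment> \<open>The sign accounts for the difference between Cramer's numerator
    \<open>N a\<close> and \<open>Delta k A n f a\<close>; a change of sign preserves
    commutation.\<close>
  define H' where "H' a = (if evenperm (cycle_to a) then H a else \<ominus>\<^bsub>Q\<^esub> H a)" for a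
  have H'c: "H' a \<in> carrier Q" for a using H(1)[of a] by (simp add: H'_def)
  have H'_comm: "H' a \<otimes>\<^bsub>Q\<^esub> H' b = H' b \<otimes>\<^bsub>Q\<^esub> H' a" if "a \<in> {1..n}" "b \<in> {1..n}" for a b
    using comm[OF that] H(1)[of a] H(1)[of b] by (simp add: H'_def qz.Q.l_minus qz.Q.r_minus)
  have red_H': "red (H' a) = fraction T (Delta k A n f a) (Delta k A n f 0)" if a: "a \<in> {1..n}" for a
  proof -
    have Da: "Delta k A n f a = [sign (cycle_to a)] \<cdot>\<^bsub>T\<^esub> N a" unfolding N_def by (rule TA.Delta_det(2)[OF T.is_cring f a])
    have "red (H' a) \<otimes>\<^bsub>?K\<^esub> fr.incl \<Delta> = fr.incl ([sign (cycle_to a)] \<cdot>\<^bsub>T\<^esub> N a)"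
    proof (cases "evenperm (cycle_to a)")
      case True
      then show ?thesis using redH[OF a] T.sign_mult_simps[OF Nc[of a], of "cycle_to a"] by (simp add: H'_def)
    next
      case False
      have "red (H' a) = \<ominus>\<^bsub>?K\<^esub> red (H a)" using False H(1) by (simp add: H'_def)
      then have "red (H' a) \<otimes>\<^bsub>?K\<^esub> fr.incl \<Delta> = \<ominus>\<^bsub>?K\<^esub> fr.incl (N a)"
        using qz.K.l_minus[OF rH inc_c[OF \<Delta>c]] redH[OF a] by simp
      then show ?thesis using False T.sign_mult_simps[OF Nc[of a], of "cycle_to a"] inc.hom_a_inv[OF Nc[of a]] by simp
    qed
    then show ?thesis unfolding Da \<Delta>
      by (intro fr.frac_unique[OF _ _ \<Delta>D] T.sign_mult_closed Nc) (rule ring_hom_closed[OF qz.red_hom H'c])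
  qed
  \<comment> \<open>Here the completed localization is replaced by a ring of sequences in
    \<open>K\<close>; the homomorphism \<open>\<Phi>\<close> carries the commuting elements along
    without changing their reductions.\<close>
  obtain Kh :: "(nat \<Rightarrow> 'k, nat \<Rightarrow> (((nat \<Rightarrow> 'a) \<Rightarrow> 'k) set \<times> ((nat \<Rightarrow> 'a) \<Rightarrow> 'k) set) set) module" and \<phi> \<Phi>
    where Kh: "quantization k ?K Kh \<phi>" "\<Phi> \<in> ring_hom Q Kh" "\<And>x. x \<in> carrier Q \<Longrightarrow> reduction k Kh \<phi> (\<Phi> x) = red x"
    by (rule qz.quantization_exists) blast
  show ?thesis
  proof (intro exI conjI ballI)
    show "quantization k ?K Kh \<phi>" by (rule Kh(1))
    show "\<Phi> (H' i) \<in> carrier Kh" for i by (rule ring_hom_closed[OF Kh(2) H'c])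
    show "\<Phi> (H' i) \<otimes>\<^bsub>Kh\<^esub> \<Phi> (H' j) = \<Phi> (H' j) \<otimes>\<^bsub>Kh\<^esub> \<Phi> (H' i)" if "i \<in> {1..n}" "j \<in> {1..n}" for i j
      unfolding ring_hom_mult[OF Kh(2) H'c H'c, symmetric] H'_comm[OF that] ..
    show "reduction k Kh \<phi> (\<Phi> (H' i)) = fraction T (Delta k A n f i) (Delta k A n f 0)" if "i \<in> {1..n}" for i
      unfolding Kh(3)[OF H'c] by (rule red_H'[OF that])
  qed
qed

end

theorem proposition3p2:
  fixes k :: "('k, 'm) ring_scheme"
    and A :: "('k, 'a) poisson"
    and n :: nat
    and f :: "nat \<Rightarrow> 'a"
  defines "T \<equiv> tensor_power k A n"
  defines "K \<equiv> frac_field T"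
  defines "h \<equiv> (\<lambda>i. fraction T (Delta k A n f i) (Delta k A n f 0))"
  assumes "field k" and "[(2::nat)] \<cdot>\<^bsub>k\<^esub> \<one>\<^bsub>k\<^esub> \<noteq> \<zero>\<^bsub>k\<^esub>"
    and "poisson_algebra k A"
    and "n \<ge> 1" and "domain T"
    and "f \<in> {0..n} \<rightarrow> carrier A" and "lin_indep k A {0..n} f"
    and "\<exists>(Ah :: (nat \<Rightarrow> 'k, 'b) module) \<psi>. quantization k A Ah \<psi>"
  shows "\<exists>(Kh :: (nat \<Rightarrow> 'k, nat \<Rightarrow> (((nat \<Rightarrow> 'a) \<Rightarrow> 'k) set \<times> ((nat \<Rightarrow> 'a) \<Rightarrow> 'k) set) set) module) \<phi> hh.
    quantization k K Kh \<phi> \<and>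
    (\<forall>i\<in>{1..n}. hh i \<in> carrier Kh) \<and>
    (\<forall>i\<in>{1..n}. \<forall>j\<in>{1..n}. hh i \<otimes>\<^bsub>Kh\<^esub> hh j = hh j \<otimes>\<^bsub>Kh\<^esub> hh i) \<and>
    (\<forall>i\<in>{1..n}. reduction k Kh \<phi> (hh i) = h i)"
proof -
  obtain Ah :: "(nat \<Rightarrow> 'k, 'b) module" and \<psi> where q: "quantization k A Ah \<psi>"
    using assms(11) by (elim exE)
  obtain B :: "(nat \<Rightarrow> 'k, 'b) poisson" and \<chi> where "tensor_deformation k A n B \<chi>"
    by (rule quantization_deformation[OF assms(4,6) q assms(7) assms(8)[unfolded T_def]]) blast
  then interpret TD: tensor_deformation k A n B \<chi> .
  obtain \<rho> where "\<And>U. U \<in> carrier TD.R \<Longrightarrow> \<rho> U \<in> carrier TD.T"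
    "\<And>U V. U \<in> carrier TD.R \<Longrightarrow> V \<in> carrier TD.R \<Longrightarrow> \<rho> (U \<oplus>\<^bsub>TD.R\<^esub> V) = \<rho> U \<oplus>\<^bsub>TD.T\<^esub> \<rho> V"
    "\<And>d U. d \<in> carrier TD.kh \<Longrightarrow> U \<in> carrier TD.R \<Longrightarrow> \<rho> (d \<odot>\<^bsub>TD.R\<^esub> U) = d 0 \<odot>\<^bsub>TD.T\<^esub> \<rho> U"
    "\<And>x. x \<in> TD.TB.tup \<Longrightarrow> \<rho> (TD.TB.pt x) = TD.TA.pt (TD.heads x)"
    by (rule TD.reduction_exists) blast
  then have "tensor_reduction k A n B \<chi> \<rho>"
    by (intro tensor_reduction.intro TD.tensor_deformation_axioms tensor_reduction_axioms.intro)
  from tensor_reduction.commuting_quantization[OF this assms(4,5,9,10)]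
  show ?thesis unfolding K_def h_def T_def .
qed

end
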